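(* Let $n \ge 2$ and $T>0$, and let $V_1, V_2 \in L^1((0,T); L^\infty(\mathbb{R}^n))$. For $j \in \{1,2\}$ let $\mathcal{U}_T^j$ denote the initial-to-final-state map associated to the Hamiltonian $-\Delta + V_j$. If $V_1$ and $V_2$ have super-exponential decay, then $$ \mathcal{U}_T^1 = \mathcal{U}_T^2 \ \Longrightarrow\ V_1 = V_2 . $$
   Context: Notation: $\Sigma = (0,T)\times\mathbb{R}^n$, and $|\mathrm{x}|$ denotes the function $(t,x)\mapsto |x|$. Potentials are complex valued; equality of potentials means equality almost everywhere in $\Sigma$. Initial-to-final-state map: for $V \in L^1((0,T);L^\infty(\mathbb{R}^n))$ and every $f\in L^2(\mathbb{R}^n)$ there is a unique $u \in C([0,T];L^2(\mathbb{R}^n))$ solving $i\partial_t u = -\Delta u + Vu$ in $(0,T)\times\mathbb{R}^n$ with $u(0,\cdot)=f$. The initial-to-final-state map associated to $-\Delta+V$ is the bounded linear map $\mathcal{U}_T: f \in L^2(\mathbb{R}^n) \mapsto u(T,\cdot)\in L^2(\mathbb{R}^n)$. Super-exponential decay: $V \in L^1((0,T);L^\infty(\mathbb{R}^n))$ has super-exponential decay if $e^{\rho|\mathrm{x}|}V \in L^2(\Sigma)\cap L^\infty(\Sigma)$ for all $\rho>0$. *)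

theory Defs
  imports "HOL-Analysis.Analysis" "HOL-Probability.Essential_Supremum"
begin

text \<open>
  Elements of Lebesgue spaces are represented by Lebesgue measurable functions; equality of
  classes is equality almost everywhere.  A function on $\Sigma$ is a function of a pair $(t,x)$
  of which only the restriction to \<open>slab T\<close> matters.
\<close>

definition slab :: "real \<Rightarrow> (real \<times> (real ^ 'n)) set" where
  "slab T = {0<..<T} \<times> UNIV"

definition L2_space :: "'a measure \<Rightarrow> ('a \<Rightarrow> complex) set" where
  "L2_space M = {f \<in> borel_measurable M. integrable M (\<lambda>x. (norm (f x))\<^sup>2)}"

definition L2_norm :: "'a measure \<Rightarrow> ('a \<Rightarrow> complex) \<Rightarrow> real" where
  "L2_norm M f = sqrt (LINT x|M. (norm (f x))\<^sup>2)"

definition Linf_space :: "'a measure \<Rightarrow> ('a \<Rightarrow> complex) set" where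
  "Linf_space M = {f \<in> borel_measurable M. esssup M (\<lambda>x. ennreal (norm (f x))) < \<infinity>}"

text \<open>
  $L^1((0,T);L^\infty(\mathbb{R}^n))$ as a mixed-norm space of functions measurable on $\Sigma$.
  By Fubini almost every slice of such a function is Lebesgue measurable; on the remaining null
  set of times the value of \<^const>\<open>esssup\<close> is irrelevant.
\<close>

definition L1_Linf :: "real \<Rightarrow> (real \<times> (real ^ 'n) \<Rightarrow> complex) set" where
  "L1_Linf T = {V \<in> borel_measurable (lebesgue_on (slab T)).
     (\<integral>\<^sup>+t. esssup lebesgue (\<lambda>x. ennreal (norm (V (t, x)))) \<partial>lebesgue_on {0<..<T}) < \<infinity>}"

definition C_L2 :: "real \<Rightarrow> (real \<Rightarrow> real ^ 'n \<Rightarrow> complex) set" where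
  "C_L2 T = {u. \<forall>t\<in>{0..T}. u t \<in> L2_space lebesgue \<and>
     ((\<lambda>s. L2_norm lebesgue (\<lambda>x. u s x - u t x)) \<longlongrightarrow> 0) (at t within {0..T})}"

definition dir_deriv :: "'a::real_normed_vector \<Rightarrow> ('a \<Rightarrow> complex) \<Rightarrow> 'a \<Rightarrow> complex" where
  "dir_deriv v f z = frechet_derivative f (at z) v"

fun C_k :: "nat \<Rightarrow> ('a::real_normed_vector \<Rightarrow> complex) \<Rightarrow> bool" where
  "C_k 0 f \<longleftrightarrow> continuous_on UNIV f"
| "C_k (Suc k) f \<longleftrightarrow> (\<forall>z. f differentiable (at z)) \<and> (\<forall>v. C_k k (dir_deriv v f))"

definition test_function :: "real \<Rightarrow> (real \<times> (real ^ 'n) \<Rightarrow> complex) \<Rightarrow> bool" where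
  "test_function T \<phi> \<longleftrightarrow> (\<forall>k. C_k k \<phi>) \<and>
     compact (closure {z. \<phi> z \<noteq> 0}) \<and> closure {z. \<phi> z \<noteq> 0} \<subseteq> slab T"

definition dt :: "(real \<times> (real ^ 'n) \<Rightarrow> complex) \<Rightarrow> real \<times> (real ^ 'n) \<Rightarrow> complex" where
  "dt = dir_deriv (1, 0)"

definition laplace_x :: "(real \<times> (real ^ 'n) \<Rightarrow> complex) \<Rightarrow> real \<times> (real ^ 'n) \<Rightarrow> complex" where
  "laplace_x \<phi> z = (\<Sum>i\<in>UNIV. dir_deriv (0, axis i 1) (dir_deriv (0, axis i 1) \<phi>) z)"

text \<open>
  Solutions are understood in the sense of distributions on $\Sigma$: both sides of
  $i\partial_t u = -\Delta u + Vu$ are paired (bilinearly, without conjugation) with a test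
  function and the derivatives are moved onto it.  For \<open>u \<in> C_L2 T\<close> and \<open>V \<in> L1_Linf T\<close> the inner
  integrals define integrable functions of $t$.
\<close>

definition schroedinger_solution ::
  "real \<Rightarrow> (real \<times> (real ^ 'n) \<Rightarrow> complex) \<Rightarrow> (real ^ 'n \<Rightarrow> complex) \<Rightarrow>
   (real \<Rightarrow> real ^ 'n \<Rightarrow> complex) \<Rightarrow> bool" where
  "schroedinger_solution T V f u \<longleftrightarrow>
     u \<in> C_L2 T \<and>
     (AE x in lebesgue. u 0 x = f x) \<and>
     (\<forall>\<phi>. test_function T \<phi> \<longrightarrow>
        (LINT t|lebesgue_on {0<..<T}. LINT x|lebesgue. - \<i> * u t x * dt \<phi> (t, x)) =
        (LINT t|lebesgue_on {0<..<T}. LINT x|lebesgue.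
            - u t x * laplace_x \<phi> (t, x) + V (t, x) * u t x * \<phi> (t, x)))"

text \<open>
  For \<open>V \<in> L1_Linf T\<close> and \<open>f \<in> L2_space lebesgue\<close> the solution exists, and each of its time slices
  is unique up to a null set; hence a representative is chosen with \<open>SOME\<close>, and the values of the
  map are to be compared almost everywhere.
\<close>

definition initial_to_final ::
  "real \<Rightarrow> (real \<times> (real ^ 'n) \<Rightarrow> complex) \<Rightarrow> (real ^ 'n \<Rightarrow> complex) \<Rightarrow> real ^ 'n \<Rightarrow> complex" where
  "initial_to_final T V f = (SOME u. schroedinger_solution T V f u) T"

definition L2_map_eq ::
  "((real ^ 'n \<Rightarrow> complex) \<Rightarrow> real ^ 'n \<Rightarrow> complex) \<Rightarrow>
   ((real ^ 'n \<Rightarrow> complex) \<Rightarrow> real ^ 'n \<Rightarrow> complex) \<Rightarrow> bool" where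
  "L2_map_eq A B \<longleftrightarrow> (\<forall>f \<in> L2_space lebesgue. AE x in lebesgue. A f x = B f x)"

definition super_exp_decay :: "real \<Rightarrow> (real \<times> (real ^ 'n) \<Rightarrow> complex) \<Rightarrow> bool" where
  "super_exp_decay T V \<longleftrightarrow> V \<in> L1_Linf T \<and>
     (\<forall>\<rho>>0. (\<lambda>(t, x). of_real (exp (\<rho> * norm x)) * V (t, x))
        \<in> L2_space (lebesgue_on (slab T)) \<inter> Linf_space (lebesgue_on (slab T)))"

end

theory Submission
 imports Defs "HOL-Probability.Characteristic_Functions" "HOL-Real_Asymp.Real_Asymp"
begin

text \<open>
 On the Fourier side and in the interaction picture, $k(t,\eta) = e^{it|\eta|^2}\hat u(t,\eta)$, the equation becomes
 the Volterra equation $k(t) = k_0 - i\int_0^t B(s)k(s)\,ds$, where $B(s)$ is convolution with $(2\pi)^{-n}\hat V(s)$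
 conjugated by the free evolution.  The bound $|V| \le Ce^{-|x|}$ makes the kernel of $B(s)$ bounded
 and square integrable, so that $B(s)k$ is controlled at every single frequency.

 Take for $k_0$ the normalised indicator of a small ball around $\xi$.  As $\xi \to \infty$ in a direction $\omega$, the
 Born term $\int_0^t B(s)k_0\,ds$ tends to $0$ in $L^2$ by the Riemann-Lebesgue lemma in time, so by Gronwall's
 inequality all further terms of the Born series are negligible at every frequency.  Hence the value of the final state
 near $\xi + \kappa$ determines $\int_0^T e^{is(2\xi\cdot\kappa + |\kappa|^2)}\hat V(s,\kappa)\,ds$ up to $o(1)$.  For
 $n \ge 2$ the direction $\omega$ can be chosen orthogonal to $\kappa$, which keeps $2\xi\cdot\kappa + |\kappa|^2$ at
 any prescribed value: the space-time Fourier transforms of the two potentials agree.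

 Every distributional solution is tested with cut-off plane waves to see that it solves the Volterra equation;
 conversely the Picard iterates of the Volterra equation yield a distributional solution, so that \<open>SOME\<close> in the
 definition of the initial-to-final-state map picks a solution.
\<close>

section \<open>The space $L^2$\<close>

text \<open>The radius r of the ball that carries k_0 can only be chosen after \<xi>: over it the
  phase |\<eta>|^2 - |\<zeta>|^2 moves by an amount of order r|\<xi>|. The L^2 norm of k_0 is then
  out of control as \<xi> grows, so the bounds must not contain it. They use the L^1 norm, which is
  1: the Born term is an average over \<zeta> of the terms belonging to point masses at \<zeta>,
  whose size \<open>osc \<zeta>\<close> does not involve k_0. The value to be read off lives in a
  ball that shrinks with r, where smallness in L^2 says nothing. This is why the Volterra equation
  is required at every frequency and why B(s) is bounded from L^2 into bounded functions. The final
  states agree only almost everywhere, but one frequency of the ball around \<xi> + \<kappa> is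
  enough, and k_0 itself drops out of the difference. The Fourier transform on L^2 is a relation
  given by duality. The analysis uses Borel functions that are jointly measurable in time and space,
  so that Fubini's theorem applies; Lebesgue measurable data enter at the end.\<close>

abbreviation "N2 \<equiv> L2_norm lborel"
abbreviation "L2 \<equiv> L2_space lborel"

abbreviation lint :: "('a::euclidean_space \<Rightarrow> 'b::{banach, second_countable_topology}) \<Rightarrow> 'b" (binder "LB " 60) where
 "lint f \<equiv> integral\<^sup>L lborel f"

abbreviation nnlint :: "('a::euclidean_space \<Rightarrow> ennreal) \<Rightarrow> ennreal" (binder "NN " 60) where
 "nnlint f \<equiv> integral\<^sup>N lborel f"

text \<open>Fubini's theorem needs measurability in both variables together; measurability of each
  slice would not suffice.\<close>

abbreviation joint :: "('a::topological_space \<Rightarrow> 'b::topological_space \<Rightarrow> 'c::topological_space) \<Rightarrow> bool" where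
 "joint f \<equiv> (\<lambda>(t, x). f t x) \<in> borel_measurable (borel \<Otimes>\<^sub>M borel)"

text \<open>The multiplier of e^{-it\<Delta>}: it undoes the free evolution, whose own multiplier is
  \<open>phase (- t)\<close>.\<close>

abbreviation phase :: "real \<Rightarrow> 'a::real_normed_vector \<Rightarrow> complex" where
 "phase t \<eta> \<equiv> cis (t * (norm \<eta>)^2)"

lemmas lint_cong = Bochner_Integration.integral_cong
 and lint_add = Bochner_Integration.integral_add
 and lint_diff = Bochner_Integration.integral_diff
 and lint_sum = Bochner_Integration.integral_sum
 and lint_bound = Bochner_Integration.integrable_bound
 and lint_integrable_diff = Bochner_Integration.integrable_diff
 and lint_integrable_add = Bochner_Integration.integrable_add
 and lint_integrable_sum = Bochner_Integration.integrable_sum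

lemma integrable_Icc_const: "integrable lborel (\<lambda>s. indicator {a..b::real} s * (R::real))"
 by (intro integrable_mult_left integrable_real_indicator) (auto simp: emeasure_lborel_Icc_eq)

section \<open>Vector space structure, Cauchy-Schwarz and triangle inequalities\<close>

lemma L2_spaceI:
 "f \<in> borel_measurable M \<Longrightarrow> integrable M (\<lambda>x. (norm (f x))^2) \<Longrightarrow> f \<in> L2_space M"
 by (simp add: L2_space_def)

lemma L2_space_measurable: "f \<in> L2_space M \<Longrightarrow> f \<in> borel_measurable M"
 and L2_space_integrable: "f \<in> L2_space M \<Longrightarrow> integrable M (\<lambda>x. (norm (f x))^2)"
 by (simp_all add: L2_space_def)

lemma L2_norm_nonneg [simp]: "0 \<le> L2_norm M f"
 by (simp add: L2_norm_def)

lemma L2_norm_sq: "(L2_norm M f)^2 = (LINT x|M. (norm (f x))^2)"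
 by (simp add: L2_norm_def)

lemma L2_space_bound:
 assumes "f \<in> L2_space M" "g \<in> borel_measurable M" "AE x in M. norm (g x) \<le> C * norm (f x)"
 shows "g \<in> L2_space M"
proof (rule L2_spaceI)
 show "integrable M (\<lambda>x. (norm (g x))^2)"
 proof (rule lint_bound)
  show "integrable M (\<lambda>x. C^2 * (norm (f x))^2)"
   using L2_space_integrable[OF assms(1)] by simp
  show "AE x in M. norm ((norm (g x))^2) \<le> norm (C^2 * (norm (f x))^2)"
   using assms(3)
  proof eventually_elim
   case (elim x)
   have "(norm (g x))^2 \<le> (C * norm (f x))^2"
    by (rule power_mono) (use elim in auto)
   then show ?case by (simp add: power_mult_distrib)
  qed
 qed (use assms(2) in measurable)
qed (use assms in auto)

lemma L2_space_cmult: "f \<in> L2_space M \<Longrightarrow> (\<lambda>x. c * f x) \<in> L2_space M"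
 by (rule L2_space_bound[where f=f and C="norm c"]) (auto simp: norm_mult dest: L2_space_measurable)

lemma L2_space_norm_eq:
 assumes "f \<in> L2_space M" "g \<in> borel_measurable M" "\<And>x. norm (g x) = norm (f x)"
 shows "g \<in> L2_space M"
 by (rule L2_space_bound[OF assms(1,2), where C=1]) (use assms(3) in auto)

lemma L2_norm_cong: "(\<And>x. x \<in> space M \<Longrightarrow> norm (g x) = norm (f x)) \<Longrightarrow> L2_norm M g = L2_norm M f"
 unfolding L2_norm_def by (metis (no_types, lifting) lint_cong)

lemma L2_space_add:
 assumes "f \<in> L2_space M" "g \<in> L2_space M"
 shows "(\<lambda>x. f x + g x) \<in> L2_space M"
proof (rule L2_spaceI)
 note [measurable] = assms[THEN L2_space_measurable]
 show "(\<lambda>x. f x + g x) \<in> borel_measurable M" by measurable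
 show "integrable M (\<lambda>x. (norm (f x + g x))^2)"
 proof (rule lint_bound)
  show "integrable M (\<lambda>x. 2 * (norm (f x))^2 + 2 * (norm (g x))^2)"
   using assms[THEN L2_space_integrable] by simp
  show "AE x in M. norm ((norm (f x + g x))^2) \<le> norm (2 * (norm (f x))^2 + 2 * (norm (g x))^2)"
  proof (rule AE_I2)
   fix x
   have "(norm (f x + g x))^2 \<le> (norm (f x) + norm (g x))^2"
    by (rule power_mono) (auto simp: norm_triangle_ineq)
   also have "\<dots> \<le> 2 * (norm (f x))^2 + 2 * (norm (g x))^2"
    using sum_squares_bound[of "norm (f x)" "norm (g x)"] by (simp add: power2_sum)
   finally show "norm ((norm (f x + g x))^2) \<le> norm (2 * (norm (f x))^2 + 2 * (norm (g x))^2)"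
    by simp
  qed
 qed measurable
qed

lemma L2_space_diff: "f \<in> L2_space M \<Longrightarrow> g \<in> L2_space M \<Longrightarrow> (\<lambda>x. f x - g x) \<in> L2_space M"
 using L2_space_add[of f M "\<lambda>x. (-1) * g x"] L2_space_cmult[of g M "-1"] by simp

lemma L2_space_zero: "(\<lambda>x. 0) \<in> L2_space M"
 by (auto intro: L2_spaceI)

lemma L2_space_sum: "(\<And>i. i \<in> I \<Longrightarrow> f i \<in> L2_space M) \<Longrightarrow> (\<lambda>x. \<Sum>i\<in>I. f i x) \<in> L2_space M"
 by (induction I rule: infinite_finite_induct) (auto intro: L2_space_add L2_space_zero)

lemma L2_mult_integrable:
 assumes "f \<in> L2_space M" "g \<in> L2_space M"
 shows "integrable M (\<lambda>x. f x * g x)"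
proof (rule lint_bound)
 note [measurable] = assms[THEN L2_space_measurable]
 show "integrable M (\<lambda>x. (norm (f x))^2 + (norm (g x))^2)"
  using assms[THEN L2_space_integrable] by simp
 show "AE x in M. norm (f x * g x) \<le> norm ((norm (f x))^2 + (norm (g x))^2)"
 proof (rule AE_I2)
  fix x
  show "norm (f x * g x) \<le> norm ((norm (f x))^2 + (norm (g x))^2)"
   using sum_squares_bound[of "norm (f x)" "norm (g x)"]
    mult_nonneg_nonneg[OF norm_ge_zero[of "f x"] norm_ge_zero[of "g x"]]
   unfolding norm_mult real_norm_def mult.assoc by linarith
 qed
qed (use assms[THEN L2_space_measurable] in measurable)

lemma L2_Cauchy_Schwarz_norm:
 assumes "f \<in> L2_space M" "g \<in> L2_space M"
 shows "(LINT x|M. norm (f x) * norm (g x)) \<le> L2_norm M f * L2_norm M g"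
proof -
 note [measurable] = assms[THEN L2_space_measurable]
 have i: "integrable M (\<lambda>x. norm (f x) * norm (g x))"
  using integrable_norm[OF L2_mult_integrable[OF assms]] by (simp add: norm_mult)
 have "ennreal ((LINT x|M. norm (f x) * norm (g x))^2) = (\<integral>\<^sup>+x. ennreal (norm (f x)) * ennreal (norm (g x)) \<partial>M)^2"
  by (subst nn_integral_eq_integral[OF i, simplified ennreal_mult'[OF norm_ge_zero]])
   (auto simp: ennreal_power)
 also have "\<dots> \<le> (\<integral>\<^sup>+x. (ennreal (norm (f x)))^2 \<partial>M) * (\<integral>\<^sup>+x. (ennreal (norm (g x)))^2 \<partial>M)"
  by (rule Cauchy_Schwarz_nn_integral) auto
 also have "\<dots> = ennreal ((LINT x|M. (norm (f x))^2) * (LINT x|M. (norm (g x))^2))"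
  using assms[THEN L2_space_integrable]
  by (simp add: ennreal_power nn_integral_eq_integral ennreal_mult')
 finally have "(LINT x|M. norm (f x) * norm (g x))^2 \<le> (L2_norm M f * L2_norm M g)^2"
  by (subst (asm) ennreal_le_iff) (auto simp: power_mult_distrib L2_norm_sq)
 then show ?thesis by (rule power2_le_imp_le) auto
qed

lemma L2_Cauchy_Schwarz:
 assumes "f \<in> L2_space M" "g \<in> L2_space M"
 shows "norm (LINT x|M. f x * g x) \<le> L2_norm M f * L2_norm M g"
proof -
 have "norm (LINT x|M. f x * g x) \<le> (LINT x|M. norm (f x * g x))"
  by simp
 also have "\<dots> \<le> L2_norm M f * L2_norm M g"
  using L2_Cauchy_Schwarz_norm[OF assms] by (simp add: norm_mult)
 finally show ?thesis .
qed

lemma L2_norm_triangle: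
 assumes "f \<in> L2_space M" "g \<in> L2_space M"
 shows "L2_norm M (\<lambda>x. f x + g x) \<le> L2_norm M f + L2_norm M g"
proof (rule power2_le_imp_le)
 have i: "integrable M (\<lambda>x. norm (f x) * norm (g x))"
  using integrable_norm[OF L2_mult_integrable[OF assms]] by (simp add: norm_mult)
 note i' = assms[THEN L2_space_integrable]
 have "(L2_norm M (\<lambda>x. f x + g x))^2 = (LINT x|M. (norm (f x + g x))^2)"
  by (rule L2_norm_sq)
 also have "\<dots> \<le> (LINT x|M. (norm (f x))^2 + 2 * (norm (f x) * norm (g x)) + (norm (g x))^2)"
 proof (rule integral_mono)
  fix x
  have "(norm (f x + g x))^2 \<le> (norm (f x) + norm (g x))^2"
   by (rule power_mono) (auto simp: norm_triangle_ineq)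
  then show "(norm (f x + g x))^2 \<le> (norm (f x))^2 + 2 * (norm (f x) * norm (g x)) + (norm (g x))^2"
   by (simp add: power2_sum)
 qed (use i i' L2_space_integrable[OF L2_space_add[OF assms]] in auto)
 also have "\<dots> = (L2_norm M f)^2 + 2 * (LINT x|M. norm (f x) * norm (g x)) + (L2_norm M g)^2"
  using i i' by (simp add: L2_norm_sq)
 also have "\<dots> \<le> (L2_norm M f + L2_norm M g)^2"
  using L2_Cauchy_Schwarz_norm[OF assms] by (simp add: power2_sum)
 finally show "(L2_norm M (\<lambda>x. f x + g x))^2 \<le> (L2_norm M f + L2_norm M g)^2" .
qed auto

lemma L2_norm_cmult: "L2_norm M (\<lambda>x. c * f x) = norm c * L2_norm M f"
 by (simp add: L2_norm_def norm_mult power_mult_distrib real_sqrt_mult)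

lemma L2_norm_minus_commute: "L2_norm M (\<lambda>x. f x - g x) = L2_norm M (\<lambda>x. g x - f x)"
 by (rule L2_norm_cong) (simp add: norm_minus_commute)

lemma L2_norm_triangle_diff:
 assumes "f \<in> L2_space M" "g \<in> L2_space M" "h \<in> L2_space M"
 shows "L2_norm M (\<lambda>x. f x - h x) \<le> L2_norm M (\<lambda>x. f x - g x) + L2_norm M (\<lambda>x. g x - h x)"
 using L2_norm_triangle[OF L2_space_diff[OF assms(1,2)] L2_space_diff[OF assms(2,3)]] by simp

lemma L2_norm_zero [simp]: "L2_norm M (\<lambda>x. 0) = 0"
 by (simp add: L2_norm_def)

lemma L2_norm_sum:
 assumes "\<And>i. i \<in> I \<Longrightarrow> f i \<in> L2_space M"
 shows "L2_norm M (\<lambda>x. \<Sum>i\<in>I. f i x) \<le> (\<Sum>i\<in>I. L2_norm M (f i))"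
 using assms
proof (induction I rule: infinite_finite_induct)
 case (insert i I)
 have "L2_norm M (\<lambda>x. f i x + (\<Sum>i\<in>I. f i x)) \<le> L2_norm M (f i) + L2_norm M (\<lambda>x. \<Sum>i\<in>I. f i x)"
  by (rule L2_norm_triangle) (use insert.prems in \<open>auto intro: L2_space_sum\<close>)
 then show ?case using insert by fastforce
qed auto

lemma L2_norm_AE_cong:
 assumes "AE x in M. f x = g x" "f \<in> borel_measurable M" "g \<in> borel_measurable M"
 shows "L2_norm M f = L2_norm M g"
proof -
 have "(LINT x|M. (norm (f x))^2) = (LINT x|M. (norm (g x))^2)"
  by (rule integral_cong_AE) (use assms in auto)
 then show ?thesis by (simp add: L2_norm_def)
qed

lemma L2_space_AE_cong:
 assumes "f \<in> L2_space M" "AE x in M. f x = g x" "g \<in> borel_measurable M"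
 shows "g \<in> L2_space M"
 by (rule L2_space_bound[OF assms(1,3), where C=1]) (use assms(2) in auto)

lemma L2_norm_eq_0_AE:
 assumes "f \<in> L2_space M" "L2_norm M f = 0"
 shows "AE x in M. f x = 0"
proof -
 have "(LINT x|M. (norm (f x))^2) = 0"
  using assms(2) by (simp add: L2_norm_def)
 then have "AE x in M. (norm (f x))^2 = 0"
  using L2_space_integrable[OF assms(1)] by (subst (asm) integral_nonneg_eq_0_iff_AE) auto
 then show ?thesis by eventually_elim simp
qed

section \<open>Fatou's lemma, completeness and limits of pairings\<close>

lemma L2_space_nn:
 assumes "f \<in> borel_measurable M" "(\<integral>\<^sup>+x. ennreal ((norm (f x))^2) \<partial>M) \<le> ennreal (C^2)" "0 \<le> C"
 shows "f \<in> L2_space M" "L2_norm M f \<le> C"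
proof -
 have m: "(\<lambda>x. (norm (f x))^2) \<in> borel_measurable M" using assms(1) by measurable
 have i: "integrable M (\<lambda>x. (norm (f x))^2)"
  by (rule integrableI_bounded[OF m]) (use assms(2) in \<open>auto simp: le_less_trans\<close>)
 then show "f \<in> L2_space M" using assms(1) by (simp add: L2_space_def)
 have "ennreal (LINT x|M. (norm (f x))^2) \<le> ennreal (C^2)"
  using nn_integral_eq_integral[OF i] assms(2) by simp
 then have "(L2_norm M f)^2 \<le> C^2" by (simp add: L2_norm_sq)
 then show "L2_norm M f \<le> C" using assms(3) power2_le_imp_le by blast
qed

lemma nn_integral_L2_norm:
 "f \<in> L2_space M \<Longrightarrow> (\<integral>\<^sup>+x. ennreal ((norm (f x))^2) \<partial>M) = ennreal ((L2_norm M f)^2)"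
 by (simp add: L2_norm_sq nn_integral_eq_integral L2_space_integrable)

text \<open>Fatou's lemma for the squares; the limit comes out square integrable together with the
  bound, so membership need not be known beforehand.\<close>

lemma L2_Fatou:
 assumes "\<And>n. f n \<in> L2_space M" "\<And>n. L2_norm M (f n) \<le> C" "AE x in M. (\<lambda>n. f n x) \<longlonglongrightarrow> g x"
  and [measurable]: "g \<in> borel_measurable M"
 shows "g \<in> L2_space M" "L2_norm M g \<le> C"
proof -
 note [measurable] = assms(1)[THEN L2_space_measurable]
 have C: "0 \<le> C" using assms(2)[of 0] L2_norm_nonneg[of M "f 0"] by linarith
 have "(\<integral>\<^sup>+x. ennreal ((norm (g x))^2) \<partial>M) = (\<integral>\<^sup>+x. liminf (\<lambda>n. ennreal ((norm (f n x))^2)) \<partial>M)"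
 proof (rule nn_integral_cong_AE, use assms(3) in eventually_elim)
  case (elim x)
  have "(\<lambda>n. ennreal ((norm (f n x))^2)) \<longlonglongrightarrow> ennreal ((norm (g x))^2)"
   using elim by (intro tendsto_intros)
  then show ?case using lim_imp_Liminf[of sequentially] by (metis sequentially_bot)
 qed
 also have "\<dots> \<le> liminf (\<lambda>n. \<integral>\<^sup>+x. ennreal ((norm (f n x))^2) \<partial>M)"
  by (rule nn_integral_liminf) measurable
 also have "\<dots> \<le> ennreal (C^2)"
 proof (rule Liminf_le)
  show "\<forall>\<^sub>F n in sequentially. (\<integral>\<^sup>+x. ennreal ((norm (f n x))^2) \<partial>M) \<le> ennreal (C^2)"
   using assms(1,2) by (intro always_eventually allI) (auto simp: nn_integral_L2_norm intro!: ennreal_leI power_mono)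
 qed simp
 finally show "g \<in> L2_space M" "L2_norm M g \<le> C"
  using L2_space_nn[of g M C] C by auto
qed

text \<open>The Riesz-Fischer argument: the partial sums \<open>S m\<close> of the absolute
  increments have norm at most the geometric sum 2, so by monotone convergence their supremum is
  finite almost everywhere, and there the telescoping series converges absolutely.\<close>

lemma L2_fast_Cauchy_AE_convergent:
 assumes f: "\<And>n. f n \<in> L2_space M" and fast: "\<And>n. L2_norm M (\<lambda>x. f (Suc n) x - f n x) \<le> (1/2)^n"
 shows "AE x in M. convergent (\<lambda>n. f n x)"
proof -
 note [measurable] = f[THEN L2_space_measurable]
 define d where "d n x = f (Suc n) x - f n x" for n x
 have d: "d n \<in> L2_space M" for n unfolding d_def by (rule L2_space_diff[OF f f])
 note [measurable] = d[THEN L2_space_measurable]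
 define S where "S m x = (\<Sum>n<m. norm (d n x))" for m x
 have S2: "(\<lambda>x. complex_of_real (S m x)) \<in> L2_space M" "L2_norm M (\<lambda>x. complex_of_real (S m x)) \<le> 2" for m
 proof -
  have *: "(\<lambda>x. complex_of_real (norm (d n x))) \<in> L2_space M" for n
   by (rule L2_space_norm_eq[OF d]) auto
  show "(\<lambda>x. complex_of_real (S m x)) \<in> L2_space M"
   unfolding S_def of_real_sum by (rule L2_space_sum[OF *])
  have "L2_norm M (\<lambda>x. complex_of_real (S m x)) \<le> (\<Sum>n<m. L2_norm M (\<lambda>x. complex_of_real (norm (d n x))))"
   unfolding S_def of_real_sum by (rule L2_norm_sum[OF *])
  also have "\<dots> = (\<Sum>n<m. L2_norm M (d n))"
   by (intro sum.cong refl L2_norm_cong) auto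
  also have "\<dots> \<le> (\<Sum>n<m. (1/2)^n)" by (intro sum_mono) (use fast in \<open>simp add: d_def[abs_def]\<close>)
  also have "\<dots> \<le> (\<Sum>n. (1/2::real)^n)" by (intro sum_le_suminf) auto
  also have "\<dots> = 2" by (subst suminf_geometric) auto
  finally show "L2_norm M (\<lambda>x. complex_of_real (S m x)) \<le> 2" .
 qed
 define G where "G x = (SUP m. ennreal ((S m x)^2))" for x
 have Smono: "S m x \<le> S n x" if "m \<le> n" for m n x
  unfolding S_def by (rule sum_mono2) (use that in auto)
 have S0: "0 \<le> S m x" for m x unfolding S_def by (auto intro: sum_nonneg)
 have "(\<integral>\<^sup>+x. G x \<partial>M) = (SUP m. \<integral>\<^sup>+x. ennreal ((S m x)^2) \<partial>M)"
  unfolding G_def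
  by (rule nn_integral_monotone_convergence_SUP)
   (auto simp: incseq_def le_fun_def S_def intro!: ennreal_leI power_mono sum_mono2 sum_nonneg)
 also have "\<dots> \<le> ennreal 4"
 proof (rule SUP_least)
  fix m
  have "(\<integral>\<^sup>+x. ennreal ((S m x)^2) \<partial>M) = ennreal ((L2_norm M (\<lambda>x. complex_of_real (S m x)))^2)"
   using nn_integral_L2_norm[OF S2(1)[of m]] by simp
  also have "\<dots> \<le> ennreal (2^2)" by (intro ennreal_leI power_mono S2) auto
  finally show "(\<integral>\<^sup>+x. ennreal ((S m x)^2) \<partial>M) \<le> ennreal 4" by simp
 qed
 also have "\<dots> < \<infinity>" by simp
 finally have "AE x in M. G x \<noteq> \<infinity>"
  by (intro nn_integral_PInf_AE) (auto simp: G_def S_def)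
 then show ?thesis
 proof eventually_elim
  case (elim x)
  then obtain B where B: "G x = ennreal B" "0 \<le> B" by (cases "G x") auto
  have "(S m x)^2 \<le> B" for m
  proof -
   have "ennreal ((S m x)^2) \<le> G x" unfolding G_def by (rule SUP_upper) auto
   then show ?thesis using B by simp
  qed
  then have "S m x \<le> sqrt B" for m using S0 real_le_rsqrt by blast
  then have "summable (\<lambda>n. norm (d n x))"
   by (intro bounded_imp_summable[where B="sqrt B"]) (simp_all add: S_def lessThan_Suc_atMost[symmetric] del: sum.lessThan_Suc)
  then have "summable (\<lambda>n. d n x)" by (rule summable_norm_cancel)
  then have "convergent (\<lambda>m. f 0 x + (\<Sum>n<m. d n x))"
   by (intro convergent_add convergent_const) (simp add: summable_iff_convergent)
  moreover have "f 0 x + (\<Sum>n<m. d n x) = f m x" for m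
   unfolding d_def by (subst sum_lessThan_telescope) simp
  ultimately show ?case by simp
 qed
qed

text \<open>The limit \<open>g\<close> is supplied from outside, so that a limit measurable jointly
  in time and frequency can be used in each time slice. The increments from index n on sum to at
  most 2 (1/2)^n, and Fatou's lemma carries this bound to the limit.\<close>

lemma L2_fast_Cauchy_limit:
 assumes f: "\<And>n. f n \<in> L2_space M" and fast: "\<And>n. L2_norm M (\<lambda>x. f (Suc n) x - f n x) \<le> (1/2)^n"
  and lim: "AE x in M. (\<lambda>n. f n x) \<longlonglongrightarrow> g x" and g: "g \<in> borel_measurable M"
 shows "g \<in> L2_space M" "L2_norm M (\<lambda>x. g x - f n x) \<le> 2 * (1/2)^n"
proof -
 note [measurable] = f[THEN L2_space_measurable] g
 have b: "L2_norm M (\<lambda>x. f (n + m) x - f n x) \<le> 2 * (1/2)^n" for n m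
 proof -
  have "L2_norm M (\<lambda>x. f (n + m) x - f n x) \<le> (\<Sum>k<m. (1/2)^(n+k))"
  proof (induction m)
   case (Suc m)
   show ?case
    using L2_norm_triangle_diff[OF f[of "n + Suc m"] f[of "n+m"] f[of n]] fast[of "n+m"] Suc by simp
  qed simp
  also have "\<dots> \<le> (\<Sum>k. (1/2)^(n+k))" by (intro sum_le_suminf) (auto simp: power_add)
  also have "\<dots> = 2 * (1/2)^n"
   unfolding power_add by (subst suminf_mult) (auto simp: suminf_geometric)
  finally show ?thesis .
 qed
 have F: "(\<lambda>x. g x - f n x) \<in> L2_space M" "L2_norm M (\<lambda>x. g x - f n x) \<le> 2 * (1/2)^n" for n
 proof -
  have *: "AE x in M. (\<lambda>m. f (n + m) x - f n x) \<longlonglongrightarrow> g x - f n x"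
   using lim
  proof eventually_elim
   case (elim x)
   have "(\<lambda>m. f (m + n) x) \<longlonglongrightarrow> g x" using elim by (rule LIMSEQ_ignore_initial_segment)
   then show ?case by (intro tendsto_diff tendsto_const) (simp add: add.commute)
  qed
  show "(\<lambda>x. g x - f n x) \<in> L2_space M" "L2_norm M (\<lambda>x. g x - f n x) \<le> 2 * (1/2)^n"
   by (rule L2_Fatou[OF _ b *]; auto intro: L2_space_diff f)+
 qed
 show "L2_norm M (\<lambda>x. g x - f n x) \<le> 2 * (1/2)^n" by (rule F)
 show "g \<in> L2_space M" using L2_space_add[OF F(1)[of 0] f[of 0]] by simp
qed

lemma L2_complete:
 assumes f: "\<And>n::nat. f n \<in> L2_space M"
  and C: "\<And>e. e > 0 \<Longrightarrow> \<exists>N. \<forall>m\<ge>N. \<forall>n\<ge>N. L2_norm M (\<lambda>x. f m x - f n x) < e"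
 obtains g where "g \<in> L2_space M" "(\<lambda>n. L2_norm M (\<lambda>x. f n x - g x)) \<longlonglongrightarrow> 0"
proof -
 have "\<forall>k. \<exists>N. \<forall>m\<ge>N. \<forall>n\<ge>N. L2_norm M (\<lambda>x. f m x - f n x) < (1/2)^k"
  using C by simp
 then obtain N where N: "\<And>k m n. m \<ge> N k \<Longrightarrow> n \<ge> N k \<Longrightarrow> L2_norm M (\<lambda>x. f m x - f n x) < (1/2)^k"
  by metis
 \<comment> \<open>Adding up the thresholds makes both \<open>r k\<close> and
   \<open>r (Suc k)\<close> at least \<open>N k\<close>, whether or not \<open>N\<close> is
   monotone.\<close>
 define r where "r k = (\<Sum>j\<le>k. N j) " for k
 have r1: "r k \<ge> N k" for k unfolding r_def by (rule member_le_sum) auto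
 have r: "r k \<ge> N k" "r (Suc k) \<ge> N k" for k
  using r1[of k] by (auto simp: r_def)
 have rf: "f (r k) \<in> L2_space M" for k by (rule f)
 have fast: "L2_norm M (\<lambda>x. f (r (Suc k)) x - f (r k) x) \<le> (1/2)^k" for k
  using N[OF r(2,1)] by (simp add: less_imp_le)
 note [measurable] = f[THEN L2_space_measurable]
 \<comment> \<open>The value 0 where the sequence diverges makes \<open>g\<close> measurable on the
   whole space.\<close>
 define g where "g x = (if Cauchy (\<lambda>k. f (r k) x) then lim (\<lambda>k. f (r k) x) else 0)" for x
 have gm: "g \<in> borel_measurable M" unfolding g_def by measurable
 have lim: "AE x in M. (\<lambda>k. f (r k) x) \<longlonglongrightarrow> g x"
  using L2_fast_Cauchy_AE_convergent[OF rf fast]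
  by eventually_elim (auto simp: g_def convergent_LIMSEQ_iff Cauchy_convergent_iff)
 note L = L2_fast_Cauchy_limit[OF rf fast lim gm]
 show ?thesis
 proof (rule that[OF L(1)])
  show "(\<lambda>n. L2_norm M (\<lambda>x. f n x - g x)) \<longlonglongrightarrow> 0"
  proof (rule LIMSEQ_I)
   fix e :: real assume e: "e > 0"
   obtain k where k: "(1/2)^k < e/3" using real_arch_pow_inv[of "e/3" "1/2"] e by auto
   have "norm (L2_norm M (\<lambda>x. f n x - g x) - 0) < e" if "n \<ge> N k" for n
   proof -
    have "L2_norm M (\<lambda>x. f n x - g x) \<le> L2_norm M (\<lambda>x. f n x - f (r k) x) + L2_norm M (\<lambda>x. f (r k) x - g x)"
     by (rule L2_norm_triangle_diff[OF f f L(1)])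
    also have "\<dots> < (1/2)^k + 2 * (1/2)^k"
     using N[OF that r(1)] L(2)[of k] by (subst (2) L2_norm_minus_commute) linarith
    also have "\<dots> < e" using k by simp
    finally show ?thesis by simp
   qed
   then show "\<exists>no. \<forall>n\<ge>no. norm (L2_norm M (\<lambda>x. f n x - g x) - 0) < e" by blast
  qed
 qed
qed

lemma integral_L2_tendsto:
 assumes f: "\<And>n. f n \<in> L2_space M" "g \<in> L2_space M" "h \<in> L2_space M"
  and lim: "((\<lambda>n. L2_norm M (\<lambda>x. f n x - g x)) \<longlongrightarrow> 0) F"
 shows "((\<lambda>n. LINT x|M. f n x * h x) \<longlongrightarrow> (LINT x|M. g x * h x)) F"
proof (subst Lim_null, rule Lim_null_comparison)
 show "\<forall>\<^sub>F n in F. norm ((LINT x|M. f n x * h x) - (LINT x|M. g x * h x)) \<le> L2_norm M (\<lambda>x. f n x - g x) * L2_norm M h"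
 proof (rule always_eventually, rule allI)
  fix n
  have "(LINT x|M. f n x * h x) - (LINT x|M. g x * h x) = (LINT x|M. (f n x - g x) * h x)"
   using L2_mult_integrable[OF f(2,3)] L2_mult_integrable[OF f(1,3)] by (simp add: left_diff_distrib)
  also have "norm \<dots> \<le> L2_norm M (\<lambda>x. f n x - g x) * L2_norm M h"
   by (rule L2_Cauchy_Schwarz[OF L2_space_diff[OF f(1,2)] f(3)])
  finally show "norm ((LINT x|M. f n x * h x) - (LINT x|M. g x * h x)) \<le> L2_norm M (\<lambda>x. f n x - g x) * L2_norm M h" .
 qed
 show "((\<lambda>n. L2_norm M (\<lambda>x. f n x - g x) * L2_norm M h) \<longlongrightarrow> 0) F"
  using tendsto_mult[OF lim tendsto_const] by simp
qed

lemma L2_norm_tendsto: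
 assumes f: "\<And>n. f n \<in> L2_space M" "g \<in> L2_space M"
  and lim: "((\<lambda>n. L2_norm M (\<lambda>x. f n x - g x)) \<longlongrightarrow> 0) F"
 shows "((\<lambda>n. L2_norm M (f n)) \<longlongrightarrow> L2_norm M g) F"
proof (subst Lim_null, rule Lim_null_comparison[OF _ lim])
 show "\<forall>\<^sub>F n in F. norm (L2_norm M (f n) - L2_norm M g) \<le> L2_norm M (\<lambda>x. f n x - g x)"
 proof (rule always_eventually, rule allI)
  fix n
  show "norm (L2_norm M (f n) - L2_norm M g) \<le> L2_norm M (\<lambda>x. f n x - g x)"
   using L2_norm_triangle[OF L2_space_diff[OF f(2) f(1)[of n]] f(1)[of n]]
      L2_norm_triangle[OF L2_space_diff[OF f(1)[of n] f(2)] f(2)]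
   by (simp add: L2_norm_minus_commute[of M g] abs_le_iff)
 qed
qed

section \<open>Translations and Gaussians\<close>

lemma lborel_translate:
 fixes f :: "'a::euclidean_space \<Rightarrow> 'b::{banach, second_countable_topology}"
 assumes [measurable]: "f \<in> borel_measurable borel"
 shows integral_lborel_translate: "(LB x. f (x + z)) = (LB x. f x)"
  and integrable_lborel_translate: "integrable lborel (\<lambda>x. f (x + z)) \<longleftrightarrow> integrable lborel f"
proof -
 have "(LB x. f x) = (LINT x|distr lborel borel ((+) z). f x)"
  by (simp add: lborel_distr_plus)
 also have "\<dots> = (LB x. f (x + z))"
  by (subst integral_distr) (auto simp: add.commute)
 finally show "(LB x. f (x + z)) = (LB x. f x)" by simp
 have "integrable lborel f \<longleftrightarrow> integrable (distr lborel borel ((+) z)) f"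
  by (simp add: lborel_distr_plus)
 also have "\<dots> \<longleftrightarrow> integrable lborel (\<lambda>x. f (x + z))"
  by (subst integrable_distr_eq) (auto simp: add.commute)
 finally show "integrable lborel (\<lambda>x. f (x + z)) \<longleftrightarrow> integrable lborel f" by simp
qed

lemma L2_translate:
 fixes f :: "'a::euclidean_space \<Rightarrow> complex"
 assumes f: "f \<in> L2"
 shows L2_space_translate: "(\<lambda>x. f (x + z)) \<in> L2"
  and L2_norm_translate: "N2 (\<lambda>x. f (x + z)) = N2 f"
proof -
 note [measurable] = L2_space_measurable[OF f, simplified]
 show "(\<lambda>x. f (x + z)) \<in> L2"
  using L2_space_integrable[OF f] integrable_lborel_translate[of "\<lambda>x. (norm (f x))^2" z]
  by (intro L2_spaceI) auto
 show "N2 (\<lambda>x. f (x + z)) = N2 f"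
  unfolding L2_norm_def using integral_lborel_translate[of "\<lambda>x. (norm (f x))^2" z] by simp
qed

section \<open>Continuity of translations, from open sets through simple functions to all of
  $L^2$\<close>

lemma L2_translation_continuous_approx:
 fixes f :: "'a::euclidean_space \<Rightarrow> complex" and z :: "nat \<Rightarrow> 'a"
 assumes f: "f \<in> L2"
  and ap: "\<And>e. e > 0 \<Longrightarrow> \<exists>g \<in> L2. N2 (\<lambda>x. f x - g x) < e \<and>
    (\<lambda>n. N2 (\<lambda>x. g (x + z n) - g x)) \<longlonglongrightarrow> 0"
 shows "(\<lambda>n. N2 (\<lambda>x. f (x + z n) - f x)) \<longlonglongrightarrow> 0"
proof (rule LIMSEQ_I)
 fix e :: real assume "e > 0"
 then obtain g where g: "g \<in> L2" "N2 (\<lambda>x. f x - g x) < e/3"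
  "(\<lambda>n. N2 (\<lambda>x. g (x + z n) - g x)) \<longlonglongrightarrow> 0"
  using ap[of "e/3"] by auto
 obtain N where N: "\<And>n. n \<ge> N \<Longrightarrow> N2 (\<lambda>x. g (x + z n) - g x) < e/3"
  using LIMSEQ_D[OF g(3), of "e/3"] \<open>e > 0\<close> by fastforce
 have "N2 (\<lambda>x. f (x + z n) - f x) < e" if "n \<ge> N" for n
 proof -
  have "N2 (\<lambda>x. f (x + z n) - f x) \<le>
    N2 (\<lambda>x. f (x + z n) - g (x + z n)) + N2 (\<lambda>x. g (x + z n) - f x)"
   by (intro L2_norm_triangle_diff L2_space_translate f g)
  also have "N2 (\<lambda>x. f (x + z n) - g (x + z n)) = N2 (\<lambda>x. f x - g x)"
   by (rule L2_norm_translate[OF L2_space_diff[OF f g(1)]])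
  also have "N2 (\<lambda>x. g (x + z n) - f x) \<le>
    N2 (\<lambda>x. g (x + z n) - g x) + N2 (\<lambda>x. g x - f x)"
   by (intro L2_norm_triangle_diff L2_space_translate f g)
  also have "N2 (\<lambda>x. g x - f x) = N2 (\<lambda>x. f x - g x)"
   by (rule L2_norm_minus_commute)
  finally show ?thesis using g(2) N[OF that] by linarith
 qed
 then show "\<exists>no. \<forall>n\<ge>no. norm (N2 (\<lambda>x. f (x + z n) - f x) - 0) < e" by auto
qed

lemma indicator_L2_space:
 "B \<in> sets M \<Longrightarrow> emeasure M B < \<infinity> \<Longrightarrow> (\<lambda>x. indicator B x :: complex) \<in> L2_space M"
proof (rule L2_spaceI)
 assume B: "B \<in> sets M" "emeasure M B < \<infinity>"
 have "(\<lambda>x. (norm (indicator B x :: complex))^2) = indicator B"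
  by (auto simp: indicator_def)
 then show "integrable M (\<lambda>x. (norm (indicator B x :: complex))^2)"
  using integrable_real_indicator[OF B] by simp
qed auto

lemma L2_norm_tendsto_0:
 assumes "(\<lambda>n. LINT x|M. (norm (f n x))^2) \<longlonglongrightarrow> 0"
 shows "(\<lambda>n. L2_norm M (f n)) \<longlonglongrightarrow> 0"
 unfolding L2_norm_def using tendsto_real_sqrt[OF assms] by simp

lemma L2_dominated:
 assumes "\<And>n. f n \<in> L2_space M" "g \<in> L2_space M" "\<And>n x. norm (f n x) \<le> norm (g x)"
  "AE x in M. (\<lambda>n. f n x) \<longlonglongrightarrow> 0"
 shows "(\<lambda>n. L2_norm M (f n)) \<longlonglongrightarrow> 0"
proof (rule L2_norm_tendsto_0)
 note [measurable] = assms(1)[THEN L2_space_measurable] assms(2)[THEN L2_space_measurable]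
 have "(\<lambda>n. LINT x|M. (norm (f n x))^2) \<longlonglongrightarrow> (LINT x|M. 0)"
 proof (rule integral_dominated_convergence[where w="\<lambda>x. (norm (g x))^2"])
  show "integrable M (\<lambda>x. (norm (g x))^2)" using assms(2) by (rule L2_space_integrable)
  show "AE x in M. (\<lambda>n. (norm (f n x))^2) \<longlonglongrightarrow> 0"
   using assms(4) by eventually_elim (auto intro!: tendsto_eq_intros)
  show "AE x in M. norm ((norm (f n x))^2) \<le> (norm (g x))^2" for n
   using assms(3) by (auto intro!: power_mono)
 qed measurable
 then show "(\<lambda>n. LINT x|M. (norm (f n x))^2) \<longlonglongrightarrow> 0" by simp
qed

text \<open>The squared norm is twice the measure of U minus twice the measure of its overlap with
  the translate. For the overlap only points of U have to be followed, and openness keeps their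
  translates in U eventually; boundary points never matter.\<close>

lemma L2_translation_continuous_open:
 fixes U :: "'a::euclidean_space set" and z :: "nat \<Rightarrow> 'a"
 assumes U: "open U" "emeasure lborel U < \<infinity>" and z: "z \<longlonglongrightarrow> 0"
 shows "(\<lambda>n. N2 (\<lambda>x. indicator U (x + z n) - indicator U x :: complex)) \<longlonglongrightarrow> 0"
proof (rule L2_norm_tendsto_0)
 have [measurable]: "U \<in> sets borel" using U by simp
 let ?I = "indicator U :: 'a \<Rightarrow> real"
 have i: "integrable lborel ?I" using U by (intro integrable_real_indicator) auto
 have i': "integrable lborel (\<lambda>x. ?I (x + z n))" for n using i by (subst integrable_lborel_translate) auto
 have ii: "integrable lborel (\<lambda>x. ?I (x + z n) * ?I x)" for n
  by (rule lint_bound[OF i]) (auto simp: indicator_def)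
 have "(\<lambda>n. LB x. ?I (x + z n) * ?I x) \<longlonglongrightarrow> (LB x. ?I x)"
 proof (rule integral_dominated_convergence[where w="?I"])
  show "AE x in lborel. (\<lambda>n. ?I (x + z n) * ?I x) \<longlonglongrightarrow> ?I x"
  proof (rule AE_I2)
   fix x
   show "(\<lambda>n. ?I (x + z n) * ?I x) \<longlonglongrightarrow> ?I x"
   proof (cases "x \<in> U")
    case True
    have "(\<lambda>n. x + z n) \<longlonglongrightarrow> x" using tendsto_add[OF tendsto_const z, of x] by simp
    then have "\<forall>\<^sub>F n in sequentially. x + z n \<in> U" using U(1) True by (rule topological_tendstoD)
    then have "\<forall>\<^sub>F n in sequentially. ?I (x + z n) * ?I x = ?I x" by eventually_elim auto
    then show ?thesis by (rule tendsto_eventually)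
   qed auto
  qed
 qed (use i in \<open>auto simp: indicator_def\<close>)
 then have "(\<lambda>n. 2 * (LB x. ?I x) - 2 * (LB x. ?I (x + z n) * ?I x)) \<longlonglongrightarrow>
   2 * (LB x. ?I x) - 2 * (LB x. ?I x)"
  by (intro tendsto_intros)
 moreover have "(LB x. (norm (indicator U (x + z n) - indicator U x :: complex))^2) =
   2 * (LB x. ?I x) - 2 * (LB x. ?I (x + z n) * ?I x)" for n
 proof -
  have "(LB x. (norm (indicator U (x + z n) - indicator U x :: complex))^2) =
   (LB x. ?I (x + z n) + ?I x - 2 * (?I (x + z n) * ?I x))"
   by (intro lint_cong) (auto simp: indicator_def)
  also have "\<dots> = (LB x. ?I (x + z n)) + (LB x. ?I x) - 2 * (LB x. ?I (x + z n) * ?I x)"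
   using i i' ii by simp
  also have "(LB x. ?I (x + z n)) = (LB x. ?I x)"
   by (rule integral_lborel_translate) simp
  finally show ?thesis by simp
 qed
 ultimately show "(\<lambda>n. LB x. (norm (indicator U (x + z n) - indicator U x :: complex))^2) \<longlonglongrightarrow> 0"
  by simp
qed

text \<open>Outer regularity provides an open superset whose excess has measure below e^2, hence an
  approximant at L^2 distance below e to which the open case applies.\<close>

lemma L2_translation_continuous_set:
 fixes B :: "'a::euclidean_space set" and z :: "nat \<Rightarrow> 'a"
 assumes B: "B \<in> sets borel" "emeasure lborel B < \<infinity>" and z: "z \<longlonglongrightarrow> 0"
 shows "(\<lambda>n. N2 (\<lambda>x. indicator B (x + z n) - indicator B x :: complex)) \<longlonglongrightarrow> 0"
proof (rule L2_translation_continuous_approx)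
 show BL: "(\<lambda>x. indicator B x :: complex) \<in> L2" using B by (intro indicator_L2_space) auto
 fix e :: real assume "e > 0"
 then obtain U where U: "open U" "B \<subseteq> U" "emeasure lborel (U - B) < ennreal (e^2)"
  using outer_regular_lborel[OF B(1), of "e^2"] by auto
 note [measurable] = B(1) borel_open[OF U(1)]
 have "emeasure lborel U \<le> emeasure lborel B + emeasure lborel (U - B)"
  using emeasure_subadditive[of B lborel "U - B"] U(2) by (simp add: Un_absorb1)
 also have "\<dots> < \<infinity>" using B(2) U(3) by (auto simp: ennreal_add_less_top less_trans less_top)
 finally have fU: "emeasure lborel U < \<infinity>" .
 have fD: "emeasure lborel (U - B) < \<infinity>" using less_trans[OF U(3) ennreal_less_top] by simp
 have "(N2 (\<lambda>x. indicator B x - indicator U x :: complex))^2 = (LB x. indicator (U - B) x)"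
  unfolding L2_norm_sq using U(2) by (intro lint_cong) (auto simp: indicator_def)
 also have "\<dots> < e\<^sup>2"
  using U(3) fD by (simp add: emeasure_eq_ennreal_measure less_top[symmetric] ennreal_less_iff)
 finally have "N2 (\<lambda>x. indicator B x - indicator U x :: complex) < e"
  using \<open>e > 0\<close> power_less_imp_less_base[of _ 2 e] by fastforce
 then show "\<exists>g\<in>L2. N2 (\<lambda>x. indicator B x - g x :: complex) < e \<and>
   (\<lambda>n. N2 (\<lambda>x. g (x + z n) - g x)) \<longlonglongrightarrow> 0"
  using L2_translation_continuous_open[OF U(1) fU z] fU
  by (intro bexI[of _ "\<lambda>x. indicator U x"] conjI indicator_L2_space) auto
qed

lemma L2_translation_continuous_simple:
 fixes f :: "'a::euclidean_space \<Rightarrow> complex" and z :: "nat \<Rightarrow> 'a"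
 assumes s: "simple_function lborel f" and f: "f \<in> L2" and z: "z \<longlonglongrightarrow> 0"
 shows "(\<lambda>n. N2 (\<lambda>x. f (x + z n) - f x)) \<longlonglongrightarrow> 0"
proof -
 note [measurable] = L2_space_measurable[OF f, simplified]
 define I where "I = range f - {0}"
 have fin: "finite I" using simple_functionD(1)[OF s] by (simp add: I_def)
 have B: "f -` {y} \<in> sets borel" for y using simple_functionD(2)[OF s, of "{y}"] by simp
 \<comment> \<open>Chebyshev's inequality: on the level set of a non-zero value y the function |f|^2
   / |y|^2 is 1, and it is integrable.\<close>
 have eB: "emeasure lborel (f -` {y}) < \<infinity>" if "y \<in> I" for y
 proof -
  have y: "y \<noteq> 0" using that by (simp add: I_def)
  have "integrable lborel (\<lambda>x. indicator (f -` {y}) x :: real)"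
  proof (rule lint_bound)
   show "integrable lborel (\<lambda>x. (norm (f x))^2 / (norm y)\<^sup>2)"
    using L2_space_integrable[OF f] by simp
   show "AE x in lborel. norm (indicator (f -` {y}) x :: real) \<le> norm ((norm (f x))^2 / (norm y)\<^sup>2)"
    using y by (intro AE_I2) (auto simp: indicator_def)
  qed (use B in measurable)
  then show ?thesis by (simp add: integrable_indicator_iff B)
 qed
 have rep: "f x = (\<Sum>y\<in>I. y * indicator (f -` {y}) x)" for x
 proof (cases "f x = 0")
  case False
  then have "f x \<in> I" by (simp add: I_def)
  then show ?thesis
   by (subst sum.remove[OF fin \<open>f x \<in> I\<close>]) (auto simp: indicator_def intro!: sum.neutral)
 qed (auto simp: I_def indicator_def intro!: sum.neutral)
 let ?i = "\<lambda>y. indicator (f -` {y}) :: 'a \<Rightarrow> complex"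
 have D: "(\<lambda>x. ?i y (x + z n) - ?i y x) \<in> L2" if "y \<in> I" for y n
  by (intro L2_space_diff L2_space_translate indicator_L2_space) (use B eB[OF that] in auto)
 have le: "N2 (\<lambda>x. f (x + z n) - f x) \<le>
  (\<Sum>y\<in>I. norm y * N2 (\<lambda>x. ?i y (x + z n) - ?i y x))" for n
 proof -
  have "N2 (\<lambda>x. f (x + z n) - f x) =
    N2 (\<lambda>x. \<Sum>y\<in>I. y * (?i y (x + z n) - ?i y x))"
   by (subst (1 2) rep) (simp add: sum_subtractf right_diff_distrib)
  also have "\<dots> \<le> (\<Sum>y\<in>I. N2 (\<lambda>x. y * (?i y (x + z n) - ?i y x)))"
   by (rule L2_norm_sum) (intro L2_space_cmult D)
  finally show ?thesis by (simp add: L2_norm_cmult)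
 qed
 have "(\<lambda>n. \<Sum>y\<in>I. norm y * N2 (\<lambda>x. ?i y (x + z n) - ?i y x)) \<longlonglongrightarrow> (\<Sum>y\<in>I. norm y * 0)"
  by (intro tendsto_sum tendsto_mult tendsto_const L2_translation_continuous_set B eB z)
 then have lim: "(\<lambda>n. \<Sum>y\<in>I. norm y * N2 (\<lambda>x. ?i y (x + z n) - ?i y x)) \<longlonglongrightarrow> 0"
  by simp
 show ?thesis
 proof (rule Lim_null_comparison[OF _ lim])
  show "\<forall>\<^sub>F n in sequentially. norm (N2 (\<lambda>x. f (x + z n) - f x)) \<le>
   (\<Sum>y\<in>I. norm y * N2 (\<lambda>x. ?i y (x + z n) - ?i y x))"
   using le by (intro always_eventually allI) (simp only: real_norm_def abs_of_nonneg[OF L2_norm_nonneg])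
 qed
qed

theorem L2_translation_continuous:
 fixes f :: "'a::euclidean_space \<Rightarrow> complex" and z :: "nat \<Rightarrow> 'a"
 assumes f: "f \<in> L2" and z: "z \<longlonglongrightarrow> 0"
 shows "(\<lambda>n. N2 (\<lambda>x. f (x + z n) - f x)) \<longlonglongrightarrow> 0"
proof (rule L2_translation_continuous_approx[OF f])
 fix e :: real assume e: "e > 0"
 note [measurable] = L2_space_measurable[OF f, simplified]
 obtain F where F: "\<And>i. simple_function lborel (F i)" "\<And>x. (\<lambda>i. F i x) \<longlonglongrightarrow> f x"
  "\<And>i x. norm (F i x) \<le> 2 * norm (f x)"
  using borel_measurable_implies_sequence_metric[of f lborel 0] by auto
 have FL: "F i \<in> L2" for i
  by (rule L2_space_bound[OF f, where C=2]) (use F borel_measurable_simple_function[OF F(1)] in auto)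
 have "(\<lambda>i. N2 (\<lambda>x. f x - F i x)) \<longlonglongrightarrow> 0"
 proof (rule L2_dominated[where g="\<lambda>x. 3 * f x"])
  show "norm (f x - F n x) \<le> norm (3 * f x)" for n x
   using norm_triangle_ineq4[of "f x" "F n x"] F(3)[of n x] by (simp add: norm_mult)
  show "AE x in lborel. (\<lambda>n. f x - F n x) \<longlonglongrightarrow> 0"
  proof (rule AE_I2)
   fix x
   show "(\<lambda>n. f x - F n x) \<longlonglongrightarrow> 0"
    using tendsto_diff[OF tendsto_const F(2), of "f x" x] by simp
  qed
 qed (intro L2_space_diff L2_space_cmult f FL)+
 then have "\<forall>\<^sub>F i in sequentially. N2 (\<lambda>x. f x - F i x) < e"
  using e by (rule order_tendstoD)
 then obtain i where "N2 (\<lambda>x. f x - F i x) < e"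
  by (auto simp: eventually_sequentially)
 then show "\<exists>g\<in>L2. N2 (\<lambda>x. f x - g x) < e \<and> (\<lambda>n. N2 (\<lambda>x. g (x + z n) - g x)) \<longlonglongrightarrow> 0"
  using FL L2_translation_continuous_simple[OF F(1) FL z] by blast
qed

section \<open>Gaussians and their Fourier integrals\<close>

lemma lborel_affine_integral:
 fixes f :: "'a::euclidean_space \<Rightarrow> complex"
 assumes c: "c > 0" and [measurable]: "f \<in> borel_measurable borel"
 shows "(LB x. f x) = of_real (c ^ DIM('a)) * (LB x. f (t + c *\<^sub>R x))"
proof -
 have "(LB x. f x) = (LINT x|density (distr lborel borel (\<lambda>x. t + c *\<^sub>R x)) (\<lambda>_. \<bar>c\<bar>^DIM('a)). f x)"
  using lborel_affine[of c t] c by simp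
 also have "\<dots> = (LINT x|distr lborel borel (\<lambda>x. t + c *\<^sub>R x). (\<bar>c\<bar>^DIM('a)) *\<^sub>R f x)"
  by (rule integral_density) auto
 also have "\<dots> = (LB x. (\<bar>c\<bar>^DIM('a)) *\<^sub>R f (t + c *\<^sub>R x))"
  by (rule integral_distr) auto
 finally show ?thesis using c by (simp add: scaleR_conv_of_real)
qed

text \<open>Built from one-dimensional normal densities, so that its total mass and its Fourier
  integral factor over the coordinates and come from the normal law.\<close>

definition gauss :: "'a::euclidean_space \<Rightarrow> real" where
 "gauss x = (\<Prod>b\<in>Basis. std_normal_density (x \<bullet> b))"

lemma gauss_measurable [measurable]: "gauss \<in> borel_measurable borel"
 unfolding gauss_def by measurable

lemma gauss_pos: "0 < gauss x"
 unfolding gauss_def by (intro prod_pos) (simp add: normal_density_pos)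

lemma gauss_eq: "gauss (x::'a::euclidean_space) = (1 / sqrt (2 * pi)) ^ DIM('a) * exp (- (norm x)\<^sup>2 / 2)"
proof -
 have "gauss x = (\<Prod>b\<in>(Basis :: 'a set). 1 / sqrt (2 * pi)) * (\<Prod>b\<in>Basis. exp (- (x \<bullet> b)\<^sup>2 / 2))"
  unfolding gauss_def std_normal_density_def by (rule prod.distrib)
 also have "(\<Prod>b\<in>Basis. exp (- (x \<bullet> b)\<^sup>2 / 2)) = exp (\<Sum>b\<in>Basis. - (x \<bullet> b)\<^sup>2 / 2)"
  by (simp add: exp_sum)
 also have "(\<Sum>b\<in>Basis. - (x \<bullet> b)\<^sup>2 / 2) = - (norm x)\<^sup>2 / 2"
  by (simp add: norm_eq_sqrt_inner euclidean_inner[of x x] power2_eq_square sum_negf sum_divide_distrib sum_nonneg)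
 finally show ?thesis by simp
qed

lemma integral_lborel_prod:
 fixes f :: "'a::euclidean_space \<Rightarrow> real \<Rightarrow> complex"
 assumes "\<And>b. b \<in> Basis \<Longrightarrow> integrable lborel (f b)"
 shows "(LB x. (\<Prod>b\<in>Basis. f b (x \<bullet> b))) = (\<Prod>b\<in>Basis. LB x. f b x)"
proof -
 interpret product_sigma_finite "\<lambda>_::'a. lborel :: real measure" ..
 have m: "\<And>b. b \<in> Basis \<Longrightarrow> f b \<in> borel_measurable borel"
  using assms borel_measurable_integrable by fastforce
 have "(LB x. (\<Prod>b\<in>Basis. f b (x \<bullet> b))) =
  (LINT x|Pi\<^sub>M Basis (\<lambda>_. lborel). (\<Prod>b\<in>Basis. f b ((\<Sum>c\<in>Basis. x c *\<^sub>R c) \<bullet> b)))"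
  by (subst lborel_eq, subst integral_distr) (use m in auto)
 also have "\<dots> = (LINT x|Pi\<^sub>M Basis (\<lambda>_. lborel). (\<Prod>b\<in>Basis. f b (x b)))"
  by (intro lint_cong prod.cong refl) simp
 also have "\<dots> = (\<Prod>b\<in>Basis. LB x. f b x)"
  by (rule product_integral_prod) (use assms in auto)
 finally show ?thesis .
qed

lemma nn_integral_gauss: "(NN x. ennreal (gauss (x::'a::euclidean_space))) = 1"
proof -
 have "(NN x. ennreal (gauss (x::'a))) = (\<integral>\<^sup>+x. (\<Prod>b\<in>Basis. ennreal (std_normal_density (x \<bullet> b))) \<partial>(lborel :: 'a measure))"
  unfolding gauss_def by (subst prod_ennreal) auto
 also have "\<dots> = (\<Prod>b\<in>(Basis :: 'a set). NN x. ennreal (std_normal_density x))"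
  by (rule nn_integral_lborel_prod) auto
 also have "(NN x. ennreal (std_normal_density x)) = 1"
  using nn_integral_eq_integral[of lborel std_normal_density]
  by (simp add: integrable_normal_density integral_normal_density)
 finally show ?thesis by simp
qed

lemma integrable_gauss: "integrable lborel gauss"
 by (rule integrableI_nonneg) (auto simp: nn_integral_gauss less_imp_le[OF gauss_pos])

lemma integral_gauss: "(LB x. gauss (x::'a::euclidean_space)) = 1"
 using nn_integral_eq_integral[OF integrable_gauss[where 'a='a]] nn_integral_gauss[where 'a='a]
 by (simp add: less_imp_le[OF gauss_pos] ennreal_eq_1)

lemma cis_measurable [measurable]: "cis \<in> borel_measurable borel"
 by (intro borel_measurable_continuous_onI continuous_on_cis continuous_on_id)

text \<open>Each coordinate contributes the characteristic function of the standard normal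
  distribution.\<close>

lemma integral_cis_gauss:
 fixes z :: "'a::euclidean_space"
 shows "(LB x. cis (z \<bullet> x) * gauss x) = of_real (exp (- (norm z)\<^sup>2 / 2))"
proof -
 have 1: "(LB x. cis (t * x) * of_real (std_normal_density x)) = of_real (exp (- (t^2) / 2))" for t :: real
 proof -
  have "of_real (exp (- (t^2) / 2)) = char std_normal_distribution t"
   by (simp add: char_std_normal_distribution)
  also have "\<dots> = (LB x. std_normal_density x *\<^sub>R iexp (t * x))"
   unfolding char_def by (subst integral_density) auto
  also have "\<dots> = (LB x. cis (t * x) * of_real (std_normal_density x))"
   by (simp add: cis_conv_exp scaleR_conv_of_real mult.commute)
  finally show ?thesis by simp
 qed
 have i: "integrable lborel (\<lambda>x. cis (t * x) * of_real (std_normal_density x))" for t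
  by (rule lint_bound[where f="std_normal_density"])
   (auto simp: norm_mult integrable_normal_density)
 have "(LB x. cis (z \<bullet> x) * gauss x) =
  (LB x. (\<Prod>b\<in>Basis. cis ((z \<bullet> b) * (x \<bullet> b)) * of_real (std_normal_density (x \<bullet> b))))"
 proof (intro lint_cong refl)
  fix x
  have "cis (z \<bullet> x) = (\<Prod>b\<in>Basis. cis ((z \<bullet> b) * (x \<bullet> b)))"
   by (subst euclidean_inner) (simp add: cis_conv_exp exp_sum sum_distrib_left)
  then show "cis (z \<bullet> x) * gauss x = (\<Prod>b\<in>Basis. cis ((z \<bullet> b) * (x \<bullet> b)) * of_real (std_normal_density (x \<bullet> b)))"
   by (simp add: gauss_def prod.distrib)
 qed
 also have "\<dots> = (\<Prod>b\<in>Basis. of_real (exp (- ((z \<bullet> b)^2) / 2)))"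
  by (subst integral_lborel_prod[OF i]) (simp only: 1)
 also have "\<dots> = of_real (exp (\<Sum>b\<in>Basis. - (z \<bullet> b)\<^sup>2 / 2))"
  by (simp add: exp_sum)
 also have "(\<Sum>b\<in>Basis. - (z \<bullet> b)\<^sup>2 / 2) = - (norm z)\<^sup>2 / 2"
  by (simp add: norm_eq_sqrt_inner euclidean_inner[of z z] power2_eq_square sum_negf sum_divide_distrib sum_nonneg)
 finally show ?thesis .
qed

section \<open>Plancherel's theorem\<close>

lemma integrable_pair_mult:
 fixes f :: "'a::euclidean_space \<Rightarrow> complex" and g :: "'b::euclidean_space \<Rightarrow> complex"
 assumes f: "integrable lborel f" and g: "integrable lborel g"
 shows "integrable (lborel \<Otimes>\<^sub>M lborel) (\<lambda>(x, y). f x * g y)"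
proof -
 note [measurable] = borel_measurable_integrable[OF f] borel_measurable_integrable[OF g]
 show ?thesis
 proof (rule lborel_pair.Fubini_integrable)
  show "integrable lborel (\<lambda>x. LB y. norm (case (x, y) of (x, y) \<Rightarrow> f x * g y))"
   using f by (simp add: norm_mult)
  show "AE x in lborel. integrable lborel (\<lambda>y. case (x, y) of (x, y) \<Rightarrow> f x * g y)"
   using g by simp
 qed measurable
qed

text \<open>The form in which Fubini's hypothesis is met in most exchanges of integrals below: a
  bounded jointly measurable kernel times a product of two integrable functions of one variable
  each.\<close>

lemma integrable_pair_mult_bounded:
 fixes f :: "'a::euclidean_space \<Rightarrow> complex" and g :: "'b::euclidean_space \<Rightarrow> complex"
  and K :: "'a \<Rightarrow> 'b \<Rightarrow> complex"
 assumes f: "integrable lborel f" and g: "integrable lborel g"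
  and K: "(\<lambda>(x, y). K x y) \<in> borel_measurable (lborel \<Otimes>\<^sub>M lborel)" "\<And>x y. norm (K x y) \<le> C"
 shows "integrable (lborel \<Otimes>\<^sub>M lborel) (\<lambda>(x, y). K x y * (f x * g y))"
proof (rule lint_bound)
 note [measurable] = borel_measurable_integrable[OF f] borel_measurable_integrable[OF g] K(1)
 show "integrable (lborel \<Otimes>\<^sub>M lborel) (\<lambda>z. of_real C * (\<lambda>(x, y). f x * g y) z)"
  by (intro integrable_mult_right integrable_pair_mult f g)
 show "(\<lambda>(x, y). K x y * (f x * g y)) \<in> borel_measurable (lborel \<Otimes>\<^sub>M lborel)"
  using borel_measurable_times[OF K(1), of "\<lambda>(x, y). f x * g y"] by (simp add: split_def)
 have C: "0 \<le> C" using K(2) norm_ge_zero order_trans by blast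
 show "AE z in lborel \<Otimes>\<^sub>M lborel. norm (case z of (x, y) \<Rightarrow> K x y * (f x * g y))
   \<le> norm (complex_of_real C * (case z of (x, y) \<Rightarrow> f x * g y))"
  using K(2) C by (auto simp: norm_mult intro!: AE_I2 mult_right_mono)
qed

text \<open>Without normalisation and with the sign as a parameter: \<open>s = -1\<close> is the
  forward transform and \<open>s = 1\<close> inverts it up to (2\<pi>)^n. The hypothesis
  \<open>s^2 = 1\<close> in later statements covers both.\<close>

definition fourier :: "real \<Rightarrow> ('a::euclidean_space \<Rightarrow> complex) \<Rightarrow> 'a \<Rightarrow> complex" where
 "fourier s f \<eta> = (LB x. cis (s * (\<eta> \<bullet> x)) * f x)"

lemma fourier_measurable [measurable]:
 assumes [measurable]: "f \<in> borel_measurable borel"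
 shows "fourier s f \<in> borel_measurable borel"
 unfolding fourier_def by measurable

lemma integrable_cis_mult:
 fixes \<phi> :: "'a::euclidean_space \<Rightarrow> real"
 assumes f: "integrable lborel f" and [measurable]: "\<phi> \<in> borel_measurable borel"
 shows "integrable lborel (\<lambda>x. cis (\<phi> x) * f x)"
proof (rule lint_bound[OF f])
 note [measurable] = borel_measurable_integrable[OF f]
 show "(\<lambda>x. cis (\<phi> x) * f x) \<in> borel_measurable lborel" by measurable
qed (simp add: norm_mult)

lemma norm_fourier_le: "norm (fourier s f \<eta>) \<le> (LB x. norm (f x))"
 unfolding fourier_def by (rule order_trans[OF integral_norm_bound]) (simp add: norm_mult)

text \<open>Fubini's theorem and the symmetry of the kernel in x and y. This identity is what allows
  the transform to be shifted from one factor to the other, and later to be extended to L^2 by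
  duality.\<close>

lemma fourier_mult:
 fixes f g :: "'a::euclidean_space \<Rightarrow> complex"
 assumes f: "integrable lborel f" and g: "integrable lborel g"
 shows "(LB x. fourier s f x * g x) = (LB x. f x * fourier s g x)"
proof -
 have i: "integrable (lborel \<Otimes>\<^sub>M lborel) (\<lambda>(x::'a, y::'a). cis (s * (x \<bullet> y)) * (f x * g y))"
  by (rule integrable_pair_mult_bounded[OF f g, where C=1]) (simp_all add: split_def)
 have "(LB y. fourier s f y * g y) = (LB y. LB x. cis (s * (x \<bullet> y)) * (f x * g y))"
  unfolding fourier_def
  by (simp add: inner_commute mult.assoc flip: integral_mult_left_zero)
 also have "\<dots> = (LB x. LB y. cis (s * (x \<bullet> y)) * (f x * g y))"
  by (rule lborel_pair.Fubini_integral[OF i])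
 also have "\<dots> = (LB x. f x * fourier s g x)"
  unfolding fourier_def by (simp add: mult.left_commute flip: integral_mult_right_zero)
 finally show ?thesis .
qed

lemma cnj_measurable [measurable (raw)]:
 "f \<in> borel_measurable M \<Longrightarrow> (\<lambda>x. cnj (f x)) \<in> borel_measurable M"
 by (rule measurable_compose[of f M borel cnj borel])
  (auto intro!: borel_measurable_continuous_onI continuous_intros)

lemma cnj_fourier: "cnj (fourier s f \<eta>) = fourier (- s) (\<lambda>x. cnj (f x)) \<eta>"
 unfolding fourier_def by (simp add: cis_cnj flip: Bochner_Integration.integral_cnj)

section \<open>Plancherel's identity by Gaussian regularisation\<close>

lemma gauss_scale_FT:
 fixes z :: "'a::euclidean_space"
 assumes \<delta>: "\<delta> > 0"
 shows "(LB \<eta>. cis (\<eta> \<bullet> z) * gauss (\<delta> *\<^sub>R \<eta>))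
  = of_real ((1/\<delta>) ^ DIM('a) * exp (- (norm z)\<^sup>2 / (2 * \<delta>\<^sup>2)))"
proof -
 have "(LB \<eta>. cis (\<eta> \<bullet> z) * gauss (\<delta> *\<^sub>R \<eta>)) =
  of_real ((1/\<delta>) ^ DIM('a)) * (LB \<eta>. cis ((0 + (1/\<delta>) *\<^sub>R \<eta>) \<bullet> z) * gauss (\<delta> *\<^sub>R (0 + (1/\<delta>) *\<^sub>R \<eta>)))"
  using \<delta> by (intro lborel_affine_integral) auto
 also have "(LB \<eta>. cis ((0 + (1/\<delta>) *\<^sub>R \<eta>) \<bullet> z) * gauss (\<delta> *\<^sub>R (0 + (1/\<delta>) *\<^sub>R \<eta>)))
  = (LB \<eta>. cis (((1/\<delta>) *\<^sub>R z) \<bullet> \<eta>) * gauss \<eta>)"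
  using \<delta> by (simp add: inner_commute)
 also have "\<dots> = of_real (exp (- (norm ((1/\<delta>) *\<^sub>R z))\<^sup>2 / 2))"
  by (rule integral_cis_gauss)
 also have "- (norm ((1/\<delta>) *\<^sub>R z))\<^sup>2 / 2 = - (norm z)\<^sup>2 / (2 * \<delta>\<^sup>2)"
  by (simp add: power_divide)
 finally show ?thesis by simp
qed

definition L12 :: "('a::euclidean_space \<Rightarrow> complex) set" where
 "L12 = {f \<in> L2. integrable lborel f}"

lemma L12D:
 assumes "f \<in> L12"
 shows "f \<in> L2" "integrable lborel f" "f \<in> borel_measurable borel"
 using assms by (auto simp: L12_def dest: L2_space_measurable)

text \<open>A function that is not integrable has integral 0 by convention; scaling would then make
  the integral of \<open>gauss\<close>, which is 1, vanish.\<close>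

lemma integrable_gauss_scale:
 assumes \<delta>: "\<delta> > 0"
 shows "integrable lborel (\<lambda>x::'a::euclidean_space. complex_of_real (gauss (\<delta> *\<^sub>R x)))"
proof (rule ccontr)
 assume n: "\<not> ?thesis"
 have "(LB x. complex_of_real (gauss (x::'a))) =
  of_real (\<delta> ^ DIM('a)) * (LB x. complex_of_real (gauss (0 + \<delta> *\<^sub>R (x::'a))))"
  by (rule lborel_affine_integral) (use \<delta> in auto)
 with not_integrable_integral_eq[OF n] show False by (simp add: integral_gauss)
qed

lemma integrable_gauss_exp: "integrable lborel (\<lambda>x::'a::euclidean_space. exp (- (norm x)\<^sup>2 / 2))"
 and integral_gauss_exp: "(LB x. exp (- (norm (x::'a))\<^sup>2 / 2)) = sqrt (2 * pi) ^ DIM('a)"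
proof -
 have e: "(\<lambda>x::'a. exp (- (norm x)\<^sup>2 / 2)) = (\<lambda>x. sqrt (2 * pi) ^ DIM('a) * gauss x)"
  by (rule ext) (simp add: gauss_eq power_divide)
 show "integrable lborel (\<lambda>x::'a. exp (- (norm x)\<^sup>2 / 2))"
  unfolding e using integrable_gauss by simp
 show "(LB x. exp (- (norm (x::'a))\<^sup>2 / 2)) = sqrt (2 * pi) ^ DIM('a)"
  unfolding e by (simp add: integral_gauss)
qed

text \<open>The autocorrelation z \<mapsto> \<integral> f(x) cnj f(x + z) dx is bounded by its value
  at 0, the squared norm of f, and its deviation from that value is controlled by the modulus of
  continuity of translations. The Fourier transform of the autocorrelation is |f^|^2 up to
  reflection, which is why Plancherel's identity reduces to its behaviour at 0.\<close>

lemma autocorrelation_bound: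
 assumes f: "f \<in> L2"
 shows "(LB x. norm (f x * cnj (f (x + z)))) \<le> (N2 f)^2"
  and "integrable lborel (\<lambda>x. f x * cnj (f (x + z)))"
  and "norm ((LB x. f x * cnj (f (x + z))) - of_real ((N2 f)^2)) \<le>
   N2 f * N2 (\<lambda>x. f (x + z) - f x)"
proof -
 note [measurable] = L2_space_measurable[OF f, simplified]
 have ct: "(\<lambda>x. cnj (f (x + z))) \<in> L2" for z
  by (rule L2_space_norm_eq[OF L2_space_translate[OF f, of z]]) auto
 have nt: "N2 (\<lambda>x. cnj (f (x + z))) = N2 f"
  using L2_norm_translate[OF f, of z] by (subst L2_norm_cong[where f="\<lambda>x. f (x + z)"]) auto
 show "(LB x. norm (f x * cnj (f (x + z)))) \<le> (N2 f)^2"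
  using L2_Cauchy_Schwarz_norm[OF f ct[of z]] by (simp add: nt norm_mult power2_eq_square)
 show i: "integrable lborel (\<lambda>x. f x * cnj (f (x + z)))" for z
  by (rule L2_mult_integrable[OF f ct])
 have i0: "integrable lborel (\<lambda>x. f x * cnj (f x))" using i[of 0] by simp
 have "of_real ((N2 f)^2) = (LB x. f x * cnj (f x))"
  by (simp add: L2_norm_sq complex_norm_square[symmetric] del: of_real_power flip: integral_complex_of_real)
 then have "(LB x. f x * cnj (f (x + z))) - of_real ((N2 f)^2) =
  (LB x. f x * cnj (f (x + z) - f x))"
  using i[of z] i0 by (simp add: right_diff_distrib)
 also have "norm \<dots> \<le> N2 f * N2 (\<lambda>x. cnj (f (x + z) - f x))"
  by (rule L2_Cauchy_Schwarz[OF f]) (use L2_space_diff[OF ct[of z] ct[of 0]] in simp)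
 also have "N2 (\<lambda>x. cnj (f (x + z) - f x)) = N2 (\<lambda>x. f (x + z) - f x)"
  by (rule L2_norm_cong) (metis complex_mod_cnj)
 finally show "norm ((LB x. f x * cnj (f (x + z))) - of_real ((N2 f)^2)) \<le>
   N2 f * N2 (\<lambda>x. f (x + z) - f x)" .
qed

text \<open>The square of the transform is not yet known to be integrable, so a Gaussian factor
  damps it. Shifting the transform twice with \<open>fourier_mult\<close> turns the damped integral
  into a Gaussian average of the autocorrelation of f at scale \<delta>.\<close>

lemma Plancherel_regularised:
 fixes f :: "'a::euclidean_space \<Rightarrow> complex"
 assumes f: "f \<in> L12" and s: "s^2 = 1" and \<delta>: "\<delta> > 0"
 shows "integrable lborel (\<lambda>\<eta>. (norm (fourier s f \<eta>))^2 * gauss (\<delta> *\<^sub>R \<eta>))"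
  and "of_real (LB \<eta>. (norm (fourier s f \<eta>))^2 * gauss (\<delta> *\<^sub>R \<eta>)) =
   (LB w. exp (- (norm (w::'a))\<^sup>2 / 2) * (LB x. f x * cnj (f (x + \<delta> *\<^sub>R w))))"
proof -
 note fD = L12D[OF f]
 note [measurable] = fD(3)
 have fc: "integrable lborel (\<lambda>x. cnj (f x))" using fD(2) by simp
 let ?g = "\<lambda>x::'a. complex_of_real (gauss (\<delta> *\<^sub>R x))"
 note gi = integrable_gauss_scale[OF \<delta>, where 'a='a]
 define G where "G \<eta> = cnj (fourier s f \<eta>) * ?g \<eta>" for \<eta>
 define B where "B = (LB x. norm (f x))"
 have B: "norm (fourier s f \<eta>) \<le> B" for \<eta> unfolding B_def by (rule norm_fourier_le)
 have B0: "0 \<le> B" unfolding B_def by simp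
 have Gi: "integrable lborel G"
 proof (rule lint_bound)
  show "integrable lborel (\<lambda>\<eta>. of_real B * ?g \<eta>)" using gi by simp
  show "AE x in lborel. norm (G x) \<le> norm (of_real B * ?g x)"
   using B B0 by (intro AE_I2) (auto simp: G_def norm_mult intro!: mult_right_mono)
 qed (simp add: G_def[abs_def])
 show int: "integrable lborel (\<lambda>\<eta>. (norm (fourier s f \<eta>))^2 * gauss (\<delta> *\<^sub>R \<eta>))"
 proof (rule lint_bound)
  show "integrable lborel (\<lambda>\<eta>. of_real (B^2) * ?g \<eta>)" using gi by (intro integrable_mult_right)
  show "AE x in lborel. norm ((norm (fourier s f x))^2 * gauss (\<delta> *\<^sub>R x)) \<le> norm (of_real (B^2) * ?g x)"
  proof (rule AE_I2)
   fix x
   have "(norm (fourier s f x))^2 \<le> B^2" using B by (intro power_mono) auto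
   then show "norm ((norm (fourier s f x))^2 * gauss (\<delta> *\<^sub>R x)) \<le> norm (of_real (B^2) * ?g x)"
    by (simp add: norm_mult abs_mult mult_right_mono norm_power)
  qed
 qed measurable
 \<comment> \<open>The transform is moved from the conjugate of f to a modulated Gaussian, whose
   transform is a Gaussian centred at x.\<close>
 have *: "fourier s G x = (LB w. exp (- (norm (w::'a))\<^sup>2 / 2) * cnj (f (x + \<delta> *\<^sub>R w)))" for x
 proof -
  let ?c = "\<lambda>\<eta>::'a. cis (s * (x \<bullet> \<eta>)) * ?g \<eta>"
  have ci: "integrable lborel ?c" by (rule integrable_cis_mult[OF gi]) simp
  have "fourier s G x = (LB \<eta>. fourier (-s) (\<lambda>x. cnj (f x)) \<eta> * ?c \<eta>)"
   unfolding fourier_def[of s G] G_def cnj_fourier by (simp add: ac_simps)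
  also have "\<dots> = (LB y. cnj (f y) * fourier (-s) ?c y)"
   by (rule fourier_mult[OF fc ci])
  also have "\<dots> = (LB y. cnj (f y) * of_real ((1/\<delta>) ^ DIM('a) * exp (- (norm (x - y))\<^sup>2 / (2 * \<delta>\<^sup>2))))"
  proof (intro lint_cong refl)
   fix y
   have "fourier (-s) ?c y = (LB \<eta>. cis (\<eta> \<bullet> (s *\<^sub>R (x - y))) * ?g \<eta>)"
    unfolding fourier_def
    by (intro lint_cong refl)
     (simp add: cis_mult mult.assoc[symmetric] inner_diff_right inner_commute right_diff_distrib)
   also have "\<dots> = of_real ((1/\<delta>) ^ DIM('a) * exp (- (norm (s *\<^sub>R (x - y)))\<^sup>2 / (2 * \<delta>\<^sup>2)))"
    by (rule gauss_scale_FT[OF \<delta>])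
   also have "(norm (s *\<^sub>R (x - y)))^2 = (norm (x - y))^2"
    using s by (simp add: power_mult_distrib)
   finally show "cnj (f y) * fourier (-s) ?c y = cnj (f y) * of_real ((1/\<delta>) ^ DIM('a) * exp (- (norm (x - y))\<^sup>2 / (2 * \<delta>\<^sup>2)))"
    by simp
  qed
  \<comment> \<open>The substitution y = x + \<delta> w produces \<delta>^n, which cancels the power
    (1/\<delta>)^n in front of the Gaussian.\<close>
  also have "\<dots> = of_real (\<delta> ^ DIM('a)) * (LB w. cnj (f (x + \<delta> *\<^sub>R w)) *
    of_real ((1/\<delta>) ^ DIM('a) * exp (- (norm (x - (x + \<delta> *\<^sub>R w)))\<^sup>2 / (2 * \<delta>\<^sup>2))))"
   by (rule lborel_affine_integral[OF \<delta>]) measurable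
  also have "\<dots> = (LB w. of_real (\<delta> ^ DIM('a)) * (cnj (f (x + \<delta> *\<^sub>R w)) *
    of_real ((1/\<delta>) ^ DIM('a) * exp (- (norm (x - (x + \<delta> *\<^sub>R w)))\<^sup>2 / (2 * \<delta>\<^sup>2)))))"
   by simp
  also have "\<dots> = (LB w. exp (- (norm (w::'a))\<^sup>2 / 2) * cnj (f (x + \<delta> *\<^sub>R w)))"
   using \<delta> by (intro lint_cong refl)
    (simp add: power_mult_distrib power_one_over field_simps)
  finally show ?thesis .
 qed
 have ei: "integrable lborel (\<lambda>w::'a. complex_of_real (exp (- (norm w)\<^sup>2 / 2)))"
  using integrable_gauss_exp[where 'a='a] by simp
 have fub: "integrable (lborel \<Otimes>\<^sub>M lborel)
  (\<lambda>(w::'a, x). complex_of_real (exp (- (norm w)\<^sup>2 / 2)) * (f x * cnj (f (x + \<delta> *\<^sub>R w))))"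
 proof (rule lborel_pair.Fubini_integrable)
  show "AE w in lborel. integrable lborel (\<lambda>x. case (w, x) of (w, x) \<Rightarrow>
    complex_of_real (exp (- (norm w)\<^sup>2 / 2)) * (f x * cnj (f (x + \<delta> *\<^sub>R w))))"
   by (intro AE_I2) (unfold prod.case, intro integrable_mult_right autocorrelation_bound(2)[OF fD(1)])
  show "integrable lborel (\<lambda>w. LB x. norm (case (w, x) of (w, x) \<Rightarrow>
    complex_of_real (exp (- (norm w)\<^sup>2 / 2)) * (f x * cnj (f (x + \<delta> *\<^sub>R w)))))"
  proof (rule lint_bound)
   show "integrable lborel (\<lambda>w::'a. exp (- (norm w)\<^sup>2 / 2) * (N2 f)^2)"
    using integrable_gauss_exp[where 'a='a] by simp
   show "AE w in lborel. norm (LB x. norm (case (w, x) of (w, x) \<Rightarrow>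
     complex_of_real (exp (- (norm w)\<^sup>2 / 2)) * (f x * cnj (f (x + \<delta> *\<^sub>R w)))))
     \<le> norm (exp (- (norm w)\<^sup>2 / 2) * (N2 f)^2)"
    using autocorrelation_bound(1)[OF fD(1)]
    by (intro AE_I2) (simp add: norm_mult abs_mult integral_nonneg_AE)
  qed measurable
 qed measurable
 have "complex_of_real (LB \<eta>. (norm (fourier s f \<eta>))^2 * gauss (\<delta> *\<^sub>R \<eta>)) =
   (LB \<eta>. fourier s f \<eta> * G \<eta>)"
  unfolding integral_complex_of_real[symmetric]
  by (intro lint_cong refl) (simp add: G_def complex_norm_square mult.assoc del: of_real_power)
 also have "\<dots> = (LB x. f x * fourier s G x)"
  by (rule fourier_mult[OF fD(2) Gi])
 also have "\<dots> = (LB x. LB w. complex_of_real (exp (- (norm (w::'a))\<^sup>2 / 2)) * (f x * cnj (f (x + \<delta> *\<^sub>R w))))"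
  unfolding * by (simp add: mult.left_commute flip: integral_mult_right_zero)
 also have "\<dots> = (LB w. LB x. complex_of_real (exp (- (norm (w::'a))\<^sup>2 / 2)) * (f x * cnj (f (x + \<delta> *\<^sub>R w))))"
  by (rule lborel_pair.Fubini_integral[OF fub])
 finally show "of_real (LB \<eta>. (norm (fourier s f \<eta>))^2 * gauss (\<delta> *\<^sub>R \<eta>)) =
   (LB w. exp (- (norm (w::'a))\<^sup>2 / 2) * (LB x. f x * cnj (f (x + \<delta> *\<^sub>R w))))"
  by simp
qed

text \<open>Let \<delta> tend to 0 in the regularised identity. The averages of the autocorrelation
  converge by dominated convergence and the continuity of translations, the damped integrals by
  monotone convergence; the second limit also yields the integrability of the squared
  transform.\<close>

theorem Plancherel:
 fixes f :: "'a::euclidean_space \<Rightarrow> complex"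
 assumes f: "f \<in> L12" and s: "s^2 = 1"
 shows "fourier s f \<in> L2"
  and "(N2 (fourier s f))^2 = (2 * pi) ^ DIM('a) * (N2 f)^2"
proof -
 note fD = L12D[OF f]
 note [measurable] = fD(3)
 define \<delta> where "\<delta> k = inverse (real (Suc k))" for k
 have \<delta>: "\<delta> k > 0" for k by (simp add: \<delta>_def)
 have \<delta>0: "\<delta> \<longlonglongrightarrow> 0" unfolding \<delta>_def by (rule LIMSEQ_inverse_real_of_nat)
 let ?N = "(N2 f)^2"
 let ?J = "\<lambda>k. LB \<eta>. (norm (fourier s f \<eta>))^2 * gauss (\<delta> k *\<^sub>R \<eta>)"
 let ?A = "\<lambda>z. LB x. f x * cnj (f (x + z))"
 have "(\<lambda>k. LB w. exp (- (norm (w::'a))\<^sup>2 / 2) * ?A (\<delta> k *\<^sub>R w)) \<longlonglongrightarrow>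
  (LB w. complex_of_real (exp (- (norm (w::'a))\<^sup>2 / 2)) * of_real ?N)"
 proof (rule integral_dominated_convergence[where w="\<lambda>w::'a. exp (- (norm w)\<^sup>2 / 2) * ?N"])
  show "integrable lborel (\<lambda>w::'a. exp (- (norm w)\<^sup>2 / 2) * ?N)"
   using integrable_gauss_exp[where 'a='a] by simp
  have le: "norm (?A z) \<le> ?N" for z
   by (rule order_trans[OF integral_norm_bound autocorrelation_bound(1)[OF fD(1)]])
  show "AE w in lborel. norm (complex_of_real (exp (- (norm (w::'a))\<^sup>2 / 2)) * ?A (\<delta> k *\<^sub>R w)) \<le> exp (- (norm w)\<^sup>2 / 2) * ?N" for k
   using le by (intro AE_I2) (simp add: norm_mult)
  show "AE w in lborel. (\<lambda>k. complex_of_real (exp (- (norm (w::'a))\<^sup>2 / 2)) * ?A (\<delta> k *\<^sub>R w)) \<longlonglongrightarrow>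
    complex_of_real (exp (- (norm w)\<^sup>2 / 2)) * of_real ?N"
  proof (intro AE_I2 tendsto_mult tendsto_const)
   fix w :: 'a
   have "(\<lambda>k. \<delta> k *\<^sub>R w) \<longlonglongrightarrow> 0" using tendsto_scaleR[OF \<delta>0 tendsto_const, of w] by simp
   then have "(\<lambda>k. N2 (\<lambda>x. f (x + \<delta> k *\<^sub>R w) - f x)) \<longlonglongrightarrow> 0"
    by (rule L2_translation_continuous[OF fD(1)])
   then have "(\<lambda>k. N2 f * N2 (\<lambda>x. f (x + \<delta> k *\<^sub>R w) - f x)) \<longlonglongrightarrow> 0"
    by (rule tendsto_mult_right_zero)
   then show "(\<lambda>k. ?A (\<delta> k *\<^sub>R w)) \<longlonglongrightarrow> of_real ?N"
    unfolding Lim_null[of _ "of_real ?N"]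
    by (rule Lim_null_comparison[rotated]) (use autocorrelation_bound(3)[OF fD(1)] in simp)
  qed
 qed measurable
 also have "(\<lambda>k. LB w. exp (- (norm (w::'a))\<^sup>2 / 2) * ?A (\<delta> k *\<^sub>R w)) = (\<lambda>k. complex_of_real (?J k))"
  using Plancherel_regularised(2)[OF f s \<delta>] by simp
 also have "(LB w. complex_of_real (exp (- (norm (w::'a))\<^sup>2 / 2)) * of_real ?N) =
   of_real (sqrt (2 * pi) ^ DIM('a) * ?N)"
 proof -
  have "(LB w. complex_of_real (exp (- (norm (w::'a))\<^sup>2 / 2)) * of_real ?N) =
   (LB w. complex_of_real (exp (- (norm (w::'a))\<^sup>2 / 2) * ?N))" by simp
  also have "\<dots> = of_real (LB w. exp (- (norm (w::'a))\<^sup>2 / 2) * ?N)"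
   by (rule integral_complex_of_real)
  also have "(LB w. exp (- (norm (w::'a))\<^sup>2 / 2) * ?N) = sqrt (2 * pi) ^ DIM('a) * ?N"
   by (simp only: integral_mult_left_zero integral_gauss_exp)
  finally show ?thesis .
 qed
 finally have J: "?J \<longlonglongrightarrow> sqrt (2 * pi) ^ DIM('a) * ?N"
  unfolding tendsto_of_real_iff .
 let ?g0 = "(1 / sqrt (2 * pi)) ^ DIM('a)"
 let ?F = "\<lambda>k \<eta>. (norm (fourier s f \<eta>))^2 * gauss (\<delta> k *\<^sub>R \<eta>)"
 \<comment> \<open>As \<delta> decreases, the Gaussian weights increase to the constant
   \<open>gauss 0\<close>, which is \<open>?g0\<close>.\<close>
 have mono: "AE \<eta> in lborel. mono (\<lambda>k. ?F k \<eta>)"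
 proof (rule AE_I2, rule monoI)
  fix \<eta> :: 'a and k l :: nat assume "k \<le> l"
  then have "\<delta> l \<le> \<delta> k" by (simp add: \<delta>_def field_simps)
  then have "(norm (\<delta> l *\<^sub>R \<eta>))^2 \<le> (norm (\<delta> k *\<^sub>R \<eta>))^2"
   using \<delta>[of l] by (intro power_mono) (auto simp: mult_right_mono)
  then show "?F k \<eta> \<le> ?F l \<eta>"
   unfolding gauss_eq by (intro mult_left_mono) auto
 qed
 have lim: "AE \<eta> in lborel. (\<lambda>k. ?F k \<eta>) \<longlonglongrightarrow> (norm (fourier s f \<eta>))\<^sup>2 * ?g0"
 proof (rule AE_I2)
  fix \<eta> :: 'a
  have "(\<lambda>k. gauss (\<delta> k *\<^sub>R \<eta>)) \<longlonglongrightarrow> ?g0 * exp (- (norm (0 *\<^sub>R \<eta>))\<^sup>2 / 2)"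
   unfolding gauss_eq by (intro tendsto_intros \<delta>0) auto
  then show "(\<lambda>k. ?F k \<eta>) \<longlonglongrightarrow> (norm (fourier s f \<eta>))\<^sup>2 * ?g0"
   by (intro tendsto_mult tendsto_const) simp
 qed
 have m: "(\<lambda>\<eta>. (norm (fourier s f \<eta>))^2 * ?g0) \<in> borel_measurable lborel" by measurable
 note mc = Plancherel_regularised(1)[OF f s \<delta>] mono lim J m
 have i: "integrable lborel (\<lambda>\<eta>. (norm (fourier s f \<eta>))^2 * ?g0)"
  by (rule integrable_monotone_convergence[OF mc])
 have e: "(LB \<eta>. (norm (fourier s f \<eta>))^2 * ?g0) = sqrt (2 * pi) ^ DIM('a) * ?N"
  by (rule integral_monotone_convergence[OF mc])
 have g0: "?g0 \<noteq> 0" by simp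
 have i': "integrable lborel (\<lambda>\<eta>. (norm (fourier s f \<eta>))^2)"
  using integrable_mult_left[of "inverse ?g0", OF i]
  by (simp only: mult.assoc right_inverse[OF g0] mult_1_right)
 then show "fourier s f \<in> L2" by (intro L2_spaceI) auto
 \<comment> \<open>One factor \<open>q\<close> is the mass of exp(-|w|^2/2), the other the
   reciprocal of \<open>gauss 0\<close>; their product is the constant (2\<pi>)^n.\<close>
 define q where "q = sqrt (2 * pi) ^ DIM('a)"
 have q: "q > 0" unfolding q_def by simp
 have "?g0 = inverse q" unfolding q_def by (simp add: power_one_over inverse_eq_divide)
 moreover have "(LB \<eta>. (norm (fourier s f \<eta>))^2 * ?g0) = (N2 (fourier s f))^2 * ?g0"
  unfolding L2_norm_sq by (rule integral_mult_left_zero)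
 ultimately have "(N2 (fourier s f))^2 * inverse q = q * ?N"
  using e by (simp only: q_def)
 then have "(N2 (fourier s f))^2 = (q * q) * ?N"
  using q by (simp add: divide_eq_eq flip: divide_inverse)
 also have "q * q = (sqrt (2 * pi) * sqrt (2 * pi)) ^ DIM('a)"
  by (simp only: q_def power_mult_distrib)
 also have "sqrt (2 * pi) * sqrt (2 * pi) = 2 * pi"
  by simp
 finally show "(N2 (fourier s f))^2 = (2 * pi) ^ DIM('a) * ?N" .
qed

section \<open>The Fourier transform on $L^2$\<close>

definition fourier_const :: "nat \<Rightarrow> real" where
 "fourier_const n = (2 * pi) ^ n"

lemma fourier_const_pos [simp]: "0 < fourier_const n"
 by (simp add: fourier_const_def)

lemma fourier_const_nz [simp]: "fourier_const n \<noteq> 0"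
 by (simp add: fourier_const_def)

lemmas Plancherel_const = Plancherel[folded fourier_const_def]

section \<open>Parseval's formula and extension to $L^2$\<close>

lemma L2_norm_sq_add:
 assumes f: "f \<in> L2_space M" and g: "g \<in> L2_space M"
 shows "(L2_norm M (\<lambda>x. f x + g x))^2 = (L2_norm M f)^2 + (L2_norm M g)^2 + 2 * Re (LINT x|M. f x * cnj (g x))"
proof -
 note [measurable] = f[THEN L2_space_measurable] g[THEN L2_space_measurable]
 have cg: "(\<lambda>x. cnj (g x)) \<in> L2_space M" by (rule L2_space_norm_eq[OF g]) auto
 have i: "integrable M (\<lambda>x. f x * cnj (g x))" by (rule L2_mult_integrable[OF f cg])
 have iR: "integrable M (\<lambda>x. Re (f x * cnj (g x)))" using i by (rule integrable_Re)
 have "(L2_norm M (\<lambda>x. f x + g x))^2 = (LINT x|M. (norm (f x))^2 + (norm (g x))^2 + 2 * Re (f x * cnj (g x)))"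
  unfolding L2_norm_sq
  by (intro lint_cong refl) (simp only: cmod_power2, simp add: power2_eq_square algebra_simps)
 also have "\<dots> = (LINT x|M. (norm (f x))^2) + (LINT x|M. (norm (g x))^2) + 2 * (LINT x|M. Re (f x * cnj (g x)))"
  using iR f[THEN L2_space_integrable] g[THEN L2_space_integrable]
  by (simp only: lint_add lint_integrable_add integrable_mult_right integral_mult_right_zero)
 also have "(LINT x|M. Re (f x * cnj (g x))) = Re (LINT x|M. f x * cnj (g x))"
  by (rule integral_Re[OF i])
 finally show ?thesis by (simp add: L2_norm_sq)
qed

lemma L12_add: "f \<in> L12 \<Longrightarrow> g \<in> L12 \<Longrightarrow> (\<lambda>x. f x + g x) \<in> L12"
 and L12_cmult: "f \<in> L12 \<Longrightarrow> (\<lambda>x. c * f x) \<in> L12"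
 by (auto simp: L12_def intro: L2_space_add L2_space_cmult)

lemma L12_cnj: "f \<in> L12 \<Longrightarrow> (\<lambda>x. cnj (f x)) \<in> L12"
 unfolding L12_def
 by (auto intro!: L2_space_norm_eq[where g="\<lambda>x. cnj (f x)" and f=f] dest: L2_space_measurable)

lemma fourier_add:
 assumes "integrable lborel f" "integrable lborel g"
 shows "fourier s (\<lambda>x. f x + g x) \<eta> = fourier s f \<eta> + fourier s g \<eta>"
 unfolding fourier_def using assms
 by (simp add: distrib_left integrable_cis_mult)

lemma fourier_diff:
 assumes "integrable lborel f" "integrable lborel g"
 shows "fourier s (\<lambda>x. f x - g x) \<eta> = fourier s f \<eta> - fourier s g \<eta>"
 unfolding fourier_def using assms
 by (simp add: right_diff_distrib integrable_cis_mult)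

lemma fourier_cmult: "fourier s (\<lambda>x. c * f x) \<eta> = c * fourier s f \<eta>"
 unfolding fourier_def by (simp add: mult.left_commute)

text \<open>Polarisation: Plancherel for f + g gives the real part of the sesquilinear identity, and
  replacing g by \<i> g gives the imaginary part. Conjugating g makes the identity bilinear, and
  conjugation flips the sign of the transform.\<close>

lemma Parseval:
 fixes f g :: "'a::euclidean_space \<Rightarrow> complex"
 assumes f: "f \<in> L12" and g: "g \<in> L12" and s: "s^2 = 1"
 shows "(LB x. fourier s f x * fourier (- s) g x) = of_real (fourier_const DIM('a)) * (LB x. f x * g x)"
proof -
 let ?c = "fourier_const DIM('a)"
 have R: "Re (LB x. fourier s f x * cnj (fourier s g x)) = ?c * Re (LB x. f x * cnj (g x))"
  if g: "g \<in> L12" for g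
 proof -
  note F = Plancherel_const[OF _ s]
  have "(N2 (\<lambda>x. fourier s f x + fourier s g x))^2 = (N2 (fourier s (\<lambda>x. f x + g x)))^2"
   by (simp only: fourier_add[OF L12D(2)[OF f] L12D(2)[OF g], abs_def])
  also have "\<dots> = ?c * (N2 (\<lambda>x. f x + g x))^2"
   by (rule F(2)[OF L12_add[OF f g]])
  finally show ?thesis
   using f g by (simp add: L2_norm_sq_add F L12D algebra_simps)
 qed
 have *: "(LB x. fourier s f x * cnj (fourier s g x)) = ?c * (LB x. f x * cnj (g x))"
  if g: "g \<in> L12" for g
 proof (rule complex_eqI)
  show "Re (LB x. fourier s f x * cnj (fourier s g x)) = Re (?c * (LB x. f x * cnj (g x)))"
   using R[OF g] by simp
  have "Re (- \<i> * (LB x. fourier s f x * cnj (fourier s g x))) = ?c * Re (- \<i> * (LB x. f x * cnj (g x)))"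
   using R[OF L12_cmult[OF g, of \<i>]]
   by (simp only: fourier_cmult complex_cnj_mult complex_cnj_i mult.left_commute[of _ "- \<i>"] integral_mult_right_zero)
  then show "Im (LB x. fourier s f x * cnj (fourier s g x)) = Im (?c * (LB x. f x * cnj (g x)))"
   by simp
 qed
 show ?thesis using *[OF L12_cnj[OF g]] by (simp add: cnj_fourier)
qed

lemma L12_ball_cutoff:
 fixes u :: "'a::euclidean_space \<Rightarrow> complex"
 assumes u: "u \<in> L2"
 shows "(\<lambda>x. u x * indicator (cball 0 m) x) \<in> L12"
proof -
 note [measurable] = L2_space_measurable[OF u, simplified]
 have i: "(\<lambda>x. indicator (cball 0 m) x :: complex) \<in> L2"
  by (rule indicator_L2_space) (auto intro!: emeasure_bounded_finite[unfolded infinity_ennreal_def])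
 show ?thesis
  unfolding L12_def using L2_mult_integrable[OF u i]
  by (auto intro!: L2_space_bound[OF u, where C=1] simp: indicator_def)
qed

text \<open>Testing with the conjugate of h, restricted to a ball, returns the squared norm of h on
  that ball. Test functions of bounded support are enough, which matters later where the pairing
  involves multiplication by the unbounded \<eta>.\<close>

lemma L2_zero_test:
 fixes h :: "'a::euclidean_space \<Rightarrow> complex"
 assumes h: "h \<in> L2"
  and z: "\<And>g r. g \<in> L12 \<Longrightarrow> (\<And>x. r < norm x \<Longrightarrow> g x = 0) \<Longrightarrow> (LB x. h x * g x) = 0"
 shows "AE x in lborel. h x = 0"
proof -
 note [measurable] = L2_space_measurable[OF h, simplified]
 have "AE x in lborel. h x * indicator (cball 0 (real m)) x = 0" for m :: nat
 proof -
  have hm: "(\<lambda>x. h x * indicator (cball 0 (real m)) x) \<in> L12" by (rule L12_ball_cutoff[OF h])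
  note c = L12_cnj[OF hm]
  have "(LB x. h x * cnj (h x * indicator (cball 0 (real m)) x)) = 0"
   by (rule z[OF c, of "real m"]) (auto simp: indicator_def)
  moreover have "h x * cnj (h x * indicator (cball 0 (real m)) x) =
   complex_of_real ((norm (h x * indicator (cball 0 (real m)) x))^2)" for x
   by (cases "x \<in> cball 0 (real m)") (simp_all add: complex_norm_square del: of_real_power)
  ultimately have "(LB x. (norm (h x * indicator (cball 0 (real m)) x))^2) = 0"
   by (simp only: integral_complex_of_real of_real_eq_0_iff)
  then have "N2 (\<lambda>x. h x * indicator (cball 0 (real m)) x) = 0"
   unfolding L2_norm_def by simp
  then show ?thesis by (rule L2_norm_eq_0_AE[OF L12D(1)[OF hm]])
 qed
 then have "AE x in lborel. \<forall>m::nat. h x * indicator (cball 0 (real m)) x = 0"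
  by (intro AE_all_countable[THEN iffD2] allI)
 then show ?thesis
 proof eventually_elim
  case (elim x)
  obtain m :: nat where "norm x \<le> real m" using real_arch_simple by blast
  then show ?case using elim[rule_format, of m] by (simp add: indicator_def)
 qed
qed

lemma ball_cutoff_tendsto:
 fixes u :: "'a::euclidean_space \<Rightarrow> complex"
 assumes u: "u \<in> L2"
 shows "(\<lambda>m::nat. N2 (\<lambda>x. u x * indicator (cball 0 (real m)) x - u x)) \<longlonglongrightarrow> 0"
proof (rule L2_dominated[OF _ u])
 show "(\<lambda>x. u x * indicator (cball 0 (real m)) x - u x) \<in> L2" for m
  by (intro L2_space_diff u L12D(1)[OF L12_ball_cutoff[OF u]])
 show "norm (u x * indicator (cball 0 (real m)) x - u x) \<le> norm (u x)" for m x
  by (auto simp: indicator_def)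
 show "AE x in lborel. (\<lambda>m. u x * indicator (cball 0 (real m)) x - u x) \<longlonglongrightarrow> 0"
 proof (rule AE_I2)
  fix x :: 'a
  obtain M :: nat where M: "norm x \<le> real M" using real_arch_simple by blast
  have "\<forall>\<^sub>F m in sequentially. u x * indicator (cball 0 (real m)) x - u x = 0"
   using eventually_ge_at_top[of M] by eventually_elim (use M in \<open>auto simp: indicator_def\<close>)
  then show "(\<lambda>m. u x * indicator (cball 0 (real m)) x - u x) \<longlonglongrightarrow> 0"
   by (rule tendsto_eventually)
 qed
qed

text \<open>The truncations \<open>U m\<close> of u to balls lie in \<open>L12\<close>, and by
  Plancherel their transforms form a Cauchy sequence. Its limit inherits the multiplication formula,
  Parseval's formula and the norm identity, since all three are continuous in L^2.\<close>

lemma fourier_L2_extension: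
 fixes u :: "'a::euclidean_space \<Rightarrow> complex"
 assumes u: "u \<in> L2" and s: "s^2 = 1"
 obtains h where "h \<in> L2"
  "\<And>g. g \<in> L12 \<Longrightarrow> (LB x. h x * g x) = (LB x. u x * fourier s g x)"
  "\<And>g. g \<in> L12 \<Longrightarrow> (LB x. h x * fourier (-s) g x) =
    of_real (fourier_const DIM('a)) * (LB x. u x * g x)"
  "(N2 h)^2 = fourier_const DIM('a) * (N2 u)^2"
proof -
 let ?c = "fourier_const DIM('a)"
 define U where "U m x = u x * indicator (cball 0 (real m)) x" for m x
 have U: "U m \<in> L12" for m unfolding U_def by (rule L12_ball_cutoff[OF u])
 note UD = L12D[OF U]
 have Ulim: "(\<lambda>m. N2 (\<lambda>x. U m x - u x)) \<longlonglongrightarrow> 0"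
  unfolding U_def by (rule ball_cutoff_tendsto[OF u])
 have FL: "fourier s (U m) \<in> L2" for m by (rule Plancherel_const[OF U s])
 have FN: "N2 (\<lambda>x. fourier s (U m) x - fourier s (U n) x) = sqrt ?c * N2 (\<lambda>x. U m x - U n x)" for m n
 proof -
  have d: "(\<lambda>x. U m x - U n x) \<in> L12"
   using L12_add[OF U[of m] L12_cmult[OF U[of n], of "-1"]] by simp
  have "(N2 (fourier s (\<lambda>x. U m x - U n x)))^2 = (sqrt ?c * N2 (\<lambda>x. U m x - U n x))^2"
   using Plancherel_const(2)[OF d s] by (simp add: power_mult_distrib less_imp_le)
  then have "N2 (fourier s (\<lambda>x. U m x - U n x)) = sqrt ?c * N2 (\<lambda>x. U m x - U n x)"
   by (rule power2_eq_imp_eq) (auto simp: less_imp_le)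
  then show ?thesis
   by (simp only: fourier_diff[OF UD(2) UD(2), abs_def])
 qed
 have C: "\<exists>N. \<forall>m\<ge>N. \<forall>n\<ge>N. N2 (\<lambda>x. fourier s (U m) x - fourier s (U n) x) < e" if e: "e > 0" for e
 proof -
  have "\<forall>\<^sub>F m in sequentially. N2 (\<lambda>x. U m x - u x) < e / (2 * sqrt ?c)"
   using Ulim by (rule order_tendstoD) (use e in simp)
  then obtain N where N: "\<And>m. m \<ge> N \<Longrightarrow> N2 (\<lambda>x. U m x - u x) < e / (2 * sqrt ?c)"
   by (auto simp: eventually_sequentially)
  show ?thesis
  proof (intro exI[of _ N] allI impI)
   fix m n assume "m \<ge> N" "n \<ge> N"
   have "N2 (\<lambda>x. U m x - U n x) \<le> N2 (\<lambda>x. U m x - u x) + N2 (\<lambda>x. u x - U n x)"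
    by (rule L2_norm_triangle_diff[OF UD(1) u UD(1)])
   also have "\<dots> < e / (2 * sqrt ?c) + e / (2 * sqrt ?c)"
    using N[OF \<open>m \<ge> N\<close>] N[OF \<open>n \<ge> N\<close>] by (simp add: L2_norm_minus_commute[of _ u])
   also have "\<dots> = e / sqrt ?c" by (simp add: field_simps)
   finally show "N2 (\<lambda>x. fourier s (U m) x - fourier s (U n) x) < e"
    unfolding FN by (simp add: pos_less_divide_eq mult.commute)
  qed
 qed
 obtain h where h: "h \<in> L2" "(\<lambda>m. N2 (\<lambda>x. fourier s (U m) x - h x)) \<longlonglongrightarrow> 0"
  using L2_complete[of "\<lambda>m. fourier s (U m)" lborel] FL C by blast
 show ?thesis
 proof (rule that[OF h(1)])
  fix g :: "'a \<Rightarrow> complex" assume g: "g \<in> L12"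
  note gD = L12D[OF g]
  have "(\<lambda>m. LB x. fourier s (U m) x * g x) \<longlonglongrightarrow> (LB x. h x * g x)"
   by (rule integral_L2_tendsto[OF FL h(1) gD(1) h(2)])
  moreover have "(\<lambda>m. LB x. U m x * fourier s g x) \<longlonglongrightarrow> (LB x. u x * fourier s g x)"
   by (rule integral_L2_tendsto[OF UD(1) u Plancherel(1)[OF g s] Ulim])
  ultimately show "(LB x. h x * g x) = (LB x. u x * fourier s g x)"
   unfolding fourier_mult[OF UD(2) gD(2)] by (rule LIMSEQ_unique)
  have s': "(-s)^2 = 1" using s by simp
  have "(\<lambda>m. LB x. fourier s (U m) x * fourier (-s) g x) \<longlonglongrightarrow> (LB x. h x * fourier (-s) g x)"
   by (rule integral_L2_tendsto[OF FL h(1) Plancherel(1)[OF g s'] h(2)])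
  moreover have "(\<lambda>m. of_real ?c * (LB x. U m x * g x)) \<longlonglongrightarrow> of_real ?c * (LB x. u x * g x)"
   by (intro tendsto_mult tendsto_const integral_L2_tendsto[OF UD(1) u gD(1) Ulim])
  ultimately show "(LB x. h x * fourier (-s) g x) = of_real ?c * (LB x. u x * g x)"
   unfolding Parseval[OF U g s] by (rule LIMSEQ_unique)
 next
  have "(\<lambda>m. (N2 (fourier s (U m)))^2) \<longlonglongrightarrow> (N2 h)\<^sup>2"
   by (intro tendsto_intros L2_norm_tendsto[OF FL h])
  moreover have "(\<lambda>m. ?c * (N2 (U m))^2) \<longlonglongrightarrow> ?c * (N2 u)^2"
   by (intro tendsto_intros L2_norm_tendsto[OF UD(1) u Ulim])
  ultimately show "(N2 h)^2 = ?c * (N2 u)^2"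
   unfolding Plancherel_const(2)[OF U s] by (rule LIMSEQ_unique)
 qed
qed

text \<open>\<open>h\<close> is the Fourier transform of \<open>u\<close> in the sense of $L^2$, expressed by duality so that no
 representative has to be fixed.\<close>

definition ft_pair :: "('a::euclidean_space \<Rightarrow> complex) \<Rightarrow> ('a \<Rightarrow> complex) \<Rightarrow> bool" where
 "ft_pair u h \<longleftrightarrow> u \<in> L2 \<and> h \<in> L2 \<and>
  (\<forall>g\<in>L12. (LB x. h x * g x) = (LB x. u x * fourier (-1) g x)) \<and>
  (\<forall>g\<in>L12. (LB x. h x * fourier 1 g x) =
    of_real (fourier_const DIM('a)) * (LB x. u x * g x))"

lemma ft_pairD:
 assumes "ft_pair u (h :: 'a::euclidean_space \<Rightarrow> complex)"
 shows "u \<in> L2" "h \<in> L2"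
  "g \<in> L12 \<Longrightarrow> (LB x. h x * g x) = (LB x. u x * fourier (-1) g x)"
  "g \<in> L12 \<Longrightarrow> (LB x. h x * fourier 1 g x) =
    of_real (fourier_const DIM('a)) * (LB x. u x * g x)"
 using assms by (auto simp: ft_pair_def)

lemma ft_pair_diff:
 assumes p: "ft_pair u h" "ft_pair v k"
 shows "ft_pair (\<lambda>x. u x - v x) (\<lambda>x. h x - k x)"
proof -
 note D = ft_pairD[OF p(1)] ft_pairD[OF p(2)]
 have *: "(LB x. (a x - b x) * c x) = (LB x. a x * c x) - (LB x. b x * c x)"
  if "a \<in> L2" "b \<in> L2" "c \<in> L2" for a b c :: "'a \<Rightarrow> complex"
  using L2_mult_integrable[OF that(1,3)] L2_mult_integrable[OF that(2,3)] by (simp add: left_diff_distrib)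
 have F: "g \<in> L12 \<Longrightarrow> fourier (-1) g \<in> L2" "g \<in> L12 \<Longrightarrow> fourier 1 g \<in> L2" for g :: "'a \<Rightarrow> complex"
  by (auto intro: Plancherel)
 show ?thesis
  unfolding ft_pair_def
  by (intro conjI ballI L2_space_diff D(1,2,5,6))
   (simp_all add: * D F L12D right_diff_distrib)
qed

text \<open>Each of the two duality relations in \<open>ft_pair\<close> gives one direction: the
  first kills h when u vanishes, the second kills u when h vanishes.\<close>

lemma ft_pair_zero:
 assumes p: "ft_pair u h"
 shows "(AE x in lborel. u x = 0) \<longleftrightarrow> (AE x in lborel. h x = 0)"
proof
 note D = ft_pairD[OF p]
 note [measurable] = D(1,2)[THEN L2_space_measurable, simplified]
 have F: "fourier s g \<in> borel_measurable borel" if "g \<in> L12" for s and g :: "'a \<Rightarrow> complex"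
  using L12D(3)[OF that] by measurable
 show "AE x in lborel. h x = 0" if z: "AE x in lborel. u x = 0"
 proof (rule L2_zero_test[OF D(2)])
  fix g :: "'a \<Rightarrow> complex" assume g: "g \<in> L12"
  have "(LB x. u x * fourier (-1) g x) = (LINT x|(lborel :: 'a measure). 0)"
   by (rule integral_cong_AE) (use z F[OF g, of "-1"] in \<open>auto\<close>)
  then show "(LB x. h x * g x) = 0" by (simp add: D(3)[OF g])
 qed
 show "AE x in lborel. u x = 0" if z: "AE x in lborel. h x = 0"
 proof (rule L2_zero_test[OF D(1)])
  fix g :: "'a \<Rightarrow> complex" assume g: "g \<in> L12"
  have "(LB x. h x * fourier 1 g x) = (LINT x|(lborel :: 'a measure). 0)"
   by (rule integral_cong_AE) (use z F[OF g, of "1"] in \<open>auto\<close>)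
  then show "(LB x. u x * g x) = 0" using D(4)[OF g] by simp
 qed
qed

lemma ft_pair_AE_iff:
 assumes "ft_pair u h" "ft_pair v k"
 shows "(AE x in lborel. u x = v x) \<longleftrightarrow> (AE x in lborel. h x = k x)"
 using ft_pair_zero[OF ft_pair_diff[OF assms]] by simp

lemma ft_pair_AE_cong:
 assumes p: "ft_pair u (h :: 'a::euclidean_space \<Rightarrow> complex)" and h: "AE x in lborel. h x = k x" and u: "AE x in lborel. u x = v x"
  and [measurable]: "k \<in> borel_measurable borel" "v \<in> borel_measurable borel"
 shows "ft_pair v k"
proof -
 note D = ft_pairD[OF p]
 note [measurable] = D(1,2)[THEN L2_space_measurable, simplified]
 have *: "(LB x. k x * g x) = (LB x. h x * g x)" "(LB x. v x * g x) = (LB x. u x * g x)"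
  if [measurable]: "g \<in> borel_measurable borel" for g :: "'a \<Rightarrow> complex"
  by (rule integral_cong_AE; use h u in \<open>auto\<close>)+
 show ?thesis
  unfolding ft_pair_def using L2_space_AE_cong[OF D(1) u] L2_space_AE_cong[OF D(2) h]
  by (auto simp: * D L12D(3) fourier_measurable)
qed

lemma ft_pair_exists:
 fixes u :: "'a::euclidean_space \<Rightarrow> complex"
 assumes "u \<in> L2"
 obtains h where "ft_pair u h"
proof (rule fourier_L2_extension[OF assms, of "-1"])
 fix h assume "h \<in> L2"
  "\<And>g. g \<in> L12 \<Longrightarrow> (LB x. h x * g x) = (LB x. u x * fourier (-1) g x)"
  "\<And>g. g \<in> L12 \<Longrightarrow> (LB x. h x * fourier (- (-1)) g x) =
    of_real (fourier_const DIM('a)) * (LB x. u x * g x)"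
 then have "ft_pair u h" using assms by (simp add: ft_pair_def)
 then show thesis by (rule that)
qed simp

text \<open>Extend the transform with the opposite sign and divide by (2\<pi>)^n; the two duality
  relations then exchange their roles.\<close>

lemma ft_pair_inverse_exists:
 fixes h :: "'a::euclidean_space \<Rightarrow> complex"
 assumes h: "h \<in> L2"
 obtains u where "ft_pair u h"
proof -
 let ?c = "complex_of_real (fourier_const DIM('a))"
 obtain u where u: "u \<in> L2"
  "\<And>g. g \<in> L12 \<Longrightarrow> (LB x. u x * g x) = (LB x. h x * fourier 1 g x)"
  "\<And>g. g \<in> L12 \<Longrightarrow> (LB x. u x * fourier (-1) g x) = ?c * (LB x. h x * g x)"
  by (rule fourier_L2_extension[OF h, of 1]) auto
 have "ft_pair (\<lambda>x. inverse ?c * u x) h"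
  unfolding ft_pair_def
  by (intro conjI ballI L2_space_cmult u(1) h) (simp_all add: mult.assoc u)
 then show ?thesis by (rule that)
qed

text \<open>The norm identity is known for the transform constructed by
  \<open>fourier_L2_extension\<close>; by uniqueness every transform of u agrees with it almost
  everywhere.\<close>

lemma ft_pair_norm:
 assumes p: "ft_pair u (h :: 'a::euclidean_space \<Rightarrow> complex)"
 shows "(N2 h)^2 = fourier_const DIM('a) * (N2 u)^2"
proof -
 note D = ft_pairD[OF p]
 obtain k where k: "ft_pair u k" "(N2 k)^2 = fourier_const DIM('a) * (N2 u)^2"
 proof (rule fourier_L2_extension[OF D(1), of "-1"])
  fix k assume "k \<in> L2"
   "\<And>g. g \<in> L12 \<Longrightarrow> (LB x. k x * g x) = (LB x. u x * fourier (-1) g x)"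
   "\<And>g. g \<in> L12 \<Longrightarrow> (LB x. k x * fourier (- (-1)) g x) =
     of_real (fourier_const DIM('a)) * (LB x. u x * g x)"
   and n: "(N2 k)^2 = fourier_const DIM('a) * (N2 u)^2"
  then have "ft_pair u k" using D(1) by (simp add: ft_pair_def)
  then show thesis using n by (rule that)
 qed simp
 have "AE x in lborel. h x = k x" using ft_pair_AE_iff[OF p k(1)] by simp
 then have "N2 h = N2 k"
  using D(2) ft_pairD(2)[OF k(1)] by (intro L2_norm_AE_cong) (auto dest: L2_space_measurable)
 then show ?thesis using k(2) by simp
qed

lemma ft_pair_fourier:
 assumes g: "g \<in> L12"
 shows "ft_pair g (fourier (-1) g)"
 unfolding ft_pair_def
 using Plancherel(1)[OF g, of "-1"] Parseval[OF g, of _ "-1"] fourier_mult[OF L12D(2)[OF g], of _ "-1"]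
 by (auto simp: L12D(1)[OF g] L12D(2))

lemma fourier_injective:
 assumes g: "g \<in> L12" and s: "s^2 = 1" and z: "AE \<eta> in lborel. fourier s g \<eta> = 0"
 shows "AE x in lborel. g x = 0"
proof (rule L2_norm_eq_0_AE[OF L12D(1)[OF g]])
 have "N2 (fourier s g) = N2 (\<lambda>x::'a. 0)"
  by (rule L2_norm_AE_cong) (use z L12D(3)[OF g] in auto)
 then show "N2 g = 0" using Plancherel_const(2)[OF g s] by simp
qed

text \<open>Translating by \<pi>/\<tau> reverses the sign of the oscillating factor, so twice the
  integral is the integral of f minus its translate. Both live in a fixed bounded set, where
  Cauchy-Schwarz and the continuity of translations apply.\<close>

lemma Riemann_Lebesgue_real:
 fixes f :: "real \<Rightarrow> complex" and \<tau> :: "nat \<Rightarrow> real"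
 assumes f: "f \<in> L2" and K: "\<And>x. K < \<bar>x\<bar> \<Longrightarrow> f x = 0" "K \<ge> 0"
  and \<tau>: "filterlim (\<lambda>n. \<bar>\<tau> n\<bar>) at_top sequentially"
 shows "(\<lambda>n. LB x. cis (\<tau> n * x) * f x) \<longlonglongrightarrow> 0"
proof -
 note [measurable] = L2_space_measurable[OF f, simplified]
 define z where "z n = (if \<tau> n = 0 then 0 else pi / \<tau> n)" for n
 \<comment> \<open>The threshold \<pi> excludes \<tau> = 0, where \<open>z\<close> has a dummy
   value, and makes the shift at most 1, so that the interval of radius K + 1 holds f and its
   translate.\<close>
 have ev: "\<forall>\<^sub>F n in sequentially. \<bar>\<tau> n\<bar> \<ge> pi" using \<tau> unfolding filterlim_at_top by blast
 have "(\<lambda>n. inverse \<bar>\<tau> n\<bar>) \<longlonglongrightarrow> 0" using \<tau> by (rule tendsto_inverse_0_at_top)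
 then have "(\<lambda>n. pi * inverse \<bar>\<tau> n\<bar>) \<longlonglongrightarrow> 0" by (rule tendsto_mult_right_zero)
 then have z0: "z \<longlonglongrightarrow> 0"
  by (rule Lim_null_comparison[rotated]) (auto simp: z_def divide_inverse abs_mult)
 let ?I = "indicator (cball 0 (K + 1)) :: real \<Rightarrow> complex"
 have IL: "(\<lambda>x. ?I x) \<in> L2"
  by (rule indicator_L2_space) (auto intro!: emeasure_bounded_finite[unfolded infinity_ennreal_def])
 have lim: "(\<lambda>n. N2 (\<lambda>x. ?I x) * N2 (\<lambda>x. f (x + z n) - f x)) \<longlonglongrightarrow> 0"
  by (intro tendsto_mult_right_zero L2_translation_continuous f z0)
 have fL1: "integrable lborel f"
 proof -
  have "f = (\<lambda>x. f x * indicator (cball 0 K) x)" using K by (auto simp: fun_eq_iff indicator_def not_le)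
  then show ?thesis using L12D(2)[OF L12_ball_cutoff[OF f, of K]] by simp
 qed
 show ?thesis
 proof (rule Lim_null_comparison[OF _ lim], use ev in eventually_elim)
  case (elim n)
  have t: "\<tau> n \<noteq> 0" using elim pi_gt_zero by linarith
  have zn: "\<bar>z n\<bar> \<le> 1" using elim t by (simp add: z_def abs_div divide_le_eq)
  let ?J = "LB x. cis (\<tau> n * x) * f x"
  have i: "integrable lborel (\<lambda>x. cis (\<tau> n * x) * f x)" by (rule integrable_cis_mult[OF fL1]) simp
  have i': "integrable lborel (\<lambda>x. cis (\<tau> n * x) * f (x + z n))"
   by (rule integrable_cis_mult) (use fL1 in \<open>auto simp: integrable_lborel_translate\<close>)
  have "?J = (LB x. cis (\<tau> n * (x + z n)) * f (x + z n))"
   by (rule integral_lborel_translate[symmetric]) measurable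
  also have "\<dots> = - (LB x. cis (\<tau> n * x) * f (x + z n))"
   using t by (simp add: z_def distrib_left cis_mult[symmetric] flip: Bochner_Integration.integral_minus)
  finally have J1: "(LB x. cis (\<tau> n * x) * f (x + z n)) = - ?J" by simp
  have "(LB x. cis (\<tau> n * x) * (f (x + z n) - f x)) = (LB x. cis (\<tau> n * x) * f (x + z n)) - ?J"
   using i i' by (simp add: right_diff_distrib)
  then have J2: "(LB x. cis (\<tau> n * x) * (f (x + z n) - f x)) = - (2 * ?J)"
   using J1 by simp
  have "2 * norm ?J = norm (LB x. cis (\<tau> n * x) * (f (x + z n) - f x))"
   by (simp only: J2 norm_minus_cancel norm_mult norm_numeral)
  also have "\<dots> \<le> (LB x. norm (?I x) * norm (f (x + z n) - f x))"
  proof (rule order_trans[OF integral_norm_bound], rule Bochner_Integration.integral_mono)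
   have "f (x + z n) - f x = 0" if "x \<notin> cball 0 (K + 1)" for x
    using that K zn by (simp add: abs_real_def split: if_splits)
   then have e: "norm (?I x) * norm (f (x + z n) - f x) = norm (cis (\<tau> n * x) * (f (x + z n) - f x))" for x
    by (cases "x \<in> cball 0 (K + 1)") (auto simp: norm_mult indicator_def)
   then show "norm (cis (\<tau> n * x) * (f (x + z n) - f x)) \<le> norm (?I x) * norm (f (x + z n) - f x)" for x
    by simp
   show ii: "integrable lborel (\<lambda>x. norm (cis (\<tau> n * x) * (f (x + z n) - f x)))"
    using i i' by (intro integrable_norm) (simp add: right_diff_distrib)
   then show "integrable lborel (\<lambda>x. norm (?I x) * norm (f (x + z n) - f x))"
    using e by simp
  qed
  also have "\<dots> \<le> N2 (\<lambda>x. ?I x) * N2 (\<lambda>x. f (x + z n) - f x)"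
   by (rule L2_Cauchy_Schwarz_norm[OF IL]) (intro L2_space_diff L2_space_translate f)
  finally show "norm ?J \<le> N2 (\<lambda>x. ?I x) * N2 (\<lambda>x. f (x + z n) - f x)"
   using norm_ge_zero[of ?J] by linarith
 qed
qed

section \<open>The interaction picture\<close>

lemma nn_integral_exp_abs_finite:
 assumes a: "a > 0"
 shows "(NN x. ennreal (exp (- a * \<bar>x\<bar>))) < \<infinity>"
proof -
 have 1: "(NN x. ennreal (exponential_density a x)) = 1"
 proof -
  interpret prob_space "density lborel (exponential_density a)" by (rule prob_space_exponential_density[OF a])
  show ?thesis using emeasure_space_1 by (simp add: emeasure_density)
 qed
 have 2: "(NN x. ennreal (exponential_density a (-x))) = 1"
  using nn_integral_real_affine[of "\<lambda>x. ennreal (exponential_density a x)" "-1" 0] 1 by simp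
 have "(NN x. ennreal (exp (- a * \<bar>x\<bar>))) \<le>
   (NN x. ennreal (1/a) * (ennreal (exponential_density a x) + ennreal (exponential_density a (-x))))"
  using a by (intro nn_integral_mono)
   (auto simp: exponential_density_def ennreal_mult[symmetric] ac_simps simp flip: ennreal_plus)
 also have "\<dots> = ennreal (1/a) * (1 + 1)"
  by (simp add: nn_integral_cmult nn_integral_add 1 2)
 also have "\<dots> < \<infinity>" by (simp add: ennreal_mult_less_top)
 finally show ?thesis .
qed

lemma integrable_exp_norm: "integrable lborel (\<lambda>x::'a::euclidean_space. exp (- norm x))"
proof (rule integrableI_nonneg)
 \<comment> \<open>The mean of the moduli of the n coordinates is at most the norm, so with rate 1/n
   in each coordinate the product of one-dimensional exponentials dominates e^{-|x|}.\<close>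
 let ?a = "1 / real DIM('a)"
 have a: "?a > 0" by simp
 have "(NN x. ennreal (exp (- norm (x::'a)))) \<le> (NN x. (\<Prod>b\<in>Basis. ennreal (exp (- ?a * \<bar>(x::'a) \<bullet> b\<bar>))))"
 proof (intro nn_integral_mono)
  fix x :: 'a
  have "(\<Sum>b\<in>(Basis::'a set). ?a * \<bar>x \<bullet> b\<bar>) \<le> (\<Sum>b\<in>(Basis::'a set). ?a * norm x)"
   by (intro sum_mono mult_left_mono Basis_le_norm) auto
  also have "\<dots> = norm x" by simp
  finally have "exp (- norm x) \<le> exp (\<Sum>b\<in>(Basis::'a set). - ?a * \<bar>x \<bullet> b\<bar>)"
   by (simp add: sum_negf)
  also have "\<dots> = (\<Prod>b\<in>(Basis::'a set). exp (- ?a * \<bar>x \<bullet> b\<bar>))" by (simp add: exp_sum)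
  finally show "ennreal (exp (- norm x)) \<le> (\<Prod>b\<in>Basis. ennreal (exp (- ?a * \<bar>x \<bullet> b\<bar>)))"
   by (subst prod_ennreal) (auto intro: ennreal_leI)
 qed
 also have "\<dots> = (\<Prod>b\<in>(Basis :: 'a set). NN x. ennreal (exp (- ?a * \<bar>x\<bar>)))"
  by (rule nn_integral_lborel_prod) auto
 also have "\<dots> < \<infinity>"
  using nn_integral_exp_abs_finite[OF a] by (simp add: power_less_top_ennreal)
 finally show "(NN x. ennreal (exp (- norm (x::'a)))) < \<infinity>" .
qed auto

text \<open>Cauchy-Schwarz in time at each frequency, with the length b - a as the price, followed
  by Tonelli's theorem.\<close>

lemma nn_time_integral_L2:
 fixes G :: "real \<Rightarrow> 'a::euclidean_space \<Rightarrow> complex"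
 assumes [measurable]: "joint G" and ab: "a \<le> b"
 shows "(NN \<eta>. ennreal ((norm (LB s. indicator {a..b} s * G s \<eta>))^2)) \<le>
  ennreal (b - a) * (NN s. indicator {a..b} s * (NN \<eta>. ennreal ((norm (G s \<eta>))^2)))"
proof -
 have "(NN \<eta>. ennreal ((norm (LB s. indicator {a..b} s * G s \<eta>))^2)) \<le>
  (NN \<eta>. ennreal (b - a) * (NN s. indicator {a..b} s * ennreal ((norm (G s \<eta>))^2)))"
 proof (rule nn_integral_mono)
  fix \<eta>
  \<comment> \<open>A slice that is not integrable has integral 0 by convention, so the inequality
    holds there as well.\<close>
  have "ennreal (norm (LB s. indicator {a..b} s * G s \<eta>)) \<le> (NN s. ennreal (norm (indicator {a..b} s * G s \<eta>)))"
   by (cases "integrable lborel (\<lambda>s. indicator {a..b} s * G s \<eta>)")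
    (auto simp: not_integrable_integral_eq intro: integral_norm_bound_ennreal)
  also have "\<dots> = (NN s. indicator {a..b} s * (indicator {a..b} s * ennreal (norm (G s \<eta>))))"
   by (intro nn_integral_cong) (auto simp: indicator_def)
  finally have "(ennreal (norm (LB s. indicator {a..b} s * G s \<eta>)))^2 \<le>
   (NN s. indicator {a..b} s * (indicator {a..b} s * ennreal (norm (G s \<eta>))))\<^sup>2"
   by (rule power_mono) auto
  also have "\<dots> \<le> (NN s. (indicator {a..b} s)^2) * (NN s. (indicator {a..b} s * ennreal (norm (G s \<eta>)))^2)"
   by (rule Cauchy_Schwarz_nn_integral) measurable
  also have "(NN s. (indicator {a..b} s)^2) = (NN s. indicator {a..b} s)"
   by (intro nn_integral_cong) (auto simp: indicator_def)
  also have "\<dots> = ennreal (b - a)" using ab by simp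
  also have "(NN s. (indicator {a..b} s * ennreal (norm (G s \<eta>)))^2) =
   (NN s. indicator {a..b} s * ennreal ((norm (G s \<eta>))^2))"
   by (intro nn_integral_cong) (auto simp: indicator_def ennreal_power)
  finally show "ennreal ((norm (LB s. indicator {a..b} s * G s \<eta>))^2) \<le>
   ennreal (b - a) * (NN s. indicator {a..b} s * ennreal ((norm (G s \<eta>))^2))"
   by (simp add: ennreal_power)
 qed
 also have "\<dots> = ennreal (b - a) * (NN \<eta>. (NN s. indicator {a..b} s * ennreal ((norm (G s \<eta>))^2)))"
  by (rule nn_integral_cmult) measurable
 also have "(NN \<eta>. (NN s. indicator {a..b} s * ennreal ((norm (G s \<eta>))^2))) =
  (NN s. (NN \<eta>. indicator {a..b} s * ennreal ((norm (G s \<eta>))^2)))"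
  by (rule lborel_pair.Fubini'[of "\<lambda>s \<eta>. indicator {a..b} s * ennreal ((norm (G s \<eta>))^2)"]) measurable
 also have "\<dots> = (NN s. indicator {a..b} s * (NN \<eta>. ennreal ((norm (G s \<eta>))^2)))"
  by (intro nn_integral_cong nn_integral_cmult) measurable
 finally show ?thesis .
qed

text \<open>The squared norms are compared with a majorant \<beta> that can be integrated
  explicitly: an exponential for the Picard terms, a constant or the Gronwall function
  elsewhere.\<close>

lemma time_integral_L2:
 fixes G :: "real \<Rightarrow> 'a::euclidean_space \<Rightarrow> complex"
 assumes m [measurable]: "joint G" and ab: "a \<le> b"
  and G: "\<And>s. s \<in> {a..b} \<Longrightarrow> G s \<in> L2" "\<And>s. s \<in> {a..b} \<Longrightarrow> (N2 (G s))\<^sup>2 \<le> \<beta> s"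
  and \<beta>: "integrable lborel (\<lambda>s. indicator {a..b} s * \<beta> s)"
 shows "(\<lambda>\<eta>. LB s. indicator {a..b} s * G s \<eta>) \<in> L2"
  and "(N2 (\<lambda>\<eta>. LB s. indicator {a..b} s * G s \<eta>))^2 \<le> (b - a) * (LB s. indicator {a..b} s * \<beta> s)"
proof -
 let ?I = "LB s. indicator {a..b} s * \<beta> s"
 have b0: "0 \<le> indicator {a..b} s * \<beta> s" for s
  using order_trans[OF zero_le_power2 G(2)[of s]] by (auto simp: indicator_def)
 have I0: "0 \<le> ?I" using b0 by (intro integral_nonneg_AE) auto
 have "(NN \<eta>. ennreal ((norm (LB s. indicator {a..b} s * G s \<eta>))^2)) \<le>
  ennreal (b - a) * (NN s. indicator {a..b} s * (NN \<eta>. ennreal ((norm (G s \<eta>))^2)))"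
  by (rule nn_time_integral_L2[OF m ab])
 also have "\<dots> \<le> ennreal (b - a) * (NN s. ennreal (indicator {a..b} s * \<beta> s))"
  using G by (intro mult_left_mono nn_integral_mono) (auto simp: indicator_def nn_integral_L2_norm intro: ennreal_leI)
 also have "(NN s. ennreal (indicator {a..b} s * \<beta> s)) = ennreal ?I"
  by (rule nn_integral_eq_integral[OF \<beta>]) (use b0 in auto)
 also have "ennreal (b - a) * ennreal ?I = ennreal ((sqrt ((b - a) * ?I))^2)"
  using ab I0 by (simp add: ennreal_mult)
 finally have *: "(NN \<eta>. ennreal ((norm (LB s. indicator {a..b} s * G s \<eta>))^2)) \<le> ennreal ((sqrt ((b - a) * ?I))^2)" .
 have mm: "(\<lambda>\<eta>. LB s. indicator {a..b} s * G s \<eta>) \<in> borel_measurable lborel" by measurable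
 note N = L2_space_nn[OF mm *]
 have s0: "0 \<le> sqrt ((b - a) * ?I)" using ab I0 by simp
 show "(\<lambda>\<eta>. LB s. indicator {a..b} s * G s \<eta>) \<in> L2" by (rule N(1)[OF s0])
 have "(N2 (\<lambda>\<eta>. LB s. indicator {a..b} s * G s \<eta>))^2 \<le> (sqrt ((b - a) * ?I))^2"
  by (rule power_mono[OF N(2)[OF s0]]) simp
 then show "(N2 (\<lambda>\<eta>. LB s. indicator {a..b} s * G s \<eta>))^2 \<le> (b - a) * ?I"
  using ab I0 by simp
qed

text \<open>A representative of the potential for which the bound holds at every point and which
  vanishes off (0,T), so that no exceptional null sets have to be carried along.\<close>

locale potential =
 fixes T C :: real and W :: "real \<Rightarrow> 'a::euclidean_space \<Rightarrow> complex"
 assumes T_pos: "T > 0" and C_nonneg: "C \<ge> 0"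
  and W_measurable [measurable]: "joint W"
  and W_bound: "norm (W s x) \<le> C * exp (- norm x)"
  and W_outside: "s \<notin> {0<..<T} \<Longrightarrow> W s x = 0"
begin

definition mass :: real where "mass = (LB x. exp (- norm (x::'a)))"

lemma W_le_C: "norm (W s x) \<le> C"
proof -
 have "C * exp (- norm x) \<le> C * 1" using C_nonneg by (intro mult_left_mono) auto
 then show ?thesis using W_bound[of s x] by linarith
qed

lemma W_slice_measurable [measurable]: "W s \<in> borel_measurable borel"
 by measurable

lemma mass_nonneg: "0 \<le> mass"
 unfolding mass_def by (rule integral_nonneg_AE) auto

lemma W_slice: "W s \<in> L12"
 and W_slice_L1: "(LB x. norm (W s x)) \<le> C * mass"
 and W_slice_L2: "(N2 (W s))^2 \<le> C^2 * mass"
proof -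
 have i: "integrable lborel (\<lambda>x::'a. C * exp (- norm x))" using integrable_exp_norm by (rule integrable_mult_right)
 have i1: "integrable lborel (W s)"
  by (rule lint_bound[OF i]) (use W_bound[of s] C_nonneg in auto)
 have i2: "integrable lborel (\<lambda>x::'a. C * (C * exp (- norm x)))" using i by (rule integrable_mult_right)
 have b: "(norm (W s x))^2 \<le> C * (C * exp (- norm x))" for x
  unfolding power2_eq_square by (intro mult_mono W_le_C W_bound C_nonneg) auto
 have i3: "integrable lborel (\<lambda>x. (norm (W s x))^2)"
  by (rule lint_bound[OF i2]) (use b C_nonneg in auto)
 show "W s \<in> L12" unfolding L12_def using i1 i3 by (auto intro: L2_spaceI)
 have "(LB x. norm (W s x)) \<le> (LB x. C * exp (- norm (x::'a)))"
  by (rule integral_mono[OF integrable_norm[OF i1] i W_bound])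
 then show "(LB x. norm (W s x)) \<le> C * mass" by (simp add: mass_def)
 have "(N2 (W s))^2 \<le> (LB x. C * (C * exp (- norm (x::'a))))"
  unfolding L2_norm_sq by (rule integral_mono[OF i3 i2 b])
 then show "(N2 (W s))^2 \<le> C^2 * mass" by (simp add: mass_def power2_eq_square mult.assoc)
qed

definition What :: "real \<Rightarrow> 'a \<Rightarrow> complex" where
 "What s = fourier (-1) (W s)"

lemma What_measurable [measurable]: "joint What"
 unfolding What_def fourier_def by measurable

lemma What_bound: "norm (What s \<kappa>) \<le> C * mass"
 unfolding What_def by (rule order_trans[OF norm_fourier_le W_slice_L1])

lemma What_outside: "s \<notin> {0<..<T} \<Longrightarrow> What s \<kappa> = 0"
 by (simp add: What_def fourier_def W_outside)

text \<open>The Plancherel bound for the transform of a time slice; it bounds \<open>What s\<close>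
  and equally its reflected translates \<open>kern s \<eta>\<close>, uniformly in s and
  \<eta>.\<close>

definition Wnorm :: real where "Wnorm = sqrt (fourier_const DIM('a) * (C^2 * mass))"

lemma What_L2: "What s \<in> L2" "N2 (What s) \<le> Wnorm"
proof -
 show "What s \<in> L2" unfolding What_def by (rule Plancherel[OF W_slice]) simp
 have "(N2 (What s))^2 = fourier_const DIM('a) * (N2 (W s))^2"
  unfolding What_def by (rule Plancherel_const[OF W_slice]) simp
 also have "\<dots> \<le> fourier_const DIM('a) * (C^2 * mass)"
  by (intro mult_left_mono W_slice_L2) (simp add: less_imp_le)
 finally show "N2 (What s) \<le> Wnorm"
  unfolding Wnorm_def by (rule real_le_rsqrt)
qed

abbreviation kern :: "real \<Rightarrow> 'a \<Rightarrow> 'a \<Rightarrow> complex" where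
 "kern s \<eta> \<zeta> \<equiv> cis (s * ((norm \<eta>)^2 - (norm \<zeta>)^2)) * What s (\<eta> - \<zeta>)"

text \<open>The multiplication operator \<open>W s\<close> on the Fourier side, in the interaction picture.\<close>

definition B :: "real \<Rightarrow> ('a \<Rightarrow> complex) \<Rightarrow> 'a \<Rightarrow> complex" where
 "B s k \<eta> = inverse (of_real (fourier_const DIM('a))) *
  (LB \<zeta>. kern s \<eta> \<zeta> * k \<zeta>)"

lemma B_measurable [measurable]:
 assumes [measurable]: "joint k"
 shows "joint (\<lambda>s \<eta>. B s (k s) \<eta>)"
 unfolding B_def by measurable

lemma B_outside: "s \<notin> {0<..<T} \<Longrightarrow> B s k \<eta> = 0"
 by (simp add: B_def What_outside)

text \<open>As a function of \<zeta>, \<open>What s (\<eta> - \<zeta>)\<close> is the transform,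
  with the opposite sign, of W times a plane wave. Plancherel therefore applies directly, and the
  modulation leaves the norm independent of \<eta>.\<close>

lemma What_reflect_L2: "(\<lambda>\<zeta>. kern s \<eta> \<zeta>) \<in> L2"
 "N2 (\<lambda>\<zeta>. kern s \<eta> \<zeta>) \<le> Wnorm"
proof -
 have refl: "What s (\<eta> - \<zeta>) = fourier 1 (\<lambda>x. cis (- (\<eta> \<bullet> x)) * W s x) \<zeta>" for \<zeta>
  unfolding What_def fourier_def
  by (intro lint_cong refl)
   (simp add: mult.assoc[symmetric] cis_mult inner_diff_left)
 have g: "(\<lambda>x. cis (- (\<eta> \<bullet> x)) * W s x) \<in> L12"
  unfolding L12_def using L12D[OF W_slice[of s]]
  by (auto intro!: integrable_cis_mult L2_space_norm_eq[where f="W s"] simp: norm_mult)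
 have L: "(\<lambda>\<zeta>. What s (\<eta> - \<zeta>)) \<in> L2"
  unfolding refl by (rule Plancherel[OF g, of 1]) simp
 show "(\<lambda>\<zeta>. kern s \<eta> \<zeta>) \<in> L2"
  using L2_space_measurable[OF L] by (intro L2_space_norm_eq[OF L]) (auto simp: norm_mult)
 have "(N2 (\<lambda>\<zeta>. What s (\<eta> - \<zeta>)))^2 = fourier_const DIM('a) * (N2 (\<lambda>x. cis (- (\<eta> \<bullet> x)) * W s x))^2"
  unfolding refl by (rule Plancherel_const[OF g]) simp
 also have "N2 (\<lambda>x. cis (- (\<eta> \<bullet> x)) * W s x) = N2 (W s)"
  by (rule L2_norm_cong) (simp add: norm_mult)
 also have "fourier_const DIM('a) * (N2 (W s))^2 \<le> fourier_const DIM('a) * (C^2 * mass)"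
  by (intro mult_left_mono W_slice_L2) (simp add: less_imp_le)
 finally have "N2 (\<lambda>\<zeta>. What s (\<eta> - \<zeta>)) \<le> Wnorm"
  unfolding Wnorm_def by (rule real_le_rsqrt)
 also have "N2 (\<lambda>\<zeta>. What s (\<eta> - \<zeta>)) = N2 (\<lambda>\<zeta>. kern s \<eta> \<zeta>)"
  by (rule L2_norm_cong) (simp add: norm_mult)
 finally show "N2 (\<lambda>\<zeta>. kern s \<eta> \<zeta>) \<le> Wnorm" .
qed

lemma Wnorm_nonneg: "0 \<le> Wnorm"
 by (rule order_trans[OF L2_norm_nonneg What_reflect_L2(2)])

lemma B_integrable:
 "k \<in> L2 \<Longrightarrow> integrable lborel (\<lambda>\<zeta>. kern s \<eta> \<zeta> * k \<zeta>)"
 by (rule L2_mult_integrable[OF What_reflect_L2(1)])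

text \<open>Cauchy-Schwarz against the square integrable kernel. The constant does not depend on
  \<eta>: this bound is what makes the estimates available at a single frequency.\<close>

lemma B_pointwise:
 assumes k: "k \<in> L2"
 shows "norm (B s k \<eta>) \<le> Wnorm / fourier_const DIM('a) * N2 k"
proof -
 have "norm (LB \<zeta>. kern s \<eta> \<zeta> * k \<zeta>) \<le> Wnorm * N2 k"
  by (rule order_trans[OF L2_Cauchy_Schwarz[OF What_reflect_L2(1) k]])
   (intro mult_right_mono What_reflect_L2(2) L2_norm_nonneg)
 then have "inverse (fourier_const DIM('a)) * norm (LB \<zeta>. kern s \<eta> \<zeta> * k \<zeta>)
   \<le> inverse (fourier_const DIM('a)) * (Wnorm * N2 k)"
  by (intro mult_left_mono) (simp_all add: less_imp_le)
 moreover have "norm (inverse (complex_of_real (fourier_const DIM('a)))) = inverse (fourier_const DIM('a))"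
  by (simp only: norm_inverse norm_of_real abs_of_pos[OF fourier_const_pos])
 ultimately show ?thesis
  unfolding B_def norm_mult by (simp add: divide_inverse ac_simps)
qed

lemma B_diff:
 assumes "k \<in> L2" "l \<in> L2"
 shows "B s (\<lambda>\<zeta>. k \<zeta> - l \<zeta>) \<eta> = B s k \<eta> - B s l \<eta>"
 unfolding B_def using B_integrable[OF assms(1), of s \<eta>] B_integrable[OF assms(2), of s \<eta>]
 by (simp add: right_diff_distrib)

lemma B_add:
 assumes "k \<in> L2" "l \<in> L2"
 shows "B s (\<lambda>\<zeta>. k \<zeta> + l \<zeta>) \<eta> = B s k \<eta> + B s l \<eta>"
 unfolding B_def using B_integrable[OF assms(1), of s \<eta>] B_integrable[OF assms(2), of s \<eta>]
 by (simp add: distrib_left)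

lemma B_AE_cong:
 assumes "AE \<zeta> in lborel. k \<zeta> = l \<zeta>" "k \<in> borel_measurable borel" "l \<in> borel_measurable borel"
 shows "B s k \<eta> = B s l \<eta>"
proof -
 note [measurable] = assms(2,3)
 show ?thesis
  unfolding B_def
  by (intro arg_cong2[where f="(*)"] refl integral_cong_AE) (use assms(1) in auto)
qed

text \<open>The second duality relation of \<open>ft_pair\<close>, tested with W times a plane wave,
  turns the convolution with the transform of W into the transform of the product.\<close>

lemma B_fourier:
 assumes p: "ft_pair u (\<lambda>\<zeta>. phase (- s) \<zeta> * k \<zeta>)"
 shows "B s k \<eta> = phase s \<eta> * fourier (-1) (\<lambda>x. W s x * u x) \<eta>"
proof -
 have g: "(\<lambda>x. cis (- (\<eta> \<bullet> x)) * W s x) \<in> L12"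
  unfolding L12_def using L12D[OF W_slice[of s]]
  by (auto intro!: integrable_cis_mult L2_space_norm_eq[where f="W s"] simp: norm_mult)
 have refl: "fourier 1 (\<lambda>x. cis (- (\<eta> \<bullet> x)) * W s x) \<zeta> = What s (\<eta> - \<zeta>)" for \<zeta>
  unfolding What_def fourier_def
  by (intro lint_cong refl)
   (simp add: mult.assoc[symmetric] cis_mult inner_diff_left)
 have "(LB \<zeta>. kern s \<eta> \<zeta> * k \<zeta>) =
  (LB \<zeta>. phase s \<eta> * ((phase (- s) \<zeta> * k \<zeta>) * fourier 1 (\<lambda>x. cis (- (\<eta> \<bullet> x)) * W s x) \<zeta>))"
  unfolding refl
 proof (intro lint_cong refl)
  fix \<zeta> :: 'a
  have "cis (s * ((norm \<eta>)^2 - (norm \<zeta>)^2)) = phase s \<eta> * phase (- s) \<zeta>"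
   by (simp add: cis_mult right_diff_distrib)
  then show "kern s \<eta> \<zeta> * k \<zeta> =
   phase s \<eta> * (phase (- s) \<zeta> * k \<zeta> * What s (\<eta> - \<zeta>))"
   by (simp only: ac_simps)
 qed simp
 also have "\<dots> = phase s \<eta> * (of_real (fourier_const DIM('a)) * (LB x. u x * (cis (- (\<eta> \<bullet> x)) * W s x)))"
  by (simp only: integral_mult_right_zero ft_pairD(4)[OF p g])
 also have "(LB x. u x * (cis (- (\<eta> \<bullet> x)) * W s x)) = fourier (-1) (\<lambda>x. W s x * u x) \<eta>"
  unfolding fourier_def by (simp add: ac_simps)
 finally show ?thesis unfolding B_def by simp
qed

lemma W_mult_L12:
 assumes u: "u \<in> L2"
 shows "(\<lambda>x. W s x * u x) \<in> L12" "N2 (\<lambda>x. W s x * u x) \<le> C * N2 u"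
proof -
 note [measurable] = L2_space_measurable[OF u, simplified]
 have L: "(\<lambda>x. W s x * u x) \<in> L2"
  by (rule L2_space_bound[OF u, where C=C]) (auto simp: norm_mult intro!: mult_right_mono W_le_C)
 then show "(\<lambda>x. W s x * u x) \<in> L12"
  unfolding L12_def using L2_mult_integrable[OF L12D(1)[OF W_slice] u] by simp
 have "(N2 (\<lambda>x. W s x * u x))^2 \<le> (LB x. C^2 * (norm (u x))^2)"
  unfolding L2_norm_sq
 proof (rule integral_mono)
  show "(norm (W s x * u x))^2 \<le> C^2 * (norm (u x))^2" for x
   unfolding norm_mult power_mult_distrib by (intro mult_right_mono power_mono W_le_C) auto
 qed (use L2_space_integrable[OF L] L2_space_integrable[OF u] in auto)
 also have "\<dots> = (C * N2 u)^2" by (simp add: L2_norm_sq power_mult_distrib)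
 finally show "N2 (\<lambda>x. W s x * u x) \<le> C * N2 u"
  by (rule power2_le_imp_le) (use C_nonneg in auto)
qed

text \<open>Back in x-space B is multiplication by W, whose modulus is at most C; the two Plancherel
  constants cancel. The kernel bound of \<open>B_pointwise\<close> would not give an estimate from
  L^2 to L^2.\<close>

lemma B_L2:
 assumes k: "k \<in> L2"
 shows "B s k \<in> L2" "N2 (B s k) \<le> C * N2 k"
proof -
 let ?c = "fourier_const DIM('a)"
 note [measurable] = L2_space_measurable[OF k, simplified]
 let ?h = "\<lambda>\<zeta>. phase (- s) \<zeta> * k \<zeta>"
 have h: "?h \<in> L2" by (rule L2_space_norm_eq[OF k]) (auto simp: norm_mult)
 obtain u where u: "ft_pair u ?h" using ft_pair_inverse_exists[OF h] .
 note W = W_mult_L12[OF ft_pairD(1)[OF u], of s]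
 let ?F = "fourier (-1) (\<lambda>x. W s x * u x)"
 have F: "?F \<in> L2" "(N2 ?F)^2 = ?c * (N2 (\<lambda>x. W s x * u x))^2"
  by (rule Plancherel_const[OF W(1)], simp)+
 have eq: "B s k = (\<lambda>\<eta>. phase s \<eta> * ?F \<eta>)" by (rule ext) (rule B_fourier[OF u])
 show "B s k \<in> L2"
  unfolding eq by (rule L2_space_norm_eq[OF F(1)]) (use L2_space_measurable[OF F(1)] in \<open>auto simp: norm_mult\<close>)
 have "(N2 (B s k))^2 = (N2 ?F)^2"
  unfolding eq by (simp add: norm_mult cong: L2_norm_cong[of lborel "\<lambda>\<eta>. phase s \<eta> * ?F \<eta>" ?F])
 also have "\<dots> \<le> ?c * (C * N2 u)^2"
  unfolding F(2) by (intro mult_left_mono power_mono W(2)) (auto simp: less_imp_le)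
 also have "\<dots> = C^2 * (N2 ?h)^2"
  unfolding ft_pair_norm[OF u] power_mult_distrib by (rule mult.left_commute)
 also have "N2 ?h = N2 k" by (rule L2_norm_cong) (simp add: norm_mult)
 finally have "(N2 (B s k))^2 \<le> (C * N2 k)^2" by (simp add: power_mult_distrib)
 then show "N2 (B s k) \<le> C * N2 k"
  by (rule power2_le_imp_le) (use C_nonneg in auto)
qed

end

section \<open>The Volterra equation\<close>

text \<open>The completeness argument rescaled by P. The limit is given by an explicit formula in
  the sequence, so that for sequences depending measurably on time it is jointly measurable.\<close>

lemma L2_geometric_limit:
 fixes f :: "nat \<Rightarrow> 'a \<Rightarrow> complex"
 assumes f: "\<And>n. f n \<in> L2_space M" and fast: "\<And>n. L2_norm M (\<lambda>x. f (Suc n) x - f n x) \<le> P * (1/2)^n"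
  and P: "P > 0"
  and g: "\<And>x. g x = (if Cauchy (\<lambda>n. f n x) then lim (\<lambda>n. f n x) else 0)" "g \<in> borel_measurable M"
 shows "g \<in> L2_space M" "AE x in M. (\<lambda>n. f n x) \<longlonglongrightarrow> g x"
  "L2_norm M (\<lambda>x. g x - f n x) \<le> 2 * P * (1/2)^n"
proof -
 define F where "F n x = inverse (of_real P) * f n x" for n x
 have nP: "norm (inverse (complex_of_real P)) = inverse P"
  using P by (simp only: norm_inverse norm_of_real abs_of_pos)
 have FL: "F n \<in> L2_space M" for n unfolding F_def by (rule L2_space_cmult[OF f])
 have Ff: "L2_norm M (\<lambda>x. F (Suc n) x - F n x) \<le> (1/2)^n" for n
 proof -
  have "L2_norm M (\<lambda>x. F (Suc n) x - F n x) = inverse P * L2_norm M (\<lambda>x. f (Suc n) x - f n x)"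
   unfolding F_def right_diff_distrib[symmetric] L2_norm_cmult nP ..
  also have "\<dots> \<le> inverse P * (P * (1/2)^n)" using P by (intro mult_left_mono fast) auto
  also have "\<dots> = (1/2)^n" using P by simp
  finally show ?thesis .
 qed
 have conv: "AE x in M. convergent (\<lambda>n. F n x)" by (rule L2_fast_Cauchy_AE_convergent[OF FL Ff])
 show lim: "AE x in M. (\<lambda>n. f n x) \<longlonglongrightarrow> g x"
  using conv
 proof eventually_elim
  case (elim x)
  have "convergent (\<lambda>n. of_real P * F n x)"
   by (intro convergent_mult convergent_const elim)
  moreover have "of_real P * F n x = f n x" for n
   unfolding F_def mult.assoc[symmetric] using P by simp
  ultimately have "convergent (\<lambda>n. f n x)" by simp
  then show ?case by (simp add: g Cauchy_convergent_iff convergent_LIMSEQ_iff)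
 qed
 then have lim': "AE x in M. (\<lambda>n. F n x) \<longlonglongrightarrow> inverse (of_real P) * g x"
  unfolding F_def by eventually_elim (intro tendsto_mult tendsto_const)
 have m: "(\<lambda>x. inverse (of_real P) * g x) \<in> borel_measurable M"
  using g(2) by measurable
 note L = L2_fast_Cauchy_limit[OF FL Ff lim' m]
 have "(\<lambda>x. of_real P * (inverse (of_real P) * g x)) \<in> L2_space M" by (rule L2_space_cmult[OF L(1)])
 then show "g \<in> L2_space M" unfolding mult.assoc[symmetric] using P by simp
 have "inverse P * L2_norm M (\<lambda>x. g x - f n x) = L2_norm M (\<lambda>x. inverse (of_real P) * g x - F n x)"
  unfolding F_def right_diff_distrib[symmetric] L2_norm_cmult nP ..
 also have "\<dots> \<le> 2 * (1/2)^n" by (rule L(2))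
 finally have "P * (inverse P * L2_norm M (\<lambda>x. g x - f n x)) \<le> P * (2 * (1/2)^n)"
  using P by (intro mult_left_mono) auto
 moreover have "P * (inverse P * L2_norm M (\<lambda>x. g x - f n x)) = L2_norm M (\<lambda>x. g x - f n x)"
  using P by (simp flip: mult.assoc)
 ultimately show "L2_norm M (\<lambda>x. g x - f n x) \<le> 2 * P * (1/2)^n" by (simp only: ac_simps)
qed

lemma indicator_Icc_measurable [measurable]:
 "(\<lambda>(t, s). indicator {a..t} s :: complex) \<in> borel_measurable (borel \<Otimes>\<^sub>M (borel :: real measure))"
proof -
 have "(\<lambda>(t, s). indicator {a..t} s :: complex) = (\<lambda>(t, s). if a \<le> s \<and> s \<le> t then 1 else 0)"
  by (auto simp: indicator_def)
 also have "\<dots> \<in> borel_measurable (borel \<Otimes>\<^sub>M borel)" by measurable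
 finally show ?thesis .
qed

context potential
begin

text \<open>The equation is required at every \<eta>, not almost everywhere, so that K t can be
  evaluated at a chosen frequency. The uniform bound R makes the time integrals of B converge
  there.\<close>

definition volterra :: "('a \<Rightarrow> complex) \<Rightarrow> (real \<Rightarrow> 'a \<Rightarrow> complex) \<Rightarrow> bool" where
 "volterra k0 K \<longleftrightarrow> k0 \<in> L2 \<and> joint K \<and>
  (\<forall>t\<in>{0..T}. K t \<in> L2) \<and> (\<exists>R. \<forall>t\<in>{0..T}. N2 (K t) \<le> R) \<and>
  (\<forall>t\<in>{0..T}. \<forall>\<eta>. K t \<eta> = k0 \<eta> - \<i> * (LB s. indicator {0..t} s * B s (K s) \<eta>))"

lemma integrable_B_time:
 assumes [measurable]: "joint K"
  and K: "\<And>t. t \<in> {0..T} \<Longrightarrow> K t \<in> L2" "\<And>t. t \<in> {0..T} \<Longrightarrow> N2 (K t) \<le> R"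
  and t: "t \<le> T"
 shows "integrable lborel (\<lambda>s. indicator {0..t} s * B s (K s) \<eta>)"
proof (rule lint_bound)
 let ?c = "Wnorm / fourier_const DIM('a)"
 show "integrable lborel (\<lambda>s. indicator {0..t} s * (?c * R) :: real)"
  by (rule integrable_Icc_const)
 show "AE s in lborel. norm (indicator {0..t} s * B s (K s) \<eta>) \<le> norm (indicator {0..t} s * (?c * R))"
 proof (rule AE_I2)
  fix s
  show "norm (indicator {0..t} s * B s (K s) \<eta>) \<le> norm (indicator {0..t} s * (?c * R))"
  proof (cases "s \<in> {0..t}")
   case True
   then have s: "s \<in> {0..T}" using t by auto
   have c0: "0 \<le> ?c" using Wnorm_nonneg by (simp add: less_imp_le)
   have "norm (B s (K s) \<eta>) \<le> ?c * N2 (K s)" by (rule B_pointwise[OF K(1)[OF s]])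
   also have "\<dots> \<le> ?c * R" by (intro mult_left_mono K(2)[OF s] c0)
   also have "\<dots> \<le> norm (?c * R)" by (simp only: real_norm_def abs_ge_self)
   finally show ?thesis using True by simp
  qed simp
 qed
qed measurable

text \<open>Index j gives the j-th term of the Born series; the Picard iterates are the partial
  sums.\<close>

primrec picard :: "('a \<Rightarrow> complex) \<Rightarrow> nat \<Rightarrow> real \<Rightarrow> 'a \<Rightarrow> complex" where
 "picard k0 0 t \<eta> = k0 \<eta>"
| "picard k0 (Suc j) t \<eta> = - \<i> * (LB s. indicator {0..t} s * B s (\<lambda>\<zeta>. picard k0 j s \<zeta>) \<eta>)"

lemma picard_measurable [measurable]:
 assumes [measurable]: "k0 \<in> borel_measurable borel"
 shows "joint (\<lambda>t \<eta>. picard k0 j t \<eta>)"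
proof (induction j)
 case (Suc j)
 note [measurable] = Suc
 show ?case unfolding picard.simps by measurable
qed simp

text \<open>An exponential weight in time replaces the factorials of the usual iteration:
  integrating e^{\<lambda>s} gains 1/\<lambda>, and T C^2 / \<lambda> \<le> 1/4. The norms thus
  decay like (1/2)^j, the rate required by \<open>L2_geometric_limit\<close>. The summand 1 keeps
  \<lambda> positive when C = 0.\<close>

lemma picard_bound:
 fixes la :: real
 assumes k0: "k0 \<in> L2" and l: "la = 4 * T * C^2 + 1"
 shows "\<And>t. t \<in> {0..T} \<Longrightarrow> picard k0 j t \<in> L2 \<and>
  (N2 (picard k0 j t))\<^sup>2 \<le> (N2 k0)^2 * (1/4)^j * exp (la * t)"
proof (induction j)
 case (0 t)
 have l0: "la > 0" unfolding l using T_pos by (simp add: add_nonneg_pos)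
 have "1 \<le> exp (la * t)" using 0 l0 by simp
 then have "(N2 k0)^2 * 1 \<le> (N2 k0)^2 * exp (la * t)"
  by (intro mult_left_mono) auto
 moreover have "picard k0 0 t = k0" by (rule ext) simp
 ultimately show ?case using k0 by simp
next
 case (Suc j t)
 let ?N = "(N2 k0)^2"
 have l0: "la > 0" unfolding l using T_pos by (simp add: add_nonneg_pos)
 note [measurable] = L2_space_measurable[OF k0, simplified]
 have t: "0 \<le> t" "t \<le> T" using Suc.prems by auto
 let ?\<beta> = "\<lambda>s. C^2 * (?N * (1/4)^j) * exp (la * s)"
 let ?G = "\<lambda>s. B s (\<lambda>\<zeta>. picard k0 j s \<zeta>)"
 have bi: "has_bochner_integral lborel (\<lambda>s. exp (la * s) * indicator {0..t} s) (exp (la * t) / la - exp (la * 0) / la)"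
  using l0 by (intro has_bochner_integral_FTC_Icc_real t(1)) (auto intro!: derivative_eq_intros continuous_intros)
 have bi2: "has_bochner_integral lborel (\<lambda>s. indicator {0..t} s * ?\<beta> s) (C^2 * (?N * (1/4)^j) * (exp (la * t) / la - 1 / la))"
  using has_bochner_integral_mult_right[OF bi, of "C^2 * (?N * (1/4)^j)"] by (simp add: ac_simps)
 have G: "?G s \<in> L2" "(N2 (?G s))^2 \<le> ?\<beta> s" if "s \<in> {0..t}" for s
 proof -
  have s: "s \<in> {0..T}" using that t by auto
  note IH = Suc.IH[OF s]
  show "?G s \<in> L2" using B_L2(1) IH by auto
  have "(N2 (?G s))^2 \<le> (C * N2 (picard k0 j s))^2"
   by (intro power_mono B_L2(2)) (use IH in auto)
  also have "\<dots> \<le> C^2 * (?N * (1/4)^j * exp (la * s))"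
   unfolding power_mult_distrib by (intro mult_left_mono) (use IH in auto)
  finally show "(N2 (?G s))^2 \<le> ?\<beta> s" by (simp add: ac_simps)
 qed
 have m: "joint (\<lambda>s \<eta>. ?G s \<eta>)" by measurable
 note TI = time_integral_L2[OF m t(1) G integrable.intros[OF bi2]]
 have eq: "picard k0 (Suc j) t = (\<lambda>\<eta>. - \<i> * (LB s. indicator {0..t} s * ?G s \<eta>))" by (rule ext) simp
 show ?case
 proof
  show "picard k0 (Suc j) t \<in> L2" unfolding eq by (rule L2_space_cmult[OF TI(1)])
  have "(N2 (picard k0 (Suc j) t))^2 = (N2 (\<lambda>\<eta>. LB s. indicator {0..t} s * ?G s \<eta>))^2"
   unfolding eq by (simp only: L2_norm_cmult norm_minus_cancel norm_ii mult_1_left)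
  also have "\<dots> \<le> (t - 0) * (C^2 * (?N * (1/4)^j) * (exp (la * t) / la - 1 / la))"
   using TI(2) has_bochner_integral_integral_eq[OF bi2] by simp
  also have "\<dots> \<le> T * (C^2 * (?N * (1/4)^j) * (exp (la * t) / la))"
  proof (rule mult_mono)
   show "C^2 * (?N * (1/4)^j) * (exp (la * t) / la - 1 / la) \<le> C^2 * (?N * (1/4)^j) * (exp (la * t) / la)"
    by (rule mult_left_mono) (use l0 in auto)
   have "1 \<le> exp (la * t)" using t l0 by simp
   then have "0 \<le> exp (la * t) / la - 1 / la"
    using l0 by (simp add: diff_divide_distrib[symmetric])
   then show "0 \<le> C^2 * (?N * (1/4)^j) * (exp (la * t) / la - 1 / la)" by simp
  qed (use t in auto)
  also have "\<dots> = (T * C^2 / la) * (?N * (1/4)^j * exp (la * t))" by simp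
  also have "\<dots> \<le> (1/4) * (?N * (1/4)^j * exp (la * t))"
  proof (rule mult_right_mono)
   show "T * C^2 / la \<le> 1/4" using l0 by (simp add: divide_le_eq) (simp add: l)
  qed simp
  finally show "(N2 (picard k0 (Suc j) t))^2 \<le> ?N * (1/4)^(Suc j) * exp (la * t)" by simp
 qed
qed

theorem volterra_exists:
 assumes k0: "k0 \<in> L2"
 obtains K where "volterra k0 K"
proof -
 define la where "la = 4 * T * C^2 + 1"
 have l0: "la > 0" unfolding la_def using T_pos by (simp add: add_nonneg_pos)
 note pb = picard_bound[OF k0 la_def]
 note [measurable] = L2_space_measurable[OF k0, simplified]
 define P where "P = N2 k0 * exp (la * T) + 1"
 have P: "P > 0" unfolding P_def by (simp add: add_nonneg_pos)
 have pL: "picard k0 j t \<in> L2" if "t \<in> {0..T}" for j t using pb[OF that] by auto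
 have pN: "N2 (picard k0 j t) \<le> P * (1/2)^j" if t: "t \<in> {0..T}" for j t
 proof (rule power2_le_imp_le)
  have "exp (la * t) \<le> (exp (la * T))^2"
  proof -
   have "exp (la * t) \<le> exp (la * T) * 1" using t l0 by simp
   also have "\<dots> \<le> exp (la * T) * exp (la * T)" using T_pos l0 by (intro mult_left_mono) auto
   finally show ?thesis by (simp add: power2_eq_square)
  qed
  then have "(N2 k0)^2 * (1/4)^j * exp (la * t) \<le> (N2 k0)^2 * (1/4)^j * (exp (la * T))^2"
   by (intro mult_left_mono) auto
  also have "\<dots> = (N2 k0 * exp (la * T) * (1/2)^j)^2"
   by (simp add: power_mult_distrib power2_eq_square[of "(1/2::real)^j"] flip: power_mult_distrib[of "1/2::real" "1/2"])
  also have "\<dots> \<le> (P * (1/2)^j)^2"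
   by (intro power_mono mult_right_mono) (auto simp: P_def)
  finally show "(N2 (picard k0 j t))^2 \<le> (P * (1/2)^j)^2"
   using pb[OF t, of j] by linarith
 qed (use P in auto)
 define f where "f n t \<eta> = (\<Sum>j<n. picard k0 j t \<eta>)" for n t \<eta>
 have fm [measurable]: "joint (\<lambda>t \<eta>. f n t \<eta>)" for n
  unfolding f_def by measurable
 have fL: "f n t \<in> L2" if "t \<in> {0..T}" for n t
  unfolding f_def[abs_def] by (rule L2_space_sum[OF pL[OF that]])
 have fd: "N2 (\<lambda>\<eta>. f (Suc n) t \<eta> - f n t \<eta>) \<le> P * (1/2)^n" if "t \<in> {0..T}" for n t
  using pN[OF that, of n] by (simp add: f_def)
 define K0 where "K0 t \<eta> = (if Cauchy (\<lambda>n. f n t \<eta>) then lim (\<lambda>n. f n t \<eta>) else 0)" for t \<eta>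
 have K0m [measurable]: "joint K0"
  unfolding K0_def by measurable
 have K0s: "K0 t \<in> borel_measurable lborel" for t by measurable
 note gl = L2_geometric_limit[OF fL fd P K0_def K0s]
 have K0N: "N2 (K0 t) \<le> 3 * P" if t: "t \<in> {0..T}" for t
 proof -
  have "N2 (\<lambda>\<eta>. (K0 t \<eta> - f 0 t \<eta>)) \<le> 2 * P * (1/2)^0" by (rule gl(3)[OF t t])
  then show ?thesis using P by (simp add: f_def)
 qed
 have fN: "N2 (f n t) \<le> 5 * P" if t: "t \<in> {0..T}" for n t
 proof -
  have "N2 (\<lambda>\<eta>. f n t \<eta> - 0) \<le> N2 (\<lambda>\<eta>. f n t \<eta> - K0 t \<eta>) + N2 (\<lambda>\<eta>. K0 t \<eta> - 0)"
   by (rule L2_norm_triangle_diff[OF fL[OF t] gl(1)[OF t t] L2_space_zero])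
  moreover have "N2 (\<lambda>\<eta>. f n t \<eta> - K0 t \<eta>) \<le> 2 * P * (1/2)^n"
   using gl(3)[OF t t] by (subst L2_norm_minus_commute)
  moreover have "2 * P * (1/2)^n \<le> 2 * P * 1" using P by (intro mult_left_mono power_le_one) auto
  ultimately show ?thesis using K0N[OF t] by simp
 qed
 have pi: "integrable lborel (\<lambda>s. indicator {0..t} s * B s (picard k0 j s) \<eta>)" if "t \<in> {0..T}" for t j \<eta>
 proof (rule integrable_B_time)
  show "N2 (picard k0 j s) \<le> P * 1" if "s \<in> {0..T}" for s
   by (rule order_trans[OF pN[OF that]]) (use P in \<open>intro mult_left_mono power_le_one, auto\<close>)
 qed (use that pL in auto)
 have fB: "B s (f n s) \<eta> = (\<Sum>j<n. B s (picard k0 j s) \<eta>)" if s: "s \<in> {0..T}" for n s \<eta>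
 proof (induction n)
  case 0
  then show ?case by (simp add: f_def[abs_def] B_def)
 next
  case (Suc n)
  have "f (Suc n) s = (\<lambda>\<zeta>. f n s \<zeta> + picard k0 n s \<zeta>)" by (rule ext) (simp add: f_def)
  then show ?case using B_add[OF fL[OF s, of n] pL[OF s, of n], of s \<eta>] Suc by simp
 qed
 have rec: "f (Suc n) t \<eta> = k0 \<eta> - \<i> * (LB s. indicator {0..t} s * B s (f n s) \<eta>)"
  if t: "t \<in> {0..T}" for n t \<eta>
 proof -
  have "(LB s. indicator {0..t} s * B s (f n s) \<eta>) =
   (LB s. (\<Sum>j<n. indicator {0..t} s * B s (picard k0 j s) \<eta>))"
  proof (intro lint_cong refl)
   fix s
   show "indicator {0..t} s * B s (f n s) \<eta> = (\<Sum>j<n. indicator {0..t} s * B s (picard k0 j s) \<eta>)"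
    using fB[of s n \<eta>] t by (cases "s \<in> {0..t}") auto
  qed
  also have "\<dots> = (\<Sum>j<n. (LB s. indicator {0..t} s * B s (picard k0 j s) \<eta>))"
   by (rule lint_sum) (rule pi[OF t])
  finally have I: "(LB s. indicator {0..t} s * B s (f n s) \<eta>) =
   (\<Sum>j<n. (LB s. indicator {0..t} s * B s (picard k0 j s) \<eta>))" .
  have "f (Suc n) t \<eta> = picard k0 0 t \<eta> + (\<Sum>j<n. picard k0 (Suc j) t \<eta>)"
   unfolding f_def by (rule sum.lessThan_Suc_shift)
  then show ?thesis unfolding I by (simp add: sum_distrib_left sum_negf)
 qed
 \<comment> \<open>By \<open>B_pointwise\<close>, convergence in L^2 of each time slice gives
   convergence of the integrand at every frequency, with a constant majorant.\<close>
 have lim: "(\<lambda>n. LB s. indicator {0..t} s * B s (f n s) \<eta>) \<longlonglongrightarrow> (LB s. indicator {0..t} s * B s (K0 s) \<eta>)"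
  if t: "t \<in> {0..T}" for t \<eta>
 proof (rule integral_dominated_convergence)
  let ?c = "Wnorm / fourier_const DIM('a)"
  have c0: "0 \<le> ?c" using Wnorm_nonneg by (simp add: less_imp_le)
  show "integrable lborel (\<lambda>s. indicator {0..t} s * (?c * (5 * P)) :: real)"
   by (rule integrable_Icc_const)
  show "AE s in lborel. norm (indicator {0..t} s * B s (f n s) \<eta>) \<le> indicator {0..t} s * (?c * (5 * P))" for n
  proof (rule AE_I2)
   fix s
   show "norm (indicator {0..t} s * B s (f n s) \<eta>) \<le> indicator {0..t} s * (?c * (5 * P))"
   proof (cases "s \<in> {0..t}")
    case True
    then have s: "s \<in> {0..T}" using t by auto
    have "norm (B s (f n s) \<eta>) \<le> ?c * N2 (f n s)" by (rule B_pointwise[OF fL[OF s]])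
    also have "\<dots> \<le> ?c * (5 * P)" by (intro mult_left_mono fN[OF s] c0)
    finally show ?thesis using True by simp
   qed simp
  qed
  show "AE s in lborel. (\<lambda>n. indicator {0..t} s * B s (f n s) \<eta>) \<longlonglongrightarrow> indicator {0..t} s * B s (K0 s) \<eta>"
  proof (rule AE_I2)
   fix s
   show "(\<lambda>n. indicator {0..t} s * B s (f n s) \<eta>) \<longlonglongrightarrow> indicator {0..t} s * B s (K0 s) \<eta>"
   proof (cases "s \<in> {0..t}")
    case True
    then have s: "s \<in> {0..T}" using t by auto
    have "(\<lambda>n. B s (f n s) \<eta>) \<longlonglongrightarrow> B s (K0 s) \<eta>"
     unfolding Lim_null[of _ "B s (K0 s) \<eta>"]
    proof (rule Lim_null_comparison)
     show "\<forall>\<^sub>F n in sequentially. norm (B s (f n s) \<eta> - B s (K0 s) \<eta>) \<le> ?c * (2 * P * (1/2)^n)"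
     proof (intro always_eventually allI)
      fix n
      have d: "(\<lambda>\<zeta>. f n s \<zeta> - K0 s \<zeta>) \<in> L2" by (rule L2_space_diff[OF fL[OF s] gl(1)[OF s s]])
      have "norm (B s (f n s) \<eta> - B s (K0 s) \<eta>) \<le> ?c * N2 (\<lambda>\<zeta>. f n s \<zeta> - K0 s \<zeta>)"
       unfolding B_diff[OF fL[OF s] gl(1)[OF s s], symmetric] by (rule B_pointwise[OF d])
      also have "\<dots> \<le> ?c * (2 * P * (1/2)^n)"
       using gl(3)[OF s s] by (intro mult_left_mono c0) (subst L2_norm_minus_commute)
      finally show "norm (B s (f n s) \<eta> - B s (K0 s) \<eta>) \<le> ?c * (2 * P * (1/2)^n)" .
     qed
     show "(\<lambda>n. ?c * (2 * P * (1/2)^n)) \<longlonglongrightarrow> 0"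
      by (intro tendsto_mult_right_zero LIMSEQ_power_zero) simp
    qed
    then show ?thesis using True by simp
   qed simp
  qed
 qed measurable
 \<comment> \<open>The limit \<open>K0\<close> satisfies the equation only almost everywhere. Its
   right-hand side, taken as a new function, satisfies it everywhere, because \<open>B\<close> does
   not see the change on null sets.\<close>
 define K where "K t \<eta> = (if t \<in> {0..T} then k0 \<eta> - \<i> * (LB s. indicator {0..t} s * B s (K0 s) \<eta>) else 0)" for t \<eta>
 have Km [measurable]: "joint K"
  unfolding K_def by measurable
 have KK0: "AE \<eta> in lborel. K0 t \<eta> = K t \<eta>" if t: "t \<in> {0..T}" for t
  using gl(2)[OF t t]
 proof eventually_elim
  case (elim \<eta>)
  have "(\<lambda>n. f (Suc n) t \<eta>) \<longlonglongrightarrow> K0 t \<eta>" using elim by (rule LIMSEQ_Suc)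
  moreover have "(\<lambda>n. f (Suc n) t \<eta>) \<longlonglongrightarrow> k0 \<eta> - \<i> * (LB s. indicator {0..t} s * B s (K0 s) \<eta>)"
   unfolding rec[OF t] by (intro tendsto_intros lim[OF t])
  ultimately have "K0 t \<eta> = k0 \<eta> - \<i> * (LB s. indicator {0..t} s * B s (K0 s) \<eta>)"
   by (rule LIMSEQ_unique)
  then show ?case using t by (simp add: K_def)
 qed
 have Kms: "K t \<in> borel_measurable borel" for t by measurable
 have K0ms: "K0 t \<in> borel_measurable borel" for t by measurable
 have BK: "B s (K0 s) \<eta> = B s (K s) \<eta>" if s: "s \<in> {0..T}" for s \<eta>
  by (rule B_AE_cong[OF KK0[OF s] K0ms Kms])
 have "volterra k0 K"
  unfolding volterra_def
 proof (intro conjI ballI allI exI)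
  show "K t \<in> L2" if t: "t \<in> {0..T}" for t
   by (rule L2_space_AE_cong[OF gl(1)[OF t t] KK0[OF t]]) (use Kms in simp)
  show "N2 (K t) \<le> 3 * P" if t: "t \<in> {0..T}" for t
   using K0N[OF t] L2_norm_AE_cong[OF KK0[OF t]] Kms[of t] K0ms[of t] by simp
  show "K t \<eta> = k0 \<eta> - \<i> * (LB s. indicator {0..t} s * B s (K s) \<eta>)" if t: "t \<in> {0..T}" for t \<eta>
  proof -
   have "(LB s. indicator {0..t} s * B s (K0 s) \<eta>) = (LB s. indicator {0..t} s * B s (K s) \<eta>)"
   proof (intro lint_cong refl)
    fix s show "indicator {0..t} s * B s (K0 s) \<eta> = indicator {0..t} s * B s (K s) \<eta>"
     using BK[of s] t by (cases "s \<in> {0..t}") auto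
   qed
   then show ?thesis using t by (simp add: K_def)
  qed
 qed (use k0 Km in auto)
 then show ?thesis by (rule that)
qed

end

section \<open>High frequencies\<close>

lemma pred_in_Icc [measurable (raw)]:
 fixes f g :: "'a \<Rightarrow> real"
 assumes [measurable]: "f \<in> borel_measurable M" "g \<in> borel_measurable M"
 shows "Measurable.pred M (\<lambda>x. g x \<in> {a..f x})"
 unfolding atLeastAtMost_iff by measurable

lemma integrable_Icc_bounded:
 fixes f :: "real \<Rightarrow> real"
 assumes [measurable]: "f \<in> borel_measurable borel" and b: "\<And>t. t \<in> {a..b} \<Longrightarrow> \<bar>f t\<bar> \<le> R"
 shows "integrable lborel (\<lambda>s. indicator {a..b} s * f s)"
proof (rule lint_bound)
 show "integrable lborel (\<lambda>s. indicator {a..b} s * R :: real)"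
  by (rule integrable_Icc_const)
 show "AE s in lborel. norm (indicator {a..b} s * f s) \<le> norm (indicator {a..b} s * R)"
  using b by (intro AE_I2) (force simp: indicator_def)
qed measurable

text \<open>With $l = 2\kappa + 1$ and $\alpha = \int_0^T a$, the supremum $m$ of $e^{-lt}\int_0^t y$ satisfies
 $m \le \alpha + m/2$.\<close>

lemma Gronwall_integrated:
 fixes y a :: "real \<Rightarrow> real"
 assumes T: "T \<ge> 0" and \<kappa>: "\<kappa> \<ge> 0"
  and [measurable]: "y \<in> borel_measurable borel" "a \<in> borel_measurable borel"
  and y0: "\<And>t. 0 \<le> y t" and a0: "\<And>t. 0 \<le> a t"
  and yR: "\<And>t. t \<in> {0..T} \<Longrightarrow> y t \<le> R"
  and le: "\<And>t. t \<in> {0..T} \<Longrightarrow> y t \<le> a t + \<kappa> * (LB s. indicator {0..t} s * y s)"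
 shows "(NN t. indicator {0..T} t * ennreal (y t)) \<le>
  ennreal (2 * exp ((2 * \<kappa> + 1) * T)) * (NN t. indicator {0..T} t * ennreal (a t))"
proof -
 define l where "l = 2 * \<kappa> + 1"
 have l: "l > 0" using \<kappa> by (simp add: l_def)
 define Z where "Z t = (LB s. indicator {0..t} s * y s)" for t
 have [measurable]: "Z \<in> borel_measurable borel" unfolding Z_def[abs_def] by measurable
 have yi: "integrable lborel (\<lambda>s. indicator {0..t} s * y s)" if "t \<le> T" for t
  by (rule integrable_Icc_bounded[where R=R]) (use y0 yR that in auto)
 have Z: "0 \<le> Z t" "Z t \<le> Z T" if "t \<le> T" for t
  unfolding Z_def
  by (rule integral_nonneg_AE, use y0 in simp) (rule integral_mono[OF yi[OF that] yi[OF order_refl]], use y0 that in \<open>auto simp: indicator_def\<close>)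
 have nn: "(NN t. indicator {0..T} t * ennreal (y t)) = ennreal (Z T)"
  unfolding Z_def using y0 by (subst nn_integral_eq_integral[symmetric, OF yi]) (auto intro!: nn_integral_cong simp: indicator_def)
 show ?thesis
 proof (cases "(NN t. indicator {0..T} t * ennreal (a t)) = \<infinity>")
  case True
  then show ?thesis by (simp add: ennreal_mult_eq_top_iff)
 next
  case False
  have eq: "indicator {0..T} t * ennreal (a t) = ennreal (norm (indicator {0..T} t * a t))" for t
   using a0[of t] by (auto simp: indicator_def)
  have ai: "integrable lborel (\<lambda>t. indicator {0..T} t * a t)"
   using False unfolding eq by (intro integrableI_bounded) (auto simp: top.not_eq_extremum)
  define \<alpha> where "\<alpha> = (LB t. indicator {0..T} t * a t)"
  have an: "norm (indicator {0..T} t * a t) = indicator {0..T} t * a t" for t using a0[of t] by simp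
  have \<alpha>: "(NN t. indicator {0..T} t * ennreal (a t)) = ennreal \<alpha>" "0 \<le> \<alpha>"
   unfolding \<alpha>_def eq an using a0 by (auto intro!: nn_integral_eq_integral[OF ai] integral_nonneg_AE)
  define m where "m = (SUP t\<in>{0..T}. exp (- l * t) * Z t)"
  have ub: "exp (- l * t) * Z t \<le> Z T" if "t \<in> {0..T}" for t
   using mult_mono[of "exp (- l * t)" 1 "Z t" "Z T"] Z[of t] Z[of T] l that by simp
  have m: "exp (- l * t) * Z t \<le> m" if "t \<in> {0..T}" for t
   unfolding m_def by (rule cSUP_upper[OF that bdd_aboveI2[where M="Z T"]]) (rule ub)
  have m0: "0 \<le> m" using order_trans[OF mult_nonneg_nonneg[OF exp_ge_zero Z(1)[OF T]] m[of 0]] T by auto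
  have Zm: "Z t \<le> exp (l * t) * m" if "t \<in> {0..T}" for t
   using mult_left_mono[OF m[OF that], of "exp (l * t)"] by (simp add: mult.assoc[symmetric] exp_add[symmetric])
  have "exp (- l * t) * Z t \<le> \<alpha> + m / 2" if t: "t \<in> {0..T}" for t
  proof -
   have bi: "has_bochner_integral lborel (\<lambda>s. exp (l * s) * indicator {0..t} s) (exp (l * t) / l - exp (l * 0) / l)"
    using l t by (intro has_bochner_integral_FTC_Icc_real) (auto intro!: derivative_eq_intros continuous_intros)
   have at: "integrable lborel (\<lambda>s. indicator {0..t} s * a s)"
    by (rule lint_bound[OF ai]) (use t in \<open>auto simp: indicator_def\<close>)
   have "Z t \<le> (LB s. indicator {0..t} s * a s + \<kappa> * m * (exp (l * s) * indicator {0..t} s))"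
    unfolding Z_def
   proof (rule integral_mono[OF yi])
    fix s
    have "y s \<le> a s + \<kappa> * m * exp (l * s)" if "s \<in> {0..t}"
     using le[of s] mult_left_mono[OF Zm[of s] \<kappa>] that t by (simp add: Z_def ac_simps)
    then show "indicator {0..t} s * y s \<le> indicator {0..t} s * a s + \<kappa> * m * (exp (l * s) * indicator {0..t} s)"
     by (auto simp: indicator_def)
   qed (use t at integrable.intros[OF bi] in auto)
   also have "\<dots> = (LB s. indicator {0..t} s * a s) + \<kappa> * m * (exp (l * t) / l - exp (l * 0) / l)"
    using at bi by (simp add: has_bochner_integral_iff)
   also have "\<dots> \<le> \<alpha> + \<kappa> * m * (exp (l * t) / l)"
    unfolding \<alpha>_def using a0 t \<kappa> m0 l
    by (intro add_mono integral_mono at ai mult_left_mono) (auto simp: indicator_def)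
   finally have "exp (- l * t) * Z t \<le> exp (- l * t) * (\<alpha> + \<kappa> * m * (exp (l * t) / l))" by (rule mult_left_mono) simp
   also have "\<dots> = exp (- l * t) * \<alpha> + \<kappa> / l * m * (exp (- l * t) * exp (l * t))" by (simp add: algebra_simps)
   also have "\<dots> = exp (- l * t) * \<alpha> + \<kappa> / l * m" by (simp add: exp_add[symmetric])
   also have "\<dots> \<le> 1 * \<alpha> + 1 / 2 * m"
   proof (intro add_mono mult_right_mono \<alpha>(2) m0)
    show "exp (- l * t) \<le> 1" using l t by simp
    show "\<kappa> / l \<le> 1 / 2" using \<kappa> l by (simp add: l_def divide_le_eq)
   qed
   finally show ?thesis by simp
  qed
  then have "m \<le> \<alpha> + m / 2" unfolding m_def[symmetric] by (subst m_def, intro cSUP_least) (use T in auto)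
  then have "m \<le> 2 * \<alpha>" by linarith
  then have m2: "exp (l * T) * m \<le> exp (l * T) * (2 * \<alpha>)" by (rule mult_left_mono) simp
  have "Z T \<le> exp (l * T) * (2 * \<alpha>)" by (rule order_trans[OF Zm m2]) (use T in simp)
  then show ?thesis
   unfolding nn \<alpha>(1) l_def using \<alpha>(2) by (simp add: ennreal_mult[symmetric] ennreal_leI ac_simps)
 qed
qed

text \<open>Jensen's inequality for the probability weight |g|, obtained from Cauchy-Schwarz by
  splitting |g| into two square roots.\<close>

lemma nn_integral_weighted_square:
 fixes g F :: "'a \<Rightarrow> complex"
 assumes g: "integrable M g" "(LINT x|M. norm (g x)) = 1" and [measurable]: "F \<in> borel_measurable M"
 shows "ennreal ((norm (LINT x|M. g x * F x))^2) \<le> (\<integral>\<^sup>+x. ennreal (norm (g x)) * ennreal ((norm (F x))^2) \<partial>M)"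
proof -
 note [measurable] = borel_measurable_integrable[OF g(1)]
 have "ennreal (norm (LINT x|M. g x * F x)) \<le> (\<integral>\<^sup>+x. ennreal (norm (g x * F x)) \<partial>M)"
  by (cases "integrable M (\<lambda>x. g x * F x)")
   (auto simp: not_integrable_integral_eq intro: integral_norm_bound_ennreal)
 also have "\<dots> = (\<integral>\<^sup>+x. ennreal (sqrt (norm (g x))) * ennreal (sqrt (norm (g x)) * norm (F x)) \<partial>M)"
  by (intro nn_integral_cong) (simp add: norm_mult ennreal_mult[symmetric] mult.assoc[symmetric])
 finally have "(ennreal (norm (LINT x|M. g x * F x)))^2 \<le>
  (\<integral>\<^sup>+x. ennreal (sqrt (norm (g x))) * ennreal (sqrt (norm (g x)) * norm (F x)) \<partial>M)\<^sup>2"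
  by (rule power_mono) auto
 also have "\<dots> \<le> (\<integral>\<^sup>+x. (ennreal (sqrt (norm (g x))))^2 \<partial>M) * (\<integral>\<^sup>+x. (ennreal (sqrt (norm (g x)) * norm (F x)))^2 \<partial>M)"
  by (rule Cauchy_Schwarz_nn_integral) measurable
 also have "(\<integral>\<^sup>+x. (ennreal (sqrt (norm (g x))))^2 \<partial>M) = (\<integral>\<^sup>+x. ennreal (norm (g x)) \<partial>M)"
  by (intro nn_integral_cong) (simp add: ennreal_power)
 also have "\<dots> = 1"
  using nn_integral_eq_integral[OF integrable_norm[OF g(1)]] g(2) by simp
 also have "(\<integral>\<^sup>+x. (ennreal (sqrt (norm (g x)) * norm (F x)))^2 \<partial>M) = (\<integral>\<^sup>+x. ennreal (norm (g x)) * ennreal ((norm (F x))^2) \<partial>M)"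
  by (intro nn_integral_cong) (simp add: ennreal_power power_mult_distrib ennreal_mult)
 finally show ?thesis by (simp add: ennreal_power)
qed

section \<open>Oscillatory time integrals of the transformed potential\<close>

context potential
begin

text \<open>At t = T this is a space-time Fourier transform of W, see \<open>Psi_fourier\<close>;
  the earlier times are needed for the Gronwall argument.\<close>

definition Psi :: "real \<Rightarrow> real \<Rightarrow> 'a \<Rightarrow> complex" where
 "Psi t \<tau> \<kappa> = (LB s. indicator {0..t} s * (cis (s * \<tau>) * What s \<kappa>))"

lemma Psi_measurable [measurable]:
 "(\<lambda>(t, \<tau>, \<kappa>). Psi t \<tau> \<kappa>) \<in> borel_measurable (borel \<Otimes>\<^sub>M borel \<Otimes>\<^sub>M borel)"
 unfolding Psi_def by measurable

lemma Psi_measurable_compose [measurable (raw)]: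
 assumes [measurable]: "t \<in> borel_measurable M" "\<tau> \<in> borel_measurable M" "\<kappa> \<in> measurable M borel"
 shows "(\<lambda>x. Psi (t x) (\<tau> x) (\<kappa> x)) \<in> borel_measurable M"
 using measurable_compose[of "\<lambda>x. (t x, \<tau> x, \<kappa> x)" M _ _ borel, OF _ Psi_measurable] by simp

text \<open>By Fubini the Born term with initial value g is a superposition over \<zeta> of time
  integrals oscillating at frequency |\<eta>|^2 - |\<zeta>|^2.\<close>

lemma time_integral_B:
 assumes g: "g \<in> L12"
 shows "(LB s. indicator {0..t} s * B s g \<eta>) =
  inverse (of_real (fourier_const DIM('a))) * (LB \<zeta>. g \<zeta> * Psi t ((norm \<eta>)^2 - (norm \<zeta>)^2) (\<eta> - \<zeta>))"
proof -
 let ?c = "inverse (complex_of_real (fourier_const DIM('a)))"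
 note [measurable] = L12D(3)[OF g]
 let ?f = "\<lambda>s \<zeta>. (kern s \<eta> \<zeta>) * (indicator {0..t} s * g \<zeta>)"
 have i: "integrable (lborel \<Otimes>\<^sub>M lborel) (\<lambda>(s, \<zeta>). ?f s \<zeta>)"
 proof (rule integrable_pair_mult_bounded)
  have "integrable lborel (\<lambda>s. complex_of_real (indicator {0..t} s))"
   by (intro integrable_of_real integrable_real_indicator) (auto simp: emeasure_lborel_Icc_eq)
  moreover have "(\<lambda>s. indicator {0..t} s :: complex) = (\<lambda>s. complex_of_real (indicator {0..t} s))"
   by (auto simp: indicator_def)
  ultimately show "integrable lborel (\<lambda>s. indicator {0..t} s :: complex)" by (simp only:)
  show "integrable lborel g" by (rule L12D[OF g])
  show "norm (kern s \<eta> \<zeta>) \<le> C * mass" for s \<zeta>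
   using What_bound by (simp add: norm_mult)
 qed measurable
 have "(LB s. indicator {0..t} s * B s g \<eta>) = (LB s. ?c * (LB \<zeta>. ?f s \<zeta>))"
  unfolding B_def
  by (intro lint_cong refl)
   (simp add: mult.assoc[symmetric] mult.commute[of "indicator {0..t} _"] indicator_def)
 also have "\<dots> = ?c * (LB s. LB \<zeta>. ?f s \<zeta>)" by simp
 also have "(LB s. LB \<zeta>. ?f s \<zeta>) = (LB \<zeta>. LB s. ?f s \<zeta>)"
  by (rule lborel_pair.Fubini_integral[OF i, symmetric])
 also have "\<dots> = (LB \<zeta>. g \<zeta> * Psi t ((norm \<eta>)^2 - (norm \<zeta>)^2) (\<eta> - \<zeta>))"
  unfolding Psi_def by (simp add: ac_simps flip: integral_mult_right_zero)
 finally show ?thesis .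
qed

text \<open>Up to the factor (2\<pi>)^{2n}, the squared norm over [0,T] and all frequencies of the
  Born term that a point mass at \<zeta> would produce; k stands for \<eta> - \<zeta>.\<close>

definition osc :: "'a \<Rightarrow> ennreal" where
 "osc \<zeta> = (NN t. indicator {0..T} t * (NN k. ennreal ((norm (Psi t ((norm (\<zeta> + k))^2 - (norm \<zeta>)^2) k))^2)))"

lemma osc_measurable [measurable]: "osc \<in> borel_measurable borel"
 unfolding osc_def by measurable

text \<open>Cauchy-Schwarz in time. The right-hand side is independent of t and \<tau> and serves as
  the majorant when \<tau> tends to infinity.\<close>

lemma Psi_bound: "ennreal ((norm (Psi t \<tau> \<kappa>))^2) \<le> ennreal T * (NN s. indicator {0..T} s * ennreal ((norm (What s \<kappa>))^2))"
proof -
 have "ennreal (norm (Psi t \<tau> \<kappa>)) \<le> (NN s. ennreal (norm (indicator {0..t} s * (cis (s * \<tau>) * What s \<kappa>))))"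
  unfolding Psi_def
  by (cases "integrable lborel (\<lambda>s. indicator {0..t} s * (cis (s * \<tau>) * What s \<kappa>))")
   (auto simp: not_integrable_integral_eq intro: integral_norm_bound_ennreal)
 also have "\<dots> \<le> (NN s. indicator {0..T} s * (indicator {0..T} s * ennreal (norm (What s \<kappa>))))"
 proof (intro nn_integral_mono)
  fix s
  show "ennreal (norm (indicator {0..t} s * (cis (s * \<tau>) * What s \<kappa>))) \<le> indicator {0..T} s * (indicator {0..T} s * ennreal (norm (What s \<kappa>)))"
   using What_outside[of s \<kappa>] by (cases "s \<in> {0<..<T}") (auto simp: indicator_def norm_mult)
 qed
 finally have "(ennreal (norm (Psi t \<tau> \<kappa>)))^2 \<le> (NN s. indicator {0..T} s * (indicator {0..T} s * ennreal (norm (What s \<kappa>))))^2"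
  by (rule power_mono) auto
 also have "\<dots> \<le> (NN s. (indicator {0..T} s)^2) * (NN s. (indicator {0..T} s * ennreal (norm (What s \<kappa>)))^2)"
  by (rule Cauchy_Schwarz_nn_integral) measurable
 also have "(NN s. (indicator {0..T} s)^2) = (NN s. indicator {0..T} s)"
  by (intro nn_integral_cong) (auto simp: indicator_def)
 also have "\<dots> = ennreal T" using T_pos by simp
 also have "(NN s. (indicator {0..T} s * ennreal (norm (What s \<kappa>)))^2) =
  (NN s. indicator {0..T} s * ennreal ((norm (What s \<kappa>))^2))"
  by (intro nn_integral_cong) (auto simp: indicator_def ennreal_power)
 finally show ?thesis by (simp add: ennreal_power)
qed

lemma Psi_Riemann_Lebesgue:
 assumes \<tau>: "filterlim (\<lambda>n. \<bar>\<tau> n\<bar>) at_top sequentially"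
 shows "(\<lambda>n. Psi t (\<tau> n) \<kappa>) \<longlonglongrightarrow> 0"
proof -
 let ?f = "\<lambda>s. indicator {0..t} s * What s \<kappa>"
 have i: "(\<lambda>s::real. indicator {0..t} s :: complex) \<in> L2"
  by (rule indicator_L2_space) (auto simp: emeasure_lborel_Icc_eq)
 have f: "?f \<in> L2"
 proof (rule L2_space_bound[OF i, where C="C * mass"])
  show "AE s in lborel. norm (?f s) \<le> C * mass * norm (indicator {0..t} s :: complex)"
   using What_bound by (intro AE_I2) (auto simp: indicator_def)
 qed measurable
 have "(\<lambda>n. LB s. cis (\<tau> n * s) * ?f s) \<longlonglongrightarrow> 0"
 proof (rule Riemann_Lebesgue_real[OF f _ _ \<tau>])
  show "?f s = 0" if "\<bar>t\<bar> < \<bar>s\<bar>" for s using that by (auto simp: indicator_def)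
 qed simp
 then show ?thesis unfolding Psi_def by (simp add: ac_simps)
qed

text \<open>Dominated convergence in (t, k): the phase |\<zeta> + k|^2 - |\<zeta>|^2 tends to
  infinity in modulus unless k is orthogonal to \<omega>, and the Riemann-Lebesgue lemma applies to
  each such k.\<close>

lemma osc_tendsto:
 assumes \<omega>: "norm \<omega> = 1" and \<zeta>: "\<And>n. norm (\<zeta> n - (a + real n *\<^sub>R \<omega>)) \<le> 1"
 shows "(\<lambda>n. osc (\<zeta> n)) \<longlonglongrightarrow> 0"
proof -
 let ?F = "\<lambda>n (t, k). indicator {0..T} t * ennreal ((norm (Psi t ((norm (\<zeta> n + k))^2 - (norm (\<zeta> n))^2) k))^2)"
 let ?q = "\<lambda>k. (NN s. indicator {0..T} s * ennreal ((norm (What s k))^2))"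
 let ?w = "\<lambda>(t, k). indicator {0..T} t * (ennreal T * ?q k)"
 have eq: "osc (\<zeta> n) = (\<integral>\<^sup>+z. ?F n z \<partial>(lborel \<Otimes>\<^sub>M lborel))" for n
 proof -
  have "osc (\<zeta> n) = (NN t. (NN k. ?F n (t, k)))"
   unfolding osc_def by (intro nn_integral_cong) (simp add: nn_integral_cmult)
  also have "\<dots> = (\<integral>\<^sup>+z. ?F n z \<partial>(lborel \<Otimes>\<^sub>M lborel))"
   by (rule lborel.nn_integral_fst) measurable
  finally show ?thesis .
 qed
 have "(\<lambda>n. \<integral>\<^sup>+z. ?F n z \<partial>(lborel \<Otimes>\<^sub>M lborel)) \<longlonglongrightarrow> (\<integral>\<^sup>+z. 0 \<partial>((lborel :: real measure) \<Otimes>\<^sub>M (lborel :: 'a measure)))"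
 proof (rule nn_integral_dominated_convergence[where w="?w"])
  show "AE z in lborel \<Otimes>\<^sub>M lborel. ?F n z \<le> ?w z" for n
   using Psi_bound by (intro AE_I2) (auto intro!: mult_left_mono)
  have "(\<integral>\<^sup>+z. ?w z \<partial>(lborel \<Otimes>\<^sub>M lborel)) = (NN t. (NN k. ?w (t, k)))"
   by (rule lborel.nn_integral_fst[symmetric]) measurable
  also have "\<dots> = (NN t. indicator {0..T} t * (ennreal T * (NN k. ?q k)))"
   by (intro nn_integral_cong) (simp add: nn_integral_cmult)
  also have "\<dots> = ennreal T * (ennreal T * (NN k. ?q k))"
   using T_pos by (simp add: nn_integral_multc)
  also have "(NN k. ?q k) = (NN s. (NN k. indicator {0..T} s * ennreal ((norm (What s k))^2)))"
   by (rule lborel_pair.Fubini'[of "\<lambda>s k. indicator {0..T} s * ennreal ((norm (What s k))^2)"]) measurable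
  also have "\<dots> = (NN s. indicator {0..T} s * ennreal ((N2 (What s))^2))"
   by (intro nn_integral_cong) (simp add: nn_integral_cmult nn_integral_L2_norm[OF What_L2(1)])
  also have "\<dots> \<le> (NN s. indicator {0..T} s * ennreal (Wnorm^2))"
   by (intro nn_integral_mono mult_left_mono ennreal_leI power_mono What_L2(2)) auto
  also have "\<dots> = ennreal T * ennreal (Wnorm^2)" using T_pos by (simp add: nn_integral_multc)
  finally have "(\<integral>\<^sup>+z. ?w z \<partial>(lborel \<Otimes>\<^sub>M lborel)) \<le> ennreal T * (ennreal T * (ennreal T * ennreal (Wnorm^2)))"
   by (simp add: mult_left_mono)
  also have "\<dots> < \<infinity>" by (simp add: ennreal_mult_less_top)
  finally show "(\<integral>\<^sup>+z. ?w z \<partial>(lborel \<Otimes>\<^sub>M lborel)) < \<infinity>" .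
  \<comment> \<open>The exceptional k form a hyperplane, which is a null set.\<close>
  have "\<omega> \<noteq> 0" using \<omega> by auto
  then have "negligible {k. \<omega> \<bullet> k = 0}" by (intro negligible_hyperplane disjI1)
  then have "{k. \<omega> \<bullet> k = 0} \<in> null_sets lborel"
   by (subst null_sets_completion_iff[symmetric]) (auto simp: negligible_iff_null_sets closed_hyperplane)
  then have "AE k in lborel. \<omega> \<bullet> k \<noteq> 0" by (rule AE_I'[where N="{k. \<omega> \<bullet> k = 0}"]) auto
  then have ae_y: "AE k in lborel. \<omega> \<bullet> snd (t::real, k) \<noteq> 0" for t by simp
  have ae: "AE z in (lborel :: real measure) \<Otimes>\<^sub>M lborel. \<omega> \<bullet> snd z \<noteq> 0"
  proof (rule lborel_pair.AE_pair_measure)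
   show "{z \<in> space ((lborel :: real measure) \<Otimes>\<^sub>M lborel). \<omega> \<bullet> snd z \<noteq> 0} \<in> sets (lborel \<Otimes>\<^sub>M lborel)"
    by measurable
  qed (intro AE_I2 ae_y)
  show "AE z in lborel \<Otimes>\<^sub>M lborel. (\<lambda>n. ?F n z) \<longlonglongrightarrow> 0"
   using ae
  proof eventually_elim
   case (elim z)
   obtain t k where z: "z = (t, k)" by (cases z)
   have k: "\<omega> \<bullet> k \<noteq> 0" using elim z by simp
   let ?\<tau> = "\<lambda>n. (norm (\<zeta> n + k))^2 - (norm (\<zeta> n))^2"
   have "filterlim (\<lambda>n. \<bar>?\<tau> n\<bar>) at_top sequentially"
   proof (rule filterlim_at_top_mono)
    \<comment> \<open>The phase equals 2 \<zeta> n \<bullet> k + |k|^2, and \<zeta> n differs from n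
      \<omega> by a vector of norm at most |a| + 1; hence it deviates from 2 n (\<omega> \<bullet>
      k) by at most \<open>?b\<close>.\<close>
    let ?b = "2 * (norm a + 1) * norm k + (norm k)^2"
    show "filterlim (\<lambda>n. 2 * \<bar>\<omega> \<bullet> k\<bar> * real n - ?b) at_top sequentially"
     using k by real_asymp
    show "\<forall>\<^sub>F n in sequentially. 2 * \<bar>\<omega> \<bullet> k\<bar> * real n - ?b \<le> \<bar>?\<tau> n\<bar>"
    proof (intro always_eventually allI)
     fix n
     have \<tau>: "?\<tau> n = 2 * (\<zeta> n \<bullet> k) + (norm k)^2"
      by (simp add: power2_norm_eq_inner inner_add_left inner_add_right inner_commute)
     have "\<zeta> n \<bullet> k = real n * (\<omega> \<bullet> k) + (a + (\<zeta> n - (a + real n *\<^sub>R \<omega>))) \<bullet> k"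
      by (simp add: inner_add_left inner_diff_left)
     moreover have "\<bar>(a + (\<zeta> n - (a + real n *\<^sub>R \<omega>))) \<bullet> k\<bar> \<le> (norm a + 1) * norm k"
     proof (rule order_trans[OF Cauchy_Schwarz_ineq2], rule mult_right_mono)
      show "norm (a + (\<zeta> n - (a + real n *\<^sub>R \<omega>))) \<le> norm a + 1"
       using norm_triangle_ineq[of a "\<zeta> n - (a + real n *\<^sub>R \<omega>)"] \<zeta>[of n] by linarith
     qed simp
     moreover have "\<bar>real n * (\<omega> \<bullet> k)\<bar> = \<bar>\<omega> \<bullet> k\<bar> * real n" by (simp add: abs_mult)
     moreover have "2 * \<bar>p\<bar> - (2 * b + s) \<le> \<bar>2 * x + s\<bar>"
      if "x = p + q" "\<bar>q\<bar> \<le> b" "0 \<le> s" for x p q b s :: real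
      using that by linarith
     ultimately have "2 * (\<bar>\<omega> \<bullet> k\<bar> * real n) - (2 * ((norm a + 1) * norm k) + (norm k)^2)
       \<le> \<bar>2 * (\<zeta> n \<bullet> k) + (norm k)^2\<bar>"
      using zero_le_power2[of "norm k"] by metis
     then show "2 * \<bar>\<omega> \<bullet> k\<bar> * real n - ?b \<le> \<bar>?\<tau> n\<bar>"
      unfolding \<tau> by (simp only: mult.assoc)
    qed
   qed
   then have "(\<lambda>n. Psi t (?\<tau> n) k) \<longlonglongrightarrow> 0" by (rule Psi_Riemann_Lebesgue)
   then have "(\<lambda>n. (norm (Psi t (?\<tau> n) k))^2) \<longlonglongrightarrow> 0" by (auto intro!: tendsto_eq_intros)
   then have "(\<lambda>n. ennreal ((norm (Psi t (?\<tau> n) k))^2)) \<longlonglongrightarrow> ennreal 0" by (rule tendsto_ennrealI)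
   then show ?case unfolding z by (cases "t \<in> {0..T}") auto
  qed
 qed measurable
 then show ?thesis by (simp add: eq)
qed

text \<open>Convergence along every sequence of points in the moving unit balls is uniform over the
  balls: a sequence is chosen that violates the bound at every n where some point does.\<close>

lemma osc_uniform:
 assumes \<omega>: "norm \<omega> = 1" and e: "e > (0::ennreal)"
 shows "\<forall>\<^sub>F n in sequentially. \<forall>\<zeta>. norm (\<zeta> - (a + real n *\<^sub>R \<omega>)) \<le> 1 \<longrightarrow> osc \<zeta> < e"
proof -
 define \<zeta> where "\<zeta> n = (if \<exists>\<zeta>. norm (\<zeta> - (a + real n *\<^sub>R \<omega>)) \<le> 1 \<and> \<not> osc \<zeta> < e
  then SOME \<zeta>. norm (\<zeta> - (a + real n *\<^sub>R \<omega>)) \<le> 1 \<and> \<not> osc \<zeta> < e else a + real n *\<^sub>R \<omega>)" for n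
 have \<zeta>: "norm (\<zeta> n - (a + real n *\<^sub>R \<omega>)) \<le> 1 \<and>
   ((\<exists>\<zeta>. norm (\<zeta> - (a + real n *\<^sub>R \<omega>)) \<le> 1 \<and> \<not> osc \<zeta> < e) \<longrightarrow> \<not> osc (\<zeta> n) < e)" for n
 proof (cases "\<exists>\<zeta>. norm (\<zeta> - (a + real n *\<^sub>R \<omega>)) \<le> 1 \<and> \<not> osc \<zeta> < e")
  case True
  from someI_ex[OF this] have "norm (\<zeta> n - (a + real n *\<^sub>R \<omega>)) \<le> 1 \<and> \<not> osc (\<zeta> n) < e"
   unfolding \<zeta>_def if_P[OF True] .
  then show ?thesis by (intro conjI impI) (elim conjE, assumption)+
 next
  case False
  then have "\<zeta> n = a + real n *\<^sub>R \<omega>" unfolding \<zeta>_def by (rule if_not_P)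
  then show ?thesis using False by simp
 qed
 have "(\<lambda>n. osc (\<zeta> n)) \<longlonglongrightarrow> 0" by (rule osc_tendsto[OF \<omega>, where a=a]) (use \<zeta> in auto)
 then have "\<forall>\<^sub>F n in sequentially. osc (\<zeta> n) < e" using e by (rule order_tendstoD)
 then show ?thesis by eventually_elim (use \<zeta> in auto)
qed

end

section \<open>The Born term and the remainder of the Born series\<close>

context potential
begin

lemma L2_norm_sq_measurable:
 assumes [measurable]: "(\<lambda>(t, \<eta>). f t \<eta>) \<in> borel_measurable (borel \<Otimes>\<^sub>M (borel :: 'a measure))"
 shows "(\<lambda>t. (N2 (f t))^2) \<in> borel_measurable (borel :: real measure)"
 unfolding L2_norm_sq by measurable

text \<open>Jensen's inequality in \<zeta> with weight |g|, then Tonelli: for fixed \<zeta> the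
  integral over \<eta> and t is \<open>osc \<zeta>\<close> after translating \<eta> by \<zeta>. Of g
  only its L^1 norm and its support enter, so the bound survives when g concentrates.\<close>

lemma Born_term_bound:
 assumes g: "g \<in> L12" "(LB \<zeta>. norm (g \<zeta>)) = 1"
  and e: "\<And>\<zeta>. g \<zeta> \<noteq> 0 \<Longrightarrow> osc \<zeta> \<le> e"
 shows "(NN t. indicator {0..T} t * (NN \<eta>. ennreal ((norm (LB s. indicator {0..t} s * B s g \<eta>))^2)))
  \<le> ennreal ((inverse (fourier_const DIM('a)))^2) * e"
proof -
 let ?c = "fourier_const DIM('a)"
 note [measurable] = L12D(3)[OF g(1)]
 define Q where "Q t \<zeta> \<eta> = ennreal ((norm (Psi t ((norm \<eta>)^2 - (norm \<zeta>)^2) (\<eta> - \<zeta>)))^2)" for t \<zeta> \<eta>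
 have Qm [measurable]: "(\<lambda>(t, \<zeta>, \<eta>). Q t \<zeta> \<eta>) \<in> borel_measurable (borel \<Otimes>\<^sub>M borel \<Otimes>\<^sub>M borel)"
  unfolding Q_def by measurable
 have Qm2 [measurable]: "joint (\<lambda>\<zeta> \<eta>. Q t \<zeta> \<eta>)" for t
  unfolding Q_def by measurable
 have Qm3 [measurable]: "joint (\<lambda>t \<zeta>. NN \<eta>. Q t \<zeta> \<eta>)"
  unfolding Q_def by measurable
 have nc: "norm (inverse (complex_of_real ?c)) = inverse ?c"
  by (simp only: norm_inverse norm_of_real abs_of_pos[OF fourier_const_pos])
 have osc_eq: "(NN t. indicator {0..T} t * (NN \<eta>. Q t \<zeta> \<eta>)) = osc \<zeta>" for \<zeta>
  unfolding osc_def
 proof (rule nn_integral_cong, rule arg_cong2[where f="(*)"], rule refl)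
  fix t
  have "(NN \<eta>. Q t \<zeta> \<eta>) = (\<integral>\<^sup>+\<eta>. Q t \<zeta> \<eta> \<partial>(distr lborel borel ((+) \<zeta>)))"
   by (simp only: lborel_distr_plus)
  also have "\<dots> = (NN k. Q t \<zeta> (\<zeta> + k))"
   by (rule nn_integral_distr) (auto simp: Q_def)
  finally show "(NN \<eta>. Q t \<zeta> \<eta>) = (NN k. ennreal ((norm (Psi t ((norm (\<zeta> + k))^2 - (norm \<zeta>)^2) k))^2))"
   by (simp add: Q_def)
 qed
 have "(NN t. indicator {0..T} t * (NN \<eta>. ennreal ((norm (LB s. indicator {0..t} s * B s g \<eta>))^2)))
  \<le> (NN t. indicator {0..T} t * (ennreal ((inverse ?c)^2) * (NN \<zeta>. ennreal (norm (g \<zeta>)) * (NN \<eta>. Q t \<zeta> \<eta>))))"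
 proof (intro nn_integral_mono mult_left_mono)
  fix t
  have "(NN \<eta>. ennreal ((norm (LB s. indicator {0..t} s * B s g \<eta>))^2)) \<le>
   (NN \<eta>. ennreal ((inverse ?c)^2) * (NN \<zeta>. ennreal (norm (g \<zeta>)) * Q t \<zeta> \<eta>))"
  proof (rule nn_integral_mono)
   fix \<eta>
   have "ennreal ((norm (LB s. indicator {0..t} s * B s g \<eta>))^2) =
    ennreal ((inverse ?c)^2) * ennreal ((norm (LB \<zeta>. g \<zeta> * Psi t ((norm \<eta>)^2 - (norm \<zeta>)^2) (\<eta> - \<zeta>)))^2)"
    unfolding time_integral_B[OF g(1)] norm_mult nc power_mult_distrib by (rule ennreal_mult) auto
   also have "\<dots> \<le> ennreal ((inverse ?c)^2) * (NN \<zeta>. ennreal (norm (g \<zeta>)) * Q t \<zeta> \<eta>)"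
    unfolding Q_def by (intro mult_left_mono nn_integral_weighted_square L12D[OF g(1)] g(2)) auto
   finally show "ennreal ((norm (LB s. indicator {0..t} s * B s g \<eta>))^2) \<le> \<dots>" .
  qed
  also have "\<dots> = ennreal ((inverse ?c)^2) * (NN \<eta>. (NN \<zeta>. ennreal (norm (g \<zeta>)) * Q t \<zeta> \<eta>))"
   by (rule nn_integral_cmult) measurable
  also have "(NN \<eta>. (NN \<zeta>. ennreal (norm (g \<zeta>)) * Q t \<zeta> \<eta>)) =
   (NN \<zeta>. (NN \<eta>. ennreal (norm (g \<zeta>)) * Q t \<zeta> \<eta>))"
   by (rule lborel_pair.Fubini'[of "\<lambda>\<zeta> \<eta>. ennreal (norm (g \<zeta>)) * Q t \<zeta> \<eta>"]) measurable
  also have "\<dots> = (NN \<zeta>. ennreal (norm (g \<zeta>)) * (NN \<eta>. Q t \<zeta> \<eta>))"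
   by (intro nn_integral_cong nn_integral_cmult) measurable
  finally show "(NN \<eta>. ennreal ((norm (LB s. indicator {0..t} s * B s g \<eta>))^2)) \<le>
   ennreal ((inverse ?c)^2) * (NN \<zeta>. ennreal (norm (g \<zeta>)) * (NN \<eta>. Q t \<zeta> \<eta>))" .
 qed simp
 also have "\<dots> = (NN t. (NN \<zeta>. ennreal ((inverse ?c)^2) * (ennreal (norm (g \<zeta>)) * (indicator {0..T} t * (NN \<eta>. Q t \<zeta> \<eta>)))))"
  by (intro nn_integral_cong) (simp add: nn_integral_cmult[symmetric] ac_simps)
 also have "\<dots> = (NN \<zeta>. (NN t. ennreal ((inverse ?c)^2) * (ennreal (norm (g \<zeta>)) * (indicator {0..T} t * (NN \<eta>. Q t \<zeta> \<eta>)))))"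
  by (rule lborel_pair.Fubini'[symmetric, of "\<lambda>t \<zeta>. ennreal ((inverse ?c)^2) * (ennreal (norm (g \<zeta>)) * (indicator {0..T} t * (NN \<eta>. Q t \<zeta> \<eta>)))"]) measurable
 also have "\<dots> = (NN \<zeta>. ennreal ((inverse ?c)^2) * (ennreal (norm (g \<zeta>)) * osc \<zeta>))"
 proof (intro nn_integral_cong)
  fix \<zeta>
  show "(NN t. ennreal ((inverse ?c)^2) * (ennreal (norm (g \<zeta>)) * (indicator {0..T} t * (NN \<eta>. Q t \<zeta> \<eta>)))) =
   ennreal ((inverse ?c)^2) * (ennreal (norm (g \<zeta>)) * osc \<zeta>)"
   unfolding osc_eq[symmetric] by (subst nn_integral_cmult, measurable, subst nn_integral_cmult, measurable)
 qed
 also have "\<dots> \<le> (NN \<zeta>. ennreal ((inverse ?c)^2) * (ennreal (norm (g \<zeta>)) * e))"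
 proof (rule nn_integral_mono, rule mult_left_mono)
  fix \<zeta> show "ennreal (norm (g \<zeta>)) * osc \<zeta> \<le> ennreal (norm (g \<zeta>)) * e"
   using e[of \<zeta>] by (cases "g \<zeta> = 0") (auto intro: mult_left_mono)
 qed simp
 also have "\<dots> = ennreal ((inverse ?c)^2) * ((NN \<zeta>. ennreal (norm (g \<zeta>))) * e)"
  by (simp add: nn_integral_cmult nn_integral_multc)
 also have "(NN \<zeta>. ennreal (norm (g \<zeta>))) = 1"
  using nn_integral_eq_integral[OF integrable_norm[OF L12D(2)[OF g(1)]]] g(2) by simp
 finally show ?thesis by simp
qed

text \<open>The square of the bound of \<open>B_pointwise\<close>, T from Cauchy-Schwarz in time,
  the Gronwall factor 2 exp((2\<kappa> + 1)T) with \<kappa> = 2TC^2, a further 2 from squaring a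
  sum, and the constant of \<open>Born_term_bound\<close>.\<close>

definition remainder_const :: real where
 "remainder_const = (Wnorm / fourier_const DIM('a))^2 * T *
  (4 * exp ((2 * (2 * T * C^2) + 1) * T) * (inverse (fourier_const DIM('a)))^2)"

lemma remainder_const_nonneg: "0 \<le> remainder_const"
 unfolding remainder_const_def using T_pos by simp

text \<open>With w = K - g, the Born term E and the remainder F, the equation reads w = -\<i> (E +
  F). Since F is an integral of B applied to w, Gronwall bounds the time integral of the squared
  norm of w by that of E, which is of order e; then \<open>B_pointwise\<close> bounds F at the
  single frequency \<eta>.\<close>

lemma volterra_remainder:
 assumes v: "volterra g K" and g: "g \<in> L12" "(LB \<zeta>. norm (g \<zeta>)) = 1"
  and e: "\<And>\<zeta>. g \<zeta> \<noteq> 0 \<Longrightarrow> osc \<zeta> \<le> e"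
 shows "ennreal ((norm ((LB s. indicator {0..T} s * B s (K s) \<eta>) -
   (LB s. indicator {0..T} s * B s g \<eta>)))^2) \<le> ennreal remainder_const * e"
proof -
 let ?c = "fourier_const DIM('a)"
 note gL = L12D(1)[OF g(1)]
 note [measurable] = L12D(3)[OF g(1)]
 have Km [measurable]: "joint K"
  and KL: "\<And>t. t \<in> {0..T} \<Longrightarrow> K t \<in> L2"
  and Keq: "\<And>t \<eta>. t \<in> {0..T} \<Longrightarrow> K t \<eta> = g \<eta> - \<i> * (LB s. indicator {0..t} s * B s (K s) \<eta>)"
  using v by (auto simp: volterra_def)
 obtain R where R_all: "\<forall>t\<in>{0..T}. N2 (K t) \<le> R"
  using v by (auto simp only: volterra_def)
 note R = R_all[rule_format]
 define w where "w t \<eta> = K t \<eta> - g \<eta>" for t \<eta>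
 have wm [measurable]: "joint w"
  unfolding w_def by measurable
 have wL: "w t \<in> L2" if "t \<in> {0..T}" for t
  unfolding w_def[abs_def] by (rule L2_space_diff[OF KL[OF that] gL])
 define R' where "R' = R + N2 g"
 have wR: "N2 (w t) \<le> R'" if t: "t \<in> {0..T}" for t
 proof -
  have "N2 (\<lambda>x. K t x + (-1) * g x) \<le> N2 (K t) + N2 (\<lambda>x. (-1) * g x)"
   by (rule L2_norm_triangle[OF KL[OF t] L2_space_cmult[OF gL]])
  moreover have "N2 (\<lambda>x. (-1) * g x) = N2 g"
   unfolding L2_norm_cmult by simp
  ultimately show ?thesis using R[OF t] by (simp add: R'_def w_def[abs_def])
 qed
 have gc: "(\<lambda>(t::real, \<eta>). g \<eta>) \<in> borel_measurable (borel \<Otimes>\<^sub>M borel)" by measurable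
 have iw: "integrable lborel (\<lambda>s. indicator {0..t} s * B s (w s) \<eta>)" if "t \<le> T" for t \<eta>
  by (rule integrable_B_time[OF wm wL wR that])
 have ig: "integrable lborel (\<lambda>s. indicator {0..t} s * B s g \<eta>)" if "t \<le> T" for t \<eta>
  by (rule integrable_B_time[OF gc gL order_refl that])
 have split: "(LB s. indicator {0..t} s * B s (K s) \<eta>) =
  (LB s. indicator {0..t} s * B s g \<eta>) + (LB s. indicator {0..t} s * B s (w s) \<eta>)" if t: "t \<in> {0..T}" for t \<eta>
 proof -
  have "(LB s. indicator {0..t} s * B s (K s) \<eta>) =
   (LB s. indicator {0..t} s * B s g \<eta> + indicator {0..t} s * B s (w s) \<eta>)"
  proof (intro lint_cong refl)
   fix s
   show "indicator {0..t} s * B s (K s) \<eta> = indicator {0..t} s * B s g \<eta> + indicator {0..t} s * B s (w s) \<eta>"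
   proof (cases "s \<in> {0..t}")
    case True
    then have s: "s \<in> {0..T}" using t by auto
    show ?thesis using B_add[OF gL wL[OF s], of s \<eta>] True by (simp add: w_def)
   qed simp
  qed
  also have "\<dots> = (LB s. indicator {0..t} s * B s g \<eta>) + (LB s. indicator {0..t} s * B s (w s) \<eta>)"
   by (rule lint_add) (use t in \<open>auto intro!: ig iw\<close>)
  finally show ?thesis .
 qed
 define E where "E t \<eta> = (LB s. indicator {0..t} s * B s g \<eta>)" for t \<eta>
 define F where "F t \<eta> = (LB s. indicator {0..t} s * B s (w s) \<eta>)" for t \<eta>
 have Em [measurable]: "joint E"
  unfolding E_def by measurable
 have EL: "E t \<in> L2" if t: "t \<in> {0..T}" for t
  unfolding E_def[abs_def]
 proof (rule time_integral_L2(1)[where \<beta>="\<lambda>s. (C * N2 g)^2"])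
  show "(N2 (B s g))^2 \<le> (C * N2 g)^2" for s
   by (intro power_mono B_L2(2) gL) simp
  show "integrable lborel (\<lambda>s. indicator {0..t} s * (C * N2 g)^2)"
   by (rule integrable_Icc_const)
 qed (use t B_L2(1)[OF gL] in auto)
 \<comment> \<open>Outside [0,T] nothing is known about \<open>w\<close>; the indicator sets the
   function to 0 there.\<close>
 let ?y = "\<lambda>t. indicator {0..T} t * (N2 (w t))^2"
 have ym: "?y \<in> borel_measurable borel" using L2_norm_sq_measurable[OF wm] by measurable
 have yi: "integrable lborel (\<lambda>s. indicator {0..t} s * ?y s)" if "t \<le> T" for t
 proof (rule lint_bound)
  show "integrable lborel (\<lambda>s. indicator {0..t} s * R'^2 :: real)"
   by (rule integrable_Icc_const)
  show "AE s in lborel. norm (indicator {0..t} s * ?y s) \<le> norm (indicator {0..t} s * R'^2)"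
  proof (rule AE_I2)
   fix s show "norm (indicator {0..t} s * ?y s) \<le> norm (indicator {0..t} s * R'^2)"
    using power_mono[OF wR[of s], of 2] by (auto simp: indicator_def)
  qed
  show "(\<lambda>s. indicator {0..t} s * ?y s) \<in> borel_measurable lborel" using ym by measurable
 qed
 have FL: "F t \<in> L2" "(N2 (F t))^2 \<le> T * C^2 * (LB s. indicator {0..t} s * ?y s)"
  if t: "t \<in> {0..T}" for t
 proof -
  have m: "joint (\<lambda>s \<eta>. B s (w s) \<eta>)" by measurable
  have s: "s \<in> {0..T}" if "s \<in> {0..t}" for s using that t by auto
  have b: "B s (w s) \<in> L2" "(N2 (B s (w s)))^2 \<le> C^2 * ?y s" if "s \<in> {0..t}" for s
  proof -
   show "B s (w s) \<in> L2" by (rule B_L2(1)[OF wL[OF s[OF that]]])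
   have "(N2 (B s (w s)))^2 \<le> (C * N2 (w s))^2"
    by (intro power_mono B_L2(2) wL s that) simp
   then show "(N2 (B s (w s)))^2 \<le> C^2 * ?y s" using s[OF that] by (simp add: power_mult_distrib)
  qed
  have eqf: "(\<lambda>s. indicator {0..t} s * (C^2 * ?y s)) = (\<lambda>s. C^2 * (indicator {0..t} s * ?y s))"
   by (rule ext) (rule mult.left_commute)
  have i: "integrable lborel (\<lambda>s. indicator {0..t} s * (C^2 * ?y s))"
   unfolding eqf by (rule integrable_mult_right) (rule yi, use t in simp)
  have t0: "0 \<le> t" using t by simp
  note TI = time_integral_L2[OF m t0 b i]
  show "F t \<in> L2" unfolding F_def[abs_def] by (rule TI(1))
  have I0: "0 \<le> (LB s. indicator {0..t} s * ?y s)" by (intro integral_nonneg_AE) auto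
  have "(N2 (F t))^2 \<le> (t - 0) * (LB s. indicator {0..t} s * (C^2 * ?y s))"
   unfolding F_def[abs_def] by (rule TI(2))
  also have "(LB s. indicator {0..t} s * (C^2 * ?y s)) = C^2 * (LB s. indicator {0..t} s * ?y s)"
   unfolding eqf by (rule integral_mult_right_zero)
  also have "(t - 0) * (C^2 * (LB s. indicator {0..t} s * ?y s)) \<le> T * (C^2 * (LB s. indicator {0..t} s * ?y s))"
   using t I0 by (intro mult_right_mono) auto
  finally show "(N2 (F t))^2 \<le> T * C^2 * (LB s. indicator {0..t} s * ?y s)"
   by (simp only: mult.assoc)
 qed
 \<comment> \<open>Here \<kappa> = 2TC^2: the factor 2 comes from squaring the sum E + F, the factor
   TC^2 from the bound of F.\<close>
 have gron: "(NN t. indicator {0..T} t * ennreal (?y t)) \<le>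
  ennreal (2 * exp ((2 * (2 * T * C^2) + 1) * T)) * (NN t. indicator {0..T} t * ennreal (2 * (N2 (E t))^2))"
 proof (rule Gronwall_integrated)
  show "(\<lambda>t. 2 * (N2 (E t))^2) \<in> borel_measurable borel"
   using L2_norm_sq_measurable[OF Em] by measurable
  show "?y t \<le> R'^2" if "t \<in> {0..T}" for t
   using power_mono[OF wR[OF that], of 2] that by simp
  show "?y t \<le> 2 * (N2 (E t))^2 + 2 * T * C^2 * (LB s. indicator {0..t} s * ?y s)" if t: "t \<in> {0..T}" for t
  proof -
   have weq: "w t = (\<lambda>\<eta>. - \<i> * (E t \<eta> + F t \<eta>))"
    unfolding w_def[abs_def] Keq[OF t] split[OF t] E_def F_def by (rule ext) simp
   have "N2 (w t) = N2 (\<lambda>\<eta>. E t \<eta> + F t \<eta>)"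
    unfolding weq by (simp only: L2_norm_cmult norm_minus_cancel norm_ii mult_1_left)
   also have "\<dots> \<le> N2 (E t) + N2 (F t)"
    by (rule L2_norm_triangle[OF EL[OF t] FL(1)[OF t]])
   finally have "(N2 (w t))^2 \<le> (N2 (E t) + N2 (F t))^2"
    by (rule power_mono) simp
   also have "\<dots> \<le> 2 * (N2 (E t))^2 + 2 * (N2 (F t))^2"
    using sum_squares_bound[of "N2 (E t)" "N2 (F t)"] by (simp add: power2_sum)
   also have "\<dots> \<le> 2 * (N2 (E t))^2 + 2 * (T * C^2 * (LB s. indicator {0..t} s * ?y s))"
    using FL(2)[OF t] by simp
   finally show ?thesis using t by (simp add: mult.assoc)
  qed
 qed (use T_pos ym in auto)
 have EE: "(NN t. indicator {0..T} t * ennreal (2 * (N2 (E t))^2)) \<le> 2 * (ennreal ((inverse ?c)^2) * e)"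
 proof -
  have "(NN t. indicator {0..T} t * ennreal (2 * (N2 (E t))^2)) =
   (NN t. 2 * (indicator {0..T} t * (NN \<eta>. ennreal ((norm (E t \<eta>))^2))))"
  proof (intro nn_integral_cong)
   fix t show "indicator {0..T} t * ennreal (2 * (N2 (E t))^2) = 2 * (indicator {0..T} t * (NN \<eta>. ennreal ((norm (E t \<eta>))^2)))"
    using nn_integral_L2_norm[OF EL[of t]] by (cases "t \<in> {0..T}") (auto simp: ennreal_mult)
  qed
  also have "\<dots> = 2 * (NN t. indicator {0..T} t * (NN \<eta>. ennreal ((norm (E t \<eta>))^2)))"
   by (rule nn_integral_cmult) measurable
  also have "\<dots> \<le> 2 * (ennreal ((inverse ?c)^2) * e)"
   unfolding E_def by (intro mult_left_mono Born_term_bound g e) auto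
  finally show ?thesis .
 qed
 \<comment> \<open>The passage from a norm over all frequencies to one frequency: B maps into
   bounded functions, and Cauchy-Schwarz in time costs a factor T.\<close>
 have "ennreal (norm (F T \<eta>)) \<le> (NN s. ennreal (norm (indicator {0..T} s * B s (w s) \<eta>)))"
  unfolding F_def by (rule integral_norm_bound_ennreal[OF iw]) simp
 also have "\<dots> \<le> (NN s. indicator {0..T} s * (indicator {0..T} s * ennreal (Wnorm / ?c * N2 (w s))))"
 proof (intro nn_integral_mono)
  fix s
  show "ennreal (norm (indicator {0..T} s * B s (w s) \<eta>)) \<le> indicator {0..T} s * (indicator {0..T} s * ennreal (Wnorm / ?c * N2 (w s)))"
   using B_pointwise[OF wL[of s], of s \<eta>] by (cases "s \<in> {0..T}") (auto intro: ennreal_leI)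
 qed
 finally have "(ennreal (norm (F T \<eta>)))^2 \<le> (NN s. indicator {0..T} s * (indicator {0..T} s * ennreal (Wnorm / ?c * N2 (w s))))^2"
  by (rule power_mono) auto
 also have "\<dots> \<le> (NN s. (indicator {0..T} s)^2) * (NN s. (indicator {0..T} s * ennreal (Wnorm / ?c * N2 (w s)))^2)"
 proof (rule Cauchy_Schwarz_nn_integral)
  have "(\<lambda>s. sqrt ((N2 (w s))^2)) \<in> borel_measurable borel"
   using L2_norm_sq_measurable[OF wm] by measurable
  then have [measurable]: "(\<lambda>s. N2 (w s)) \<in> borel_measurable borel" by simp
  show "(\<lambda>s. indicator {0..T} s * ennreal (Wnorm / ?c * N2 (w s))) \<in> borel_measurable lborel"
   by measurable
 qed measurable
 also have "(NN s. (indicator {0..T} s)^2) = (NN s. indicator {0..T} s)"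
  by (intro nn_integral_cong) (auto simp: indicator_def)
 also have "\<dots> = ennreal T" using T_pos by simp
 also have "(NN s. (indicator {0..T} s * ennreal (Wnorm / ?c * N2 (w s)))^2) =
   (NN s. ennreal ((Wnorm / ?c)^2) * (indicator {0..T} s * ennreal (?y s)))"
 proof (intro nn_integral_cong)
  fix s
  have w0: "0 \<le> Wnorm / ?c * N2 (w s)" using Wnorm_nonneg by (simp add: less_imp_le)
  have sq: "(ennreal (Wnorm / ?c * N2 (w s)))^2 = ennreal ((Wnorm / ?c)^2) * ennreal ((N2 (w s))^2)"
   by (simp only: ennreal_power[OF w0] power_mult_distrib ennreal_mult[OF zero_le_power2 zero_le_power2])
  show "(indicator {0..T} s * ennreal (Wnorm / ?c * N2 (w s)))^2 = ennreal ((Wnorm / ?c)^2) * (indicator {0..T} s * ennreal (?y s))"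
  proof (cases "s \<in> {0..T}")
   case True
   show ?thesis by (simp only: True indicator_simps mult_1_left sq)
  qed simp
 qed
 also have "\<dots> = ennreal ((Wnorm / ?c)^2) * (NN s. indicator {0..T} s * ennreal (?y s))"
  by (rule nn_integral_cmult) (use ym in measurable)
 also have "ennreal T * (ennreal ((Wnorm / ?c)^2) * (NN s. indicator {0..T} s * ennreal (?y s))) \<le>
  ennreal T * (ennreal ((Wnorm / ?c)^2) * (ennreal (2 * exp ((2 * (2 * T * C^2) + 1) * T)) * (2 * (ennreal ((inverse ?c)^2) * e))))"
  by (intro mult_left_mono order_trans[OF gron] EE) auto
 also have "\<dots> = ennreal remainder_const * e"
 proof -
  define x1 where "x1 = (Wnorm / ?c)^2"
  define x2 where "x2 = exp ((2 * (2 * T * C^2) + 1) * T)"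
  define x3 where "x3 = (inverse ?c)^2"
  have x: "0 \<le> x1" "0 \<le> x2" "0 \<le> x3" "0 \<le> T" unfolding x1_def x2_def x3_def using T_pos by auto
  have "ennreal (x1 * T * (4 * x2 * x3)) = ennreal T * (ennreal x1 * (ennreal (2 * x2) * (2 * ennreal x3)))"
   using x by (simp add: ennreal_mult[symmetric] ac_simps flip: ennreal_numeral)
  then show ?thesis
   unfolding remainder_const_def x1_def[symmetric] x2_def[symmetric] x3_def[symmetric] by (simp only: mult.assoc)
 qed
 finally have "(ennreal (norm (F T \<eta>)))^2 \<le> ennreal remainder_const * e" .
 moreover have "(LB s. indicator {0..T} s * B s (K s) \<eta>) - (LB s. indicator {0..T} s * B s g \<eta>) = F T \<eta>"
  using split[of T \<eta>] T_pos by (simp add: F_def)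
 ultimately show ?thesis by (simp add: ennreal_power)
qed

end

section \<open>Recovery of the potential\<close>

lemma fourier_tendsto:
 fixes f :: "'a::euclidean_space \<Rightarrow> complex"
 assumes f: "integrable lborel f" and x: "x \<longlonglongrightarrow> y"
 shows "(\<lambda>n. fourier s f (x n)) \<longlonglongrightarrow> fourier s f y"
 unfolding fourier_def
proof (rule integral_dominated_convergence[where w="\<lambda>z. norm (f z)"])
 note [measurable] = borel_measurable_integrable[OF f]
 show "(\<lambda>z. cis (s * (y \<bullet> z)) * f z) \<in> borel_measurable lborel" by measurable
 show "(\<lambda>z. cis (s * (x n \<bullet> z)) * f z) \<in> borel_measurable lborel" for n by measurable
 show "integrable lborel (\<lambda>z. norm (f z))" using f by simp
 show "AE z in lborel. (\<lambda>n. cis (s * (x n \<bullet> z)) * f z) \<longlonglongrightarrow> cis (s * (y \<bullet> z)) * f z"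
  unfolding cis_conv_exp by (intro AE_I2 tendsto_intros x)
 show "AE z in lborel. norm (cis (s * (x n \<bullet> z)) * f z) \<le> norm (f z)" for n
  by (simp add: norm_mult)
qed

lemma fourier_isCont: "integrable lborel f \<Longrightarrow> isCont (fourier s f) (y :: 'a::euclidean_space)"
 unfolding continuous_at_sequentially comp_def by (auto intro: fourier_tendsto)

context potential
begin

lemma W_joint: "(\<lambda>z. W (fst z) (snd z)) \<in> (L12 :: (real \<times> 'a \<Rightarrow> complex) set)"
proof -
 let ?b = "\<lambda>(t, x). complex_of_real (indicator {0..T} t) * complex_of_real (C * exp (- norm (x::'a)))"
 have i1: "integrable lborel (\<lambda>t. complex_of_real (indicator {0..T} t))"
  by (intro integrable_of_real integrable_real_indicator) (auto simp: emeasure_lborel_Icc_eq)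
 have i2: "integrable lborel (\<lambda>x::'a. complex_of_real (C * exp (- norm x)))"
  by (intro integrable_of_real integrable_mult_right integrable_exp_norm)
 have b: "integrable lborel ?b" using integrable_pair_mult[OF i1 i2] by (simp add: lborel_prod)
 have le: "norm (W (fst z) (snd z)) \<le> norm (?b z)" for z
  using W_bound[of "fst z" "snd z"] W_outside[of "fst z" "snd z"] C_nonneg
  by (cases "fst z \<in> {0<..<T}") (auto simp: split_def norm_mult abs_mult)
 have m: "(\<lambda>z. W (fst z) (snd z)) \<in> borel_measurable borel"
  using W_measurable by (simp add: split_def borel_prod)
 have i: "integrable lborel (\<lambda>z. W (fst z) (snd z))"
  by (rule lint_bound[OF b]) (use m le in auto)
 have sq: "integrable lborel (\<lambda>z. (norm (W (fst z) (snd z)))^2)"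
 proof (rule lint_bound)
  show "integrable lborel (\<lambda>z. C * norm (W (fst z) (snd z)))" using i by (intro integrable_mult_right integrable_norm)
  show "(\<lambda>z. (norm (W (fst z) (snd z)))^2) \<in> borel_measurable lborel" using m by measurable
  show "AE z in lborel. norm ((norm (W (fst z) (snd z)))^2) \<le> norm (C * norm (W (fst z) (snd z)))"
  proof (rule AE_I2)
   fix z show "norm ((norm (W (fst z) (snd z)))^2) \<le> norm (C * norm (W (fst z) (snd z)))"
    using mult_right_mono[OF W_le_C[of "fst z" "snd z"] norm_ge_zero[of "W (fst z) (snd z)"]] C_nonneg
    by (simp add: power2_eq_square abs_mult)
  qed
 qed
 show ?thesis unfolding L12_def using i sq m by (auto intro: L2_spaceI)
qed

text \<open>The time variable enters as -\<tau> because \<open>fourier (-1)\<close> carries a minus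
  sign in the exponent while \<open>Psi\<close> does not.\<close>

lemma Psi_fourier: "Psi T \<tau> \<kappa> = fourier (-1) (\<lambda>z. W (fst z) (snd z)) (- \<tau>, \<kappa>)"
proof -
 let ?f = "\<lambda>(s, x). cis (-1 * ((- \<tau>, \<kappa>) \<bullet> (s, x))) * W s x"
 have i: "integrable (lborel \<Otimes>\<^sub>M lborel) ?f"
  unfolding lborel_prod split_def prod.collapse
  by (rule integrable_cis_mult[OF L12D(2)[OF W_joint]]) measurable
 have "fourier (-1) (\<lambda>z. W (fst z) (snd z)) (- \<tau>, \<kappa>) = (LINT z|(lborel \<Otimes>\<^sub>M lborel). ?f z)"
  unfolding fourier_def lborel_prod split_def prod.collapse ..
 also have "\<dots> = (LB s. LB x. ?f (s, x))"
  by (rule lborel_pair.integral_fst'[OF i, symmetric])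
 also have "\<dots> = (LB s. indicator {0..T} s * (cis (s * \<tau>) * What s \<kappa>))"
 proof (intro lint_cong refl)
  fix s
  show "(LB x. ?f (s, x)) = indicator {0..T} s * (cis (s * \<tau>) * What s \<kappa>)"
  proof (cases "s \<in> {0..T}")
   case True
   have "(LB x. ?f (s, x)) = (LB x. cis (s * \<tau>) * (cis (-1 * (\<kappa> \<bullet> x)) * W s x))"
   proof (intro lint_cong refl)
    fix x
    have "cis (-1 * ((- \<tau>, \<kappa>) \<bullet> (s, x))) = cis (s * \<tau>) * cis (-1 * (\<kappa> \<bullet> x))"
     unfolding cis_mult by (rule arg_cong[where f=cis]) simp
    then show "(case (s, x) of (s, x) \<Rightarrow> cis (-1 * ((- \<tau>, \<kappa>) \<bullet> (s, x))) * W s x) =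
      cis (s * \<tau>) * (cis (-1 * (\<kappa> \<bullet> x)) * W s x)"
     by (simp only: prod.case mult.assoc)
   qed
   then show ?thesis using True by (simp add: What_def fourier_def)
  next
   case False
   have "W s x = 0" for x using False by (intro W_outside) auto
   then show ?thesis using False by simp
  qed
 qed
 finally show ?thesis by (simp add: Psi_def)
qed

end

text \<open>The difference \<Phi> of the two space-time transforms is continuous. Were it non-zero
  at some (\<tau>, \<kappa>) with \<kappa> \<noteq> 0, its averages near that point would have at
  least half that size; such an average is a difference of Born terms, which the remainder estimate
  makes smaller than that.\<close>

theorem volterra_determines_potential:
 fixes W1 W2 :: "real \<Rightarrow> 'a::euclidean_space \<Rightarrow> complex"
 assumes p1: "potential T C1 W1" and p2: "potential T C2 W2" and dim: "2 \<le> DIM('a)"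
  and eq: "\<And>k0. k0 \<in> L12 \<Longrightarrow> \<exists>K1 K2. potential.volterra T W1 k0 K1 \<and> potential.volterra T W2 k0 K2 \<and>
    (AE \<eta> in lborel. K1 T \<eta> = K2 T \<eta>)"
 shows "AE z in lborel. W1 (fst z) (snd z) = W2 (fst z) (snd z)"
proof -
 interpret A: potential T C1 W1 by (rule p1)
 interpret B: potential T C2 W2 by (rule p2)
 let ?c = "fourier_const DIM('a)"
 define G where "G z = W1 (fst z) (snd z) - W2 (fst z) (snd z)" for z
 have GL: "G \<in> L12"
  using L12_add[OF A.W_joint L12_cmult[OF B.W_joint, of "-1"]] by (simp add: G_def[abs_def])
 define \<Phi> where "\<Phi> \<tau> \<kappa> = A.Psi T \<tau> \<kappa> - B.Psi T \<tau> \<kappa>" for \<tau> \<kappa>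
 have \<Phi>_fourier: "\<Phi> \<tau> \<kappa> = fourier (-1) G (- \<tau>, \<kappa>)" for \<tau> \<kappa>
  unfolding \<Phi>_def A.Psi_fourier B.Psi_fourier G_def[abs_def]
  by (rule fourier_diff[symmetric]) (rule L12D(2)[OF A.W_joint] L12D(2)[OF B.W_joint])+
 have zero: "\<Phi> \<tau> \<kappa> = 0" if \<kappa>: "\<kappa> \<noteq> 0" for \<tau> \<kappa>
 proof (rule ccontr)
  assume nz: "\<Phi> \<tau> \<kappa> \<noteq> 0"
  define \<delta> where "\<delta> = norm (\<Phi> \<tau> \<kappa>)"
  have \<delta>: "\<delta> > 0" using nz by (simp add: \<delta>_def)
  obtain d where d: "d > 0" "\<And>z. dist z (- \<tau>, \<kappa>) < d \<Longrightarrow> dist (fourier (-1) G z) (fourier (-1) G (- \<tau>, \<kappa>)) < \<delta> / 2"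
   using fourier_isCont[OF L12D(2)[OF GL], where s="-1" and y="(- \<tau>, \<kappa>)"] \<delta>
   unfolding continuous_at_eps_delta by (metis half_gt_zero)
  have near: "norm (\<Phi> \<tau>' \<kappa>' - \<Phi> \<tau> \<kappa>) \<le> \<delta> / 2" if "\<bar>\<tau>' - \<tau>\<bar> + norm (\<kappa>' - \<kappa>) < d" for \<tau>' \<kappa>'
  proof -
   have "dist (- \<tau>', \<kappa>') (- \<tau>, \<kappa>) \<le> dist (- \<tau>') (- \<tau>) + dist \<kappa>' \<kappa>"
    unfolding dist_Pair_Pair by (rule sqrt_sum_squares_le_sum) auto
   also have "\<dots> < d" using that by (simp add: dist_norm abs_minus_commute)
   finally show ?thesis using d(2) unfolding \<Phi>_fourier dist_norm by (simp add: less_imp_le)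
  qed
  obtain y where y: "y \<noteq> 0" "orthogonal \<kappa> y" using orthogonal_to_vector_exists[OF dim] by blast
  define \<omega> where "\<omega> = y /\<^sub>R norm y"
  have \<omega>: "norm \<omega> = 1" "\<kappa> \<bullet> \<omega> = 0" using y by (auto simp: \<omega>_def orthogonal_def)
  \<comment> \<open>This multiple of \<kappa> solves 2 a \<bullet> \<kappa> + |\<kappa>|^2 = \<tau>,
    and adding multiples of \<omega>, orthogonal to \<kappa>, preserves the equation while the
    frequency goes to infinity.\<close>
  define a where "a = ((\<tau> - (norm \<kappa>)^2) / (2 * (norm \<kappa>)^2)) *\<^sub>R \<kappa>"
  define R where "R = 2 * (A.remainder_const + B.remainder_const) + 1"
  have R: "R > 0" using A.remainder_const_nonneg B.remainder_const_nonneg by (simp add: R_def)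
  \<comment> \<open>The squared difference of the Born terms will be less than R \<epsilon>, which
    is half the square of the lower bound \<delta> / (2 \<open>?c\<close>).\<close>
  define \<epsilon> where "\<epsilon> = (\<delta> / (2 * ?c))^2 / (2 * R)"
  have \<epsilon>: "\<epsilon> > 0" using \<delta> R by (simp add: \<epsilon>_def)
  have "\<forall>\<^sub>F n in sequentially. (\<forall>\<zeta>. norm (\<zeta> - (a + real n *\<^sub>R \<omega>)) \<le> 1 \<longrightarrow> A.osc \<zeta> < ennreal \<epsilon>) \<and>
    (\<forall>\<zeta>. norm (\<zeta> - (a + real n *\<^sub>R \<omega>)) \<le> 1 \<longrightarrow> B.osc \<zeta> < ennreal \<epsilon>)"
   by (intro eventually_conj A.osc_uniform B.osc_uniform \<omega>(1)) (use \<epsilon> in auto)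
  then obtain n where n: "\<And>\<zeta>. norm (\<zeta> - (a + real n *\<^sub>R \<omega>)) \<le> 1 \<Longrightarrow> A.osc \<zeta> < ennreal \<epsilon>"
   "\<And>\<zeta>. norm (\<zeta> - (a + real n *\<^sub>R \<omega>)) \<le> 1 \<Longrightarrow> B.osc \<zeta> < ennreal \<epsilon>"
   by (auto simp: eventually_sequentially)
  define \<xi> where "\<xi> = a + real n *\<^sub>R \<omega>"
  have \<xi>\<kappa>: "2 * (\<xi> \<bullet> \<kappa>) + (norm \<kappa>)^2 = \<tau>"
  proof -
   have "\<xi> \<bullet> \<kappa> = (\<tau> - (norm \<kappa>)^2) / (2 * (norm \<kappa>)^2) * (\<kappa> \<bullet> \<kappa>)"
    unfolding \<xi>_def a_def inner_add_left inner_scaleR_left inner_commute[of \<omega>] \<omega>(2) by simp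
   also have "\<kappa> \<bullet> \<kappa> = (norm \<kappa>)^2" by (rule power2_norm_eq_inner[symmetric])
   finally show ?thesis using \<kappa> by simp
  qed
  \<comment> \<open>The condition r \<le> 1 keeps the ball inside the region of
    \<open>osc_uniform\<close>. For \<zeta> within r of \<xi> and \<eta> within r of \<xi> +
    \<kappa>, the arguments of \<Phi> stay within r (4|\<xi>| + 2|\<kappa>| + 4) of (\<tau>,
    \<kappa>); the 5 in place of 4 makes this strictly less than d.\<close>
  define r where "r = min 1 (d / (4 * norm \<xi> + 2 * norm \<kappa> + 5))"
  have L: "0 < 4 * norm \<xi> + 2 * norm \<kappa> + 5" by (simp add: add_nonneg_pos)
  have r: "0 < r" "r \<le> 1" using d(1) L by (auto simp: r_def)
  have rd: "r * (4 * norm \<xi> + 2 * norm \<kappa> + 4) < d"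
  proof -
   have "r * (4 * norm \<xi> + 2 * norm \<kappa> + 4) < r * (4 * norm \<xi> + 2 * norm \<kappa> + 5)"
    using r(1) by (intro mult_strict_left_mono) auto
   also have "\<dots> \<le> d / (4 * norm \<xi> + 2 * norm \<kappa> + 5) * (4 * norm \<xi> + 2 * norm \<kappa> + 5)"
    using L by (intro mult_right_mono) (auto simp: r_def)
   also have "\<dots> = d" using L by simp
   finally show ?thesis .
  qed
  define m where "m = measure lborel (ball \<xi> r)"
  have m: "m > 0" unfolding m_def using content_ball_pos[OF r(1)] by simp
  define g where "g \<zeta> = complex_of_real (inverse m) * indicator (ball \<xi> r) \<zeta>" for \<zeta>
  have fin: "emeasure lborel (ball \<xi> r) < \<infinity>" using emeasure_bounded_finite[of "ball \<xi> r"] by simp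
  have gi: "integrable lborel (\<lambda>\<zeta>. inverse m * indicator (ball \<xi> r) \<zeta>)"
   by (intro integrable_mult_right integrable_real_indicator) (use fin in auto)
  have ng: "norm (g \<zeta>) = inverse m * indicator (ball \<xi> r) \<zeta>" for \<zeta>
   using m by (auto simp: g_def norm_mult norm_inverse indicator_def)
  have gr: "g = (\<lambda>\<zeta>. complex_of_real (inverse m * indicator (ball \<xi> r) \<zeta>))"
   by (rule ext) (simp add: g_def indicator_def)
  have gL1: "integrable lborel g" unfolding gr by (rule integrable_of_real[OF gi])
  have g: "g \<in> L12"
   unfolding L12_def using gL1 L2_space_cmult[OF indicator_L2_space, of "ball \<xi> r" lborel "of_real (inverse m)"] fin
   by (simp add: g_def[abs_def])
  have int1: "(LB \<zeta>. inverse m * indicator (ball \<xi> r) \<zeta>) = 1"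
   using m by (simp add: m_def)
  have g1: "(LB \<zeta>. norm (g \<zeta>)) = 1" unfolding ng by (rule int1)
  have gsum: "(LB \<zeta>. g \<zeta>) = 1" unfolding gr integral_complex_of_real int1 by simp
  have gsupp: "norm (\<zeta> - \<xi>) < r" if "g \<zeta> \<noteq> 0" for \<zeta>
   using that by (auto simp: g_def indicator_def dist_norm norm_minus_commute split: if_splits)
  have oscA: "A.osc \<zeta> \<le> ennreal \<epsilon>" and oscB: "B.osc \<zeta> \<le> ennreal \<epsilon>" if "g \<zeta> \<noteq> 0" for \<zeta>
   using n[of \<zeta>] gsupp[OF that] r(2) by (auto simp: \<xi>_def intro: less_imp_le)
  obtain K1 K2 where K: "A.volterra g K1" "B.volterra g K2" "AE \<eta> in lborel. K1 T \<eta> = K2 T \<eta>"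
   using eq[OF g] by blast
  \<comment> \<open>A ball has positive measure, so equality almost everywhere of the final states
    holds at some frequency in it.\<close>
  have "\<not> (AE \<eta> in lborel. \<eta> \<notin> ball (\<xi> + \<kappa>) r)"
  proof
   assume "AE \<eta> in lborel. \<eta> \<notin> ball (\<xi> + \<kappa>) r"
   then have "emeasure lborel (ball (\<xi> + \<kappa>) r) = 0"
    by (subst (asm) AE_iff_measurable[of "ball (\<xi> + \<kappa>) r"]) auto
   then show False using content_ball_pos[OF r(1), of "\<xi> + \<kappa>"] by (simp add: measure_def)
  qed
  have "\<exists>\<eta>. \<eta> \<in> ball (\<xi> + \<kappa>) r \<and> K1 T \<eta> = K2 T \<eta>"
  proof (rule ccontr)
   assume "\<not> ?thesis"
   then have "\<eta> \<notin> ball (\<xi> + \<kappa>) r" if "K1 T \<eta> = K2 T \<eta>" for \<eta> using that by blast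
   with K(3) have "AE \<eta> in lborel. \<eta> \<notin> ball (\<xi> + \<kappa>) r" by (rule eventually_mono)
   then show False using \<open>\<not> (AE \<eta> in lborel. \<eta> \<notin> ball (\<xi> + \<kappa>) r)\<close> by contradiction
  qed
  then obtain \<eta> where \<eta>: "\<eta> \<in> ball (\<xi> + \<kappa>) r" "K1 T \<eta> = K2 T \<eta>" by blast
  let ?I1 = "LB s. indicator {0..T} s * A.B s (K1 s) \<eta>"
  let ?J1 = "LB s. indicator {0..T} s * A.B s g \<eta>"
  let ?I2 = "LB s. indicator {0..T} s * B.B s (K2 s) \<eta>"
  let ?J2 = "LB s. indicator {0..T} s * B.B s g \<eta>"
  have TT: "T \<in> {0..T}" using A.T_pos by simp
  have "K1 T \<eta> = g \<eta> - \<i> * ?I1" "K2 T \<eta> = g \<eta> - \<i> * ?I2"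
   using K(1,2) TT unfolding A.volterra_def B.volterra_def by blast+
  then have I: "?I1 = ?I2" using \<eta>(2) by simp
  have bound: "x^2 \<le> y * \<epsilon>" if "ennreal (x^2) \<le> ennreal y * ennreal \<epsilon>" "0 \<le> y" for x y :: real
   using that \<epsilon> by (simp add: ennreal_mult[symmetric] ennreal_le_iff)
  have b1: "(norm (?I1 - ?J1))^2 \<le> A.remainder_const * \<epsilon>"
   by (rule bound[OF A.volterra_remainder[OF K(1) g g1 oscA] A.remainder_const_nonneg])
  have b2: "(norm (?I2 - ?J2))^2 \<le> B.remainder_const * \<epsilon>"
   by (rule bound[OF B.volterra_remainder[OF K(2) g g1 oscB] B.remainder_const_nonneg])
  have "norm (?J1 - ?J2) \<le> norm (?I1 - ?J1) + norm (?I2 - ?J2)"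
   using norm_triangle_ineq4[of "?I2 - ?J2" "?I1 - ?J1"] unfolding I by (simp add: add.commute)
  then have "(norm (?J1 - ?J2))^2 \<le> (norm (?I1 - ?J1) + norm (?I2 - ?J2))^2"
   by (rule power_mono) simp
  also have "\<dots> \<le> 2 * (norm (?I1 - ?J1))^2 + 2 * (norm (?I2 - ?J2))^2"
   using sum_squares_bound[of "norm (?I1 - ?J1)" "norm (?I2 - ?J2)"] by (simp add: power2_sum)
  also have "\<dots> \<le> 2 * (A.remainder_const * \<epsilon>) + 2 * (B.remainder_const * \<epsilon>)"
   using b1 b2 by simp
  also have "\<dots> < R * \<epsilon>" using \<epsilon> by (simp add: R_def distrib_right)
  also have "\<dots> < (\<delta> / (2 * ?c))\<^sup>2"
   using R \<delta> by (simp add: \<epsilon>_def)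
  finally have "norm (?J1 - ?J2) < \<delta> / (2 * ?c)"
   by (rule power_less_imp_less_base) (use \<delta> in \<open>simp add: less_imp_le\<close>)
  \<comment> \<open>The difference of the Born terms is the average of \<Phi>, with weight g of mass
    1, over points where \<Phi> is within \<delta>/2 of its value at (\<tau>, \<kappa>).\<close>
  moreover have "\<delta> / (2 * ?c) \<le> norm (?J1 - ?J2)"
  proof -
   let ?h = "\<lambda>\<zeta>. \<Phi> ((norm \<eta>)^2 - (norm \<zeta>)^2) (\<eta> - \<zeta>)"
   have PA: "norm (A.Psi T \<tau> \<kappa>) \<le> (LB z. norm (W1 (fst z) (snd z)))" for \<tau> \<kappa>
    unfolding A.Psi_fourier by (rule norm_fourier_le)
   have PB: "norm (B.Psi T \<tau> \<kappa>) \<le> (LB z. norm (W2 (fst z) (snd z)))" for \<tau> \<kappa>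
    unfolding B.Psi_fourier by (rule norm_fourier_le)
   note [measurable] = L12D(3)[OF g]
   have iA: "integrable lborel (\<lambda>\<zeta>. g \<zeta> * A.Psi T ((norm \<eta>)^2 - (norm \<zeta>)^2) (\<eta> - \<zeta>))"
   proof (rule lint_bound)
    show "integrable lborel (\<lambda>\<zeta>. g \<zeta> * of_real (LB z. norm (W1 (fst z) (snd z))))" using gL1 by simp
    show "AE \<zeta> in lborel. norm (g \<zeta> * A.Psi T ((norm \<eta>)^2 - (norm \<zeta>)^2) (\<eta> - \<zeta>)) \<le> norm (g \<zeta> * of_real (LB z. norm (W1 (fst z) (snd z))))"
     unfolding norm_mult by (intro AE_I2 mult_left_mono order_trans[OF PA]) auto
   qed measurable
   have iB: "integrable lborel (\<lambda>\<zeta>. g \<zeta> * B.Psi T ((norm \<eta>)^2 - (norm \<zeta>)^2) (\<eta> - \<zeta>))"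
   proof (rule lint_bound)
    show "integrable lborel (\<lambda>\<zeta>. g \<zeta> * of_real (LB z. norm (W2 (fst z) (snd z))))" using gL1 by simp
    show "AE \<zeta> in lborel. norm (g \<zeta> * B.Psi T ((norm \<eta>)^2 - (norm \<zeta>)^2) (\<eta> - \<zeta>)) \<le> norm (g \<zeta> * of_real (LB z. norm (W2 (fst z) (snd z))))"
     unfolding norm_mult by (intro AE_I2 mult_left_mono order_trans[OF PB]) auto
   qed measurable
   have ih: "integrable lborel (\<lambda>\<zeta>. g \<zeta> * ?h \<zeta>)"
    unfolding \<Phi>_def right_diff_distrib by (intro lint_integrable_diff iA iB)
   have J: "?J1 - ?J2 = inverse (of_real ?c) * (LB \<zeta>. g \<zeta> * ?h \<zeta>)"
    unfolding A.time_integral_B[OF g] B.time_integral_B[OF g] \<Phi>_def right_diff_distrib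
    by (subst lint_diff[OF iA iB]) (rule right_diff_distrib[symmetric])
   have ig: "integrable lborel (\<lambda>\<zeta>. g \<zeta> * \<Phi> \<tau> \<kappa>)" using gL1 by simp
   have "norm ((LB \<zeta>. g \<zeta> * ?h \<zeta>) - \<Phi> \<tau> \<kappa>) = norm (LB \<zeta>. g \<zeta> * ?h \<zeta> - g \<zeta> * \<Phi> \<tau> \<kappa>)"
    using gsum by (simp add: lint_diff[OF ih ig])
   also have "\<dots> \<le> (LB \<zeta>. norm (g \<zeta>) * (\<delta> / 2))"
   proof (rule order_trans[OF integral_norm_bound], rule integral_mono)
    show "integrable lborel (\<lambda>\<zeta>. norm (g \<zeta> * ?h \<zeta> - g \<zeta> * \<Phi> \<tau> \<kappa>))"
     by (intro integrable_norm lint_integrable_diff ih ig)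
    show "integrable lborel (\<lambda>\<zeta>. norm (g \<zeta>) * (\<delta> / 2))" using gL1 by simp
    fix \<zeta>
    show "norm (g \<zeta> * ?h \<zeta> - g \<zeta> * \<Phi> \<tau> \<kappa>) \<le> norm (g \<zeta>) * (\<delta> / 2)"
    proof (cases "g \<zeta> = 0")
     case False
     define p where "p = \<eta> - (\<xi> + \<kappa>)"
     define q where "q = \<zeta> - \<xi>"
     have p: "norm p \<le> r" using \<eta>(1) by (simp add: p_def dist_norm norm_minus_commute)
     have q: "norm q \<le> r" using gsupp[OF False] by (simp add: q_def)
     have \<eta>\<zeta>: "\<eta> = \<xi> + \<kappa> + p" "\<zeta> = \<xi> + q" by (simp_all add: p_def q_def)
     have sq: "(norm u)^2 \<le> r" if "norm u \<le> r" for u :: 'a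
      using mult_mono[OF that order_trans[OF that r(2)]] by (simp add: power2_eq_square r(1) less_imp_le)
     have ip: "\<bar>u \<bullet> v\<bar> \<le> norm u * r" if "norm v \<le> r" for u v :: 'a
      by (rule order_trans[OF Cauchy_Schwarz_ineq2]) (intro mult_left_mono that norm_ge_zero)
     \<comment> \<open>Expansion around \<xi> + \<kappa> and \<xi>: the main part is \<tau> by the
       choice of \<xi>, the rest is linear in p and q, or quadratic and then at most r because r
       \<le> 1.\<close>
     have "(norm \<eta>)^2 - (norm \<zeta>)^2 = 2 * (\<xi> \<bullet> \<kappa>) + (norm \<kappa>)^2 + (2 * ((\<xi> + \<kappa>) \<bullet> p) + (norm p)^2 - 2 * (\<xi> \<bullet> q) - (norm q)^2)"
      unfolding \<eta>\<zeta> by (simp add: power2_norm_eq_inner inner_add_left inner_add_right inner_commute)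
     then have "\<bar>(norm \<eta>)\<^sup>2 - (norm \<zeta>)^2 - \<tau>\<bar> \<le> 2 * (norm (\<xi> + \<kappa>) * r) + r + 2 * (norm \<xi> * r) + r"
      unfolding \<xi>\<kappa> using ip[OF p, of "\<xi> + \<kappa>"] ip[OF q, of \<xi>] sq[OF p] sq[OF q]
       zero_le_power2[of "norm p"] zero_le_power2[of "norm q"] by linarith
     also have "2 * (norm (\<xi> + \<kappa>) * r) \<le> 2 * ((norm \<xi> + norm \<kappa>) * r)"
      using r(1) by (intro mult_left_mono mult_right_mono norm_triangle_ineq) auto
     finally have t1: "\<bar>(norm \<eta>)\<^sup>2 - (norm \<zeta>)^2 - \<tau>\<bar> \<le> r * (4 * norm \<xi> + 2 * norm \<kappa> + 2)"
      by (simp add: algebra_simps)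
     have "norm (\<eta> - \<zeta> - \<kappa>) \<le> norm p + norm q"
      unfolding \<eta>\<zeta> using norm_triangle_ineq4[of p q] by simp
     then have "\<bar>(norm \<eta>)\<^sup>2 - (norm \<zeta>)^2 - \<tau>\<bar> + norm (\<eta> - \<zeta> - \<kappa>) \<le> r * (4 * norm \<xi> + 2 * norm \<kappa> + 4)"
      using t1 p q by (simp add: algebra_simps)
     then have "norm (?h \<zeta> - \<Phi> \<tau> \<kappa>) \<le> \<delta> / 2" using rd by (intro near) linarith
     then show ?thesis
      unfolding right_diff_distrib[symmetric] norm_mult by (rule mult_left_mono) simp
    qed simp
   qed
   also have "\<dots> = \<delta> / 2" using g1 by simp
   finally have n1: "norm ((LB \<zeta>. g \<zeta> * ?h \<zeta>) - \<Phi> \<tau> \<kappa>) \<le> \<delta> / 2" .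
   have "\<delta> \<le> norm (LB \<zeta>. g \<zeta> * ?h \<zeta>) + norm ((LB \<zeta>. g \<zeta> * ?h \<zeta>) - \<Phi> \<tau> \<kappa>)"
    unfolding \<delta>_def using norm_triangle_ineq4[of "LB \<zeta>. g \<zeta> * ?h \<zeta>" "(LB \<zeta>. g \<zeta> * ?h \<zeta>) - \<Phi> \<tau> \<kappa>"] by simp
   with n1 have "\<delta> / 2 \<le> norm (LB \<zeta>. g \<zeta> * ?h \<zeta>)" by simp
   then have "inverse ?c * (\<delta> / 2) \<le> inverse ?c * norm (LB \<zeta>. g \<zeta> * ?h \<zeta>)"
    by (intro mult_left_mono) (simp_all add: less_imp_le)
   moreover have nc: "norm (inverse (complex_of_real ?c)) = inverse ?c"
    by (simp only: norm_inverse norm_of_real abs_of_pos[OF fourier_const_pos])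
   moreover have "\<delta> / (2 * ?c) = inverse ?c * (\<delta> / 2)" by (simp add: field_simps)
   ultimately show ?thesis unfolding J norm_mult by (simp only:)
  qed
  ultimately show False by simp
 qed
 \<comment> \<open>The value \<kappa> = 0, for which no choice of \<xi> could prescribe \<tau>, is a
   null set in each fibre.\<close>
 have "AE \<kappa> in lborel. (\<kappa>::'a) \<noteq> 0" by (rule AE_lborel_singleton)
 then have ae\<kappa>: "AE \<kappa> in lborel. fourier (-1) G (\<tau>, \<kappa>) = 0" for \<tau>
  by eventually_elim (use zero[of _ "- \<tau>"] in \<open>simp add: \<Phi>_fourier\<close>)
 have "AE z in lborel \<Otimes>\<^sub>M lborel. fourier (-1) G z = 0"
 proof (rule lborel_pair.AE_pair_measure)
  have [measurable]: "fourier (-1) G \<in> borel_measurable (borel \<Otimes>\<^sub>M borel)"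
   using fourier_measurable[OF L12D(3)[OF GL]] by (simp add: borel_prod)
  show "{z \<in> space ((lborel :: real measure) \<Otimes>\<^sub>M (lborel :: 'a measure)). fourier (-1) G z = 0} \<in> sets (lborel \<Otimes>\<^sub>M lborel)"
   by measurable
  show "AE \<tau> in lborel. AE \<kappa> in lborel. fourier (-1) G (\<tau>, \<kappa>) = 0"
   by (intro AE_I2 ae\<kappa>)
 qed
 then have "AE z in lborel. fourier (-1) G z = 0" by (simp only: lborel_prod)
 then have "AE z in lborel. G z = 0" by (intro fourier_injective[OF GL, of "-1"]) auto
 then show ?thesis by eventually_elim (simp add: G_def)
qed

section \<open>Cut-off plane waves\<close>

text \<open>The building block of smooth cut-offs: all its derivatives have the same form.\<close>

definition flat :: "real poly \<Rightarrow> real \<Rightarrow> real" where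
 "flat P y = (if y > 0 then poly P (inverse y) * exp (- inverse y) else 0)"

text \<open>The derivative of P(1/y) e^{-1/y} is y^{-2} (P - P')(1/y) e^{-1/y}; the factor
  \<open>[:0, 0, 1:]\<close> is the square of the variable 1/y.\<close>

definition flat_deriv :: "real poly \<Rightarrow> real poly" where
 "flat_deriv P = [:0, 0, 1:] * (P - pderiv P)"

lemma poly_mult_exp_tendsto_0: "((\<lambda>x. poly Q x * exp (- x)) \<longlongrightarrow> 0) (at_top :: real filter)"
proof -
 have "((\<lambda>x. \<Sum>i\<le>degree Q. coeff Q i * (x ^ i / exp x)) \<longlongrightarrow> (\<Sum>i\<le>degree Q. coeff Q i * 0)) (at_top :: real filter)"
  by (intro tendsto_sum tendsto_mult tendsto_const tendsto_power_div_exp_0)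
 moreover have "(\<Sum>i\<le>degree Q. coeff Q i * (x ^ i / exp x)) = poly Q x * exp (- x)" for x
  by (simp add: poly_altdef sum_distrib_right exp_minus divide_inverse mult.assoc)
 ultimately show ?thesis by simp
qed

text \<open>The critical point is y = 0. The difference quotient vanishes on the left, and on the
  right it is a polynomial in 1/h times e^{-1/h}, which tends to 0.\<close>

lemma flat_has_derivative: "(flat P has_real_derivative flat (flat_deriv P) y) (at y)"
proof (cases "y = 0")
 case False
 show ?thesis
 proof (cases "y > 0")
  case True
  have "((\<lambda>y. poly P (inverse y) * exp (- inverse y)) has_real_derivative flat (flat_deriv P) y) (at y)"
   using True
   by (auto intro!: derivative_eq_intros DERIV_chain2[OF poly_DERIV] simp: flat_def flat_deriv_def power2_eq_square algebra_simps)
  then show ?thesis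
  proof (rule DERIV_cong_ev[OF refl _ refl, THEN iffD2, rotated])
   have "\<forall>\<^sub>F x in nhds y. x > 0" using eventually_nhds_in_open[of "{0::real<..}" y] True by simp
   then show "\<forall>\<^sub>F x in nhds y. flat P x = poly P (inverse x) * exp (- inverse x)"
    by eventually_elim (simp add: flat_def)
  qed
 next
  case neg: False
  with False have y: "y < 0" by simp
  have "((\<lambda>y. 0) has_real_derivative flat (flat_deriv P) y) (at y)"
   using y by (simp add: flat_def)
  then show ?thesis
  proof (rule DERIV_cong_ev[OF refl _ refl, THEN iffD2, rotated])
   have "\<forall>\<^sub>F x in nhds y. x < 0" using eventually_nhds_in_open[of "{..<0::real}" y] y by simp
   then show "\<forall>\<^sub>F x in nhds y. flat P x = 0"
    by eventually_elim (simp add: flat_def)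
  qed
 qed
next
 case True
 have "((\<lambda>h. (flat P (0 + h) - flat P 0) / h) \<longlongrightarrow> 0) (at 0)"
  unfolding filterlim_at_split
 proof
  have "\<forall>\<^sub>F h in at_left (0::real). h < 0" 
   unfolding eventually_at_left_field by (intro exI[of _ "-1"]) auto
  then have "\<forall>\<^sub>F h in at_left 0. (flat P (0 + h) - flat P 0) / h = 0"
   by eventually_elim (simp add: flat_def)
  then show "((\<lambda>h. (flat P (0 + h) - flat P 0) / h) \<longlongrightarrow> 0) (at_left 0)" by (rule tendsto_eventually)
  have "((\<lambda>h. poly ([:0, 1:] * P) (inverse h) * exp (- inverse h)) \<longlongrightarrow> 0) (at_right (0::real))"
   by (rule filterlim_compose[OF poly_mult_exp_tendsto_0 filterlim_inverse_at_top_right])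
  moreover have "\<forall>\<^sub>F h in at_right (0::real). h > 0" by (rule eventually_at_right_less)
  then have "\<forall>\<^sub>F h in at_right 0. poly ([:0, 1:] * P) (inverse h) * exp (- inverse h) = (flat P (0 + h) - flat P 0) / h"
   by eventually_elim (simp add: flat_def divide_inverse)
  ultimately show "((\<lambda>h. (flat P (0 + h) - flat P 0) / h) \<longlongrightarrow> 0) (at_right 0)"
   by (rule Lim_transform_eventually)
 qed
 then show ?thesis using True by (simp add: DERIV_def flat_def)
qed

lemma flat_derivative_compose [derivative_intros]:
 "(f has_real_derivative f') (at x within A) \<Longrightarrow>
  ((\<lambda>x. flat P (f x)) has_real_derivative flat (flat_deriv P) (f x) * f') (at x within A)"
 by (rule DERIV_chain2[OF flat_has_derivative])

section \<open>Bumps, smooth steps and a class of smooth functions\<close>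

definition bump :: "real \<Rightarrow> real" where
 "bump s = flat 1 (1 + s) * flat 1 (1 - s)"

definition bump1 :: "real \<Rightarrow> real" where
 "bump1 s = flat (flat_deriv 1) (1 + s) * flat 1 (1 - s) - flat 1 (1 + s) * flat (flat_deriv 1) (1 - s)"

definition bump2 :: "real \<Rightarrow> real" where
 "bump2 s = flat (flat_deriv (flat_deriv 1)) (1 + s) * flat 1 (1 - s)
  - 2 * (flat (flat_deriv 1) (1 + s) * flat (flat_deriv 1) (1 - s))
  + flat 1 (1 + s) * flat (flat_deriv (flat_deriv 1)) (1 - s)"

lemma bump_derivative [derivative_intros]:
 "(f has_real_derivative f') (at x within A) \<Longrightarrow> ((\<lambda>x. bump (f x)) has_real_derivative bump1 (f x) * f') (at x within A)"
 unfolding bump_def bump1_def by (auto intro!: derivative_eq_intros simp: algebra_simps)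

lemma bump1_derivative [derivative_intros]:
 "(f has_real_derivative f') (at x within A) \<Longrightarrow> ((\<lambda>x. bump1 (f x)) has_real_derivative bump2 (f x) * f') (at x within A)"
 unfolding bump2_def bump1_def by (auto intro!: derivative_eq_intros simp: algebra_simps)

lemma flat_nonneg: "0 \<le> flat 1 s" and flat_pos: "0 < s \<Longrightarrow> 0 < flat 1 s" and flat_zero: "s \<le> 0 \<Longrightarrow> flat P s = 0"
 by (auto simp: flat_def)

lemma bump_nonneg: "0 \<le> bump s" and bump_pos: "\<bar>s\<bar> < 1 \<Longrightarrow> 0 < bump s"
 unfolding bump_def by (auto intro!: mult_nonneg_nonneg mult_pos_pos flat_nonneg flat_pos)

lemma bump_outside: "1 \<le> \<bar>s\<bar> \<Longrightarrow> bump s = 0" "1 \<le> \<bar>s\<bar> \<Longrightarrow> bump1 s = 0" "1 \<le> \<bar>s\<bar> \<Longrightarrow> bump2 s = 0"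
 by (auto simp: bump_def bump1_def bump2_def flat_zero abs_real_def split: if_splits)

lemma flat_continuous: "continuous_on A (flat P)"
 using flat_has_derivative by (meson DERIV_isCont continuous_at_imp_continuous_on)

lemma flat_continuous_compose [continuous_intros]:
 "continuous_on A f \<Longrightarrow> continuous_on A (\<lambda>x. flat P (f x))"
 by (rule continuous_on_compose2[OF flat_continuous[of UNIV]]) auto

lemma bump_continuous [continuous_intros]:
 "continuous_on A f \<Longrightarrow> continuous_on A (\<lambda>x. bump (f x))"
 "continuous_on A f \<Longrightarrow> continuous_on A (\<lambda>x. bump1 (f x))"
 "continuous_on A f \<Longrightarrow> continuous_on A (\<lambda>x. bump2 (f x))"
 unfolding bump_def bump1_def bump2_def by (intro continuous_intros; assumption)+

lemma bump_measurable [measurable]: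
 "bump \<in> borel_measurable borel" "bump1 \<in> borel_measurable borel" "bump2 \<in> borel_measurable borel"
 by (intro borel_measurable_continuous_onI continuous_intros)+

lemma bump_bounds:
 obtains C where "C > 0" "\<And>s. \<bar>bump s\<bar> \<le> C" "\<And>s. \<bar>bump1 s\<bar> \<le> C" "\<And>s. \<bar>bump2 s\<bar> \<le> C"
proof -
 have *: "\<exists>C>0. \<forall>s. \<bar>f s\<bar> \<le> C" if f: "continuous_on {-1..1} f" "\<And>s. 1 \<le> \<bar>s\<bar> \<Longrightarrow> f s = 0" for f :: "real \<Rightarrow> real"
 proof -
  have "bounded (f ` {-1..1})" by (intro compact_imp_bounded compact_continuous_image f(1)) simp
  then obtain C where C: "C > 0" "\<And>s. s \<in> {-1..1} \<Longrightarrow> norm (f s) \<le> C"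
   unfolding bounded_pos by auto
  have "\<bar>f s\<bar> \<le> C" for s
  proof (cases "s \<in> {-1..1}")
   case False
   then have "f s = 0" by (intro f(2)) auto
   then show ?thesis using C(1) by simp
  qed (use C(2)[of s] in simp)
  then show ?thesis using C(1) by blast
 qed
 obtain C0 where C0: "C0 > 0" "\<And>s. \<bar>bump s\<bar> \<le> C0" using *[OF bump_continuous(1)[OF continuous_on_id] bump_outside(1)] by auto
 obtain C1 where C1: "C1 > 0" "\<And>s. \<bar>bump1 s\<bar> \<le> C1" using *[OF bump_continuous(2)[OF continuous_on_id] bump_outside(2)] by auto
 obtain C2 where C2: "C2 > 0" "\<And>s. \<bar>bump2 s\<bar> \<le> C2" using *[OF bump_continuous(3)[OF continuous_on_id] bump_outside(3)] by auto
 show ?thesis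
 proof (rule that[of "C0 + C1 + C2"])
  show "\<bar>bump s\<bar> \<le> C0 + C1 + C2" "\<bar>bump1 s\<bar> \<le> C0 + C1 + C2" "\<bar>bump2 s\<bar> \<le> C0 + C1 + C2" for s
   using C0(2)[of s] C1(2)[of s] C2(2)[of s] C0(1) C1(1) C2(1) by linarith+
 qed (use C0 C1 C2 in auto)
qed

text \<open>An antiderivative of the bump. \<open>time_cutoff\<close> uses differences of its
  values, so the additive constant left open by \<open>SOME\<close> is immaterial.\<close>

definition step :: "real \<Rightarrow> real" where
 "step = (SOME H. \<forall>x. (H has_real_derivative bump x) (at x))"

lemma step_has_derivative: "(step has_real_derivative bump x) (at x)"
proof -
 have "continuous_on UNIV bump" by (intro continuous_intros)
 then have "\<exists>F. \<forall>x::real. -\<infinity> < ereal x \<longrightarrow> ereal x < \<infinity> \<longrightarrow> (F has_vector_derivative bump x) (at x)"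
  by (intro einterval_antiderivative) (auto simp: continuous_on_eq_continuous_at)
 then have "\<exists>F. \<forall>x. (F has_real_derivative bump x) (at x)"
  by (simp add: has_real_derivative_iff_has_vector_derivative)
 from someI_ex[OF this] show ?thesis unfolding step_def by blast
qed

lemma step_derivative [derivative_intros]:
 "(f has_real_derivative f') (at x within A) \<Longrightarrow> ((\<lambda>x. step (f x)) has_real_derivative bump (f x) * f') (at x within A)"
 by (rule DERIV_chain2[OF step_has_derivative])

lemma step_continuous [continuous_intros]:
 "continuous_on A f \<Longrightarrow> continuous_on A (\<lambda>x. step (f x))"
proof (rule continuous_on_compose2[of UNIV step])
 show "continuous_on UNIV step"
  using step_has_derivative by (meson DERIV_isCont continuous_at_imp_continuous_on)
qed auto

lemma step_mono: "x \<le> y \<Longrightarrow> step x \<le> step y"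
proof (rule DERIV_nonneg_imp_nondecreasing[of x y step])
 show "\<exists>y. (step has_real_derivative y) (at z) \<and> 0 \<le> y" for z
  using step_has_derivative[of z] bump_nonneg[of z] by (intro exI[of _ "bump z"] conjI)
qed

lemma step_left: "x \<le> -1 \<Longrightarrow> step x = step (-1)"
proof -
 assume x: "x \<le> -1"
 have "\<exists>y. (step has_real_derivative y) (at z) \<and> y \<le> 0" if "x \<le> z" "z \<le> -1" for z
  using step_has_derivative[of z] bump_outside(1)[of z] that by (intro exI[of _ "bump z"]) auto
 then have "step (-1) \<le> step x" using x by (intro DERIV_nonpos_imp_nonincreasing[of x "-1" step]) blast+
 then show ?thesis using step_mono[OF x] by simp
qed

lemma step_right: "1 \<le> x \<Longrightarrow> step x = step 1"
proof -
 assume x: "1 \<le> x"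
 have "\<exists>y. (step has_real_derivative y) (at z) \<and> y \<le> 0" if "1 \<le> z" "z \<le> x" for z
  using step_has_derivative[of z] bump_outside(1)[of z] that by (intro exI[of _ "bump z"]) auto
 then have "step x \<le> step 1" using x by (intro DERIV_nonpos_imp_nonincreasing[of 1 x step]) blast+
 then show ?thesis using step_mono[OF x] by simp
qed

definition bump_mass :: real where "bump_mass = step 1 - step (-1)"

lemma bump_mass_pos: "0 < bump_mass"
proof -
 have c: "continuous_on {-1..1} step" using step_continuous[of "{-1..1}" "\<lambda>x. x"] by simp
 have d: "\<exists>y. (step has_real_derivative y) (at x) \<and> 0 < y" if "-1 < x" "x < 1" for x
  using step_has_derivative[of x] bump_pos[of x] that by (intro exI[of _ "bump x"]) auto
 have "step (-1) < step 1"
  by (rule DERIV_pos_imp_increasing_open[OF _ d c]) auto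
 then show ?thesis by (simp add: bump_mass_def)
qed

lemma has_bochner_integral_bump: "has_bochner_integral lborel bump bump_mass"
proof -
 have "has_bochner_integral lborel (\<lambda>x. bump x * indicator {-1..1} x) (step 1 - step (-1))"
 proof (rule has_bochner_integral_FTC_Icc_real)
  show "isCont bump x" for x
   using bump_continuous(1)[of UNIV "\<lambda>x. x"] by (simp add: continuous_on_eq_continuous_at)
 qed (use step_has_derivative in auto)
 moreover have "bump x * indicator {-1..1} x = bump x" for x
 proof (cases "x \<in> {-1..1}")
  case False
  then have "bump x = 0" by (intro bump_outside(1)) auto
  then show ?thesis by simp
 qed simp
 ultimately show ?thesis by (simp add: bump_mass_def)
qed

text \<open>A class closed under directional derivatives, so that differentiability of every order
  follows by induction without formulas for higher derivatives. The flat functions are included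
  because the derivative of \<open>step\<close> is a product of two of them.\<close>

inductive_set smooth_class :: "('b::euclidean_space \<Rightarrow> complex) set" where
 const: "(\<lambda>z. c) \<in> smooth_class"
| flat: "(\<lambda>z. of_real (flat P (w \<bullet> z + c))) \<in> smooth_class"
| step: "(\<lambda>z. of_real (step (w \<bullet> z + c))) \<in> smooth_class"
| cis: "(\<lambda>z. cis (w \<bullet> z + c)) \<in> smooth_class"
| add: "f \<in> smooth_class \<Longrightarrow> g \<in> smooth_class \<Longrightarrow> (\<lambda>z. f z + g z) \<in> smooth_class"
| mult: "f \<in> smooth_class \<Longrightarrow> g \<in> smooth_class \<Longrightarrow> (\<lambda>z. f z * g z) \<in> smooth_class"

lemma has_derivative_affine_compose:
 fixes g :: "real \<Rightarrow> real" and z :: "'b::euclidean_space"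
 assumes "(g has_real_derivative d) (at (w \<bullet> z + c))"
 shows "((\<lambda>z. complex_of_real (g (w \<bullet> z + c))) has_derivative (\<lambda>v. of_real d * of_real (w \<bullet> v))) (at z)"
proof -
 have "((\<lambda>z. w \<bullet> z + c) has_derivative (\<lambda>v. w \<bullet> v)) (at z)"
  by (auto intro!: derivative_eq_intros)
 from has_derivative_compose[OF this assms[unfolded has_field_derivative_def]]
 have "((\<lambda>z. g (w \<bullet> z + c)) has_derivative (\<lambda>v. d * (w \<bullet> v))) (at z)" .
 from has_derivative_of_real[OF this] show ?thesis by simp
qed

lemma smooth_class_derivative:
 assumes "f \<in> smooth_class"
 shows "\<exists>f'. (\<forall>z. (f has_derivative f' z) (at z)) \<and> (\<forall>v. (\<lambda>z. f' z v) \<in> smooth_class)"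
 using assms
proof induction
 case (const c)
 show ?case by (intro exI[of _ "\<lambda>z v. 0"]) (auto intro: smooth_class.const)
next
 case (flat P w c)
 show ?case
  by (intro exI[of _ "\<lambda>z v. of_real (flat (flat_deriv P) (w \<bullet> z + c)) * of_real (w \<bullet> v)"] conjI allI
    has_derivative_affine_compose flat_has_derivative smooth_class.intros)
next
 case (step w c)
 have b: "(\<lambda>z. complex_of_real (bump (w \<bullet> z + c))) \<in> smooth_class"
 proof -
  have "(\<lambda>z. complex_of_real (flat 1 (w \<bullet> z + (1 + c))) * complex_of_real (flat 1 ((- w) \<bullet> z + (1 - c)))) \<in> smooth_class"
   by (intro smooth_class.intros)
  then show ?thesis by (simp add: bump_def algebra_simps)
 qed
 show ?case
  by (intro exI[of _ "\<lambda>z v. of_real (bump (w \<bullet> z + c)) * of_real (w \<bullet> v)"] conjI allI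
    has_derivative_affine_compose step_has_derivative smooth_class.mult smooth_class.const b)
next
 case (cis w c)
 have "((\<lambda>z. cis (w \<bullet> z + c)) has_derivative (\<lambda>v. (\<i> * of_real (w \<bullet> v)) * cis (w \<bullet> z + c))) (at z)" for z
  by (auto intro!: derivative_eq_intros simp: scaleR_conv_of_real ac_simps)
 moreover have "(\<lambda>z. (\<i> * of_real (w \<bullet> v)) * cis (w \<bullet> z + c)) \<in> smooth_class" for v
  by (intro smooth_class.intros)
 ultimately show ?case
  by (intro exI[of _ "\<lambda>z v. (\<i> * of_real (w \<bullet> v)) * cis (w \<bullet> z + c)"] conjI allI)
next
 case (add f g)
 then obtain f' g' where "\<And>z. (f has_derivative f' z) (at z)" "\<And>v. (\<lambda>z. f' z v) \<in> smooth_class"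
  "\<And>z. (g has_derivative g' z) (at z)" "\<And>v. (\<lambda>z. g' z v) \<in> smooth_class" by blast
 then show ?case
  by (intro exI[of _ "\<lambda>z v. f' z v + g' z v"]) (auto intro: derivative_intros smooth_class.add)
next
 case (mult f g)
 then obtain f' g' where d: "\<And>z. (f has_derivative f' z) (at z)" "\<And>v. (\<lambda>z. f' z v) \<in> smooth_class"
  "\<And>z. (g has_derivative g' z) (at z)" "\<And>v. (\<lambda>z. g' z v) \<in> smooth_class" by blast
 show ?case
  by (intro exI[of _ "\<lambda>z v. f z * g' z v + f' z v * g z"] conjI allI has_derivative_mult d smooth_class.add smooth_class.mult mult.hyps)
qed

lemma smooth_class_dir_deriv:
 assumes f: "f \<in> smooth_class"
 shows "f differentiable (at z)" "dir_deriv v f \<in> smooth_class"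
proof -
 obtain f' where f': "\<And>z. (f has_derivative f' z) (at z)" "\<And>v. (\<lambda>z. f' z v) \<in> smooth_class"
  using smooth_class_derivative[OF f] by blast
 show "f differentiable (at z)" using f'(1) by (auto simp: differentiable_def)
 have "dir_deriv v f = (\<lambda>z. f' z v)"
  unfolding dir_deriv_def[abs_def] using frechet_derivative_at[OF f'(1)] by metis
 then show "dir_deriv v f \<in> smooth_class" using f'(2) by simp
qed

lemma smooth_class_C_k: "f \<in> smooth_class \<Longrightarrow> C_k k f"
proof (induction k arbitrary: f)
 case 0
 have "isCont f z" for z using smooth_class_dir_deriv(1)[OF 0, of z] by (rule differentiable_imp_continuous_within)
 then show ?case by (simp add: continuous_on_eq_continuous_at)
next
 case (Suc k)
 show ?case
  unfolding C_k.simps by (intro conjI allI smooth_class_dir_deriv Suc.IH Suc.prems)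
qed

lemma smooth_class_prod:
 "(\<And>i. i \<in> I \<Longrightarrow> f i \<in> smooth_class) \<Longrightarrow> (\<lambda>z. \<Prod>i\<in>I. f i z) \<in> smooth_class"
 by (induction I rule: infinite_finite_induct) (auto intro: smooth_class.intros)

lemma smooth_class_bump: "(\<lambda>z. complex_of_real (bump (w \<bullet> z + c))) \<in> smooth_class"
proof -
 have "(\<lambda>z. complex_of_real (flat 1 (w \<bullet> z + (1 + c))) * complex_of_real (flat 1 ((- w) \<bullet> z + (1 - c)))) \<in> smooth_class"
  by (intro smooth_class.intros)
 then show ?thesis by (simp add: bump_def algebra_simps)
qed

lemma dir_deriv_line:
 assumes f: "f differentiable (at z)" and d: "((\<lambda>r. f (z + r *\<^sub>R v)) has_vector_derivative D) (at 0)"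
 shows "dir_deriv v f z = D"
proof -
 have f': "(f has_derivative frechet_derivative f (at z)) (at (z + 0 *\<^sub>R v))"
  using f by (simp add: frechet_derivative_works)
 have "((\<lambda>r. z + r *\<^sub>R v) has_derivative (\<lambda>r. r *\<^sub>R v)) (at 0)"
  by (auto intro!: derivative_eq_intros)
 from has_derivative_compose[OF this f']
 have *: "((\<lambda>r. f (z + r *\<^sub>R v)) has_derivative (\<lambda>r. frechet_derivative f (at z) (r *\<^sub>R v))) (at 0)" .
 have "(\<lambda>r. frechet_derivative f (at z) (r *\<^sub>R v)) = (\<lambda>r. r *\<^sub>R D)"
  by (rule has_derivative_unique[OF * d[unfolded has_vector_derivative_def]])
 then have "frechet_derivative f (at z) (1 *\<^sub>R v) = 1 *\<^sub>R D" by (rule fun_cong)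
 then show ?thesis by (simp add: dir_deriv_def)
qed

lemma has_vector_derivative_complex_of_real:
 "(f has_real_derivative d) F \<Longrightarrow> ((\<lambda>r. complex_of_real (f r)) has_vector_derivative of_real d) F"
 unfolding has_vector_derivative_def has_field_derivative_def
 by (drule has_derivative_of_real) (simp add: scaleR_conv_of_real mult.commute)

lemma has_vector_derivative_cis:
 assumes "(f has_real_derivative d) (at x)"
 shows "((\<lambda>r. cis (f r)) has_vector_derivative (\<i> * of_real d * cis (f x))) (at x)"
proof -
 have "((\<lambda>r. cis (f r)) has_derivative (\<lambda>h. (d * h) *\<^sub>R (\<i> * cis (f x)))) (at x)"
  using assms unfolding has_field_derivative_def by (rule has_derivative_cis)
 then show ?thesis
  unfolding has_vector_derivative_def by (simp add: scaleR_conv_of_real ac_simps)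
qed

text \<open>The indicator of [a,b] times \<open>bump_mass\<close>, smoothed within distance
  \<epsilon> of the end points; the constant factor is not normalised away, as it cancels in
  \<open>weak_derivative_integral\<close>.\<close>

definition time_cutoff :: "real \<Rightarrow> real \<Rightarrow> real \<Rightarrow> real \<Rightarrow> real" where
 "time_cutoff a b \<epsilon> t = step ((t - a) / \<epsilon>) - step ((t - b) / \<epsilon>)"

definition time_cutoff' :: "real \<Rightarrow> real \<Rightarrow> real \<Rightarrow> real \<Rightarrow> real" where
 "time_cutoff' a b \<epsilon> t = bump ((t - a) / \<epsilon>) / \<epsilon> - bump ((t - b) / \<epsilon>) / \<epsilon>"

lemma time_cutoff_derivative [derivative_intros]:
 "(f has_real_derivative f') (at x within A) \<Longrightarrow>
  ((\<lambda>x. time_cutoff a b \<epsilon> (f x)) has_real_derivative time_cutoff' a b \<epsilon> (f x) * f') (at x within A)"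
 unfolding time_cutoff_def time_cutoff'_def
 by (cases "\<epsilon> = 0") (auto intro!: derivative_eq_intros simp: algebra_simps divide_inverse)

lemma step_measurable [measurable]: "step \<in> borel_measurable borel"
 by (intro borel_measurable_continuous_onI continuous_intros)

lemma time_cutoff_measurable [measurable]:
 "time_cutoff a b \<epsilon> \<in> borel_measurable borel" "time_cutoff' a b \<epsilon> \<in> borel_measurable borel"
 unfolding time_cutoff_def[abs_def] time_cutoff'_def[abs_def] by measurable

lemma time_cutoff_outside:
 assumes e: "\<epsilon> > 0" and ab: "a < b" and t: "t < a - \<epsilon> \<or> b + \<epsilon> < t"
 shows "time_cutoff a b \<epsilon> t = 0"
 using t
proof
 assume "t < a - \<epsilon>"
 then have "(t - a) / \<epsilon> \<le> -1" "(t - b) / \<epsilon> \<le> -1" using e ab by (auto simp: divide_le_eq)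
 then show ?thesis by (simp add: time_cutoff_def step_left[of "(t - a) / \<epsilon>"] step_left[of "(t - b) / \<epsilon>"])
next
 assume "b + \<epsilon> < t"
 then have "1 \<le> (t - a) / \<epsilon>" "1 \<le> (t - b) / \<epsilon>" using e ab by (auto simp: le_divide_eq)
 then show ?thesis by (simp add: time_cutoff_def step_right[of "(t - a) / \<epsilon>"] step_right[of "(t - b) / \<epsilon>"])
qed

lemma step_bounds: "step (-1) \<le> step s" "step s \<le> step 1"
 using step_mono[of "-1" s] step_left[of s] step_mono[of s 1] step_right[of s] by linarith+

lemma time_cutoff_bound: "\<bar>time_cutoff a b \<epsilon> t\<bar> \<le> bump_mass"
 using step_bounds[of "(t - a) / \<epsilon>"] step_bounds[of "(t - b) / \<epsilon>"]
 unfolding time_cutoff_def bump_mass_def by linarith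

lemma time_cutoff_tendsto:
 assumes e: "\<And>n. \<epsilon> n > 0" "\<epsilon> \<longlonglongrightarrow> 0" and ab: "a < b" and t: "t \<noteq> a" "t \<noteq> b"
 shows "(\<lambda>n. time_cutoff a b (\<epsilon> n) t) \<longlonglongrightarrow> bump_mass * indicator {a..b} t"
proof (rule tendsto_eventually)
 have "min \<bar>t - a\<bar> \<bar>t - b\<bar> > 0" using t by simp
 then have "\<forall>\<^sub>F n in sequentially. \<epsilon> n < min \<bar>t - a\<bar> \<bar>t - b\<bar>" using e(2) by (rule order_tendstoD(2)[rotated])
 then show "\<forall>\<^sub>F n in sequentially. time_cutoff a b (\<epsilon> n) t = bump_mass * indicator {a..b} t"
 proof eventually_elim
  case (elim n)
  consider "t < a" | "a < t" "t < b" | "b < t" using t by linarith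
  then show ?case
  proof cases
   case 1
   then show ?thesis using time_cutoff_outside[of "\<epsilon> n" a b t] e(1)[of n] ab elim by auto
  next
   case 2
   then have "1 \<le> (t - a) / \<epsilon> n" "(t - b) / \<epsilon> n \<le> -1" using elim e(1)[of n] by (auto simp: le_divide_eq divide_le_eq)
   then show ?thesis
    using 2 by (simp add: time_cutoff_def bump_mass_def step_right[of "(t - a) / \<epsilon> n"] step_left[of "(t - b) / \<epsilon> n"])
  next
   case 3
   then show ?thesis using time_cutoff_outside[of "\<epsilon> n" a b t] e(1)[of n] ab elim by auto
  qed
 qed
qed

text \<open>The rescaled bumps are an approximate identity of mass \<open>bump_mass\<close>;
  substitution moves the scale into the argument of \<alpha>, where continuity at a applies.\<close>

lemma bump_average_tendsto:
 fixes \<alpha> :: "real \<Rightarrow> complex"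
 assumes [measurable]: "\<alpha> \<in> borel_measurable borel" and A: "\<And>t. norm (\<alpha> t) \<le> A" and c: "isCont \<alpha> a"
  and e: "\<And>n. \<epsilon> n > 0" "\<epsilon> \<longlonglongrightarrow> 0"
 shows "(\<lambda>n. LB t. of_real (bump ((t - a) / \<epsilon> n) / \<epsilon> n) * \<alpha> t) \<longlonglongrightarrow> of_real bump_mass * \<alpha> a"
proof -
 have bi: "integrable lborel bump" and bm: "(LB s. bump s) = bump_mass"
  using has_bochner_integral_bump by (auto simp: has_bochner_integral_iff)
 have "(\<lambda>n. LB s. of_real (bump s) * \<alpha> (a + \<epsilon> n * s)) \<longlonglongrightarrow> (LB s. of_real (bump s) * \<alpha> a)"
 proof (rule integral_dominated_convergence[where w="\<lambda>s. bump s * A"])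
  show "integrable lborel (\<lambda>s. bump s * A)" using bi by simp
  show "AE s in lborel. (\<lambda>n. of_real (bump s) * \<alpha> (a + \<epsilon> n * s)) \<longlonglongrightarrow> of_real (bump s) * \<alpha> a"
  proof (intro AE_I2 tendsto_mult tendsto_const)
   fix s :: real
   have "(\<lambda>n. a + \<epsilon> n * s) \<longlonglongrightarrow> a + 0 * s" by (intro tendsto_intros e)
   then show "(\<lambda>n. \<alpha> (a + \<epsilon> n * s)) \<longlonglongrightarrow> \<alpha> a" using isCont_tendsto_compose[OF c] by simp
  qed
  show "AE s in lborel. norm (of_real (bump s) * \<alpha> (a + \<epsilon> n * s)) \<le> bump s * A" for n
   using A bump_nonneg by (intro AE_I2) (simp add: norm_mult mult_left_mono)
 qed measurable
 also have "(\<lambda>n. LB s. of_real (bump s) * \<alpha> (a + \<epsilon> n * s)) =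
   (\<lambda>n. LB t. of_real (bump ((t - a) / \<epsilon> n) / \<epsilon> n) * \<alpha> t)"
 proof
  fix n
  have "(LB t. of_real (bump ((t - a) / \<epsilon> n) / \<epsilon> n) * \<alpha> t) =
   \<bar>\<epsilon> n\<bar> *\<^sub>R (LB s. of_real (bump ((a + \<epsilon> n * s - a) / \<epsilon> n) / \<epsilon> n) * \<alpha> (a + \<epsilon> n * s))"
   using e(1)[of n] by (intro lborel_integral_real_affine) simp
  also have "\<dots> = (LB s. \<bar>\<epsilon> n\<bar> *\<^sub>R (of_real (bump ((a + \<epsilon> n * s - a) / \<epsilon> n) / \<epsilon> n) * \<alpha> (a + \<epsilon> n * s)))"
   by simp
  also have "\<dots> = (LB s. of_real (bump s) * \<alpha> (a + \<epsilon> n * s))"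
   using e(1)[of n] by (intro lint_cong refl) (simp add: scaleR_conv_of_real)
  finally show "(LB s. of_real (bump s) * \<alpha> (a + \<epsilon> n * s)) = (LB t. of_real (bump ((t - a) / \<epsilon> n) / \<epsilon> n) * \<alpha> t)"
   by simp
 qed
 also have "(LB s. of_real (bump s) * \<alpha> a) = of_real bump_mass * \<alpha> a"
  using bi by (simp add: bm integral_complex_of_real)
 finally show ?thesis .
qed

text \<open>The derivative of the smoothed indicator concentrates at a with positive sign and at b
  with negative sign, so the weak equation turns into the increment of \<alpha> as \<epsilon> tends
  to 0.\<close>

lemma weak_derivative_integral:
 fixes \<alpha> \<rho> :: "real \<Rightarrow> complex"
 assumes m: "\<alpha> \<in> borel_measurable borel" "\<rho> \<in> borel_measurable borel"
  and A: "\<And>t. norm (\<alpha> t) \<le> A" and c: "isCont \<alpha> a" "isCont \<alpha> b"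
  and \<rho>: "integrable lborel \<rho>" and ab: "0 < a" "a < b" "b < T"
  and weak: "\<And>\<epsilon>. 0 < \<epsilon> \<Longrightarrow> 0 < a - \<epsilon> \<Longrightarrow> b + \<epsilon> < T \<Longrightarrow>
   - \<i> * (LB t. of_real (time_cutoff' a b \<epsilon> t) * \<alpha> t) = (LB t. of_real (time_cutoff a b \<epsilon> t) * \<rho> t)"
 shows "\<alpha> b - \<alpha> a = - \<i> * (LB t. indicator {a..b} t * \<rho> t)"
proof -
 note [measurable] = m
 \<comment> \<open>The factor keeps the enlarged interval inside (0,T) for every n.\<close>
 define \<epsilon> where "\<epsilon> n = min (a / 2) ((T - b) / 2) * inverse (real (Suc n))" for n
 have m0: "min (a / 2) ((T - b) / 2) > 0" using ab by simp
 have e0: "\<epsilon> n > 0" for n unfolding \<epsilon>_def using m0 by (intro mult_pos_pos) auto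
 have el: "\<epsilon> \<longlonglongrightarrow> 0"
  unfolding \<epsilon>_def using tendsto_mult_right_zero[OF LIMSEQ_inverse_real_of_nat] by blast
 have e1: "\<epsilon> n \<le> min (a / 2) ((T - b) / 2)" for n
 proof -
  have "\<epsilon> n \<le> min (a / 2) ((T - b) / 2) * 1"
   unfolding \<epsilon>_def using m0 by (intro mult_left_mono) (auto simp: divide_simps)
  then show ?thesis by simp
 qed
 have es: "0 < a - \<epsilon> n" "b + \<epsilon> n < T" for n
 proof -
  have "\<epsilon> n \<le> a / 2" "\<epsilon> n \<le> (T - b) / 2" using e1[of n] by auto
  then show "0 < a - \<epsilon> n" "b + \<epsilon> n < T" using ab by (simp_all add: field_simps)
 qed
 have ii: "integrable lborel (\<lambda>t. of_real (bump ((t - d) / \<epsilon> n) / \<epsilon> n) * \<alpha> t)" for d n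
 proof (rule lint_bound)
  have "integrable lborel (\<lambda>t. bump (- d / \<epsilon> n + inverse (\<epsilon> n) * t))"
   using has_bochner_integral_bump e0[of n] by (intro lborel_integrable_real_affine) (auto simp: has_bochner_integral_iff)
  then have "integrable lborel (\<lambda>t. bump ((t - d) / \<epsilon> n))" by (simp add: right_diff_distrib diff_divide_distrib divide_inverse mult.commute)
  then show "integrable lborel (\<lambda>t. bump ((t - d) / \<epsilon> n) / \<epsilon> n * A)" by simp
  show "AE t in lborel. norm (of_real (bump ((t - d) / \<epsilon> n) / \<epsilon> n) * \<alpha> t) \<le> norm (bump ((t - d) / \<epsilon> n) / \<epsilon> n * A)"
  proof (rule AE_I2)
   fix t
   have "norm (\<alpha> t) \<le> \<bar>A\<bar>" using A[of t] by linarith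
   then show "norm (of_real (bump ((t - d) / \<epsilon> n) / \<epsilon> n) * \<alpha> t) \<le> norm (bump ((t - d) / \<epsilon> n) / \<epsilon> n * A)"
    unfolding norm_mult norm_of_real real_norm_def abs_mult[of "bump ((t - d) / \<epsilon> n) / \<epsilon> n" A] by (rule mult_left_mono) simp
  qed
 qed measurable
 have "(LB t. of_real (time_cutoff' a b (\<epsilon> n) t) * \<alpha> t) =
  (LB t. of_real (bump ((t - a) / \<epsilon> n) / \<epsilon> n) * \<alpha> t) - (LB t. of_real (bump ((t - b) / \<epsilon> n) / \<epsilon> n) * \<alpha> t)" for n
  unfolding time_cutoff'_def of_real_diff left_diff_distrib by (rule lint_diff[OF ii ii])
 then have "(\<lambda>n. - \<i> * (LB t. of_real (time_cutoff' a b (\<epsilon> n) t) * \<alpha> t)) \<longlonglongrightarrow>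
  - \<i> * (of_real bump_mass * \<alpha> a - of_real bump_mass * \<alpha> b)"
  by (simp only:) (intro tendsto_mult tendsto_const tendsto_diff bump_average_tendsto[OF m(1) A _ e0 el] c)
 moreover have "(\<lambda>n. LB t. of_real (time_cutoff a b (\<epsilon> n) t) * \<rho> t) \<longlonglongrightarrow>
  (LB t. of_real (bump_mass * indicator {a..b} t) * \<rho> t)"
 proof (rule integral_dominated_convergence[where w="\<lambda>t. bump_mass * norm (\<rho> t)"])
  show "integrable lborel (\<lambda>t. bump_mass * norm (\<rho> t))" using \<rho> by simp
  have "AE t in lborel. t \<noteq> a" "AE t in lborel. t \<noteq> b" by (rule AE_lborel_singleton)+
  then show "AE t in lborel. (\<lambda>n. of_real (time_cutoff a b (\<epsilon> n) t) * \<rho> t) \<longlonglongrightarrow> of_real (bump_mass * indicator {a..b} t) * \<rho> t"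
   by eventually_elim (intro tendsto_mult tendsto_const tendsto_of_real time_cutoff_tendsto e0 el ab)
  show "AE t in lborel. norm (of_real (time_cutoff a b (\<epsilon> n) t) * \<rho> t) \<le> bump_mass * norm (\<rho> t)" for n
   unfolding norm_mult norm_of_real by (intro AE_I2 mult_right_mono time_cutoff_bound) auto
 qed measurable
 ultimately have "- \<i> * (of_real bump_mass * \<alpha> a - of_real bump_mass * \<alpha> b) = (LB t. of_real (bump_mass * indicator {a..b} t) * \<rho> t)"
  unfolding weak[OF e0 es] by (rule LIMSEQ_unique)
 also have "\<dots> = (LB t. of_real bump_mass * (indicator {a..b} t * \<rho> t))"
  by (intro lint_cong refl) (simp add: indicator_def)
 also have "\<dots> = of_real bump_mass * (LB t. indicator {a..b} t * \<rho> t)" by simp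
 finally have "of_real bump_mass * (- \<i> * (\<alpha> a - \<alpha> b)) = of_real bump_mass * (LB t. indicator {a..b} t * \<rho> t)"
  by (simp add: algebra_simps)
 then have "- \<i> * (\<alpha> a - \<alpha> b) = (LB t. indicator {a..b} t * \<rho> t)"
  by (rule mult_left_cancel[THEN iffD1, rotated]) (use bump_mass_pos in simp)
 then have "- \<i> * (- \<i> * (\<alpha> a - \<alpha> b)) = - \<i> * (LB t. indicator {a..b} t * \<rho> t)" by (rule arg_cong)
 then show ?thesis by simp
qed

text \<open>For growing R this tends to \<open>bump 0 ^ CARD('n)\<close> and not to 1; the constant
  is cancelled in \<open>duhamel_formula\<close>.\<close>

definition space_cutoff :: "real \<Rightarrow> real ^ 'n \<Rightarrow> real" where
 "space_cutoff R x = (\<Prod>j\<in>UNIV. bump (x $ j / R))"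

definition space_cutoff_but :: "real \<Rightarrow> 'n \<Rightarrow> real ^ 'n \<Rightarrow> real" where
 "space_cutoff_but R i x = (\<Prod>j\<in>UNIV - {i}. bump (x $ j / R))"

lemma space_cutoff_split: "space_cutoff R x = bump (x $ i / R) * space_cutoff_but R i x"
 unfolding space_cutoff_def space_cutoff_but_def by (rule prod.remove) auto

lemma space_cutoff_but_line: "space_cutoff_but R i (x + r *\<^sub>R axis i 1) = space_cutoff_but R i x"
 unfolding space_cutoff_but_def by (intro prod.cong refl) (simp add: axis_def)

text \<open>Without the cut-offs, e^{it|\<eta>|^2 - i\<eta>x} solves the free equation that the test
  function has to satisfy, so pairing a solution with it gives its Fourier transform in the
  interaction picture.\<close>

definition cutoff_wave :: "real \<Rightarrow> real \<Rightarrow> real \<Rightarrow> real \<Rightarrow> real ^ 'n \<Rightarrow> real \<times> (real ^ 'n) \<Rightarrow> complex" where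
 "cutoff_wave a b \<epsilon> R \<eta> z = of_real (time_cutoff a b \<epsilon> (fst z)) * cis (fst z * (norm \<eta>)^2) *
  (of_real (space_cutoff R (snd z)) * cis (- (\<eta> \<bullet> snd z)))"

text \<open>The part of $\Delta(\theta_R e^{-i\eta x})$ in which the cut-off $\theta_R$ is differentiated.\<close>

definition cutoff_error :: "real \<Rightarrow> real ^ 'n \<Rightarrow> real ^ 'n \<Rightarrow> complex" where
 "cutoff_error R \<eta> x = (\<Sum>i\<in>UNIV. (of_real (bump2 (x $ i / R) / R\<^sup>2) - 2 * \<i> * of_real (\<eta> $ i) * of_real (bump1 (x $ i / R) / R)) *
  of_real (space_cutoff_but R i x)) * cis (- (\<eta> \<bullet> x))"

lemma cutoff_wave_smooth:
 assumes "\<epsilon> > 0"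
 shows "cutoff_wave a b \<epsilon> R (\<eta> :: real ^ 'n) \<in> smooth_class"
proof -
 have w: "(\<lambda>z :: real \<times> (real ^ 'n). of_real (step ((inverse \<epsilon>, 0) \<bullet> z + (- a / \<epsilon>))) + (- 1) * of_real (step ((inverse \<epsilon>, 0) \<bullet> z + (- b / \<epsilon>)))) \<in> smooth_class"
  by (intro smooth_class.intros)
 have t: "(\<lambda>z :: real \<times> (real ^ 'n). complex_of_real (time_cutoff a b \<epsilon> (fst z))) \<in> smooth_class"
  using w by (simp add: time_cutoff_def inner_prod_def right_diff_distrib diff_divide_distrib divide_inverse mult.commute)
 have c1: "(\<lambda>z :: real \<times> (real ^ 'n). cis (((norm \<eta>)^2, 0) \<bullet> z + 0)) \<in> smooth_class" by (rule smooth_class.cis)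
 have c1': "(\<lambda>z :: real \<times> (real ^ 'n). cis (fst z * (norm \<eta>)^2)) \<in> smooth_class"
  using c1 by (simp add: inner_prod_def mult.commute)
 have c2: "(\<lambda>z :: real \<times> (real ^ 'n). cis ((0, - \<eta>) \<bullet> z + 0)) \<in> smooth_class" by (rule smooth_class.cis)
 have c2': "(\<lambda>z :: real \<times> (real ^ 'n). cis (- (\<eta> \<bullet> snd z))) \<in> smooth_class"
  using c2 by (simp add: inner_prod_def)
 have b: "(\<lambda>z :: real \<times> (real ^ 'n). complex_of_real (bump (snd z $ j / R))) \<in> smooth_class" for j
 proof -
  have "(\<lambda>z :: real \<times> (real ^ 'n). complex_of_real (bump ((0, axis j (inverse R)) \<bullet> z + 0))) \<in> smooth_class"
   by (rule smooth_class_bump)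
  then show ?thesis by (simp add: inner_prod_def inner_axis' divide_inverse mult.commute)
 qed
 have s: "(\<lambda>z :: real \<times> (real ^ 'n). complex_of_real (space_cutoff R (snd z))) \<in> smooth_class"
  unfolding space_cutoff_def of_real_prod by (rule smooth_class_prod[OF b])
 show ?thesis
  unfolding cutoff_wave_def[abs_def] by (intro smooth_class.mult t c1' c2' s)
qed

lemma cutoff_wave_test_function:
 assumes e: "\<epsilon> > 0" "0 < a - \<epsilon>" "b + \<epsilon> < T" "a < b" and R: "R > 0"
 shows "test_function T (cutoff_wave a b \<epsilon> R (\<eta> :: real ^ 'n))"
proof -
 define K where "K = {a - \<epsilon>..b + \<epsilon>} \<times> cbox ((\<chi> j. - R) :: real ^ 'n) (\<chi> j. R)"
 have K: "compact K" unfolding K_def by (intro compact_Times compact_Icc compact_cbox)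
 have sub: "{z. cutoff_wave a b \<epsilon> R \<eta> z \<noteq> 0} \<subseteq> K"
 proof
  fix z assume "z \<in> {z. cutoff_wave a b \<epsilon> R \<eta> z \<noteq> 0}"
  then have nz: "time_cutoff a b \<epsilon> (fst z) \<noteq> 0" "space_cutoff R (snd z) \<noteq> 0" by (auto simp: cutoff_wave_def)
  have "fst z \<in> {a - \<epsilon>..b + \<epsilon>}" using nz(1) time_cutoff_outside[OF e(1) e(4), of "fst z"] by (auto simp: not_le[symmetric])
  moreover have "\<bar>snd z $ j\<bar> \<le> R" for j
  proof -
   have "bump (snd z $ j / R) \<noteq> 0" using nz(2) unfolding space_cutoff_def by auto
   then have "\<not> 1 \<le> \<bar>snd z $ j / R\<bar>" using bump_outside(1) by blast
   then show ?thesis using R by (simp add: abs_divide)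
  qed
  then have "snd z \<in> cbox (\<chi> j. - R) (\<chi> j. R)" by (auto simp: mem_box_cart abs_le_iff) (smt (verit))+
  ultimately show "z \<in> K" by (cases z) (simp add: K_def)
 qed
 have cl: "closure {z. cutoff_wave a b \<epsilon> R \<eta> z \<noteq> 0} \<subseteq> K"
  by (rule closure_minimal[OF sub compact_imp_closed[OF K]])
 moreover have "K \<subseteq> slab T" using e by (auto simp: K_def slab_def)
 moreover have "compact (closure {z. cutoff_wave a b \<epsilon> R \<eta> z \<noteq> 0})"
  using compact_imp_bounded[OF K] bounded_subset[OF _ sub] by (simp add: compact_closure)
 ultimately show ?thesis
  unfolding test_function_def using smooth_class_C_k[OF cutoff_wave_smooth[OF e(1)]] by blast
qed

lemma cutoff_wave_dt:
 assumes e: "\<epsilon> > 0"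
 shows "dt (cutoff_wave a b \<epsilon> R (\<eta> :: real ^ 'n)) (t, x) =
  (of_real (time_cutoff' a b \<epsilon> t) + \<i> * of_real ((norm \<eta>)^2) * of_real (time_cutoff a b \<epsilon> t)) * phase t \<eta> *
  (of_real (space_cutoff R x) * cis (- (\<eta> \<bullet> x)))"
 unfolding dt_def
proof (rule dir_deriv_line[OF smooth_class_dir_deriv(1)[OF cutoff_wave_smooth[OF e]]])
 let ?f = "\<lambda>r. complex_of_real (time_cutoff a b \<epsilon> (t + r)) * cis ((t + r) * (norm \<eta>)^2)"
 let ?K = "of_real (space_cutoff R x) * cis (- (\<eta> \<bullet> x))"
 have "((\<lambda>r. time_cutoff a b \<epsilon> (t + r)) has_real_derivative time_cutoff' a b \<epsilon> (t + 0) * 1) (at 0)"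
  by (intro time_cutoff_derivative) (auto intro!: derivative_eq_intros)
 note d1 = has_vector_derivative_complex_of_real[OF this]
 have "((\<lambda>r. (t + r) * (norm \<eta>)^2) has_real_derivative (norm \<eta>)\<^sup>2) (at 0)"
  by (auto intro!: derivative_eq_intros)
 note d2 = has_vector_derivative_cis[OF this]
 have "((\<lambda>r. ?f r * ?K) has_vector_derivative
  (of_real (time_cutoff a b \<epsilon> (t + 0)) * (\<i> * of_real ((norm \<eta>)^2) * cis ((t + 0) * (norm \<eta>)^2)) +
   of_real (time_cutoff' a b \<epsilon> (t + 0) * 1) * cis ((t + 0) * (norm \<eta>)^2)) * ?K) (at 0)"
  by (intro has_vector_derivative_mult_left has_vector_derivative_mult d1 d2)
 then show "((\<lambda>r. cutoff_wave a b \<epsilon> R \<eta> ((t, x) + r *\<^sub>R (1, 0))) has_vector_derivative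
  (of_real (time_cutoff' a b \<epsilon> t) + \<i> * of_real ((norm \<eta>)^2) * of_real (time_cutoff a b \<epsilon> t)) * phase t \<eta> *
  (of_real (space_cutoff R x) * cis (- (\<eta> \<bullet> x)))) (at 0)"
  by (simp add: cutoff_wave_def algebra_simps)
qed

text \<open>The profile f is left general because the derivative along the axis has the same shape
  with a new profile; the second derivative is then another instance.\<close>

lemma cutoff_line_derivative:
 fixes f f' :: "real \<Rightarrow> complex" and \<eta> x :: "real ^ 'n"
 assumes f: "\<And>s. (f has_vector_derivative f' s) (at s)" and R: "R > 0"
 shows "((\<lambda>r. X * (f ((x + r *\<^sub>R axis i 1) $ i / R) * of_real (space_cutoff_but R i (x + r *\<^sub>R axis i 1)) * cis (- (\<eta> \<bullet> (x + r *\<^sub>R axis i 1)))))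
  has_vector_derivative X * ((of_real (1 / R) * f' (x $ i / R) - \<i> * of_real (\<eta> $ i) * f (x $ i / R)) * of_real (space_cutoff_but R i x) * cis (- (\<eta> \<bullet> x)))) (at 0)"
proof -
 let ?P = "complex_of_real (space_cutoff_but R i x)"
 have l: "((\<lambda>r. x $ i / R + r / R) has_vector_derivative 1 / R) (at 0)"
  unfolding has_real_derivative_iff_has_vector_derivative[symmetric] using R by (auto intro!: derivative_eq_intros)
 have "(f \<circ> (\<lambda>r. x $ i / R + r / R) has_vector_derivative (1 / R) *\<^sub>R f' (x $ i / R + 0 / R)) (at 0)"
  by (rule vector_diff_chain_at[OF l f])
 then have d1: "((\<lambda>r. f (x $ i / R + r / R)) has_vector_derivative (of_real (1 / R) * f' (x $ i / R))) (at 0)"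
  by (simp add: comp_def scaleR_conv_of_real)
 have "((\<lambda>r. - (\<eta> \<bullet> x) - r * (\<eta> $ i)) has_real_derivative - (\<eta> $ i)) (at 0)"
  by (auto intro!: derivative_eq_intros)
 note d2 = has_vector_derivative_cis[OF this]
 have "((\<lambda>r. X * (f (x $ i / R + r / R) * ?P * cis (- (\<eta> \<bullet> x) - r * (\<eta> $ i)))) has_vector_derivative
  X * (f (x $ i / R + 0 / R) * ?P * (\<i> * of_real (- (\<eta> $ i)) * cis (- (\<eta> \<bullet> x) - 0 * (\<eta> $ i))) +
   of_real (1 / R) * f' (x $ i / R) * ?P * cis (- (\<eta> \<bullet> x) - 0 * (\<eta> $ i)))) (at 0)"
  by (intro has_vector_derivative_mult_right has_vector_derivative_mult has_vector_derivative_mult_left d1 d2)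
 then show ?thesis
  unfolding space_cutoff_but_line
  by (simp add: axis_def add_divide_distrib inner_add_right inner_axis[unfolded axis_def] algebra_simps)
qed

lemma cutoff_wave_laplace:
 assumes e: "\<epsilon> > 0" and R: "R > 0"
 shows "laplace_x (cutoff_wave a b \<epsilon> R (\<eta> :: real ^ 'n)) (t, x) =
  of_real (time_cutoff a b \<epsilon> t) * phase t \<eta> *
   (cutoff_error R \<eta> x - of_real ((norm \<eta>)^2) * (of_real (space_cutoff R x) * cis (- (\<eta> \<bullet> x))))"
proof -
 let ?\<phi> = "cutoff_wave a b \<epsilon> R \<eta>"
 let ?X = "\<lambda>t. complex_of_real (time_cutoff a b \<epsilon> t) * phase t \<eta>"
 let ?e = "\<lambda>x. cis (- (\<eta> \<bullet> x))"
 note sm = cutoff_wave_smooth[OF e, of a b R \<eta>]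
 have b0: "((\<lambda>s. complex_of_real (bump s)) has_vector_derivative of_real (bump1 s)) (at s)" for s
  by (rule has_vector_derivative_complex_of_real) (auto intro!: derivative_eq_intros)
 have b1: "((\<lambda>s. complex_of_real (bump1 s)) has_vector_derivative of_real (bump2 s)) (at s)" for s
  by (rule has_vector_derivative_complex_of_real) (auto intro!: derivative_eq_intros)
 have D1: "dir_deriv (0, axis i 1) ?\<phi> (t, x) =
  ?X t * ((of_real (1 / R) * of_real (bump1 (x $ i / R)) - \<i> * of_real (\<eta> $ i) * of_real (bump (x $ i / R))) * of_real (space_cutoff_but R i x) * ?e x)" for t x i
 proof (rule dir_deriv_line[OF smooth_class_dir_deriv(1)[OF sm]])
  show "((\<lambda>r. ?\<phi> ((t, x) + r *\<^sub>R (0, axis i 1))) has_vector_derivative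
   ?X t * ((of_real (1 / R) * of_real (bump1 (x $ i / R)) - \<i> * of_real (\<eta> $ i) * of_real (bump (x $ i / R))) * of_real (space_cutoff_but R i x) * ?e x)) (at 0)"
   using cutoff_line_derivative[OF b0 R, of "?X t" x i \<eta>]
   unfolding cutoff_wave_def space_cutoff_split[of R _ i] by (simp add: mult.assoc)
 qed
 have D2: "dir_deriv (0, axis i 1) (dir_deriv (0, axis i 1) ?\<phi>) (t, x) =
  ?X t * ((of_real (bump2 (x $ i / R) / R\<^sup>2) - 2 * \<i> * of_real (\<eta> $ i) * of_real (bump1 (x $ i / R) / R) - of_real ((\<eta> $ i)^2) * of_real (bump (x $ i / R))) * of_real (space_cutoff_but R i x) * ?e x)" for i
 proof (rule dir_deriv_line[OF smooth_class_dir_deriv(1)[OF smooth_class_dir_deriv(2)[OF sm]]])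
  let ?f = "\<lambda>s. of_real (1 / R) * complex_of_real (bump1 s) - \<i> * of_real (\<eta> $ i) * of_real (bump s)"
  let ?f' = "\<lambda>s. of_real (1 / R) * complex_of_real (bump2 s) - \<i> * of_real (\<eta> $ i) * of_real (bump1 s)"
  have f: "(?f has_vector_derivative ?f' s) (at s)" for s
   by (intro has_vector_derivative_diff has_vector_derivative_mult_right b0 b1)
  have "(of_real (1 / R) * ?f' (x $ i / R) - \<i> * of_real (\<eta> $ i) * ?f (x $ i / R)) =
   of_real (bump2 (x $ i / R) / R\<^sup>2) - 2 * \<i> * of_real (\<eta> $ i) * of_real (bump1 (x $ i / R) / R) - of_real ((\<eta> $ i)^2) * of_real (bump (x $ i / R))"
   by (simp add: power2_eq_square algebra_simps)
  then show "((\<lambda>r. dir_deriv (0, axis i 1) ?\<phi> ((t, x) + r *\<^sub>R (0, axis i 1))) has_vector_derivative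
   ?X t * ((of_real (bump2 (x $ i / R) / R\<^sup>2) - 2 * \<i> * of_real (\<eta> $ i) * of_real (bump1 (x $ i / R) / R) - of_real ((\<eta> $ i)^2) * of_real (bump (x $ i / R))) * of_real (space_cutoff_but R i x) * ?e x)) (at 0)"
   using cutoff_line_derivative[OF f R, of "?X t" x i \<eta>] by (simp add: D1)
 qed
 have n2: "(norm \<eta>)^2 = (\<Sum>i\<in>UNIV. (\<eta> $ i)^2)"
  unfolding power2_norm_eq_inner inner_vec_def by (simp add: power2_eq_square)
 have "laplace_x ?\<phi> (t, x) = (\<Sum>i\<in>UNIV. ?X t * (((of_real (bump2 (x $ i / R) / R\<^sup>2) - 2 * \<i> * of_real (\<eta> $ i) * of_real (bump1 (x $ i / R) / R)) * of_real (space_cutoff_but R i x)) * ?e x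
   - of_real ((\<eta> $ i)^2) * (of_real (space_cutoff R x) * ?e x)))"
  unfolding laplace_x_def
 proof (rule sum.cong[OF refl])
  fix i
  show "dir_deriv (0, axis i 1) (dir_deriv (0, axis i 1) ?\<phi>) (t, x) = ?X t * (((of_real (bump2 (x $ i / R) / R\<^sup>2) - 2 * \<i> * of_real (\<eta> $ i) * of_real (bump1 (x $ i / R) / R)) * of_real (space_cutoff_but R i x)) * ?e x
   - of_real ((\<eta> $ i)^2) * (of_real (space_cutoff R x) * ?e x))"
   unfolding D2 space_cutoff_split[of R x i] by (simp add: algebra_simps)
 qed
 also have "\<dots> = ?X t * (cutoff_error R \<eta> x - of_real ((norm \<eta>)^2) * (of_real (space_cutoff R x) * ?e x))"
  unfolding cutoff_error_def n2 of_real_sum sum_distrib_left[symmetric] sum_subtractf sum_distrib_right ..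
 finally show ?thesis .
qed

section \<open>From distributional solutions to the Volterra equation\<close>

lemma L2_bounded_mult:
 assumes u: "u \<in> L2" and [measurable]: "m \<in> borel_measurable borel" and b: "\<And>x. norm (m x) \<le> A"
 shows "(\<lambda>x. m x * u x) \<in> L2" "N2 (\<lambda>x. m x * u x) \<le> A * N2 u"
proof -
 have A: "0 \<le> A" using b norm_ge_zero order_trans by blast
 note [measurable] = L2_space_measurable[OF u, simplified]
 show L: "(\<lambda>x. m x * u x) \<in> L2"
  by (rule L2_space_bound[OF u, where C=A]) (auto simp: norm_mult intro!: mult_right_mono b)
 have "(N2 (\<lambda>x. m x * u x))^2 \<le> (LB x. A^2 * (norm (u x))^2)"
  unfolding L2_norm_sq
 proof (rule integral_mono)
  show "(norm (m x * u x))^2 \<le> A^2 * (norm (u x))^2" for x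
   unfolding norm_mult power_mult_distrib by (intro mult_right_mono power_mono b) auto
 qed (use L2_space_integrable[OF L] L2_space_integrable[OF u] in auto)
 also have "\<dots> = (A * N2 u)^2" by (simp add: L2_norm_sq power_mult_distrib)
 finally show "N2 (\<lambda>x. m x * u x) \<le> A * N2 u"
  by (rule power2_le_imp_le) (use A in auto)
qed

lemma L12_bounded_support:
 fixes m :: "'a::euclidean_space \<Rightarrow> complex"
 assumes [measurable]: "m \<in> borel_measurable borel" and b: "\<And>x. norm (m x) \<le> A" and s: "\<And>x. m x \<noteq> 0 \<Longrightarrow> norm x \<le> r"
 shows "m \<in> L12"
proof -
 have i: "(\<lambda>x. indicator (cball 0 r) x :: complex) \<in> L2_space (lborel :: 'a measure)"
  by (rule indicator_L2_space) (auto intro!: emeasure_bounded_finite[unfolded infinity_ennreal_def])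
 have "norm (m x) \<le> A * norm (indicator (cball 0 r) x :: complex)" for x
 proof (cases "m x = 0")
  case True
  moreover have "0 \<le> A" using order_trans[OF norm_ge_zero b[of x]] .
  ultimately show ?thesis by simp
 qed (use b[of x] s[of x] in \<open>auto simp: indicator_def\<close>)
 then have L: "m \<in> L2" by (intro L2_space_bound[OF i, where C=A]) auto
 have "(\<lambda>x. m x * indicator (cball 0 r) x) = m" using s by (auto simp: indicator_def fun_eq_iff)
 then show ?thesis using L12_ball_cutoff[OF L, of r] by simp
qed

lemma L12_mult_L2:
 assumes m: "m \<in> L12" "\<And>x. norm (m x) \<le> A" and u: "u \<in> L2"
 shows "(\<lambda>x. m x * u x) \<in> L12"
 unfolding L12_def
 using L2_bounded_mult(1)[OF u L12D(3)[OF m(1)] m(2)] L2_mult_integrable[OF L12D(1)[OF m(1)] u] by simp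

definition cutoff2 :: "real \<Rightarrow> 'n \<Rightarrow> real ^ 'n \<Rightarrow> real" where
 "cutoff2 R i x = bump2 (x $ i / R) / R\<^sup>2 * space_cutoff_but R i x"

definition cutoff1 :: "real \<Rightarrow> 'n \<Rightarrow> real ^ 'n \<Rightarrow> real" where
 "cutoff1 R i x = bump1 (x $ i / R) / R * space_cutoff_but R i x"

lemma cutoffs_measurable [measurable]:
 "space_cutoff R \<in> borel_measurable (borel :: (real ^ 'n) measure)"
 "space_cutoff_but R i \<in> borel_measurable (borel :: (real ^ 'n) measure)"
 "cutoff1 R i \<in> borel_measurable (borel :: (real ^ 'n) measure)"
 "cutoff2 R i \<in> borel_measurable (borel :: (real ^ 'n) measure)"
proof -
 have [measurable]: "(\<lambda>x :: real ^ 'n. x $ j) \<in> borel_measurable borel" for j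
  by (intro borel_measurable_continuous_onI continuous_intros)
 show "space_cutoff R \<in> borel_measurable (borel :: (real ^ 'n) measure)"
  "space_cutoff_but R i \<in> borel_measurable (borel :: (real ^ 'n) measure)"
  "cutoff1 R i \<in> borel_measurable (borel :: (real ^ 'n) measure)"
  "cutoff2 R i \<in> borel_measurable (borel :: (real ^ 'n) measure)"
  unfolding space_cutoff_def[abs_def] space_cutoff_but_def[abs_def] cutoff1_def[abs_def] cutoff2_def[abs_def]
  by measurable
qed

lemma cutoffs_bounds:
 obtains A where "A > 0" "\<And>R (x :: real ^ 'n). \<bar>space_cutoff R x\<bar> \<le> A"
  "\<And>R i (x :: real ^ 'n). R > 0 \<Longrightarrow> \<bar>cutoff1 R i x\<bar> \<le> A / R"
  "\<And>R i (x :: real ^ 'n). R > 0 \<Longrightarrow> \<bar>cutoff2 R i x\<bar> \<le> A / R\<^sup>2"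
proof -
 obtain C where C: "C > 0" "\<And>s. \<bar>bump s\<bar> \<le> C" "\<And>s. \<bar>bump1 s\<bar> \<le> C" "\<And>s. \<bar>bump2 s\<bar> \<le> C"
  using bump_bounds by blast
 \<comment> \<open>At least 1, so that a product with fewer factors is still bounded by the full
   power.\<close>
 define D where "D = max 1 C"
 have D: "1 \<le> D" "\<And>s. \<bar>bump s\<bar> \<le> D" "\<And>s. \<bar>bump1 s\<bar> \<le> D" "\<And>s. \<bar>bump2 s\<bar> \<le> D"
  using order_trans[OF C(2) max.cobounded2] order_trans[OF C(3) max.cobounded2] order_trans[OF C(4) max.cobounded2]
  by (auto simp: D_def)
 have p: "(\<Prod>j\<in>J. \<bar>bump (x $ j / R)\<bar>) \<le> D ^ card J" for J R and x :: "real ^ 'n"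
  using D(1,2) by (intro prod_le_power) auto
 have but: "\<bar>space_cutoff_but R i x\<bar> \<le> D ^ CARD('n)" for R i and x :: "real ^ 'n"
 proof -
  have "\<bar>space_cutoff_but R i x\<bar> \<le> D ^ card (UNIV - {i})" unfolding space_cutoff_but_def abs_prod by (rule p)
  also have "\<dots> \<le> D ^ CARD('n)" using D(1) by (intro power_increasing card_mono) auto
  finally show ?thesis .
 qed
 have D0: "0 \<le> D" using D(1) by simp
 show ?thesis
 proof (rule that[of "D * D ^ CARD('n)"])
  show "0 < D * D ^ CARD('n)" using D(1) by simp
  show "\<bar>space_cutoff R x\<bar> \<le> D * D ^ CARD('n)" for R and x :: "real ^ 'n"
  proof -
   have "\<bar>space_cutoff R x\<bar> \<le> 1 * D ^ CARD('n)" unfolding space_cutoff_def abs_prod using p by simp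
   also have "\<dots> \<le> D * D ^ CARD('n)" using D(1) D0 by (intro mult_right_mono) auto
   finally show ?thesis .
  qed
  show "\<bar>cutoff1 R i x\<bar> \<le> D * D ^ CARD('n) / R" if "R > 0" for R i and x :: "real ^ 'n"
  proof -
   have "\<bar>bump1 (x $ i / R)\<bar> * \<bar>space_cutoff_but R i x\<bar> \<le> D * D ^ CARD('n)"
    by (intro mult_mono D but D0) auto
   then show ?thesis using that by (simp add: cutoff1_def abs_mult divide_right_mono)
  qed
  show "\<bar>cutoff2 R i x\<bar> \<le> D * D ^ CARD('n) / R\<^sup>2" if "R > 0" for R i and x :: "real ^ 'n"
  proof -
   have "\<bar>bump2 (x $ i / R)\<bar> * \<bar>space_cutoff_but R i x\<bar> \<le> D * D ^ CARD('n)"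
    by (intro mult_mono D but D0) auto
   then show ?thesis using that by (simp add: cutoff2_def abs_mult divide_right_mono)
  qed
 qed
qed

lemma cutoffs_support:
 fixes x :: "real ^ 'n"
 assumes R: "R > 0" and nz: "space_cutoff R x \<noteq> 0 \<or> cutoff1 R i x \<noteq> 0 \<or> cutoff2 R i x \<noteq> 0"
 shows "norm x \<le> real CARD('n) * R"
proof -
 have *: "\<bar>x $ j\<bar> \<le> R" for j
 proof -
  have "\<not> 1 \<le> \<bar>x $ j / R\<bar>"
  proof
   assume 1: "1 \<le> \<bar>x $ j / R\<bar>"
   note z = bump_outside[OF 1]
   have a: "space_cutoff R x = 0" unfolding space_cutoff_def using z(1) by (intro prod_zero) auto
   have b: "space_cutoff_but R i x = 0" if "j \<noteq> i"
    unfolding space_cutoff_but_def using z(1) that by (intro prod_zero) auto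
   show False using nz a b z by (cases "j = i") (auto simp: cutoff1_def cutoff2_def)
  qed
  then show ?thesis using R by (simp add: abs_divide)
 qed
 have "norm x \<le> (\<Sum>j\<in>UNIV. \<bar>x $ j\<bar>)" by (rule norm_le_l1_cart)
 also have "\<dots> \<le> (\<Sum>j\<in>(UNIV :: 'n set). R)" by (intro sum_mono *)
 finally show ?thesis by simp
qed

lemma space_cutoff_tendsto:
 "(\<lambda>m. space_cutoff (real (Suc m)) (x :: real ^ 'n)) \<longlonglongrightarrow> bump 0 ^ CARD('n)"
proof -
 have "(\<lambda>m. bump (x $ j / real (Suc m))) \<longlonglongrightarrow> bump 0" for j
 proof (rule isCont_tendsto_compose[where g=bump])
  show "isCont bump 0" using bump_continuous(1)[of UNIV "\<lambda>x. x"] by (simp add: continuous_on_eq_continuous_at)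
  show "(\<lambda>m. x $ j / real (Suc m)) \<longlonglongrightarrow> 0"
   using tendsto_mult_right_zero[OF LIMSEQ_inverse_real_of_nat, of "x $ j"] by (simp add: divide_inverse)
 qed
 then have "(\<lambda>m. \<Prod>j\<in>(UNIV :: 'n set). bump (x $ j / real (Suc m))) \<longlonglongrightarrow> (\<Prod>j\<in>(UNIV :: 'n set). bump 0)"
  by (intro tendsto_prod)
 then show ?thesis by (simp add: space_cutoff_def)
qed

lemma time_cutoff'_outside:
 assumes e: "\<epsilon> > 0" and ab: "a < b" and t: "t < a - \<epsilon> \<or> b + \<epsilon> < t"
 shows "time_cutoff' a b \<epsilon> t = 0"
proof -
 have "1 \<le> \<bar>(t - a) / \<epsilon>\<bar>" "1 \<le> \<bar>(t - b) / \<epsilon>\<bar>" using e ab t by (auto simp: abs_divide le_divide_eq)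
 then show ?thesis by (simp add: time_cutoff'_def bump_outside(1))
qed

lemma time_cutoff'_bound:
 obtains A where "\<And>t. \<bar>time_cutoff' a b \<epsilon> t\<bar> \<le> A"
proof -
 obtain C where "C > 0" and C: "\<And>s. \<bar>bump s\<bar> \<le> C" and "\<And>s. \<bar>bump1 s\<bar> \<le> C" "\<And>s. \<bar>bump2 s\<bar> \<le> C"
  by (rule bump_bounds) blast
 have d: "\<bar>bump s / \<epsilon>\<bar> \<le> C / \<bar>\<epsilon>\<bar>" for s unfolding abs_divide by (intro divide_right_mono C) simp
 have "\<bar>time_cutoff' a b \<epsilon> t\<bar> \<le> C / \<bar>\<epsilon>\<bar> + C / \<bar>\<epsilon>\<bar>" for t
  unfolding time_cutoff'_def
  by (rule order_trans[OF abs_triangle_ineq4 add_mono[OF d d]])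
 then show ?thesis by (rule that)
qed

lemma integrable_bounded_interval:
 fixes f :: "real \<Rightarrow> complex"
 assumes [measurable]: "f \<in> borel_measurable borel" and b: "\<And>t. norm (f t) \<le> A" and z: "\<And>t. t \<notin> {c..d} \<Longrightarrow> f t = 0"
 shows "integrable lborel f"
proof (rule lint_bound)
 show "integrable lborel (\<lambda>t. indicator {c..d} t * A)"
  by (rule integrable_Icc_const)
 show "AE t in lborel. norm (f t) \<le> norm (indicator {c..d} t * A)"
 proof (rule AE_I2)
  fix t show "norm (f t) \<le> norm (indicator {c..d} t * A)"
   using b[of t] z[of t] by (cases "t \<in> {c..d}") auto
 qed
qed measurable

lemma integrable_indicator_Icc: "integrable lborel (\<lambda>s. indicator {a..b::real} s :: complex)"
 by (rule integrable_bounded_interval[where A=1 and c=a and d=b]) (auto simp: indicator_def)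

lemma cutoffs_L12:
 assumes R: "R > 0"
 shows "(\<lambda>x :: real ^ 'n. complex_of_real (space_cutoff R x)) \<in> L12"
  "(\<lambda>x :: real ^ 'n. complex_of_real (cutoff1 R i x)) \<in> L12"
  "(\<lambda>x :: real ^ 'n. complex_of_real (cutoff2 R i x)) \<in> L12"
proof -
 obtain A where "A > 0" and A: "\<And>R (x :: real ^ 'n). \<bar>space_cutoff R x\<bar> \<le> A"
  "\<And>R i (x :: real ^ 'n). R > 0 \<Longrightarrow> \<bar>cutoff1 R i x\<bar> \<le> A / R"
  "\<And>R i (x :: real ^ 'n). R > 0 \<Longrightarrow> \<bar>cutoff2 R i x\<bar> \<le> A / R\<^sup>2"
  by (rule cutoffs_bounds[where 'n='n]) blast
 note s = cutoffs_support[OF R]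
 show "(\<lambda>x :: real ^ 'n. complex_of_real (space_cutoff R x)) \<in> L12"
  by (rule L12_bounded_support[where A=A and r="real CARD('n) * R"]) (use s A(1) in auto)
 show "(\<lambda>x :: real ^ 'n. complex_of_real (cutoff1 R i x)) \<in> L12"
  by (rule L12_bounded_support[where A="A / R" and r="real CARD('n) * R"]) (use s A(2)[OF R] in auto)
 show "(\<lambda>x :: real ^ 'n. complex_of_real (cutoff2 R i x)) \<in> L12"
  by (rule L12_bounded_support[where A="A / R\<^sup>2" and r="real CARD('n) * R"]) (use s A(3)[OF R] in auto)
qed

locale schroedinger = potential T C W for T C and W :: "real \<Rightarrow> real ^ 'n \<Rightarrow> complex"
begin

text \<open>The distributional equation with Borel functions and integrals over
  \<open>lborel\<close>; \<open>weak_solution_lebesgue_iff\<close> relates it to the Lebesgue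
  formulation.\<close>

definition weak_solution :: "(real \<Rightarrow> real ^ 'n \<Rightarrow> complex) \<Rightarrow> bool" where
 "weak_solution U \<longleftrightarrow> (\<forall>\<phi>. test_function T \<phi> \<longrightarrow>
  (LB t. indicator {0<..<T} t * (LB x. - \<i> * U t x * dt \<phi> (t, x))) =
  (LB t. indicator {0<..<T} t *
    (LB x. - U t x * laplace_x \<phi> (t, x) + W t x * U t x * \<phi> (t, x))))"

end

text \<open>A distributional solution in normal form: jointly measurable, bounded in L^2 and
  extended by 0 to all times. \<open>L2_path_joint_version\<close> provides such a version of a
  continuous path.\<close>

locale schroedinger_flow = schroedinger T C W for T C and W :: "real \<Rightarrow> real ^ 'n \<Rightarrow> complex" +
 fixes U :: "real \<Rightarrow> real ^ 'n \<Rightarrow> complex" and M :: real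
 assumes U_measurable [measurable]: "joint U"
  and U_L2: "\<And>t. U t \<in> L2" and U_norm: "\<And>t. N2 (U t) \<le> M"
  and U_outside: "\<And>t x. t \<notin> {0..T} \<Longrightarrow> U t x = 0"
  and U_continuous: "\<And>t. t \<in> {0..T} \<Longrightarrow> ((\<lambda>s. N2 (\<lambda>x. U s x - U t x)) \<longlongrightarrow> 0) (at t within {0..T})"
  and weak: "weak_solution U"
begin

lemma M_nonneg: "0 \<le> M"
 using order_trans[OF L2_norm_nonneg U_norm] .

definition wave :: "real \<Rightarrow> real ^ 'n \<Rightarrow> real ^ 'n \<Rightarrow> complex" where
 "wave R \<eta> x = of_real (space_cutoff R x) * cis (- (\<eta> \<bullet> x))"

text \<open>A cut-off version of the interaction-picture transform of U t, defined at every \<eta>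
  because the spatial cut-off makes the integrand integrable.\<close>

definition alpha :: "real \<Rightarrow> real ^ 'n \<Rightarrow> real \<Rightarrow> complex" where
 "alpha R \<eta> t = phase t \<eta> * (LB x. U t x * wave R \<eta> x)"

text \<open>The function for which -\<i> times the time integral of \<open>rho\<close> is the
  increment of \<open>alpha\<close>; its first integral comes from the potential, the second from
  derivatives that fall on the spatial cut-off.\<close>

definition rho :: "real \<Rightarrow> real ^ 'n \<Rightarrow> real \<Rightarrow> complex" where
 "rho R \<eta> t = phase t \<eta> * ((LB x. (W t x * U t x) * wave R \<eta> x) - (LB x. U t x * cutoff_error R \<eta> x))"

lemma cutoff_error_eq: "cutoff_error R \<eta> x =
  (\<Sum>i\<in>UNIV. of_real (cutoff2 R i x) - 2 * \<i> * of_real (\<eta> $ i) * of_real (cutoff1 R i x)) * cis (- (\<eta> \<bullet> x))"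
 unfolding cutoff_error_def cutoff1_def cutoff2_def by (simp add: left_diff_distrib mult.assoc)

lemma cutoff_error_joint [measurable]: "(\<lambda>(\<eta> :: real ^ 'n, x). cutoff_error R \<eta> x) \<in> borel_measurable (borel \<Otimes>\<^sub>M borel)"
proof -
 have [measurable]: "(\<lambda>x :: real ^ 'n. x $ j) \<in> borel_measurable borel" for j
  by (intro borel_measurable_continuous_onI continuous_intros)
 show ?thesis unfolding cutoff_error_eq by measurable
qed

lemma wave_joint [measurable]: "joint (\<lambda>\<eta> x. wave R \<eta> x)"
 unfolding wave_def by measurable

lemma wave_L2:
 assumes R: "R > 0"
 shows "wave R \<eta> \<in> L2" "N2 (wave R \<eta>) = N2 (\<lambda>x. complex_of_real (space_cutoff R (x :: real ^ 'n)))"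
proof -
 show "wave R \<eta> \<in> L2"
  by (rule L2_space_norm_eq[OF L12D(1)[OF cutoffs_L12(1)[OF R]]]) (auto simp: wave_def norm_mult)
 show "N2 (wave R \<eta>) = N2 (\<lambda>x. complex_of_real (space_cutoff R (x :: real ^ 'n)))"
  by (rule L2_norm_cong) (simp add: wave_def norm_mult)
qed

lemma cutoff_error_L2:
 assumes R: "R > 0"
 shows "cutoff_error R (\<eta> :: real ^ 'n) \<in> L2"
proof -
 have "(\<lambda>x. \<Sum>i\<in>UNIV. of_real (cutoff2 R i x) - 2 * \<i> * of_real (\<eta> $ i) * of_real (cutoff1 R i x)) \<in> L2"
  by (intro L2_space_sum L2_space_diff L2_space_cmult L12D(1) cutoffs_L12 R)
 then show ?thesis
  by (rule L2_space_norm_eq) (use measurable_Pair2[OF cutoff_error_joint, of \<eta>] in \<open>auto simp: cutoff_error_eq norm_mult\<close>)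
qed

lemma WU_L2: "(\<lambda>x. W t x * U t x) \<in> L2" "N2 (\<lambda>x. W t x * U t x) \<le> C * M"
proof -
 show "(\<lambda>x. W t x * U t x) \<in> L2" by (rule L12D(1)[OF W_mult_L12(1)[OF U_L2]])
 show "N2 (\<lambda>x. W t x * U t x) \<le> C * M"
  by (rule order_trans[OF W_mult_L12(2)[OF U_L2]]) (intro mult_left_mono U_norm C_nonneg)
qed

lemma alpha_bound:
 assumes R: "R > 0"
 shows "norm (alpha R \<eta> t) \<le> M * N2 (wave R \<eta>)"
proof -
 have "norm (LB x. U t x * wave R \<eta> x) \<le> N2 (U t) * N2 (wave R \<eta>)"
  by (rule L2_Cauchy_Schwarz[OF U_L2 wave_L2(1)[OF R]])
 also have "\<dots> \<le> M * N2 (wave R \<eta>)" by (intro mult_right_mono U_norm) simp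
 finally show ?thesis by (simp add: alpha_def norm_mult)
qed

lemma rho_bound:
 assumes R: "R > 0"
 shows "norm (rho R \<eta> t) \<le> C * M * N2 (wave R \<eta>) + M * N2 (cutoff_error R \<eta>)"
proof -
 have "norm (LB x. (W t x * U t x) * wave R \<eta> x) \<le> C * M * N2 (wave R \<eta>)"
  by (rule order_trans[OF L2_Cauchy_Schwarz[OF WU_L2(1) wave_L2(1)[OF R]]]) (intro mult_right_mono WU_L2(2), simp)
 moreover have "norm (LB x. U t x * cutoff_error R \<eta> x) \<le> M * N2 (cutoff_error R \<eta>)"
  by (rule order_trans[OF L2_Cauchy_Schwarz[OF U_L2 cutoff_error_L2[OF R]]]) (intro mult_right_mono U_norm, simp)
 ultimately show ?thesis
  unfolding rho_def norm_mult norm_cis mult_1_left by (intro order_trans[OF norm_triangle_ineq4]) linarith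
qed

lemma alpha_measurable [measurable]: "joint (\<lambda>\<eta> t. alpha R \<eta> t)"
 unfolding alpha_def by measurable

lemma rho_measurable [measurable]: "joint (\<lambda>\<eta> t. rho R \<eta> t)"
 unfolding rho_def by measurable

lemma rho_outside: "t \<notin> {0..T} \<Longrightarrow> rho R \<eta> t = 0"
 by (simp add: rho_def U_outside)

lemma rho_integrable:
 assumes R: "R > 0" shows "integrable lborel (rho R \<eta>)"
 by (rule integrable_bounded_interval[OF _ rho_bound[OF R] rho_outside]) measurable

lemma alpha_tendsto:
 assumes R: "R > 0" and t: "t \<in> {0..T}"
 shows "(alpha R \<eta> \<longlongrightarrow> alpha R \<eta> t) (at t within {0..T})"
 unfolding alpha_def[abs_def]
 by (intro tendsto_mult integral_L2_tendsto[OF U_L2 U_L2 wave_L2(1)[OF R] U_continuous[OF t]])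
  (auto simp: cis_conv_exp intro!: tendsto_intros)

text \<open>Tested with \<open>cutoff_wave\<close>, both sides of the equation contain |\<eta>|^2
  times the cut-off \<open>alpha\<close>: on the left from the time derivative of the phase, on the
  right from the Laplacian. These terms cancel and leave the weak form of the equation for
  \<open>alpha\<close>.\<close>

lemma alpha_increment_interior:
 assumes R: "R > 0" and ab: "0 < a" "a < b" "b < T"
 shows "alpha R \<eta> b - alpha R \<eta> a = - \<i> * (LB t. indicator {a..b} t * rho R \<eta> t)"
proof (rule weak_derivative_integral[OF _ _ alpha_bound[OF R] _ _ rho_integrable[OF R] ab])
 show "alpha R \<eta> \<in> borel_measurable borel" "rho R \<eta> \<in> borel_measurable borel" by measurable
 have ic: "isCont (alpha R \<eta>) t" if "0 < t" "t < T" for t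
 proof -
  have "at t within {0..T} = at t" using that by (intro at_within_interior) (auto simp: interior_atLeastAtMost_real)
  then show ?thesis using alpha_tendsto[OF R, of t \<eta>] that by (simp add: isCont_def)
 qed
 show "isCont (alpha R \<eta>) a" "isCont (alpha R \<eta>) b" using ab by (auto intro: ic)
 fix \<epsilon> :: real assume e: "0 < \<epsilon>" "0 < a - \<epsilon>" "b + \<epsilon> < T"
 let ?\<phi> = "cutoff_wave a b \<epsilon> R \<eta>"
 let ?\<chi> = "\<lambda>t. complex_of_real (time_cutoff a b \<epsilon> t)" and ?\<chi>' = "\<lambda>t. complex_of_real (time_cutoff' a b \<epsilon> t)"
 let ?n = "complex_of_real ((norm \<eta>)^2)"
 have \<chi>0: "?\<chi> t = 0" "?\<chi>' t = 0" if "t \<notin> {0<..<T}" for t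
  using that e ab time_cutoff_outside[of \<epsilon> a b t] time_cutoff'_outside[of \<epsilon> a b t] by auto
 note Uw = L2_mult_integrable[OF U_L2 wave_L2(1)[OF R]]
 note UE = L2_mult_integrable[OF U_L2 cutoff_error_L2[OF R]]
 note WUw = L2_mult_integrable[OF WU_L2(1) wave_L2(1)[OF R]]
 have L: "indicator {0<..<T} t * (LB x. - \<i> * U t x * dt ?\<phi> (t, x)) =
  - \<i> * (?\<chi>' t * alpha R \<eta> t) + ?n * (?\<chi> t * alpha R \<eta> t)" for t
 proof (cases "t \<in> {0<..<T}")
  case True
  have "(LB x. - \<i> * U t x * dt ?\<phi> (t, x)) =
   (LB x. (- \<i> * (?\<chi>' t + \<i> * ?n * ?\<chi> t) * phase t \<eta>) * (U t x * wave R \<eta> x))"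
   by (intro lint_cong refl) (simp only: cutoff_wave_dt[OF e(1)] wave_def ac_simps)
  also have "\<dots> = (- \<i> * (?\<chi>' t + \<i> * ?n * ?\<chi> t) * phase t \<eta>) * (LB x. U t x * wave R \<eta> x)"
   by (rule integral_mult_right_zero)
  also have "\<dots> = - \<i> * (?\<chi>' t * alpha R \<eta> t) + ?n * (?\<chi> t * alpha R \<eta> t)"
   unfolding alpha_def by (simp add: algebra_simps)
  finally show ?thesis using True by simp
 qed (use \<chi>0[of t] in simp)
 have Rr: "indicator {0<..<T} t * (LB x. - U t x * laplace_x ?\<phi> (t, x) + W t x * U t x * ?\<phi> (t, x)) =
  ?n * (?\<chi> t * alpha R \<eta> t) + ?\<chi> t * rho R \<eta> t" for t
 proof (cases "t \<in> {0<..<T}")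
  case True
  let ?X = "?\<chi> t * phase t \<eta>"
  have "(LB x. - U t x * laplace_x ?\<phi> (t, x) + W t x * U t x * ?\<phi> (t, x)) =
   (LB x. ?X * (?n * (U t x * wave R \<eta> x) + ((W t x * U t x) * wave R \<eta> x - U t x * cutoff_error R \<eta> x)))"
  proof (intro lint_cong refl)
   fix x
   show "- U t x * laplace_x ?\<phi> (t, x) + W t x * U t x * ?\<phi> (t, x) =
    ?X * (?n * (U t x * wave R \<eta> x) + ((W t x * U t x) * wave R \<eta> x - U t x * cutoff_error R \<eta> x))"
    unfolding cutoff_wave_laplace[OF e(1) R] cutoff_wave_def[of a b \<epsilon> R \<eta> "(t, x)"] wave_def fst_conv snd_conv
    by (simp add: algebra_simps)
  qed
  also have "\<dots> = ?X * (?n * (LB x. U t x * wave R \<eta> x) + ((LB x. (W t x * U t x) * wave R \<eta> x) - (LB x. U t x * cutoff_error R \<eta> x)))"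
   unfolding integral_mult_right_zero
   by (subst lint_add lint_diff,
     (intro integrable_mult_right lint_integrable_diff Uw UE WUw)+)+
    (simp add: lint_diff[OF WUw UE])
  also have "\<dots> = ?n * (?\<chi> t * alpha R \<eta> t) + ?\<chi> t * rho R \<eta> t"
   unfolding alpha_def rho_def by (simp add: algebra_simps)
  finally show ?thesis using True by simp
 qed (use \<chi>0[of t] in simp)
 obtain A' where A': "\<And>t. \<bar>time_cutoff' a b \<epsilon> t\<bar> \<le> A'" using time_cutoff'_bound by blast
 have t0: "t \<notin> {0<..<T}" if "t \<notin> {0..T}" for t :: real using that by auto
 have i1: "integrable lborel (\<lambda>t. ?\<chi>' t * alpha R \<eta> t)"
 proof (rule integrable_bounded_interval)
  show "norm (?\<chi>' t * alpha R \<eta> t) \<le> A' * (M * N2 (wave R \<eta>))" for t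
   unfolding norm_mult norm_of_real using order_trans[OF abs_ge_zero A'[of t]] by (intro mult_mono A' alpha_bound R) auto
  show "?\<chi>' t * alpha R \<eta> t = 0" if "t \<notin> {0..T}" for t using \<chi>0[OF t0[OF that]] by simp
 qed measurable
 have i2: "integrable lborel (\<lambda>t. ?\<chi> t * alpha R \<eta> t)"
 proof (rule integrable_bounded_interval)
  show "norm (?\<chi> t * alpha R \<eta> t) \<le> bump_mass * (M * N2 (wave R \<eta>))" for t
   unfolding norm_mult norm_of_real using bump_mass_pos by (intro mult_mono time_cutoff_bound alpha_bound R) auto
  show "?\<chi> t * alpha R \<eta> t = 0" if "t \<notin> {0..T}" for t using \<chi>0[OF t0[OF that]] by simp
 qed measurable
 have i3: "integrable lborel (\<lambda>t. ?\<chi> t * rho R \<eta> t)"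
 proof (rule integrable_bounded_interval)
  show "norm (?\<chi> t * rho R \<eta> t) \<le> bump_mass * (C * M * N2 (wave R \<eta>) + M * N2 (cutoff_error R \<eta>))" for t
   unfolding norm_mult norm_of_real using bump_mass_pos by (intro mult_mono time_cutoff_bound rho_bound R) auto
  show "?\<chi> t * rho R \<eta> t = 0" if "t \<notin> {0..T}" for t using \<chi>0[OF t0[OF that]] by simp
 qed measurable
 have "(LB t. - \<i> * (?\<chi>' t * alpha R \<eta> t) + ?n * (?\<chi> t * alpha R \<eta> t)) =
  (LB t. ?n * (?\<chi> t * alpha R \<eta> t) + ?\<chi> t * rho R \<eta> t)"
  using weak cutoff_wave_test_function[OF e ab(2) R, of \<eta>] unfolding weak_solution_def L[symmetric] Rr[symmetric] by blast
 moreover have "(LB t. - \<i> * (?\<chi>' t * alpha R \<eta> t) + ?n * (?\<chi> t * alpha R \<eta> t)) =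
  - \<i> * (LB t. ?\<chi>' t * alpha R \<eta> t) + ?n * (LB t. ?\<chi> t * alpha R \<eta> t)"
  by (subst lint_add[OF integrable_mult_right[OF i1] integrable_mult_right[OF i2]]) (simp only: integral_mult_right_zero)
 moreover have "(LB t. ?n * (?\<chi> t * alpha R \<eta> t) + ?\<chi> t * rho R \<eta> t) =
  ?n * (LB t. ?\<chi> t * alpha R \<eta> t) + (LB t. ?\<chi> t * rho R \<eta> t)"
  by (subst lint_add[OF integrable_mult_right[OF i2] i3]) (simp only: integral_mult_right_zero)
 ultimately show "- \<i> * (LB t. ?\<chi>' t * alpha R \<eta> t) = (LB t. ?\<chi> t * rho R \<eta> t)"
  by (simp add: add.commute)
qed

text \<open>Test functions are supported in the open slab, so the end points 0 and t are reached
  from inside, by continuity of \<open>alpha\<close> and dominated convergence of the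
  integral.\<close>

lemma alpha_increment:
 assumes R: "R > 0" and t: "t \<in> {0..T}"
 shows "alpha R \<eta> t - alpha R \<eta> 0 = - \<i> * (LB s. indicator {0..t} s * rho R \<eta> s)"
proof (cases "t = 0")
 case True
 have "(LB s. indicator {0..t} s * rho R \<eta> s) = (LINT s|(lborel :: real measure). 0)"
 proof (rule integral_cong_AE)
  have "AE s in lborel. s \<noteq> (0::real)" by (rule AE_lborel_singleton)
  then show "AE s in lborel. indicator {0..t} s * rho R \<eta> s = 0" by eventually_elim (simp add: True indicator_def)
 qed measurable
 then show ?thesis using True by simp
next
 case False
 then have t0: "0 < t" "t \<le> T" using t by auto
 \<comment> \<open>The denominator is at least 3, hence a n \<le> t/3 and the interval from a n to t
   - a n is not degenerate.\<close>
 define a where "a n = t * inverse (real (Suc n) + 2)" for n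
 define b where "b n = t - a n" for n
 have i3: "0 < inverse (real (Suc n) + 2)" "inverse (real (Suc n) + 2) \<le> 1/3" for n by (auto simp: divide_simps)
 have a: "0 < a n" "a n \<le> t * (1/3)" for n
  unfolding a_def using t0 i3[of n] by (auto intro!: mult_pos_pos mult_left_mono)
 have ab: "0 < a n" "a n < b n" "b n < T" for n using a[of n] t0 by (auto simp: b_def)
 have alim: "a \<longlonglongrightarrow> 0" unfolding a_def by real_asymp
 then have blim: "b \<longlonglongrightarrow> t" unfolding b_def[abs_def] by (auto intro!: tendsto_eq_intros)
 have A: "(\<lambda>n. alpha R \<eta> (x n)) \<longlonglongrightarrow> alpha R \<eta> y" if "x \<longlonglongrightarrow> y" "\<And>n. x n \<in> {0..T}" "\<And>n. x n \<noteq> y" "y \<in> {0..T}" for x y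
  by (rule filterlim_compose[OF alpha_tendsto[OF R that(4)]])
   (use that in \<open>auto simp: filterlim_at\<close>)
 have ar: "a n \<in> {0..T}" "a n \<noteq> 0" and br: "b n \<in> {0..T}" "b n \<noteq> t" for n
  using a(1)[of n] ab(2,3)[of n] by (auto simp: b_def)
 have "(\<lambda>n. alpha R \<eta> (b n) - alpha R \<eta> (a n)) \<longlonglongrightarrow> alpha R \<eta> t - alpha R \<eta> 0"
  by (intro tendsto_diff A[OF blim br(1) br(2) t] A[OF alim ar(1) ar(2)]) (use t0 in simp)
 moreover have "(\<lambda>n. - \<i> * (LB s. indicator {a n..b n} s * rho R \<eta> s)) \<longlonglongrightarrow> - \<i> * (LB s. indicator {0..t} s * rho R \<eta> s)"
 proof (intro tendsto_mult tendsto_const integral_dominated_convergence[where w="\<lambda>s. norm (rho R \<eta> s)"])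
  show "integrable lborel (\<lambda>s. norm (rho R \<eta> s))" using rho_integrable[OF R] by simp
  have ae: "AE s in lborel. s \<noteq> (0::real)" "AE s in lborel. s \<noteq> t" by (rule AE_lborel_singleton)+
  show "AE s in lborel. (\<lambda>n. indicator {a n..b n} s * rho R \<eta> s) \<longlonglongrightarrow> indicator {0..t} s * rho R \<eta> s"
   using ae
  proof eventually_elim
   case (elim s)
   have "\<forall>\<^sub>F n in sequentially. indicator {a n..b n} s = (indicator {0..t} s :: complex)"
   proof (cases "s \<in> {0..t}")
    case True
    then have "0 < s" "s < t" using elim by auto
    then have "\<forall>\<^sub>F n in sequentially. a n < s" "\<forall>\<^sub>F n in sequentially. s < b n"
     using order_tendstoD(2)[OF alim] order_tendstoD(1)[OF blim] by auto
    then show ?thesis by eventually_elim (use True in \<open>simp add: indicator_def\<close>)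
   next
    case False
    then have "s \<notin> {a n..b n}" for n using a[of n] by (auto simp: b_def)
    then show ?thesis using False by simp
   qed
   then show ?case by (intro tendsto_mult tendsto_const tendsto_eventually)
  qed
  show "AE s in lborel. norm (indicator {a n..b n} s * rho R \<eta> s) \<le> norm (rho R \<eta> s)" for n
   by (intro AE_I2) (auto simp: indicator_def)
 qed measurable
 ultimately show ?thesis unfolding alpha_increment_interior[OF R ab] by (rule LIMSEQ_unique)
qed

end

section \<open>Removal of the spatial cut-off by pairing in frequency\<close>

lemma L2_norm_fourier:
 fixes v :: "'a::euclidean_space \<Rightarrow> complex"
 assumes v: "v \<in> L12"
 shows "N2 (fourier (-1) v) = sqrt (fourier_const DIM('a)) * N2 v"
 by (rule power2_eq_imp_eq)
  (use ft_pair_norm[OF ft_pair_fourier[OF v]] less_imp_le[OF fourier_const_pos[of "DIM('a)"]] in \<open>simp_all add: power_mult_distrib\<close>)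

lemma fourier_pairing_bound:
 fixes v g :: "'a::euclidean_space \<Rightarrow> complex"
 assumes v: "v \<in> L12" and g: "g \<in> L2"
 shows "norm (LB \<eta>. g \<eta> * fourier (-1) v \<eta>) \<le> N2 g * (sqrt (fourier_const DIM('a)) * N2 v)"
 using L2_Cauchy_Schwarz[OF g Plancherel(1)[OF v, of "-1"]] by (simp add: L2_norm_fourier[OF v])

lemma multiplier_pairing_bound:
 fixes v g m :: "'a::euclidean_space \<Rightarrow> complex"
 assumes m: "m \<in> L12" "\<And>x. norm (m x) \<le> A" and v: "v \<in> L2" and g: "g \<in> L2"
 shows "norm (LB \<eta>. g \<eta> * fourier (-1) (\<lambda>x. m x * v x) \<eta>) \<le>
  N2 g * (sqrt (fourier_const DIM('a)) * (A * N2 v))"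
proof (rule order_trans[OF fourier_pairing_bound[OF L12_mult_L2[OF m v] g]])
 show "N2 g * (sqrt (fourier_const DIM('a)) * N2 (\<lambda>x. m x * v x)) \<le>
  N2 g * (sqrt (fourier_const DIM('a)) * (A * N2 v))"
  by (rule mult_left_mono[OF mult_left_mono[OF L2_bounded_mult(2)[OF v L12D(3)[OF m(1)] m(2)]]])
   (simp_all add: less_imp_le)
qed

lemma multiplier_pairing_bound_cart:
 fixes v g m :: "real ^ 'n \<Rightarrow> complex"
 assumes "m \<in> L12" "\<And>x. norm (m x) \<le> A" "v \<in> L2" "g \<in> L2"
 shows "norm (LB \<eta>. g \<eta> * fourier (-1) (\<lambda>x. m x * v x) \<eta>) \<le>
  N2 g * (sqrt (fourier_const CARD('n)) * (A * N2 v))"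
 using multiplier_pairing_bound[OF assms] by simp

text \<open>Once the transform is moved onto g, the cut-off is a bounded factor that converges
  pointwise, and dominated convergence applies.\<close>

lemma cutoff_pairing_tendsto:
 fixes v g :: "real ^ 'n \<Rightarrow> complex"
 assumes v: "v \<in> L2" and g: "g \<in> L12"
 shows "(\<lambda>m. LB \<eta>. g \<eta> * fourier (-1) (\<lambda>x. of_real (space_cutoff (real (Suc m)) x) * v x) \<eta>)
  \<longlonglongrightarrow> of_real (bump 0 ^ CARD('n)) * (LB x. v x * fourier (-1) g x)"
proof -
 obtain A where "A > 0" and A: "\<And>R (x :: real ^ 'n). \<bar>space_cutoff R x\<bar> \<le> A"
  by (rule cutoffs_bounds[where 'n='n]) blast
 note [measurable] = L2_space_measurable[OF v, simplified] L12D(3)[OF g]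
 let ?\<theta> = "\<lambda>m x. complex_of_real (space_cutoff (real (Suc m)) (x :: real ^ 'n))"
 have L: "(\<lambda>x. ?\<theta> m x * v x) \<in> L12" for m
  by (rule L12_mult_L2[OF cutoffs_L12(1), where A=A]) (use A(1) v in auto)
 have "(LB \<eta>. g \<eta> * fourier (-1) (\<lambda>x. ?\<theta> m x * v x) \<eta>) =
   (LB x. ?\<theta> m x * (v x * fourier (-1) g x))" for m
  using fourier_mult[OF L12D(2)[OF g] L12D(2)[OF L[of m]], of "-1"] by (simp only: ac_simps)
 moreover have "(\<lambda>m. LB x. ?\<theta> m x * (v x * fourier (-1) g x)) \<longlonglongrightarrow>
   (LB x. of_real (bump 0 ^ CARD('n)) * (v x * fourier (-1) g x))"
 proof (rule integral_dominated_convergence[where w="\<lambda>x. A * norm (v x * fourier (-1) g x)"])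
  show "integrable lborel (\<lambda>x. A * norm (v x * fourier (-1) g x))"
   using L2_mult_integrable[OF v Plancherel(1)[OF g, of "-1"]] by simp
  show "AE x in lborel. (\<lambda>m. ?\<theta> m x * (v x * fourier (-1) g x)) \<longlonglongrightarrow> of_real (bump 0 ^ CARD('n)) * (v x * fourier (-1) g x)"
   by (intro AE_I2 tendsto_mult tendsto_const tendsto_of_real space_cutoff_tendsto)
  show "AE x in lborel. norm (?\<theta> m x * (v x * fourier (-1) g x)) \<le> A * norm (v x * fourier (-1) g x)" for m
   unfolding norm_mult[of "?\<theta> m _"] norm_of_real by (intro AE_I2 mult_right_mono A) auto
 qed measurable
 ultimately show ?thesis by simp
qed

lemma chirp_L12:
 assumes g: "g \<in> L12"
 shows "(\<lambda>\<eta>. phase t \<eta> * g \<eta>) \<in> L12"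
 unfolding L12_def using L12D[OF g]
 by (auto intro!: integrable_cis_mult L2_space_norm_eq[where f=g] simp: norm_mult)

context schroedinger_flow
begin

lemma U_slice_measurable [measurable]: "U t \<in> borel_measurable borel"
 using L2_space_measurable[OF U_L2] by simp

lemma alpha_fourier:
 "alpha R \<eta> t = phase t \<eta> * fourier (-1) (\<lambda>x. of_real (space_cutoff R x) * U t x) \<eta>"
 unfolding alpha_def fourier_def wave_def by (simp add: ac_simps)

text \<open>The error splits into transforms of U times small multipliers, with coefficients linear
  in \<eta>. These coefficients are why test functions of bounded support are used.\<close>

lemma error_fourier:
 assumes R: "R > 0"
 shows "(LB x. U t x * cutoff_error R \<eta> x) =
  (\<Sum>i\<in>UNIV. fourier (-1) (\<lambda>x. of_real (cutoff2 R i x) * U t x) \<eta> - 2 * \<i> * of_real (\<eta> $ i) * fourier (-1) (\<lambda>x. of_real (cutoff1 R i x) * U t x) \<eta>)"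
proof -
 have int: "integrable lborel (\<lambda>x. cis (- 1 * (\<eta> \<bullet> x)) * (m x * U t x))" if "m \<in> L12" for m
  by (intro integrable_cis_mult L2_mult_integrable[OF L12D(1)[OF that] U_L2]) measurable
 note i1 = int[OF cutoffs_L12(2)[OF R]] and i2 = int[OF cutoffs_L12(3)[OF R]]
 have "(LB x. U t x * cutoff_error R \<eta> x) =
  (LB x. (\<Sum>i\<in>UNIV. cis (- 1 * (\<eta> \<bullet> x)) * (of_real (cutoff2 R i x) * U t x) -
    2 * \<i> * of_real (\<eta> $ i) * (cis (- 1 * (\<eta> \<bullet> x)) * (of_real (cutoff1 R i x) * U t x))))"
  unfolding cutoff_error_eq by (intro lint_cong refl) (simp add: sum_distrib_left sum_distrib_right algebra_simps)
 also have "\<dots> = (\<Sum>i\<in>UNIV. (LB x. cis (- 1 * (\<eta> \<bullet> x)) * (of_real (cutoff2 R i x) * U t x) -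
    2 * \<i> * of_real (\<eta> $ i) * (cis (- 1 * (\<eta> \<bullet> x)) * (of_real (cutoff1 R i x) * U t x))))"
  by (intro lint_sum lint_integrable_diff integrable_mult_right i1 i2)
 also have "\<dots> = (\<Sum>i\<in>UNIV. fourier (-1) (\<lambda>x. of_real (cutoff2 R i x) * U t x) \<eta> - 2 * \<i> * of_real (\<eta> $ i) * fourier (-1) (\<lambda>x. of_real (cutoff1 R i x) * U t x) \<eta>)"
 proof (intro sum.cong refl)
  fix i
  show "(LB x. cis (- 1 * (\<eta> \<bullet> x)) * (of_real (cutoff2 R i x) * U t x) -
    2 * \<i> * of_real (\<eta> $ i) * (cis (- 1 * (\<eta> \<bullet> x)) * (of_real (cutoff1 R i x) * U t x))) =
   fourier (-1) (\<lambda>x. of_real (cutoff2 R i x) * U t x) \<eta> - 2 * \<i> * of_real (\<eta> $ i) * fourier (-1) (\<lambda>x. of_real (cutoff1 R i x) * U t x) \<eta>"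
   unfolding fourier_def lint_diff[OF i2 integrable_mult_right[OF i1]] integral_mult_right_zero ..
 qed
 finally show ?thesis .
qed

definition WU :: "real \<Rightarrow> real ^ 'n \<Rightarrow> complex" where
 "WU t x = W t x * U t x"

lemma WU_L12: "WU t \<in> L12"
 unfolding WU_def[abs_def] by (rule W_mult_L12(1)[OF U_L2])

lemma WU_norm: "N2 (WU t) \<le> C * M"
 unfolding WU_def[abs_def] by (rule WU_L2(2))

lemma WU_measurable [measurable]: "joint WU"
 unfolding WU_def by measurable

lemma rho_fourier: "rho R \<eta> t = phase t \<eta> * fourier (-1) (\<lambda>x. of_real (space_cutoff R x) * WU t x) \<eta> -
  phase t \<eta> * (LB x. U t x * cutoff_error R \<eta> x)"
 unfolding rho_def right_diff_distrib fourier_def wave_def WU_def by (simp add: ac_simps)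

text \<open>The integrand of Duhamel's formula in the interaction picture; it becomes
  \<open>B s (K s)\<close> once the transform of U is expressed through K.\<close>

definition duhamel :: "real \<Rightarrow> real ^ 'n \<Rightarrow> complex" where
 "duhamel s \<eta> = phase s \<eta> * fourier (-1) (WU s) \<eta>"

lemma duhamel_measurable [measurable]: "joint duhamel"
 unfolding duhamel_def fourier_def by measurable

lemma duhamel_L2: "duhamel s \<in> L2" "N2 (duhamel s) \<le> sqrt (fourier_const CARD('n)) * (C * M)"
proof -
 have F: "fourier (-1) (WU s) \<in> L2" by (rule Plancherel(1)[OF WU_L12]) simp
 note [measurable] = L2_space_measurable[OF F, simplified]
 show "duhamel s \<in> L2"
  unfolding duhamel_def[abs_def] by (rule L2_space_norm_eq[OF F]) (auto simp: norm_mult)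
 have "N2 (duhamel s) = N2 (fourier (-1) (WU s))"
  by (rule L2_norm_cong) (simp add: duhamel_def norm_mult)
 also have "\<dots> \<le> sqrt (fourier_const CARD('n)) * (C * M)"
  unfolding L2_norm_fourier[OF WU_L12] using WU_norm[of s] by (simp add: mult_left_mono less_imp_le)
 finally show "N2 (duhamel s) \<le> sqrt (fourier_const CARD('n)) * (C * M)" .
qed

lemma duhamel_bound: obtains D where "\<And>s \<eta>. norm (duhamel s \<eta>) \<le> D"
proof
 fix s \<eta>
 have "norm (duhamel s \<eta>) \<le> (LB x. norm (WU s x))"
  unfolding duhamel_def norm_mult norm_cis mult_1_left by (rule norm_fourier_le)
 also have "\<dots> = (LB x. norm (W s x) * norm (U s x))" by (simp add: WU_def norm_mult)
 also have "\<dots> \<le> N2 (W s) * N2 (U s)"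
  by (rule L2_Cauchy_Schwarz_norm[OF L12D(1)[OF W_slice] U_L2])
 also have "\<dots> \<le> sqrt (C^2 * mass) * M"
  by (intro mult_mono U_norm real_le_rsqrt W_slice_L2) (use mass_nonneg in auto)
 finally show "norm (duhamel s \<eta>) \<le> sqrt (C^2 * mass) * M" .
qed

lemma duhamel_integral_L2:
 assumes t: "t \<in> {0..T}"
 shows "(\<lambda>\<eta>. LB s. indicator {0..t} s * duhamel s \<eta>) \<in> L2"
proof (rule time_integral_L2(1)[where \<beta>="\<lambda>s. (sqrt (fourier_const CARD('n)) * (C * M))^2"])
 show "(N2 (duhamel s))^2 \<le> (sqrt (fourier_const CARD('n)) * (C * M))^2" for s
  by (intro power_mono duhamel_L2) simp
 show "integrable lborel (\<lambda>s. indicator {0..t} s * (sqrt (fourier_const CARD('n)) * (C * M))^2)"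
  by (rule integrable_Icc_const)
qed (use t duhamel_L2 in auto)

lemma component_mult_L2:
 assumes g: "g \<in> L12" "\<And>\<eta>. r < norm \<eta> \<Longrightarrow> g \<eta> = 0" and r: "0 \<le> r"
 shows "(\<lambda>\<eta> :: real ^ 'n. of_real (\<eta> $ i) * g \<eta>) \<in> L2"
  "N2 (\<lambda>\<eta> :: real ^ 'n. of_real (\<eta> $ i) * g \<eta>) \<le> r * N2 g"
proof -
 have [measurable]: "(\<lambda>x :: real ^ 'n. x $ i) \<in> borel_measurable borel"
  by (intro borel_measurable_continuous_onI continuous_intros)
 let ?m = "\<lambda>\<eta> :: real ^ 'n. (if norm \<eta> \<le> r then 1 else 0) * complex_of_real (\<eta> $ i)"
 have eq: "(\<lambda>\<eta> :: real ^ 'n. of_real (\<eta> $ i) * g \<eta>) = (\<lambda>\<eta>. ?m \<eta> * g \<eta>)"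
  using g(2) by (auto simp: fun_eq_iff)
 have b: "norm (?m \<eta>) \<le> r" for \<eta>
  using component_le_norm_cart[of \<eta> i] r by (auto simp: indicator_def)
 have m: "?m \<in> borel_measurable borel" by measurable
 show "(\<lambda>\<eta> :: real ^ 'n. of_real (\<eta> $ i) * g \<eta>) \<in> L2"
  "N2 (\<lambda>\<eta> :: real ^ 'n. of_real (\<eta> $ i) * g \<eta>) \<le> r * N2 g"
  unfolding eq by (rule L2_bounded_mult[OF L12D(1)[OF g(1)] m b])+
qed

text \<open>At a single \<eta>, Cauchy-Schwarz bounds the error only by the L^2 norm of the
  differentiated cut-off, of order R^{n/2 - 1}. After pairing with a square integrable g the
  supremum of the cut-off derivatives counts instead, which is of order 1/R; the factor 1 + 2r
  collects the second and first derivatives.\<close>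

lemma error_pairing_bound:
 obtains A where "\<And>g R r t. g \<in> L12 \<Longrightarrow> (\<And>\<eta>. r < norm \<eta> \<Longrightarrow> g \<eta> = 0) \<Longrightarrow> R \<ge> 1 \<Longrightarrow> 0 \<le> r \<Longrightarrow>
  norm (LB \<eta>. g \<eta> * (LB x. U t x * cutoff_error R \<eta> x)) \<le> A * (1 + 2 * r) * N2 g / R"
proof -
 obtain A where A0: "A > 0" and A: "\<And>R (x :: real ^ 'n). \<bar>space_cutoff R x\<bar> \<le> A"
  "\<And>R i (x :: real ^ 'n). R > 0 \<Longrightarrow> \<bar>cutoff1 R i x\<bar> \<le> A / R"
  "\<And>R i (x :: real ^ 'n). R > 0 \<Longrightarrow> \<bar>cutoff2 R i x\<bar> \<le> A / R\<^sup>2"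
  by (rule cutoffs_bounds[where 'n='n]) blast
 define S where "S = sqrt (fourier_const CARD('n))"
 have S0: "0 \<le> S" by (simp add: S_def less_imp_le)
 show ?thesis
 proof (rule that[of "real CARD('n) * (S * (A * M))"])
  fix g :: "real ^ 'n \<Rightarrow> complex" and R r t :: real
  assume g: "g \<in> L12" "\<And>\<eta>. r < norm \<eta> \<Longrightarrow> g \<eta> = 0" and R1: "R \<ge> 1" and r: "0 \<le> r"
  then have R: "R > 0" by simp
  note gc = component_mult_L2[OF g r]
  have gL: "g \<in> L2" by (rule L12D(1)[OF g(1)])
  let ?F1 = "\<lambda>i. fourier (-1) (\<lambda>x. of_real (cutoff1 R i x) * U t x)"
  let ?F2 = "\<lambda>i. fourier (-1) (\<lambda>x. of_real (cutoff2 R i x) * U t x)"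
  have F1: "?F1 i \<in> L2" for i
   by (intro Plancherel(1) L12_mult_L2[OF cutoffs_L12(2)[OF R], where A="A / R"]) (use A(2)[OF R] U_L2 in auto)
  have F2: "?F2 i \<in> L2" for i
   by (intro Plancherel(1) L12_mult_L2[OF cutoffs_L12(3)[OF R], where A="A / R\<^sup>2"]) (use A(3)[OF R] U_L2 in auto)
  have i1: "integrable lborel (\<lambda>\<eta>. (of_real (\<eta> $ i) * g \<eta>) * ?F1 i \<eta>)" for i by (rule L2_mult_integrable[OF gc(1) F1])
  have i2: "integrable lborel (\<lambda>\<eta>. g \<eta> * ?F2 i \<eta>)" for i by (rule L2_mult_integrable[OF gL F2])
  have "(LB \<eta>. g \<eta> * (LB x. U t x * cutoff_error R \<eta> x)) =
   (LB \<eta>. (\<Sum>i\<in>UNIV. g \<eta> * ?F2 i \<eta> - 2 * \<i> * ((of_real (\<eta> $ i) * g \<eta>) * ?F1 i \<eta>)))"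
   unfolding error_fourier[OF R] sum_distrib_left
   by (intro lint_cong sum.cong refl) (simp add: algebra_simps)
  also have "\<dots> = (\<Sum>i\<in>UNIV. (LB \<eta>. g \<eta> * ?F2 i \<eta> - 2 * \<i> * ((of_real (\<eta> $ i) * g \<eta>) * ?F1 i \<eta>)))"
   by (rule lint_sum) (rule lint_integrable_diff[OF i2 integrable_mult_right[OF i1]])
  also have "\<dots> = (\<Sum>i\<in>UNIV. (LB \<eta>. g \<eta> * ?F2 i \<eta>) - 2 * \<i> * (LB \<eta>. (of_real (\<eta> $ i) * g \<eta>) * ?F1 i \<eta>))"
   unfolding lint_diff[OF i2 integrable_mult_right[OF i1]] integral_mult_right_zero ..
  finally have eq: "(LB \<eta>. g \<eta> * (LB x. U t x * cutoff_error R \<eta> x)) =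
   (\<Sum>i\<in>UNIV. (LB \<eta>. g \<eta> * ?F2 i \<eta>) - 2 * \<i> * (LB \<eta>. (of_real (\<eta> $ i) * g \<eta>) * ?F1 i \<eta>))" .
  let ?Q = "N2 g * (S * (A / R * M))"
  have Q: "norm ((LB \<eta>. g \<eta> * ?F2 i \<eta>) - 2 * \<i> * (LB \<eta>. (of_real (\<eta> $ i) * g \<eta>) * ?F1 i \<eta>)) \<le> ?Q + 2 * (r * ?Q)" for i
  proof -
   have "norm (LB \<eta>. g \<eta> * ?F2 i \<eta>) \<le> N2 g * (S * (A / R\<^sup>2 * N2 (U t)))"
    unfolding S_def by (rule multiplier_pairing_bound_cart[OF cutoffs_L12(3)[OF R] _ U_L2 gL]) (use A(3)[OF R] in simp)
   also have "\<dots> \<le> ?Q"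
   proof (rule mult_left_mono[OF mult_left_mono[OF mult_mono]])
    show "A / R\<^sup>2 \<le> A / R" using R1 A0 by (intro divide_left_mono) (auto simp: power2_eq_square)
   qed (use S0 U_norm A0 R in auto)
   finally have 2: "norm (LB \<eta>. g \<eta> * ?F2 i \<eta>) \<le> ?Q" .
   have "norm (LB \<eta>. (of_real (\<eta> $ i) * g \<eta>) * ?F1 i \<eta>) \<le>
     N2 (\<lambda>\<eta>. of_real (\<eta> $ i) * g \<eta>) * (S * (A / R * N2 (U t)))"
    unfolding S_def by (rule multiplier_pairing_bound_cart[OF cutoffs_L12(2)[OF R] _ U_L2 gc(1)]) (use A(2)[OF R] in simp)
   also have "\<dots> \<le> (r * N2 g) * (S * (A / R * M))"
    by (intro mult_mono gc(2) order_refl U_norm mult_nonneg_nonneg S0 r L2_norm_nonneg) (use A0 R in auto)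
   finally have 1: "norm (LB \<eta>. (of_real (\<eta> $ i) * g \<eta>) * ?F1 i \<eta>) \<le> r * ?Q" by (simp add: mult.assoc)
   show ?thesis
    by (rule order_trans[OF norm_triangle_ineq4], unfold norm_mult) (use 1 2 in simp)
  qed
  have "norm (LB \<eta>. g \<eta> * (LB x. U t x * cutoff_error R \<eta> x)) \<le> (\<Sum>i\<in>(UNIV :: 'n set). ?Q + 2 * (r * ?Q))"
   unfolding eq by (rule sum_norm_le) (rule Q)
  also have "\<dots> = real CARD('n) * (S * (A * M)) * (1 + 2 * r) * N2 g / R" by (simp add: algebra_simps add_divide_distrib)
  finally show "norm (LB \<eta>. g \<eta> * (LB x. U t x * cutoff_error R \<eta> x)) \<le>
   real CARD('n) * (S * (A * M)) * (1 + 2 * r) * N2 g / R" .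
 qed
qed

text \<open>The phase is absorbed into g. The potential part converges by
  \<open>cutoff_pairing_tendsto\<close>, the cut-off error vanishes like 1/R, and the bound uniform
  in s is the majorant for the later integration over time.\<close>

lemma rho_pairing_tendsto:
 assumes g: "g \<in> L12" "\<And>\<eta>. r < norm \<eta> \<Longrightarrow> g \<eta> = 0" and r: "0 \<le> r"
 shows "(\<lambda>m. LB \<eta>. g \<eta> * rho (real (Suc m)) \<eta> s) \<longlonglongrightarrow> of_real (bump 0 ^ CARD('n)) * (LB \<eta>. g \<eta> * duhamel s \<eta>)"
  and "\<exists>D. \<forall>m s. norm (LB \<eta>. g \<eta> * rho (real (Suc m)) \<eta> s) \<le> D"
proof -
 obtain A where A0: "A > 0" and A: "\<And>R (x :: real ^ 'n). \<bar>space_cutoff R x\<bar> \<le> A"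
  "\<And>R i (x :: real ^ 'n). R > 0 \<Longrightarrow> \<bar>cutoff1 R i x\<bar> \<le> A / R"
  "\<And>R i (x :: real ^ 'n). R > 0 \<Longrightarrow> \<bar>cutoff2 R i x\<bar> \<le> A / R\<^sup>2"
  by (rule cutoffs_bounds[where 'n='n]) blast
 obtain E where E: "\<And>g R r t. g \<in> L12 \<Longrightarrow> (\<And>\<eta>. r < norm \<eta> \<Longrightarrow> g \<eta> = 0) \<Longrightarrow> R \<ge> 1 \<Longrightarrow> 0 \<le> r \<Longrightarrow>
  norm (LB \<eta>. g \<eta> * (LB x. U t x * cutoff_error R \<eta> x)) \<le> E * (1 + 2 * r) * N2 g / R"
  by (rule error_pairing_bound) blast
 let ?g = "\<lambda>s \<eta>. phase s \<eta> * g \<eta>"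
 have gs: "?g s \<in> L12" for s by (rule chirp_L12[OF g(1)])
 have gn: "N2 (?g s) = N2 g" for s by (rule L2_norm_cong) (simp add: norm_mult)
 let ?R = "\<lambda>m. real (Suc m)"
 let ?F = "\<lambda>m s. fourier (-1) (\<lambda>x. of_real (space_cutoff (?R m) x) * WU s x)"
 let ?e = "\<lambda>m s. LB \<eta>. ?g s \<eta> * (LB x. U s x * cutoff_error (?R m) \<eta> x)"
 have e: "norm (?e m s) \<le> E * (1 + 2 * r) * N2 g / ?R m" for m s
 proof -
  have "norm (?e m s) \<le> E * (1 + 2 * r) * N2 (?g s) / ?R m"
   by (rule E[OF gs _ _ r]) (use g(2) in auto)
  then show ?thesis unfolding gn .
 qed
 have WL: "WU s \<in> L2" for s by (rule L12D(1)[OF WU_L12])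
 have FL: "?F m s \<in> L2" for m s
  by (intro Plancherel(1) L12_mult_L2[OF cutoffs_L12(1), where A=A]) (use A(1) WL in auto)
 have eL: "(\<lambda>\<eta>. LB x. U s x * cutoff_error (?R m) \<eta> x) \<in> borel_measurable borel" for m s by measurable
 have ei: "integrable lborel (\<lambda>\<eta>. ?g s \<eta> * (LB x. U s x * cutoff_error (?R m) \<eta> x))" for m s
 proof -
  have R: "?R m > 0" by simp
  have i1: "integrable lborel (\<lambda>\<eta>. (of_real (\<eta> $ i) * ?g s \<eta>) * fourier (-1) (\<lambda>x. of_real (cutoff1 (?R m) i x) * U s x) \<eta>)" for i
  proof (rule L2_mult_integrable[OF component_mult_L2(1)[OF gs _ r]])
   show "fourier (-1) (\<lambda>x. of_real (cutoff1 (?R m) i x) * U s x) \<in> L2"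
    by (intro Plancherel(1) L12_mult_L2[OF cutoffs_L12(2)[OF R], where A="A / ?R m"]) (use A(2)[OF R] U_L2 in auto)
  qed (use g(2) in simp)
  have i2: "integrable lborel (\<lambda>\<eta>. ?g s \<eta> * fourier (-1) (\<lambda>x. of_real (cutoff2 (?R m) i x) * U s x) \<eta>)" for i
  proof (rule L2_mult_integrable[OF L12D(1)[OF gs]])
   show "fourier (-1) (\<lambda>x. of_real (cutoff2 (?R m) i x) * U s x) \<in> L2"
    by (intro Plancherel(1) L12_mult_L2[OF cutoffs_L12(3)[OF R], where A="A / (?R m)\<^sup>2"]) (use A(3)[OF R] U_L2 in auto)
  qed
  have "integrable lborel (\<lambda>\<eta>. \<Sum>i\<in>UNIV. ?g s \<eta> * fourier (-1) (\<lambda>x. of_real (cutoff2 (?R m) i x) * U s x) \<eta> -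
    2 * \<i> * ((of_real (\<eta> $ i) * ?g s \<eta>) * fourier (-1) (\<lambda>x. of_real (cutoff1 (?R m) i x) * U s x) \<eta>))"
   by (intro lint_integrable_sum lint_integrable_diff integrable_mult_right i1 i2)
  moreover have "(\<lambda>\<eta>. \<Sum>i\<in>UNIV. ?g s \<eta> * fourier (-1) (\<lambda>x. of_real (cutoff2 (?R m) i x) * U s x) \<eta> -
    2 * \<i> * ((of_real (\<eta> $ i) * ?g s \<eta>) * fourier (-1) (\<lambda>x. of_real (cutoff1 (?R m) i x) * U s x) \<eta>)) =
   (\<lambda>\<eta>. ?g s \<eta> * (LB x. U s x * cutoff_error (?R m) \<eta> x))"
   unfolding error_fourier[OF R] sum_distrib_left by (intro ext sum.cong refl) (simp add: algebra_simps)
  ultimately show ?thesis by simp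
 qed
 have split: "(LB \<eta>. g \<eta> * rho (?R m) \<eta> s) = (LB \<eta>. ?g s \<eta> * ?F m s \<eta>) - ?e m s" for m s
 proof -
  have "(LB \<eta>. g \<eta> * rho (?R m) \<eta> s) =
   (LB \<eta>. ?g s \<eta> * ?F m s \<eta> - ?g s \<eta> * (LB x. U s x * cutoff_error (?R m) \<eta> x))"
   unfolding rho_fourier by (intro lint_cong refl) (simp add: algebra_simps)
  also have "\<dots> = (LB \<eta>. ?g s \<eta> * ?F m s \<eta>) - ?e m s"
   by (rule lint_diff[OF L2_mult_integrable[OF L12D(1)[OF gs] FL] ei])
  finally show ?thesis .
 qed
 have "(\<lambda>m. LB \<eta>. ?g s \<eta> * ?F m s \<eta>) \<longlonglongrightarrow> of_real (bump 0 ^ CARD('n)) * (LB x. WU s x * fourier (-1) (?g s) x)"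
  by (rule cutoff_pairing_tendsto[OF WL gs])
 moreover have "(LB x. WU s x * fourier (-1) (?g s) x) = (LB \<eta>. g \<eta> * duhamel s \<eta>)"
  unfolding fourier_mult[OF L12D(2)[OF WU_L12] L12D(2)[OF gs], symmetric] duhamel_def by (simp only: ac_simps)
 moreover have "(\<lambda>m. ?e m s) \<longlonglongrightarrow> 0"
 proof (rule Lim_null_comparison)
  show "\<forall>\<^sub>F m in sequentially. norm (?e m s) \<le> E * (1 + 2 * r) * N2 g / ?R m"
   by (intro always_eventually allI e)
  show "(\<lambda>m. E * (1 + 2 * r) * N2 g / ?R m) \<longlonglongrightarrow> 0"
   using tendsto_mult_right_zero[OF LIMSEQ_inverse_real_of_nat] by (simp only: divide_inverse)
 qed
 ultimately show "(\<lambda>m. LB \<eta>. g \<eta> * rho (?R m) \<eta> s) \<longlonglongrightarrow> of_real (bump 0 ^ CARD('n)) * (LB \<eta>. g \<eta> * duhamel s \<eta>)"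
  unfolding split using tendsto_diff by fastforce
 let ?S = "sqrt (fourier_const CARD('n))"
 have "norm (LB \<eta>. g \<eta> * rho (?R m) \<eta> s) \<le>
  N2 g * (?S * (A * (C * M))) + \<bar>E * (1 + 2 * r) * N2 g\<bar>" for m s
 proof -
  have "norm (LB \<eta>. ?g s \<eta> * ?F m s \<eta>) \<le> N2 (?g s) * (?S * (A * N2 (WU s)))"
   by (rule multiplier_pairing_bound_cart[OF cutoffs_L12(1) _ WL L12D(1)[OF gs]]) (use A(1) in auto)
  also have "\<dots> \<le> N2 g * (?S * (A * (C * M)))"
   unfolding gn using A0 WU_norm[of s] by (intro mult_left_mono) (auto simp: less_imp_le)
  finally have 1: "norm (LB \<eta>. ?g s \<eta> * ?F m s \<eta>) \<le> N2 g * (?S * (A * (C * M)))" .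
  have "E * (1 + 2 * r) * N2 g / ?R m \<le> \<bar>E * (1 + 2 * r) * N2 g\<bar> / ?R m"
   by (intro divide_right_mono abs_ge_self) simp
  also have "\<dots> \<le> \<bar>E * (1 + 2 * r) * N2 g\<bar> / 1" by (intro divide_left_mono) auto
  finally show ?thesis
   unfolding split using 1 e[where m=m and s=s] by (intro order_trans[OF norm_triangle_ineq4]) simp
 qed
 then show "\<exists>D. \<forall>m s. norm (LB \<eta>. g \<eta> * rho (?R m) \<eta> s) \<le> D" by blast
qed

lemma cutoff_error_norm:
 assumes R: "R > 0"
 obtains D where "\<And>\<eta> :: real ^ 'n. norm \<eta> \<le> r \<Longrightarrow> N2 (cutoff_error R \<eta>) \<le> D"
proof
 fix \<eta> :: "real ^ 'n" assume \<eta>: "norm \<eta> \<le> r"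
 let ?c = "\<lambda>i x. of_real (cutoff2 R i x) + (- 2 * \<i> * of_real (\<eta> $ i)) * of_real (cutoff1 R i x)"
 have L: "(\<lambda>x. complex_of_real (cutoff2 R i x)) \<in> L2" "(\<lambda>x. c * complex_of_real (cutoff1 R i x)) \<in> L2" for i :: 'n and c
  by (intro L12D(1) cutoffs_L12 R L2_space_cmult)+
 have "N2 (cutoff_error R \<eta>) = N2 (\<lambda>x. \<Sum>i\<in>(UNIV :: 'n set). ?c i x)"
  by (rule L2_norm_cong) (simp add: cutoff_error_eq norm_mult)
 also have "\<dots> \<le> (\<Sum>i\<in>(UNIV :: 'n set). N2 (?c i))"
  by (intro L2_norm_sum L2_space_add L)
 also have "\<dots> \<le> (\<Sum>i\<in>(UNIV :: 'n set). N2 (\<lambda>x. complex_of_real (cutoff2 R i x)) + 2 * r * N2 (\<lambda>x. complex_of_real (cutoff1 R i x)))"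
 proof (rule sum_mono)
  fix i
  have "N2 (?c i) \<le> N2 (\<lambda>x. complex_of_real (cutoff2 R i x)) + N2 (\<lambda>x. (- 2 * \<i> * of_real (\<eta> $ i)) * complex_of_real (cutoff1 R i x))"
   by (rule L2_norm_triangle[OF L])
  also have "N2 (\<lambda>x. (- 2 * \<i> * of_real (\<eta> $ i)) * complex_of_real (cutoff1 R i x)) = 2 * \<bar>\<eta> $ i\<bar> * N2 (\<lambda>x. complex_of_real (cutoff1 R i x))"
   unfolding L2_norm_cmult by (simp add: norm_mult)
  also have "\<dots> \<le> 2 * r * N2 (\<lambda>x. complex_of_real (cutoff1 R i x))"
   using component_le_norm_cart[of \<eta> i] \<eta> by (intro mult_right_mono) auto
  finally show "N2 (?c i) \<le> N2 (\<lambda>x. complex_of_real (cutoff2 R i x)) + 2 * r * N2 (\<lambda>x. complex_of_real (cutoff1 R i x))"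
   by simp
 qed
 finally show "N2 (cutoff_error R \<eta>) \<le> (\<Sum>i\<in>(UNIV :: 'n set). N2 (\<lambda>x. complex_of_real (cutoff2 R i x)) + 2 * r * N2 (\<lambda>x. complex_of_real (cutoff1 R i x)))" .
qed

lemma rho_Fubini:
 assumes g: "g \<in> L12" "\<And>\<eta>. r < norm \<eta> \<Longrightarrow> g \<eta> = 0" and R: "R > 0"
 shows "(LB \<eta>. g \<eta> * (LB s. indicator {0..t} s * rho R \<eta> s)) =
  (LB s. indicator {0..t} s * (LB \<eta>. g \<eta> * rho R \<eta> s))"
proof -
 obtain D where D: "\<And>\<eta> :: real ^ 'n. norm \<eta> \<le> r \<Longrightarrow> N2 (cutoff_error R \<eta>) \<le> D"
  by (rule cutoff_error_norm[OF R]) blast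
 \<comment> \<open>The bound for \<open>rho\<close> grows with \<eta>. Since g vanishes off the
   ball, the kernel may be set to 0 there, which makes it bounded.\<close>
 let ?K = "\<lambda>(\<eta> :: real ^ 'n) s. (if norm \<eta> \<le> r then 1 else 0) * rho R \<eta> s"
 let ?N = "N2 (\<lambda>x. complex_of_real (space_cutoff R (x :: real ^ 'n)))"
 have "norm (?K \<eta> s) \<le> C * M * ?N + M * \<bar>D\<bar>" for \<eta> s
 proof (cases "norm \<eta> \<le> r")
  case True
  have "norm (rho R \<eta> s) \<le> C * M * ?N + M * N2 (cutoff_error R \<eta>)"
   using rho_bound[OF R, of \<eta> s] wave_L2(2)[OF R, of \<eta>] by simp
  also have "\<dots> \<le> C * M * ?N + M * \<bar>D\<bar>" using D[OF True] by (intro add_left_mono mult_left_mono M_nonneg) linarith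
  finally show ?thesis using True by simp
 next
  case False
  then show ?thesis using M_nonneg C_nonneg by simp
 qed
 then have "integrable (lborel \<Otimes>\<^sub>M lborel) (\<lambda>(\<eta>, s). ?K \<eta> s * (g \<eta> * indicator {0..t} s))"
  by (intro integrable_pair_mult_bounded[OF L12D(2)[OF g(1)] integrable_indicator_Icc]) measurable
 then have "(LB \<eta>. LB s. ?K \<eta> s * (g \<eta> * indicator {0..t} s)) =
  (LB s. LB \<eta>. ?K \<eta> s * (g \<eta> * indicator {0..t} s))"
  by (rule lborel_pair.Fubini_integral[symmetric])
 moreover have eq: "?K \<eta> s * (g \<eta> * indicator {0..t} s) = g \<eta> * (indicator {0..t} s * rho R \<eta> s)"
  "?K \<eta> s * (g \<eta> * indicator {0..t} s) = indicator {0..t} s * (g \<eta> * rho R \<eta> s)" for \<eta> s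
  using g(2)[of \<eta>] by (auto simp: indicator_def)
 have "(LB \<eta>. LB s. ?K \<eta> s * (g \<eta> * indicator {0..t} s)) =
  (LB \<eta>. g \<eta> * (LB s. indicator {0..t} s * rho R \<eta> s))"
  unfolding eq(1) integral_mult_right_zero ..
 moreover have "(LB s. LB \<eta>. ?K \<eta> s * (g \<eta> * indicator {0..t} s)) =
  (LB s. indicator {0..t} s * (LB \<eta>. g \<eta> * rho R \<eta> s))"
  unfolding eq(2) integral_mult_right_zero ..
 ultimately show ?thesis by simp
qed

lemma duhamel_Fubini:
 assumes g: "g \<in> L12"
 shows "(LB \<eta>. g \<eta> * (LB s. indicator {0..t} s * duhamel s \<eta>)) =
  (LB s. indicator {0..t} s * (LB \<eta>. g \<eta> * duhamel s \<eta>))"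
proof -
 obtain D where D: "\<And>s \<eta>. norm (duhamel s \<eta>) \<le> D" by (rule duhamel_bound) blast
 have "integrable (lborel \<Otimes>\<^sub>M lborel) (\<lambda>(\<eta>, s). duhamel s \<eta> * (g \<eta> * indicator {0..t} s))"
  by (intro integrable_pair_mult_bounded[OF L12D(2)[OF g] integrable_indicator_Icc _ D]) measurable
 then have "(LB \<eta>. LB s. duhamel s \<eta> * (g \<eta> * indicator {0..t} s)) =
  (LB s. LB \<eta>. duhamel s \<eta> * (g \<eta> * indicator {0..t} s))"
  by (rule lborel_pair.Fubini_integral[symmetric])
 moreover have "(LB \<eta>. LB s. duhamel s \<eta> * (g \<eta> * indicator {0..t} s)) =
  (LB \<eta>. g \<eta> * (LB s. indicator {0..t} s * duhamel s \<eta>))"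
  unfolding integral_mult_right_zero[symmetric] by (simp only: ac_simps)
 moreover have "(LB s. LB \<eta>. duhamel s \<eta> * (g \<eta> * indicator {0..t} s)) =
  (LB s. indicator {0..t} s * (LB \<eta>. g \<eta> * duhamel s \<eta>))"
  unfolding integral_mult_right_zero[symmetric] by (simp only: ac_simps)
 ultimately show ?thesis by simp
qed

lemma alpha_pairing:
 assumes g: "g \<in> L12"
 shows "integrable lborel (\<lambda>\<eta>. g \<eta> * alpha (real (Suc m)) \<eta> t)"
  "ft_pair (U t) h \<Longrightarrow> (\<lambda>m. LB \<eta>. g \<eta> * alpha (real (Suc m)) \<eta> t) \<longlonglongrightarrow>
   of_real (bump 0 ^ CARD('n)) * (LB \<eta>. g \<eta> * (phase t \<eta> * h \<eta>))"
proof -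
 obtain A where A0: "A > 0" and A: "\<And>R (x :: real ^ 'n). \<bar>space_cutoff R x\<bar> \<le> A"
  by (rule cutoffs_bounds[where 'n='n]) blast
 let ?g = "\<lambda>\<eta>. phase t \<eta> * g \<eta>"
 have gt: "?g \<in> L12" by (rule chirp_L12[OF g])
 have eq: "g \<eta> * alpha (real (Suc m)) \<eta> t = ?g \<eta> * fourier (-1) (\<lambda>x. of_real (space_cutoff (real (Suc m)) x) * U t x) \<eta>" for m \<eta>
  unfolding alpha_fourier by simp
 show "integrable lborel (\<lambda>\<eta>. g \<eta> * alpha (real (Suc m)) \<eta> t)"
  unfolding eq
  by (intro L2_mult_integrable[OF L12D(1)[OF gt]] Plancherel(1) L12_mult_L2[OF cutoffs_L12(1), where A=A]) (use A(1) U_L2 in auto)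
 assume "ft_pair (U t) h"
 then have "(LB x. U t x * fourier (-1) ?g x) = (LB \<eta>. g \<eta> * (phase t \<eta> * h \<eta>))"
  by (subst ft_pairD(3)[OF _ gt, symmetric]) (auto simp: ac_simps)
 then show "(\<lambda>m. LB \<eta>. g \<eta> * alpha (real (Suc m)) \<eta> t) \<longlonglongrightarrow>
   of_real (bump 0 ^ CARD('n)) * (LB \<eta>. g \<eta> * (phase t \<eta> * h \<eta>))"
  unfolding eq using cutoff_pairing_tendsto[OF U_L2 gt, of t] by simp
qed

text \<open>The increment identity for \<open>alpha\<close> survives the limit of large R only after
  pairing with a test function, so the conclusion is first obtained weakly and then, by
  \<open>L2_zero_test\<close>, almost everywhere.\<close>

lemma duhamel_formula:
 assumes t: "t \<in> {0..T}" and p0: "ft_pair (U 0) k0" and pt: "ft_pair (U t) h"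
 shows "AE \<eta> in lborel. phase t \<eta> * h \<eta> = k0 \<eta> - \<i> * (LB s. indicator {0..t} s * duhamel s \<eta>)"
proof -
 let ?I = "\<lambda>\<eta>. LB s. indicator {0..t} s * duhamel s \<eta>"
 let ?h = "\<lambda>\<eta>. phase t \<eta> * h \<eta>"
 let ?c = "complex_of_real (bump 0 ^ CARD('n))"
 \<comment> \<open>The limit of the cut-offs, common to all terms; it is non-zero and is cancelled
   below.\<close>
 have c: "?c \<noteq> 0" using bump_pos[of 0] by simp
 note [measurable] = L2_space_measurable[OF ft_pairD(2)[OF pt], simplified]
 have hL: "?h \<in> L2"
  by (rule L2_space_norm_eq[OF ft_pairD(2)[OF pt]]) (auto simp: norm_mult)
 have iL: "(\<lambda>\<eta>. \<i> * ?I \<eta>) \<in> L2" by (rule L2_space_cmult[OF duhamel_integral_L2[OF t]])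
 note kL = ft_pairD(2)[OF p0]
 have "AE \<eta> in lborel. ?h \<eta> - k0 \<eta> + \<i> * ?I \<eta> = 0"
 proof (rule L2_zero_test)
  show "(\<lambda>\<eta>. ?h \<eta> - k0 \<eta> + \<i> * ?I \<eta>) \<in> L2" by (intro L2_space_add L2_space_diff hL kL iL)
  fix g :: "real ^ 'n \<Rightarrow> complex" and r0 :: real
  assume g: "g \<in> L12" "\<And>x. r0 < norm x \<Longrightarrow> g x = 0"
  define r where "r = max 0 r0"
  have r: "0 \<le> r" "\<And>x. r < norm x \<Longrightarrow> g x = 0" using g(2) by (auto simp: r_def)
  note gL = L12D(1)[OF g(1)]
  let ?R = "\<lambda>m. real (Suc m)"
  obtain D where D: "\<And>m s. norm (LB \<eta>. g \<eta> * rho (?R m) \<eta> s) \<le> D"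
   using rho_pairing_tendsto(2)[OF g(1) r(2) r(1)] by blast
  note [measurable] = L12D(3)[OF g(1)]
  have lim1: "(\<lambda>m. (LB \<eta>. g \<eta> * alpha (?R m) \<eta> t) - (LB \<eta>. g \<eta> * alpha (?R m) \<eta> 0)) \<longlonglongrightarrow>
   ?c * (LB \<eta>. g \<eta> * ?h \<eta>) - ?c * (LB \<eta>. g \<eta> * (phase 0 \<eta> * k0 \<eta>))"
   by (intro tendsto_diff alpha_pairing(2) g(1) p0 pt)
  have eq: "(LB \<eta>. g \<eta> * alpha (?R m) \<eta> t) - (LB \<eta>. g \<eta> * alpha (?R m) \<eta> 0) =
   - \<i> * (LB s. indicator {0..t} s * (LB \<eta>. g \<eta> * rho (?R m) \<eta> s))" for m
  proof -
   have "(LB \<eta>. g \<eta> * alpha (?R m) \<eta> t) - (LB \<eta>. g \<eta> * alpha (?R m) \<eta> 0) =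
    (LB \<eta>. g \<eta> * alpha (?R m) \<eta> t - g \<eta> * alpha (?R m) \<eta> 0)"
    by (rule lint_diff[OF alpha_pairing(1) alpha_pairing(1), OF g(1) g(1), symmetric])
   also have "\<dots> = (LB \<eta>. - \<i> * (g \<eta> * (LB s. indicator {0..t} s * rho (?R m) \<eta> s)))"
    unfolding right_diff_distrib[symmetric] by (subst alpha_increment[OF _ t]) (auto simp: ac_simps)
   also have "\<dots> = - \<i> * (LB \<eta>. g \<eta> * (LB s. indicator {0..t} s * rho (?R m) \<eta> s))"
    by (rule integral_mult_right_zero)
   finally show ?thesis by (subst (asm) rho_Fubini[OF g(1) r(2)]) auto
  qed
  have lim2: "(\<lambda>m. LB s. indicator {0..t} s * (LB \<eta>. g \<eta> * rho (?R m) \<eta> s)) \<longlonglongrightarrow>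
   (LB s. indicator {0..t} s * (?c * (LB \<eta>. g \<eta> * duhamel s \<eta>)))"
  proof (rule integral_dominated_convergence[where w="\<lambda>s. indicator {0..t} s * D"])
   show "integrable lborel (\<lambda>s. indicator {0..t} s * D)"
    by (rule integrable_Icc_const)
   show "AE s in lborel. (\<lambda>m. indicator {0..t} s * (LB \<eta>. g \<eta> * rho (?R m) \<eta> s)) \<longlonglongrightarrow> indicator {0..t} s * (?c * (LB \<eta>. g \<eta> * duhamel s \<eta>))"
    by (intro AE_I2 tendsto_mult[OF tendsto_const] rho_pairing_tendsto(1)[OF g(1) r(2) r(1)])
   show "AE s in lborel. norm (indicator {0..t} s * (LB \<eta>. g \<eta> * rho (?R m) \<eta> s)) \<le> indicator {0..t} s * D" for m
    unfolding norm_mult using D by (intro AE_I2) (auto simp: indicator_def)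
  qed measurable
  have eq2: "(LB s. indicator {0..t} s * (?c * (LB \<eta>. g \<eta> * duhamel s \<eta>))) = ?c * (LB \<eta>. g \<eta> * ?I \<eta>)"
   unfolding duhamel_Fubini[OF g(1)] mult.left_commute[of _ ?c] integral_mult_right_zero ..
  have "?c * (LB \<eta>. g \<eta> * ?h \<eta>) - ?c * (LB \<eta>. g \<eta> * (phase 0 \<eta> * k0 \<eta>)) = - \<i> * (?c * (LB \<eta>. g \<eta> * ?I \<eta>))"
   using LIMSEQ_unique[OF lim1[unfolded eq] tendsto_mult[OF tendsto_const[of "- \<i>"] lim2[unfolded eq2]]] .
  moreover have "A - B + \<i> * I = 0" if "?c * A - ?c * B = - \<i> * (?c * I)" for A B I
  proof -
   have "?c * (A - B + \<i> * I) = 0" using that by (simp only: ring_distribs mult.left_commute[of \<i> ?c]) simp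
   then show ?thesis using c by (simp only: mult_eq_0_iff) blast
  qed
  moreover have "(LB \<eta>. g \<eta> * (\<i> * ?I \<eta>)) = \<i> * (LB \<eta>. g \<eta> * ?I \<eta>)"
   unfolding mult.left_commute[of _ \<i>] integral_mult_right_zero ..
  ultimately have z: "(LB \<eta>. g \<eta> * ?h \<eta>) - (LB \<eta>. g \<eta> * k0 \<eta>) + (LB \<eta>. g \<eta> * (\<i> * ?I \<eta>)) = 0"
   by (simp only: mult_zero_left cis_zero mult_1_left)
  have "(LB \<eta>. (?h \<eta> - k0 \<eta> + \<i> * ?I \<eta>) * g \<eta>) = (LB \<eta>. (g \<eta> * ?h \<eta> - g \<eta> * k0 \<eta>) + g \<eta> * (\<i> * ?I \<eta>))"
   by (intro lint_cong refl) (simp add: algebra_simps)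
  also have "\<dots> = (LB \<eta>. g \<eta> * ?h \<eta>) - (LB \<eta>. g \<eta> * k0 \<eta>) + (LB \<eta>. g \<eta> * (\<i> * ?I \<eta>))"
   by (simp only: lint_add[OF lint_integrable_diff[OF L2_mult_integrable[OF gL hL] L2_mult_integrable[OF gL kL]] L2_mult_integrable[OF gL iL]]
    lint_diff[OF L2_mult_integrable[OF gL hL] L2_mult_integrable[OF gL kL]])
  finally show "(LB \<eta>. (?h \<eta> - k0 \<eta> + \<i> * ?I \<eta>) * g \<eta>) = 0" using z by simp
 qed
 then show ?thesis by eventually_elim (simp add: algebra_simps)
qed

text \<open>K is defined by the right-hand side of Duhamel's formula and hence at every frequency.
  It agrees almost everywhere with the phase times the transform of U, and \<open>B_fourier\<close>
  then rewrites the integrand through K itself.\<close>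

theorem weak_solution_volterra:
 assumes p0: "ft_pair (U 0) k0"
 obtains K where "volterra k0 K" "\<And>t. t \<in> {0..T} \<Longrightarrow> ft_pair (U t) (\<lambda>\<eta>. phase (- t) \<eta> * K t \<eta>)"
proof -
 define K where "K t \<eta> = k0 \<eta> - \<i> * (LB s. indicator {0..t} s * duhamel s \<eta>)" for t \<eta>
 note kL = ft_pairD(2)[OF p0]
 note [measurable] = L2_space_measurable[OF kL, simplified]
 have Km [measurable]: "joint K"
  unfolding K_def by measurable
 have Ks: "K t \<in> borel_measurable borel" for t using measurable_Pair2[OF Km, of t] by simp
 have KL: "K t \<in> L2" if "t \<in> {0..T}" for t
  unfolding K_def[abs_def] by (intro L2_space_diff L2_space_cmult kL duhamel_integral_L2[OF that])
 have pair: "ft_pair (U t) (\<lambda>\<eta>. phase (- t) \<eta> * K t \<eta>)" if t: "t \<in> {0..T}" for t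
 proof -
  obtain h where h: "ft_pair (U t) h" using ft_pair_exists[OF U_L2] by blast
  have "AE \<eta> in lborel. h \<eta> = phase (- t) \<eta> * K t \<eta>"
   using duhamel_formula[OF t p0 h]
  proof eventually_elim
   case (elim \<eta>)
   have "h \<eta> = phase (- t) \<eta> * (phase t \<eta> * h \<eta>)"
    by (simp add: mult.assoc[symmetric] cis_mult)
   then show ?case unfolding elim K_def .
  qed
  then show ?thesis by (rule ft_pair_AE_cong[OF h]) (use Ks in auto)
 qed
 have "K t \<eta> = k0 \<eta> - \<i> * (LB s. indicator {0..t} s * B s (K s) \<eta>)" if t: "t \<in> {0..T}" for t \<eta>
 proof -
  have "indicator {0..t} s * duhamel s \<eta> = indicator {0..t} s * B s (K s) \<eta>" for s
  proof (cases "s \<in> {0..t}")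
   case True
   then have "s \<in> {0..T}" using t by auto
   then show ?thesis using B_fourier[OF pair, of s \<eta>] by (simp add: duhamel_def WU_def[abs_def])
  qed simp
  then show ?thesis unfolding K_def[of t \<eta>] by (simp only:)
 qed
 moreover have "N2 (K t) \<le> sqrt (fourier_const CARD('n)) * M" if t: "t \<in> {0..T}" for t
 proof -
  have "N2 (K t) = N2 (\<lambda>\<eta>. phase (- t) \<eta> * K t \<eta>)"
   by (rule L2_norm_cong) (simp add: norm_mult)
  also have "\<dots> = sqrt (fourier_const CARD('n)) * N2 (U t)"
   by (rule power2_eq_imp_eq) (use ft_pair_norm[OF pair[OF t]] less_imp_le[OF fourier_const_pos[of "CARD('n)"]] in \<open>simp_all add: power_mult_distrib\<close>)
  also have "\<dots> \<le> sqrt (fourier_const CARD('n)) * M" using U_norm by (intro mult_left_mono) (simp_all add: less_imp_le)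
  finally show ?thesis .
 qed
 ultimately have "volterra k0 K" unfolding volterra_def using kL Km KL by blast
 then show ?thesis using pair by (rule that)
qed

end

section \<open>Test functions on the Fourier side\<close>

text \<open>Vanishing off a fixed set S is used in place of a condition on the function's own
  support; for closed S the class is stable under directional derivatives.\<close>

definition supported_smooth :: "'a::real_normed_vector set \<Rightarrow> ('a \<Rightarrow> complex) set" where
 "supported_smooth S = {f. (\<forall>k. C_k k f) \<and> (\<forall>z. z \<notin> S \<longrightarrow> f z = 0)}"

lemma supported_smooth_line:
 assumes f: "f \<in> supported_smooth S"
 shows "((\<lambda>r. f (z + r *\<^sub>R v)) has_vector_derivative dir_deriv v f (z + s *\<^sub>R v)) (at s)"
proof -
 have "C_k (Suc 0) f" using f unfolding supported_smooth_def by blast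
 then have "f differentiable at (z + s *\<^sub>R v)" by simp
 then have d: "(f has_derivative frechet_derivative f (at (z + s *\<^sub>R v))) (at (z + s *\<^sub>R v))"
  unfolding frechet_derivative_works .
 have "((\<lambda>r. z + r *\<^sub>R v) has_derivative (\<lambda>r. r *\<^sub>R v)) (at s)"
  by (auto intro!: derivative_eq_intros)
 then have "((f \<circ> (\<lambda>r. z + r *\<^sub>R v)) has_derivative frechet_derivative f (at (z + s *\<^sub>R v)) \<circ> (\<lambda>r. r *\<^sub>R v)) (at s)"
  by (rule diff_chain_at) (rule d)
 then show ?thesis
  unfolding has_vector_derivative_def dir_deriv_def comp_def
  by (simp add: linear_scale[OF has_derivative_linear[OF d]])
qed

lemma supported_smooth_dir_deriv:
 assumes f: "f \<in> supported_smooth S" and S: "closed S"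
 shows "dir_deriv v f \<in> supported_smooth S"
proof -
 have "C_k k (dir_deriv v f)" for k
 proof -
  have "C_k (Suc k) f" using f unfolding supported_smooth_def by blast
  then show ?thesis by simp
 qed
 moreover have "dir_deriv v f z = 0" if z: "z \<notin> S" for z
 proof -
  have "((\<lambda>_. 0) has_derivative (\<lambda>_. 0)) (at z)" by (rule has_derivative_const)
  then have "(f has_derivative (\<lambda>_. 0)) (at z)"
   by (rule has_derivative_transform_within_open[OF _ open_Compl[OF S]])
    (use f z in \<open>auto simp: supported_smooth_def\<close>)
  then show ?thesis unfolding dir_deriv_def by (simp only: frechet_derivative_at[symmetric])
 qed
 ultimately show ?thesis unfolding supported_smooth_def by blast
qed

lemma supported_smooth_continuous:
 assumes f: "f \<in> supported_smooth S" shows "continuous_on UNIV f"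
proof -
 have "C_k 0 f" using f unfolding supported_smooth_def by blast
 then show ?thesis by simp
qed

lemma supported_smooth_bounded:
 assumes f: "f \<in> supported_smooth S" and S: "compact S"
 obtains A where "A \<ge> 0" "\<And>z. norm (f z) \<le> A"
proof -
 have "compact (f ` S)" by (rule compact_continuous_image[OF continuous_on_subset[OF supported_smooth_continuous[OF f]] S]) simp
 from compact_imp_bounded[OF this] obtain A where A: "\<And>y. y \<in> f ` S \<Longrightarrow> norm y \<le> A" unfolding bounded_iff by blast
 show ?thesis
 proof
  show "norm (f z) \<le> max 0 A" for z
   using A[of "f z"] f by (cases "z \<in> S") (auto simp: supported_smooth_def)
 qed simp
qed

text \<open>Integrating f(x + e) - f(x) over x gives 0 by translation invariance. By the fundamental
  theorem along the segment and Fubini it is also the average over s in [0,1] of the integrals of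
  f'(x + s e), all of which equal the integral of f'.\<close>

lemma integral_derivative_zero:
 fixes f f' :: "'a::euclidean_space \<Rightarrow> complex"
 assumes d: "\<And>x s. ((\<lambda>r. f (x + r *\<^sub>R e)) has_vector_derivative f' (x + s *\<^sub>R e)) (at s)"
  and c: "continuous_on UNIV f" "continuous_on UNIV f'"
  and b: "\<And>x. norm (f x) \<le> A" "\<And>x. norm (f' x) \<le> A"
  and z: "\<And>x. r < norm x \<Longrightarrow> f x = 0" "\<And>x. r < norm x \<Longrightarrow> f' x = 0"
 shows "(LB x. f' x) = 0"
proof -
 have [measurable]: "f \<in> borel_measurable borel" "f' \<in> borel_measurable borel"
  using c by (auto intro: borel_measurable_continuous_onI)
 have fi: "integrable lborel f"
  by (rule L12D(2)[OF L12_bounded_support[where A=A and r=r]]) (use b z(1) in \<open>auto simp: not_less[symmetric]\<close>)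
 have gi: "integrable lborel (\<lambda>x :: 'a. indicator (cball 0 (r + norm e)) x :: complex)"
  by (rule L12D(2)[OF L12_bounded_support[where A=1 and r="r + norm e"]]) (auto simp: indicator_def split: if_splits)
 have ftc: "(LB s. indicator {0..1} s * f' (x + s *\<^sub>R e)) = f (x + e) - f x" for x
 proof -
  have "has_bochner_integral lborel (\<lambda>s. indicator {0..1} s *\<^sub>R f' (x + s *\<^sub>R e)) (f (x + 1 *\<^sub>R e) - f (x + 0 *\<^sub>R e))"
   by (rule has_bochner_integral_FTC_Icc)
    (auto intro!: has_vector_derivative_at_within[OF d] continuous_on_compose2[OF c(2)] continuous_intros)
  then have "(LB s. indicator {0..1} s *\<^sub>R f' (x + s *\<^sub>R e)) = f (x + e) - f x"
   by (simp add: has_bochner_integral_iff)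
  moreover have "indicator {0..1} s *\<^sub>R f' (x + s *\<^sub>R e) = indicator {0..1} s * f' (x + s *\<^sub>R e)" for s :: real
   by (simp add: indicator_def)
  ultimately show ?thesis by simp
 qed
 have "integrable (lborel \<Otimes>\<^sub>M lborel) (\<lambda>(s, x). f' (x + s *\<^sub>R e) * (indicator {0..1} s * indicator (cball 0 (r + norm e)) x))"
  by (intro integrable_pair_mult_bounded[OF integrable_indicator_Icc gi _ b(2)]) measurable
 then have fub: "(LB s. LB x. f' (x + s *\<^sub>R e) * (indicator {0..1} s * indicator (cball 0 (r + norm e)) x)) =
  (LB x. LB s. f' (x + s *\<^sub>R e) * (indicator {0..1} s * indicator (cball 0 (r + norm e)) x))"
  by (rule lborel_pair.Fubini_integral[symmetric])
 \<comment> \<open>The ball of radius r + |e| contains every x for which the segment meets the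
   support; its indicator supplies integrability and then drops out.\<close>
 have eq: "f' (x + s *\<^sub>R e) * (indicator {0..1} s * indicator (cball 0 (r + norm e)) x) = indicator {0..1} s * f' (x + s *\<^sub>R e)" for s x
 proof (cases "0 \<le> s \<and> s \<le> 1 \<and> r + norm e < norm x")
  case True
  have "norm x \<le> norm (x + s *\<^sub>R e) + norm (s *\<^sub>R e)"
   using norm_triangle_ineq4[of "x + s *\<^sub>R e" "s *\<^sub>R e"] by simp
  moreover have "norm (s *\<^sub>R e) \<le> 1 * norm e" unfolding norm_scaleR using True by (intro mult_right_mono) auto
  ultimately have "f' (x + s *\<^sub>R e) = 0" using True by (intro z(2)) simp
  then show ?thesis by simp
 qed (auto simp: indicator_def)
 have "(LB s. indicator {0..1} s * (LB x. f' (x + s *\<^sub>R e))) = (LB x. f (x + e) - f x)"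
  using fub unfolding eq ftc integral_mult_right_zero .
 also have "\<dots> = (LB x. f (x + e)) - (LB x. f x)"
  using fi by (intro lint_diff) (simp_all add: integrable_lborel_translate)
 also have "\<dots> = 0" by (simp add: integral_lborel_translate)
 finally have "(LB s. indicator {0..1::real} s * (LB x. f' x)) = 0" by (simp add: integral_lborel_translate)
 moreover have "(LB s. indicator {0..1::real} s * (LB x. f' x)) = (LB s. (indicator {0..1::real} s :: complex)) * (LB x. f' x)"
  by (rule integral_mult_left_zero)
 moreover have "(LB s. (indicator {0..1::real} s :: complex)) = 1"
 proof -
  have "(LB s. complex_of_real (indicator {0..1::real} s)) = of_real (LB s. indicator {0..1::real} s)"
   by (rule integral_complex_of_real)
  moreover have "complex_of_real (indicator {0..1::real} s) = indicator {0..1::real} s" for s by (simp add: indicator_def)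
  ultimately show ?thesis by simp
 qed
 ultimately show ?thesis by simp
qed

locale slab_test =
 fixes T :: real and \<phi> :: "real \<times> (real ^ 'n) \<Rightarrow> complex" and S :: "(real \<times> (real ^ 'n)) set"
 assumes T_pos: "T > 0" and compact: "compact S" and slab: "S \<subseteq> slab T" and smooth: "\<phi> \<in> supported_smooth S"
begin

lemma closed: "closed S"
 using compact by (rule compact_imp_closed)

lemma radius: obtains r where "\<And>t x. r < norm x \<Longrightarrow> (t, x) \<notin> S"
proof -
 obtain r where r: "\<And>z. z \<in> S \<Longrightarrow> norm z \<le> r" using compact_imp_bounded[OF compact] unfolding bounded_iff by blast
 have "norm x \<le> norm (t, x)" for t :: real and x :: "real ^ 'n" by (rule norm_snd_le)
 then have "(t, x) \<notin> S" if "r < norm x" for t x using r[of "(t, x)"] that by (meson not_le order_trans)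
 then show ?thesis by (rule that)
qed

lemma outside: "t \<notin> {0<..<T} \<Longrightarrow> (t, x) \<notin> S"
 using slab by (auto simp: slab_def)

lemma measurable_pair:
 assumes "f \<in> supported_smooth S"
 shows "joint (\<lambda>t x. f (t, x))"
 using borel_measurable_continuous_onI[OF supported_smooth_continuous[OF assms]] by (simp add: borel_prod)

lemma slice:
 assumes f: "f \<in> supported_smooth S"
 obtains D where "D \<ge> 0" "\<And>t. (\<lambda>x. f (t, x)) \<in> L12" "\<And>t. N2 (\<lambda>x. f (t, x)) \<le> D"
proof -
 obtain r where r: "\<And>t x. r < norm x \<Longrightarrow> (t, x) \<notin> S" by (rule radius) blast
 obtain A where A: "A \<ge> 0" "\<And>z. norm (f z) \<le> A" using supported_smooth_bounded[OF f compact] by blast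
 have i: "(\<lambda>x :: real ^ 'n. indicator (cball 0 r) x :: complex) \<in> L12"
  by (rule L12_bounded_support[where A=1 and r=r]) (auto simp: indicator_def split: if_splits)
 have f0: "f (t, x) = 0" if "r < norm x" for t x using r[OF that, of t] f by (simp add: supported_smooth_def)
 have m: "(\<lambda>x. f (t, x)) \<in> borel_measurable borel" for t
  by (intro borel_measurable_continuous_onI continuous_on_compose2[OF supported_smooth_continuous[OF f]] continuous_intros) auto
 show ?thesis
 proof (rule that[of "A * N2 (\<lambda>x :: real ^ 'n. indicator (cball 0 r) x :: complex)"])
  show "(\<lambda>x. f (t, x)) \<in> L12" for t
   by (rule L12_bounded_support[OF m A(2)]) (use f0 not_less in auto)
  fix t
  have eq: "(\<lambda>x. f (t, x)) = (\<lambda>x. f (t, x) * indicator (cball 0 r) x)"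
   using f0[of _ t] by (auto simp: indicator_def fun_eq_iff)
  show "N2 (\<lambda>x. f (t, x)) \<le> A * N2 (\<lambda>x :: real ^ 'n. indicator (cball 0 r) x :: complex)"
   by (subst eq) (rule L2_bounded_mult(2)[OF L12D(1)[OF i] m A(2)])
 qed (use A in simp)
qed

text \<open>Integration by parts, as the vanishing integral of the derivative of the plane wave
  times the slice.\<close>

lemma fourier_slice_deriv:
 assumes f: "f \<in> supported_smooth S"
 shows "fourier 1 (\<lambda>x. dir_deriv (0, e) f (t, x)) \<eta> = - \<i> * of_real (\<eta> \<bullet> e) * fourier 1 (\<lambda>x. f (t, x)) \<eta>"
proof -
 note f' = supported_smooth_dir_deriv[OF f closed, of "(0, e)"]
 obtain r where r: "\<And>t x. r < norm x \<Longrightarrow> (t, x) \<notin> S" by (rule radius) blast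
 obtain A where A: "A \<ge> 0" "\<And>z. norm (f z) \<le> A" using supported_smooth_bounded[OF f compact] by blast
 obtain A' where A': "A' \<ge> 0" "\<And>z. norm (dir_deriv (0, e) f z) \<le> A'" using supported_smooth_bounded[OF f' compact] by blast
 obtain D where D: "D \<ge> 0" "\<And>t. (\<lambda>x. f (t, x)) \<in> L12" "\<And>t. N2 (\<lambda>x. f (t, x)) \<le> D" by (rule slice[OF f]) blast
 obtain D' where D': "D' \<ge> 0" "\<And>t. (\<lambda>x. dir_deriv (0, e) f (t, x)) \<in> L12" "\<And>t. N2 (\<lambda>x. dir_deriv (0, e) f (t, x)) \<le> D'"
  by (rule slice[OF f']) blast
 have z: "f (t, x) = 0" "dir_deriv (0, e) f (t, x) = 0" if "r < norm x" for x
  using r[OF that, of t] f f' by (auto simp: supported_smooth_def)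
 let ?a = "\<eta> \<bullet> e"
 let ?g = "\<lambda>x. cis (\<eta> \<bullet> x) * f (t, x)"
 let ?g' = "\<lambda>x. \<i> * of_real ?a * (cis (\<eta> \<bullet> x) * f (t, x)) + cis (\<eta> \<bullet> x) * dir_deriv (0, e) f (t, x)"
 have cf: "continuous_on UNIV (\<lambda>x. f (t, x))" "continuous_on UNIV (\<lambda>x. dir_deriv (0, e) f (t, x))"
  by (rule continuous_on_compose2[OF supported_smooth_continuous]; (rule f f' | auto intro!: continuous_intros))+
 have cc: "continuous_on UNIV (\<lambda>x. cis (\<eta> \<bullet> x))" by (simp add: cis_conv_exp) (intro continuous_intros)
 have "(LB x. ?g' x) = 0"
 proof (rule integral_derivative_zero[where f="?g" and e=e and A="A + (\<bar>?a\<bar> * A + A')" and r=r])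
  fix x s
  have d: "((\<lambda>r. f ((t, x) + r *\<^sub>R (0, e))) has_vector_derivative dir_deriv (0, e) f ((t, x) + s *\<^sub>R (0, e))) (at s)"
   by (rule supported_smooth_line[OF f])
  have "((\<lambda>r. \<eta> \<bullet> x + r * ?a) has_real_derivative ?a) (at s)" by (auto intro!: derivative_eq_intros)
  note d2 = has_vector_derivative_cis[OF this]
  have "((\<lambda>r. cis (\<eta> \<bullet> x + r * ?a) * f ((t, x) + r *\<^sub>R (0, e))) has_vector_derivative
   cis (\<eta> \<bullet> x + s * ?a) * dir_deriv (0, e) f ((t, x) + s *\<^sub>R (0, e)) + \<i> * of_real ?a * cis (\<eta> \<bullet> x + s * ?a) * f ((t, x) + s *\<^sub>R (0, e))) (at s)"
   by (rule has_vector_derivative_mult[OF d2 d])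
  then show "((\<lambda>r. ?g (x + r *\<^sub>R e)) has_vector_derivative ?g' (x + s *\<^sub>R e)) (at s)"
   by (simp add: inner_add_right add.commute mult.assoc)
 next
  show "continuous_on UNIV ?g" "continuous_on UNIV ?g'" by (intro continuous_intros cf cc)+
  show "norm (?g x) \<le> A + (\<bar>?a\<bar> * A + A')" for x
   using A A'(1) A(2)[of "(t, x)"] by (simp add: norm_mult add_increasing2)
  show "norm (?g' x) \<le> A + (\<bar>?a\<bar> * A + A')" for x
  proof -
   have "norm (?g' x) \<le> \<bar>?a\<bar> * norm (f (t, x)) + norm (dir_deriv (0, e) f (t, x))"
    by (rule order_trans[OF norm_triangle_ineq]) (simp add: norm_mult)
   also have "\<dots> \<le> \<bar>?a\<bar> * A + A'" by (intro add_mono mult_left_mono A A') simp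
   finally show ?thesis using A(1) by simp
  qed
 qed (use z in auto)
 moreover have "(LB x. ?g' x) = \<i> * of_real ?a * (LB x. cis (\<eta> \<bullet> x) * f (t, x)) + (LB x. cis (\<eta> \<bullet> x) * dir_deriv (0, e) f (t, x))"
 proof -
  have i: "integrable lborel (\<lambda>x. cis (\<eta> \<bullet> x) * f (t, x))" "integrable lborel (\<lambda>x. cis (\<eta> \<bullet> x) * dir_deriv (0, e) f (t, x))"
   by (intro integrable_cis_mult L12D(2) D D'; measurable)+
  show ?thesis
   by (simp only: lint_add[OF integrable_mult_right[OF i(1)] i(2)] integral_mult_right_zero)
 qed
 ultimately show ?thesis unfolding fourier_def by (simp add: add_eq_0_iff)
qed

lemma laplace_slice: "(\<lambda>x. laplace_x \<phi> (t, x)) \<in> L12"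
 and fourier_laplace: "fourier 1 (\<lambda>x. laplace_x \<phi> (t, x)) \<eta> = - of_real ((norm \<eta>)^2) * fourier 1 (\<lambda>x. \<phi> (t, x)) \<eta>"
proof -
 let ?d = "\<lambda>i. dir_deriv (0, axis i 1) \<phi>"
 let ?dd = "\<lambda>i. dir_deriv (0, axis i 1) (?d i)"
 have d: "?d i \<in> supported_smooth S" for i by (rule supported_smooth_dir_deriv[OF smooth closed])
 have dd: "?dd i \<in> supported_smooth S" for i by (rule supported_smooth_dir_deriv[OF d closed])
 have L: "(\<lambda>x. ?dd i (t, x)) \<in> L12" for i using slice[OF dd[of i]] by blast
 have i: "integrable lborel (\<lambda>x. cis (1 * (\<eta> \<bullet> x)) * ?dd i (t, x))" for i
  by (intro integrable_cis_mult L12D(2) L) measurable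
 show "(\<lambda>x. laplace_x \<phi> (t, x)) \<in> L12"
  unfolding laplace_x_def L12_def
  using L12D[OF L] by (auto intro!: L2_space_sum lint_integrable_sum)
 have "fourier 1 (\<lambda>x. laplace_x \<phi> (t, x)) \<eta> = (\<Sum>i\<in>UNIV. fourier 1 (\<lambda>x. ?dd i (t, x)) \<eta>)"
  unfolding laplace_x_def fourier_def sum_distrib_left by (rule lint_sum[OF i])
 also have "\<dots> = (\<Sum>i\<in>UNIV. - of_real ((\<eta> $ i)^2) * fourier 1 (\<lambda>x. \<phi> (t, x)) \<eta>)"
 proof (intro sum.cong refl)
  fix i
  have "- \<i> * a * (- \<i> * a * F) = (\<i> * \<i>) * (a * a) * F" for a F :: complex
   by (simp only: mult_minus_left mult_minus_right minus_minus ac_simps)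
  then show "fourier 1 (\<lambda>x. ?dd i (t, x)) \<eta> = - of_real ((\<eta> $ i)^2) * fourier 1 (\<lambda>x. \<phi> (t, x)) \<eta>"
   unfolding fourier_slice_deriv[OF d] fourier_slice_deriv[OF smooth] by (simp add: inner_axis power2_eq_square)
 qed
 also have "\<dots> = - of_real ((norm \<eta>)^2) * fourier 1 (\<lambda>x. \<phi> (t, x)) \<eta>"
  unfolding power2_norm_eq_inner inner_vec_def by (simp add: sum_distrib_right sum_negf power2_eq_square)
 finally show "fourier 1 (\<lambda>x. laplace_x \<phi> (t, x)) \<eta> = - of_real ((norm \<eta>)^2) * fourier 1 (\<lambda>x. \<phi> (t, x)) \<eta>" .
qed

lemma dt_smooth: "dt \<phi> \<in> supported_smooth S"
 unfolding dt_def by (rule supported_smooth_dir_deriv[OF smooth closed])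

lemma laplace_joint: "joint (\<lambda>t x. laplace_x \<phi> (t, x))"
proof -
 have "joint (\<lambda>t x. dir_deriv (0, axis i 1) (dir_deriv (0, axis i 1) \<phi>) (t, x))" for i
  by (intro measurable_pair supported_smooth_dir_deriv smooth closed)
 note [measurable] = this
 show ?thesis unfolding laplace_x_def by measurable
qed

lemma laplace_norm: obtains D where "D \<ge> 0" "\<And>t. N2 (\<lambda>x. laplace_x \<phi> (t, x)) \<le> D"
proof -
 let ?dd = "\<lambda>i. dir_deriv (0, axis i 1) (dir_deriv (0, axis i 1) \<phi>)"
 have "\<exists>D\<ge>0. \<forall>t. (\<lambda>x. ?dd i (t, x)) \<in> L12 \<and> N2 (\<lambda>x. ?dd i (t, x)) \<le> D" for i
  by (rule slice[OF supported_smooth_dir_deriv[OF supported_smooth_dir_deriv[OF smooth closed] closed, of "(0, axis i 1)" "(0, axis i 1)"]]) blast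
 then obtain D where D: "\<And>i. D i \<ge> 0" "\<And>i t. (\<lambda>x. ?dd i (t, x)) \<in> L12" "\<And>i t. N2 (\<lambda>x. ?dd i (t, x)) \<le> D i"
  by metis
 show ?thesis
 proof (rule that[of "\<Sum>i\<in>UNIV. D i"])
  show "N2 (\<lambda>x. laplace_x \<phi> (t, x)) \<le> (\<Sum>i\<in>UNIV. D i)" for t
   unfolding laplace_x_def
   by (rule order_trans[OF L2_norm_sum[OF L12D(1)[OF D(2)]] sum_mono[OF D(3)]])
 qed (use D in \<open>auto intro: sum_nonneg\<close>)
qed

text \<open>The test function on the Fourier side in the interaction picture dual to that of K, with
  the constant (2\<pi>)^{-n} included so that pairing K with Q equals pairing u with \<phi>.\<close>

definition Q :: "real \<Rightarrow> real ^ 'n \<Rightarrow> complex" where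
 "Q t \<eta> = inverse (of_real (fourier_const CARD('n))) * (phase (- t) \<eta> * fourier 1 (\<lambda>x. \<phi> (t, x)) \<eta>)"

text \<open>The time derivative of \<open>Q\<close>: differentiating the phase produces -\<i>
  |\<eta>|^2, which is the multiplier of \<i> times the Laplacian.\<close>

definition dQ :: "real \<Rightarrow> real ^ 'n \<Rightarrow> complex" where
 "dQ t \<eta> = inverse (of_real (fourier_const CARD('n))) * (phase (- t) \<eta> * fourier 1 (\<lambda>x. dt \<phi> (t, x) + \<i> * laplace_x \<phi> (t, x)) \<eta>)"

lemma dQ_eq: "dQ t \<eta> = inverse (of_real (fourier_const CARD('n))) * (phase (- t) \<eta> *
  fourier 1 (\<lambda>x. dt \<phi> (t, x) - \<i> * of_real ((norm \<eta>)^2) * \<phi> (t, x)) \<eta>)"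
proof -
 have L: "(\<lambda>x. \<phi> (t, x)) \<in> L12" "(\<lambda>x. dt \<phi> (t, x)) \<in> L12"
  using slice[OF smooth] slice[OF dt_smooth] by blast+
 note i = L12D(2)[OF L(1)] L12D(2)[OF L(2)] L12D(2)[OF laplace_slice]
 show ?thesis
  unfolding dQ_def fourier_add[OF i(2) integrable_mult_right[OF i(3)]] fourier_diff[OF i(2) integrable_mult_right[OF i(1)]]
   fourier_cmult fourier_laplace by simp
qed

lemma Q_outside: "t \<notin> {0<..<T} \<Longrightarrow> Q t \<eta> = 0"
 using outside[of t] smooth by (simp add: Q_def fourier_def supported_smooth_def)

text \<open>The fundamental theorem is applied at each fixed x and the result integrated over x by
  Fubini; the transform is never differentiated under the integral. The lower end contributes
  nothing because \<phi> vanishes at time 0.\<close>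

lemma Q_integral:
 assumes t: "0 \<le> t"
 shows "(LB s. indicator {0..t} s * dQ s \<eta>) = Q t \<eta>"
  and dQ_integrable: "integrable lborel (\<lambda>s. indicator {0..t} s * dQ s \<eta>)"
proof -
 obtain r where r: "\<And>t x. r < norm x \<Longrightarrow> (t, x) \<notin> S" by (rule radius) blast
 obtain A where A: "A \<ge> 0" "\<And>z. norm (\<phi> z) \<le> A" using supported_smooth_bounded[OF smooth compact] by blast
 obtain A' where A': "A' \<ge> 0" "\<And>z. norm (dt \<phi> z) \<le> A'" using supported_smooth_bounded[OF dt_smooth compact] by blast
 let ?n = "(norm \<eta>)^2"
 let ?g = "\<lambda>s x. cis (- s * ?n) * \<phi> (s, x)"
 let ?d = "\<lambda>s x. cis (- s * ?n) * (dt \<phi> (s, x) - \<i> * of_real ?n * \<phi> (s, x))"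
 have d0: "?d s x = 0" if "r < norm x" for s x
  using r[OF that, of s] smooth dt_smooth by (simp add: supported_smooth_def)
 have b: "norm (?d s x) \<le> A' + ?n * A" for s x
 proof -
  have "norm (?d s x) \<le> norm (dt \<phi> (s, x)) + ?n * norm (\<phi> (s, x))"
   unfolding norm_mult norm_cis mult_1_left by (rule order_trans[OF norm_triangle_ineq4]) (simp add: norm_mult norm_power)
  also have "\<dots> \<le> A' + ?n * A" by (intro add_mono mult_left_mono A A') simp
  finally show ?thesis .
 qed
 have cf: "continuous_on UNIV (\<lambda>s. \<phi> (s, x))" "continuous_on UNIV (\<lambda>s. dt \<phi> (s, x))" for x
  by (rule continuous_on_compose2[OF supported_smooth_continuous]; (rule smooth dt_smooth | auto intro!: continuous_intros))+
 have cc: "continuous_on UNIV (\<lambda>s. cis (- s * ?n))" by (simp add: cis_conv_exp) (intro continuous_intros)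
 have ftc: "(LB s. indicator {0..t} s * ?d s x) = ?g t x" for x
 proof -
  have der: "((\<lambda>s. ?g s x) has_vector_derivative ?d s x) (at s)" for s
  proof -
   have d1: "((\<lambda>s. \<phi> ((0, x) + s *\<^sub>R (1, 0))) has_vector_derivative dt \<phi> ((0, x) + s *\<^sub>R (1, 0))) (at s)"
    unfolding dt_def by (rule supported_smooth_line[OF smooth])
   have "((\<lambda>s. - s * ?n) has_real_derivative - ?n) (at s)" by (auto intro!: derivative_eq_intros)
   note d2 = has_vector_derivative_cis[OF this]
   have "((\<lambda>s. cis (- s * ?n) * \<phi> ((0, x) + s *\<^sub>R (1, 0))) has_vector_derivative
    cis (- s * ?n) * dt \<phi> ((0, x) + s *\<^sub>R (1, 0)) + \<i> * of_real (- ?n) * cis (- s * ?n) * \<phi> ((0, x) + s *\<^sub>R (1, 0))) (at s)"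
    by (rule has_vector_derivative_mult[OF d2 d1])
   then show ?thesis by (simp add: algebra_simps)
  qed
  have "has_bochner_integral lborel (\<lambda>s. indicator {0..t} s *\<^sub>R ?d s x) (?g t x - ?g 0 x)"
   by (rule has_bochner_integral_FTC_Icc[OF t has_vector_derivative_at_within[OF der]])
    (intro continuous_intros continuous_on_subset[OF cc] continuous_on_subset[OF cf(1)] continuous_on_subset[OF cf(2)] subset_UNIV)
  moreover have "\<phi> (0, x) = 0" using outside[of 0 x] smooth by (simp add: supported_smooth_def)
  moreover have "indicator {0..t} s *\<^sub>R ?d s x = indicator {0..t} s * ?d s x" for s by (simp add: indicator_def)
  ultimately show ?thesis by (simp add: has_bochner_integral_iff)
 qed
 have gi: "integrable lborel (\<lambda>x :: real ^ 'n. indicator (cball 0 r) x :: complex)"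
  by (rule L12D(2)[OF L12_bounded_support[where A=1 and r=r]]) (auto simp: indicator_def split: if_splits)
 note [measurable] = measurable_pair[OF smooth] measurable_pair[OF dt_smooth]
 let ?K = "\<lambda>s x. cis (1 * (\<eta> \<bullet> x)) * ?d s x"
 have "integrable (lborel \<Otimes>\<^sub>M lborel) (\<lambda>(s, x). ?K s x * (indicator {0..t} s * indicator (cball 0 r) x))"
 proof (rule integrable_pair_mult_bounded[OF integrable_indicator_Icc gi])
  show "(\<lambda>(s, x). ?K s x) \<in> borel_measurable (lborel \<Otimes>\<^sub>M lborel)" by measurable
  show "norm (?K s x) \<le> A' + ?n * A" for s x using b[of s x] by (simp add: norm_mult)
 qed
 note int = this
 from int have fub: "(LB s. LB x. ?K s x * (indicator {0..t} s * indicator (cball 0 r) x)) =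
  (LB x. LB s. ?K s x * (indicator {0..t} s * indicator (cball 0 r) x))"
  by (rule lborel_pair.Fubini_integral[symmetric])
 have e1: "?K s x * (indicator {0..t} s * indicator (cball 0 r) x) = indicator {0..t} s * ?K s x" for s x
  using d0[of x s] by (cases "r < norm x") (auto simp: indicator_def)
 have e2: "indicator {0..t} s * ?K s x = cis (1 * (\<eta> \<bullet> x)) * (indicator {0..t} s * ?d s x)" for s x by (simp only: ac_simps)
 have "(LB x. LB s. indicator {0..t} s * ?K s x) = (LB x. cis (1 * (\<eta> \<bullet> x)) * ?g t x)"
  unfolding e2 integral_mult_right_zero ftc ..
 with fub have key: "(LB s. indicator {0..t} s * (LB x. ?K s x)) = (LB x. cis (1 * (\<eta> \<bullet> x)) * ?g t x)"
  unfolding e1 integral_mult_right_zero by (rule trans)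
 have a1: "(LB x. ?K s x) = cis (- s * ?n) * fourier 1 (\<lambda>x. dt \<phi> (s, x) - \<i> * of_real ?n * \<phi> (s, x)) \<eta>" for s
  unfolding fourier_def integral_mult_right_zero[symmetric] by (simp only: ac_simps)
 have a2: "(LB x. cis (1 * (\<eta> \<bullet> x)) * ?g t x) = cis (- t * ?n) * fourier 1 (\<lambda>x. \<phi> (t, x)) \<eta>"
  unfolding fourier_def integral_mult_right_zero[symmetric] by (simp only: ac_simps)
 show "(LB s. indicator {0..t} s * dQ s \<eta>) = Q t \<eta>"
  unfolding dQ_eq Q_def key[unfolded a1 a2, symmetric] mult.left_commute[of _ "inverse _"] integral_mult_right_zero ..
 have "integrable lborel (\<lambda>s. LB x. ?K s x * (indicator {0..t} s * indicator (cball 0 r) x))"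
  by (rule lborel_pair.integrable_fst[OF int])
 then have "integrable lborel (\<lambda>s. inverse (of_real (fourier_const CARD('n))) * (indicator {0..t} s * (LB x. ?K s x)))"
  unfolding e1 integral_mult_right_zero by (rule integrable_mult_right)
 then show "integrable lborel (\<lambda>s. indicator {0..t} s * dQ s \<eta>)"
  unfolding dQ_eq a1 mult.left_commute[of _ "inverse _"] .
qed

lemma Q_joint [measurable]: "joint Q"
proof -
 note [measurable] = measurable_pair[OF smooth]
 show ?thesis unfolding Q_def fourier_def by measurable
qed

lemma dQ_joint [measurable]: "joint dQ"
proof -
 note [measurable] = measurable_pair[OF dt_smooth] laplace_joint
 show ?thesis unfolding dQ_def fourier_def by measurable
qed

lemma chirped_fourier_L2:
 fixes v :: "real ^ 'n \<Rightarrow> complex"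
 assumes v: "v \<in> L12" "N2 v \<le> D"
 shows "(\<lambda>\<eta>. inverse (of_real (fourier_const CARD('n))) * (phase (- t) \<eta> * fourier 1 v \<eta>)) \<in> L2"
  "N2 (\<lambda>\<eta>. inverse (of_real (fourier_const CARD('n))) * (phase (- t) \<eta> * fourier 1 v \<eta>)) \<le>
   inverse (fourier_const CARD('n)) * (sqrt (fourier_const CARD('n)) * D)"
proof -
 have F: "fourier 1 v \<in> L2" by (rule Plancherel(1)[OF v(1)]) simp
 note [measurable] = L2_space_measurable[OF F, simplified]
 have G: "(\<lambda>\<eta>. phase (- t) \<eta> * fourier 1 v \<eta>) \<in> L2"
  by (rule L2_space_norm_eq[OF F]) (auto simp: norm_mult)
 then show "(\<lambda>\<eta>. inverse (of_real (fourier_const CARD('n))) * (phase (- t) \<eta> * fourier 1 v \<eta>)) \<in> L2"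
  by (rule L2_space_cmult)
 have "N2 (\<lambda>\<eta>. phase (- t) \<eta> * fourier 1 v \<eta>) = N2 (fourier 1 v)"
  by (rule L2_norm_cong) (simp add: norm_mult)
 also have "\<dots> = sqrt (fourier_const CARD('n)) * N2 v"
  by (rule power2_eq_imp_eq)
   (use Plancherel_const(2)[OF v(1), of 1] less_imp_le[OF fourier_const_pos[of "CARD('n)"]] in \<open>simp_all add: power_mult_distrib\<close>)
 also have "\<dots> \<le> sqrt (fourier_const CARD('n)) * D" by (intro mult_left_mono v) (simp add: less_imp_le)
 finally show "N2 (\<lambda>\<eta>. inverse (of_real (fourier_const CARD('n))) * (phase (- t) \<eta> * fourier 1 v \<eta>)) \<le>
   inverse (fourier_const CARD('n)) * (sqrt (fourier_const CARD('n)) * D)"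
  unfolding L2_norm_cmult by (simp add: norm_inverse less_imp_le mult_left_mono)
qed

lemma Q_L2: obtains D where "\<And>t. Q t \<in> L2" "\<And>t. N2 (Q t) \<le> D"
proof -
 obtain D where D: "D \<ge> 0" "\<And>t. (\<lambda>x. \<phi> (t, x)) \<in> L12" "\<And>t. N2 (\<lambda>x. \<phi> (t, x)) \<le> D" by (rule slice[OF smooth]) blast
 show ?thesis by (rule that) (unfold Q_def[abs_def], (rule chirped_fourier_L2[OF D(2) D(3)])+)
qed

lemma dQ_L2: obtains D where "\<And>t. dQ t \<in> L2" "\<And>t. N2 (dQ t) \<le> D"
proof -
 obtain D where D: "D \<ge> 0" "\<And>t. (\<lambda>x. dt \<phi> (t, x)) \<in> L12" "\<And>t. N2 (\<lambda>x. dt \<phi> (t, x)) \<le> D" by (rule slice[OF dt_smooth]) blast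
 obtain E where E: "E \<ge> 0" "\<And>t. N2 (\<lambda>x. laplace_x \<phi> (t, x)) \<le> E" by (rule laplace_norm) blast
 have L: "(\<lambda>x. dt \<phi> (t, x) + \<i> * laplace_x \<phi> (t, x)) \<in> L12" for t
  by (intro L12_add L12_cmult D laplace_slice)
 have N: "N2 (\<lambda>x. dt \<phi> (t, x) + \<i> * laplace_x \<phi> (t, x)) \<le> D + E" for t
  using L2_norm_triangle[OF L12D(1)[OF D(2)] L2_space_cmult[OF L12D(1)[OF laplace_slice]], of t \<i> t] D(3)[of t] E(2)[of t]
  by (simp add: L2_norm_cmult)
 show ?thesis by (rule that) (unfold dQ_def[abs_def], (rule chirped_fourier_L2[OF L N])+)
qed

end

lemma test_function_slab:
 assumes T: "0 < T" and \<phi>: "test_function T \<phi>"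
 shows "slab_test T \<phi> (closure {z. \<phi> z \<noteq> 0})"
proof (rule slab_test.intro[OF T])
 show "compact (closure {z. \<phi> z \<noteq> 0})" "closure {z. \<phi> z \<noteq> 0} \<subseteq> slab T"
  using \<phi> unfolding test_function_def by blast+
 have "\<phi> z = 0" if "z \<notin> closure {z. \<phi> z \<noteq> 0}" for z using closure_subset[of "{z. \<phi> z \<noteq> 0}"] that by blast
 then show "\<phi> \<in> supported_smooth (closure {z. \<phi> z \<noteq> 0})"
  using \<phi> unfolding test_function_def supported_smooth_def by blast
qed

section \<open>Existence of distributional solutions\<close>

lemma L2_path_uniformly_continuous:
 fixes v :: "real \<Rightarrow> 'a \<Rightarrow> complex"
 assumes L: "\<And>t. t \<in> {0..T} \<Longrightarrow> v t \<in> L2_space M"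
  and c: "\<And>t. t \<in> {0..T} \<Longrightarrow> ((\<lambda>s. L2_norm M (\<lambda>x. v s x - v t x)) \<longlongrightarrow> 0) (at t within {0..T})"
  and e: "e > 0"
 shows "\<exists>d>0. \<forall>s\<in>{0..T}. \<forall>t\<in>{0..T}. \<bar>s - t\<bar> < d \<longrightarrow> L2_norm M (\<lambda>x. v s x - v t x) < e"
proof (rule ccontr)
 assume "\<not> ?thesis"
 then have "\<forall>n. \<exists>s t. s \<in> {0..T} \<and> t \<in> {0..T} \<and> \<bar>s - t\<bar> < inverse (real (Suc n)) \<and> \<not> L2_norm M (\<lambda>x. v s x - v t x) < e"
  by (meson inverse_positive_iff_positive of_nat_0_less_iff zero_less_Suc)
 then obtain s t where st: "\<And>n. s n \<in> {0..T}" "\<And>n. t n \<in> {0..T}" "\<And>n. \<bar>s n - t n\<bar> < inverse (real (Suc n))"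
  "\<And>n. \<not> L2_norm M (\<lambda>x. v (s n) x - v (t n) x) < e" by metis
 have "compact {0..T}" by simp
 then obtain l r where l: "l \<in> {0..T}" "strict_mono r" "(s \<circ> r) \<longlonglongrightarrow> l"
  unfolding compact_def using st(1) by blast
 have diff: "(\<lambda>n. s n - t n) \<longlonglongrightarrow> 0"
  by (rule Lim_null_comparison[OF _ LIMSEQ_inverse_real_of_nat]) (use st(3) in \<open>auto intro!: always_eventually less_imp_le\<close>)
 have "(\<lambda>n. (s \<circ> r) n - ((\<lambda>n. s n - t n) \<circ> r) n) \<longlonglongrightarrow> l - 0"
  by (intro tendsto_diff l LIMSEQ_subseq_LIMSEQ[OF diff l(2)])
 then have t: "(t \<circ> r) \<longlonglongrightarrow> l" by (simp add: comp_def)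
 have seq: "(\<lambda>n. L2_norm M (\<lambda>x. v (X n) x - v l x)) \<longlonglongrightarrow> 0" if X: "\<And>n. X n \<in> {0..T}" "X \<longlonglongrightarrow> l" for X
 proof (rule LIMSEQ_I)
  fix e :: real assume e: "e > 0"
  have "\<forall>\<^sub>F s in at l within {0..T}. L2_norm M (\<lambda>x. v s x - v l x) < e"
   by (rule order_tendstoD(2)[OF c[OF l(1)] e])
  then obtain d where d: "d > 0" "\<And>s. s \<in> {0..T} \<Longrightarrow> s \<noteq> l \<Longrightarrow> dist s l < d \<Longrightarrow> L2_norm M (\<lambda>x. v s x - v l x) < e"
   unfolding eventually_at by blast
  obtain n0 where "\<forall>n\<ge>n0. dist (X n) l < d" using metric_LIMSEQ_D[OF X(2) d(1)] by blast
  then have "\<forall>n\<ge>n0. norm (L2_norm M (\<lambda>x. v (X n) x - v l x) - 0) < e"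
   using d(2) X(1) e by (metis (mono_tags, lifting) L2_norm_nonneg L2_norm_zero abs_of_nonneg cancel_comm_monoid_add_class.diff_cancel diff_zero real_norm_def L2_norm_cong)
  then show "\<exists>n0. \<forall>n\<ge>n0. norm (L2_norm M (\<lambda>x. v (X n) x - v l x) - 0) < e" by blast
 qed
 have sr: "(s \<circ> r) n \<in> {0..T}" and tr: "(t \<circ> r) n \<in> {0..T}" for n using st(1,2)[of "r n"] by simp_all
 have "(\<lambda>n. L2_norm M (\<lambda>x. v ((s \<circ> r) n) x - v l x) + L2_norm M (\<lambda>x. v ((t \<circ> r) n) x - v l x)) \<longlonglongrightarrow> 0 + 0"
  by (rule tendsto_add[OF seq[OF sr l(3)] seq[OF tr t]])
 then have "\<forall>\<^sub>F n in sequentially. L2_norm M (\<lambda>x. v ((s \<circ> r) n) x - v l x) + L2_norm M (\<lambda>x. v ((t \<circ> r) n) x - v l x) < e"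
  using e by (intro order_tendstoD(2)) auto
 then obtain n where n: "L2_norm M (\<lambda>x. v ((s \<circ> r) n) x - v l x) + L2_norm M (\<lambda>x. v ((t \<circ> r) n) x - v l x) < e"
  using eventually_sequentially by auto
 have "L2_norm M (\<lambda>x. v ((s \<circ> r) n) x - v ((t \<circ> r) n) x) \<le> L2_norm M (\<lambda>x. v ((s \<circ> r) n) x - v l x) + L2_norm M (\<lambda>x. v l x - v ((t \<circ> r) n) x)"
  by (rule L2_norm_triangle_diff[OF L[OF sr] L[OF l(1)] L[OF tr]])
 also have "L2_norm M (\<lambda>x. v l x - v ((t \<circ> r) n) x) = L2_norm M (\<lambda>x. v ((t \<circ> r) n) x - v l x)" by (rule L2_norm_minus_commute)
 finally show False using n st(4)[of "r n"] by simp
qed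

text \<open>Step functions in time converge fast enough for almost everywhere convergence in each time slice.\<close>

lemma L2_path_joint_version:
 fixes v :: "real \<Rightarrow> 'a::euclidean_space \<Rightarrow> complex"
 assumes T: "T > 0" and L: "\<And>t. t \<in> {0..T} \<Longrightarrow> v t \<in> L2"
  and c: "\<And>t. t \<in> {0..T} \<Longrightarrow> ((\<lambda>s. N2 (\<lambda>x. v s x - v t x)) \<longlongrightarrow> 0) (at t within {0..T})"
 obtains U M where "joint U" "\<And>t. U t \<in> L2"
  "\<And>t. N2 (U t) \<le> M" "\<And>t x. t \<notin> {0..T} \<Longrightarrow> U t x = 0" "\<And>t. t \<in> {0..T} \<Longrightarrow> AE x in lborel. U t x = v t x"
proof -
 define w where "w t = (if t \<in> {0..T} then v t else (\<lambda>_. 0))" for t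
 have wL: "w t \<in> L2" for t using L L2_space_zero by (auto simp: w_def)
 have "\<exists>d>0. \<forall>s\<in>{0..T}. \<forall>t\<in>{0..T}. \<bar>s - t\<bar> < d \<longrightarrow> N2 (\<lambda>x. v s x - v t x) < (1/2)^n / 2" for n :: nat
  by (rule L2_path_uniformly_continuous[OF L c]) simp_all
 then obtain d where d: "\<And>n. d n > 0" "\<And>n s t. s \<in> {0..T} \<Longrightarrow> t \<in> {0..T} \<Longrightarrow> \<bar>s - t\<bar> < d n \<Longrightarrow> N2 (\<lambda>x. v s x - v t x) < (1/2)^n / 2"
  by metis
 define h where "h n = d n / 2" for n
 have h: "h n > 0" "h n < d n" for n using d(1)[of n] by (auto simp: h_def)
 \<comment> \<open>Rounding down keeps the grid point between 0 and t, so it stays in the interval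
   where the path is given.\<close>
 define grid where "grid n t = h n * of_int \<lfloor>t / h n\<rfloor>" for n and t :: real
 have grid: "grid n t \<in> {0..T}" "\<bar>grid n t - t\<bar> < d n" if t: "t \<in> {0..T}" for n t
 proof -
  have "of_int \<lfloor>t / h n\<rfloor> \<le> t / h n" "t / h n < of_int \<lfloor>t / h n\<rfloor> + 1" by linarith+
  then have "h n * of_int \<lfloor>t / h n\<rfloor> \<le> h n * (t / h n)" "h n * (t / h n) < h n * (of_int \<lfloor>t / h n\<rfloor> + 1)"
   using h(1)[of n] by (simp_all only: mult_left_mono less_imp_le mult_strict_left_mono)
  then have "h n * of_int \<lfloor>t / h n\<rfloor> \<le> t" "t < h n * of_int \<lfloor>t / h n\<rfloor> + h n"
   using h(1)[of n] by (simp_all add: distrib_left)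
  moreover have "0 \<le> h n * of_int \<lfloor>t / h n\<rfloor>" using h(1)[of n] t by (intro mult_nonneg_nonneg) auto
  ultimately show "grid n t \<in> {0..T}" "\<bar>grid n t - t\<bar> < d n" using t h(2)[of n] by (auto simp: grid_def)
 qed
 define f where "f n t = w (grid n t)" for n t
 have fL: "f n t \<in> L2" for n t unfolding f_def by (rule wL)
 have fv: "N2 (\<lambda>x. f n t x - v t x) < (1/2)^n / 2" if t: "t \<in> {0..T}" for n t
  using d(2)[OF grid(1)[OF t] t grid(2)[OF t]] grid(1)[OF t] by (simp add: f_def w_def)
 have fm [measurable]: "joint (\<lambda>t x. f n t x)" for n
 proof -
  have wm: "w s \<in> borel_measurable borel" for s using L2_space_measurable[OF wL] by simp
  have "(\<lambda>z. w (h n * of_int \<lfloor>fst z / h n\<rfloor>) (snd z)) \<in> borel_measurable (borel \<Otimes>\<^sub>M (borel :: 'a measure))"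
  proof (rule measurable_compose_countable[where f="\<lambda>k z. w (h n * of_int k) (snd z)" and g="\<lambda>z. \<lfloor>fst z / h n\<rfloor>"])
   show "(\<lambda>z. w (h n * of_int k) (snd z)) \<in> borel_measurable (borel \<Otimes>\<^sub>M (borel :: 'a measure))" for k
    by (rule measurable_compose[OF measurable_snd wm])
   show "(\<lambda>z. \<lfloor>fst z / h n\<rfloor>) \<in> measurable (borel \<Otimes>\<^sub>M (borel :: 'a measure)) (count_space UNIV)" by measurable
  qed
  then show ?thesis by (simp add: f_def grid_def split_beta')
 qed
 have fd: "N2 (\<lambda>x. f (Suc n) t x - f n t x) \<le> 1 * (1/2)^n" if t: "t \<in> {0..T}" for n t
 proof -
  have "N2 (\<lambda>x. f (Suc n) t x - f n t x) \<le> N2 (\<lambda>x. f (Suc n) t x - v t x) + N2 (\<lambda>x. v t x - f n t x)"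
   by (rule L2_norm_triangle_diff[OF fL L[OF t] fL])
  also have "N2 (\<lambda>x. v t x - f n t x) = N2 (\<lambda>x. f n t x - v t x)" by (rule L2_norm_minus_commute)
  finally show ?thesis using fv[OF t, of n] fv[OF t, of "Suc n"] zero_le_power[of "1/2::real" n] unfolding power_Suc by linarith
 qed
 define g where "g t x = (if Cauchy (\<lambda>n. f n t x) then lim (\<lambda>n. f n t x) else 0)" for t x
 have gm [measurable]: "joint g" unfolding g_def by measurable
 have gs: "g t \<in> borel_measurable lborel" for t by measurable
 note gl = L2_geometric_limit[OF fL fd zero_less_one g_def gs]
 define U where "U t x = indicator {0..T} t * g t x" for t x
 have UL: "U t \<in> L2" for t
  using gl(1)[of t] L2_space_zero by (cases "t \<in> {0..T}") (auto simp: U_def[abs_def])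
 have Uv: "AE x in lborel. U t x = v t x" if t: "t \<in> {0..T}" for t
 proof -
  have gL: "g t \<in> L2" by (rule gl(1)[OF t])
  have "N2 (\<lambda>x. g t x - v t x) \<le> 3 * (1/2)^n" for n
  proof -
   have "N2 (\<lambda>x. g t x - v t x) \<le> N2 (\<lambda>x. g t x - f n t x) + N2 (\<lambda>x. f n t x - v t x)"
    by (rule L2_norm_triangle_diff[OF gL fL L[OF t]])
   then show ?thesis using gl(3)[OF t, of n] fv[OF t, of n] zero_le_power[of "1/2::real" n] by linarith
  qed
  moreover have "(\<lambda>n. 3 * (1/2::real)^n) \<longlonglongrightarrow> 0" by (intro tendsto_mult_right_zero LIMSEQ_realpow_zero) simp_all
  ultimately have "N2 (\<lambda>x. g t x - v t x) \<le> 0" by (intro LIMSEQ_le_const[of "\<lambda>n. 3 * (1/2::real)^n"]) auto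
  then have "N2 (\<lambda>x. g t x - v t x) = 0" by (simp add: order_antisym)
  from L2_norm_eq_0_AE[OF L2_space_diff[OF gL L[OF t]] this]
  show ?thesis by eventually_elim (use t in \<open>simp add: U_def\<close>)
 qed
 define N where "N = nat \<lceil>T / h 0\<rceil>"
 \<comment> \<open>Each \<open>U t\<close> lies within distance 1/2 of the path at a grid point of
   level 0, and finitely many such points occur; their maximum is replaced by the sum.\<close>
 define M where "M = (\<Sum>k\<le>N. N2 (w (h 0 * real k))) + 1"
 have M0: "0 \<le> (\<Sum>k\<le>N. N2 (w (h 0 * real k)))" by (intro sum_nonneg) simp
 have "N2 (U t) \<le> M" for t
 proof (cases "t \<in> {0..T}")
  case t: True
  define k where "k = nat \<lfloor>t / h 0\<rfloor>"
  have tk: "0 \<le> t / h 0" "t / h 0 \<le> T / h 0" using t h(1)[of 0] by (auto simp: divide_right_mono)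
  have k: "k \<le> N" "grid 0 t = h 0 * real k"
   using tk unfolding k_def N_def grid_def by (auto intro!: nat_mono) linarith
  have "N2 (U t) = N2 (v t)"
   by (rule L2_norm_AE_cong[OF Uv[OF t] L2_space_measurable[OF UL] L2_space_measurable[OF L[OF t]]])
  also have "\<dots> = N2 (\<lambda>x. v t x - 0)" by simp
  also have "\<dots> \<le> N2 (\<lambda>x. v t x - f 0 t x) + N2 (\<lambda>x. f 0 t x - 0)"
   by (rule L2_norm_triangle_diff[OF L[OF t] fL L2_space_zero])
  also have "N2 (\<lambda>x. v t x - f 0 t x) = N2 (\<lambda>x. f 0 t x - v t x)" by (rule L2_norm_minus_commute)
  also have "N2 (\<lambda>x. f 0 t x - 0) = N2 (w (h 0 * real k))" by (simp add: f_def k(2))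
  also have "\<dots> \<le> (\<Sum>k\<le>N. N2 (w (h 0 * real k)))"
   using k(1) by (intro member_le_sum[where f="\<lambda>k. N2 (w (h 0 * real k))"]) auto
  finally show ?thesis using fv[OF t, of 0] by (simp add: M_def)
 next
  case False
  then have "U t = (\<lambda>x. 0)" by (auto simp: U_def)
  then show ?thesis using M0 by (simp add: M_def)
 qed
 moreover have "joint U" unfolding U_def by measurable
 ultimately show ?thesis using UL Uv by (intro that[of U M]) (auto simp: U_def)
qed

lemma pair_L2_integrable:
 fixes F G :: "real \<Rightarrow> 'a::euclidean_space \<Rightarrow> complex"
 assumes [measurable]: "joint F" "joint G"
  and F: "\<And>t. t \<in> {a..b} \<Longrightarrow> F t \<in> L2" "\<And>t. t \<in> {a..b} \<Longrightarrow> N2 (F t) \<le> D"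
  and G: "\<And>t. t \<in> {a..b} \<Longrightarrow> G t \<in> L2" "\<And>t. t \<in> {a..b} \<Longrightarrow> N2 (G t) \<le> E"
 shows "integrable (lborel \<Otimes>\<^sub>M lborel) (\<lambda>(t, x). indicator {a..b} t * (F t x * G t x))"
proof (rule integrableI_bounded)
 have "(\<integral>\<^sup>+z. ennreal (norm (case z of (t, x) \<Rightarrow> indicator {a..b} t * (F t x * G t x))) \<partial>(lborel \<Otimes>\<^sub>M lborel)) =
  (NN t. (NN x. ennreal (norm (indicator {a..b} t * (F t x * G t x)))))"
  by (subst lborel.nn_integral_fst[symmetric]) (simp_all add: split_beta')
 also have "\<dots> \<le> (NN t. ennreal (D * E) * indicator {a..b} t)"
 proof (rule nn_integral_mono)
  fix t :: real
  show "(NN x. ennreal (norm (indicator {a..b} t * (F t x * G t x)))) \<le> ennreal (D * E) * indicator {a..b} t"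
  proof (cases "t \<in> {a..b}")
   case True
   have "(NN x. ennreal (norm (indicator {a..b} t * (F t x * G t x)))) = (NN x. ennreal (norm (F t x * G t x)))"
    using True by simp
   also have "\<dots> = ennreal (LB x. norm (F t x * G t x))"
    by (rule nn_integral_eq_integral[OF integrable_norm[OF L2_mult_integrable[OF F(1)[OF True] G(1)[OF True]]]]) simp
   also have "\<dots> \<le> ennreal (D * E)"
   proof (rule ennreal_leI)
    have "(LB x. norm (F t x * G t x)) \<le> N2 (F t) * N2 (G t)"
     unfolding norm_mult by (rule L2_Cauchy_Schwarz_norm[OF F(1)[OF True] G(1)[OF True]])
    also have "\<dots> \<le> D * E"
     by (intro mult_mono F(2)[OF True] G(2)[OF True] L2_norm_nonneg order_trans[OF L2_norm_nonneg F(2)[OF True]])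
    finally show "(LB x. norm (F t x * G t x)) \<le> D * E" .
   qed
   finally show ?thesis using True by simp
  qed simp
 qed
 also have "\<dots> < \<infinity>"
  by (subst nn_integral_cmult_indicator) (auto simp: emeasure_lborel_Icc_eq ennreal_mult_less_top)
 finally show "(\<integral>\<^sup>+z. ennreal (norm (case z of (t, x) \<Rightarrow> indicator {a..b} t * (F t x * G t x))) \<partial>(lborel \<Otimes>\<^sub>M lborel)) < \<infinity>" .
qed measurable

text \<open>Integration by parts in which p is the derivative of a function that vanishes at 0 and T
  and the other factor is a constant minus \<i> times the integral of b. It amounts to Fubini on the
  triangle s \<le> t; the constant k drops out because p has integral 0.\<close>

lemma volterra_by_parts:
 fixes b p :: "real \<Rightarrow> complex"
 assumes [measurable]: "b \<in> borel_measurable borel" "p \<in> borel_measurable borel"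
  and b: "\<And>s. norm (b s) \<le> \<beta>" and p: "integrable lborel (\<lambda>t. indicator {0..T} t * p t)"
  and P: "(LB t. indicator {0..T} t * p t) = 0"
 shows "(LB t. indicator {0..T} t * ((k - \<i> * (LB s. indicator {0..t} s * b s)) * p t)) =
  \<i> * (LB s. indicator {0..T} s * (b s * (LB t. indicator {0..s} t * p t)))"
proof -
 let ?I = "\<lambda>t s. indicator {0..t::real} s :: complex"
 let ?F = "\<lambda>t s. (?I t s * b s) * ((?I T t * p t) * ?I T s)"
 have int: "integrable (lborel \<Otimes>\<^sub>M lborel) (\<lambda>(t, s). ?F t s)"
 proof (rule integrable_pair_mult_bounded[OF p integrable_indicator_Icc])
  show "norm (?I t s * b s) \<le> \<beta>" for t s
   using b[of s] order_trans[OF norm_ge_zero b[of s]] by (auto simp: indicator_def)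
 qed measurable
 have e1: "?F t s = (?I T t * p t) * (?I t s * b s)" for t s by (auto simp: indicator_def)
 have "(LB t. (?I T t * p t) * (LB s. ?I t s * b s)) = (LB t. LB s. ?F t s)"
  unfolding e1 integral_mult_right_zero ..
 also have "\<dots> = (LB s. LB t. ?F t s)"
  by (rule lborel_pair.Fubini_integral[OF int, symmetric])
 also have "\<dots> = (LB s. - (?I T s * (b s * (LB t. ?I s t * p t))))"
 proof (intro lint_cong refl)
  fix s
  show "(LB t. ?F t s) = - (?I T s * (b s * (LB t. ?I s t * p t)))"
  proof (cases "s \<in> {0..T}")
   case True
   have i: "integrable lborel (\<lambda>t. ?I s t * p t)"
    by (rule lint_bound[OF p]) (use True in \<open>auto simp: indicator_def\<close>)
   \<comment> \<open>For fixed s the integral of p runs over [s,T]; as the total is 0, it is minus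
     the integral over [0,s].\<close>
   have "(LB t. ?F t s) = (LB t. b s * (?I T t * p t - ?I s t * p t))"
   proof (rule integral_cong_AE)
    have "AE t in lborel. t \<noteq> s" by (rule AE_lborel_singleton)
    then show "AE t in lborel. ?F t s = b s * (?I T t * p t - ?I s t * p t)"
     by eventually_elim (use True in \<open>auto simp: indicator_def\<close>)
   qed measurable
   also have "\<dots> = b s * ((LB t. ?I T t * p t) - (LB t. ?I s t * p t))"
    unfolding integral_mult_right_zero lint_diff[OF p i] ..
   finally show ?thesis using True P by simp
  qed simp
 qed
 also have "\<dots> = - (LB s. ?I T s * (b s * (LB t. ?I s t * p t)))"
  by (rule integral_minus)
 finally have F: "(LB t. (?I T t * p t) * (LB s. ?I t s * b s)) = - (LB s. ?I T s * (b s * (LB t. ?I s t * p t)))" .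
 have i2: "integrable lborel (\<lambda>t. (?I T t * p t) * (LB s. ?I t s * b s))"
  using lborel_pair.integrable_fst[OF int] unfolding e1 integral_mult_right_zero .
 have "(LB t. ?I T t * ((k - \<i> * (LB s. ?I t s * b s)) * p t)) =
  (LB t. k * (?I T t * p t) - \<i> * ((?I T t * p t) * (LB s. ?I t s * b s)))"
  by (intro lint_cong refl) (simp add: algebra_simps)
 also have "\<dots> = k * (LB t. ?I T t * p t) - \<i> * (LB t. (?I T t * p t) * (LB s. ?I t s * b s))"
  by (simp only: lint_diff[OF integrable_mult_right[OF p] integrable_mult_right[OF i2]] integral_mult_right_zero)
 finally show ?thesis unfolding P F by simp
qed

section \<open>Regularity in time of solutions of the Volterra equation\<close>

context potential
begin

lemma volterraD:
 assumes "volterra k0 K"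
 shows "k0 \<in> L2" "joint K"
  "t \<in> {0..T} \<Longrightarrow> K t \<in> L2"
  "t \<in> {0..T} \<Longrightarrow> K t \<eta> = k0 \<eta> - \<i> * (LB s. indicator {0..t} s * B s (K s) \<eta>)"
 using assms unfolding volterra_def by blast+

lemma volterra_bound:
 assumes "volterra k0 K"
 obtains R where "R \<ge> 0" "\<And>t. t \<in> {0..T} \<Longrightarrow> N2 (K t) \<le> R"
proof -
 obtain R where R: "\<forall>t\<in>{0..T}. N2 (K t) \<le> R" using assms unfolding volterra_def by blast
 have "0 \<in> {0..T}" using T_pos by simp
 then have "R \<ge> 0" using R order_trans[OF L2_norm_nonneg] by blast
 then show ?thesis using R that by blast
qed

lemma volterra_initial:
 assumes "volterra k0 K" shows "K 0 \<eta> = k0 \<eta>"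
proof -
 note [measurable] = volterraD(2)[OF assms]
 have "(LB s. indicator {0..0} s * B s (K s) \<eta>) = (LINT s|(lborel :: real measure). 0)"
 proof (rule integral_cong_AE)
  have "AE s in lborel. s \<noteq> (0::real)" by (rule AE_lborel_singleton)
  then show "AE s in lborel. indicator {0..0} s * B s (K s) \<eta> = 0" by eventually_elim (simp add: indicator_def)
 qed measurable
 then show ?thesis using volterraD(4)[OF assms, of 0 \<eta>] T_pos by simp
qed

lemma volterra_Lipschitz:
 assumes v: "volterra k0 K"
 obtains L where "L \<ge> 0" "\<And>a b. 0 \<le> a \<Longrightarrow> a \<le> b \<Longrightarrow> b \<le> T \<Longrightarrow> N2 (\<lambda>\<eta>. K b \<eta> - K a \<eta>) \<le> L * (b - a)"
proof -
 obtain R where R: "R \<ge> 0" "\<And>t. t \<in> {0..T} \<Longrightarrow> N2 (K t) \<le> R" by (rule volterra_bound[OF v]) blast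
 note K = volterraD[OF v]
 note [measurable] = K(2)
 show ?thesis
 proof (rule that[of "C * R"])
  fix a b assume ab: "0 \<le> a" "a \<le> b" "b \<le> T"
  have "N2 (\<lambda>\<eta>. K b \<eta> - K a \<eta>) = N2 (\<lambda>\<eta>. LB s. indicator {a..b} s * B s (K s) \<eta>)"
  proof (rule L2_norm_cong)
   fix \<eta>
   note i = integrable_B_time[OF K(2) K(3) R(2), of _ \<eta>]
   have "K b \<eta> - K a \<eta> = - \<i> * ((LB s. indicator {0..b} s * B s (K s) \<eta>) - (LB s. indicator {0..a} s * B s (K s) \<eta>))"
    using K(4)[of b \<eta>] K(4)[of a \<eta>] ab by (simp add: algebra_simps)
   also have "(LB s. indicator {0..b} s * B s (K s) \<eta>) - (LB s. indicator {0..a} s * B s (K s) \<eta>) =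
    (LB s. indicator {0..b} s * B s (K s) \<eta> - indicator {0..a} s * B s (K s) \<eta>)"
    by (rule lint_diff[symmetric]) (use ab in \<open>auto intro!: i\<close>)
   also have "\<dots> = (LB s. indicator {a..b} s * B s (K s) \<eta>)"
   proof (rule integral_cong_AE)
    have "AE s in lborel. s \<noteq> a" by (rule AE_lborel_singleton)
    then show "AE s in lborel. indicator {0..b} s * B s (K s) \<eta> - indicator {0..a} s * B s (K s) \<eta> = indicator {a..b} s * B s (K s) \<eta>"
     by eventually_elim (use ab in \<open>auto simp: indicator_def\<close>)
   qed measurable
   finally show "norm (K b \<eta> - K a \<eta>) = norm (LB s. indicator {a..b} s * B s (K s) \<eta>)" by (simp add: norm_mult)
  qed
  also have "\<dots> \<le> C * R * (b - a)"
  proof (rule power2_le_imp_le)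
   have "(N2 (\<lambda>\<eta>. LB s. indicator {a..b} s * B s (K s) \<eta>))^2 \<le> (b - a) * (LB s. indicator {a..b} s * (C * R)^2)"
   proof (rule time_integral_L2(2))
    fix s assume "s \<in> {a..b}"
    then have s: "s \<in> {0..T}" using ab by auto
    show "B s (K s) \<in> L2" by (rule B_L2(1)[OF K(3)[OF s]])
    have "N2 (B s (K s)) \<le> C * R"
     by (rule order_trans[OF B_L2(2)[OF K(3)[OF s]]]) (intro mult_left_mono R(2)[OF s] C_nonneg)
    then show "(N2 (B s (K s)))^2 \<le> (C * R)^2" by (rule power_mono) simp
   next
    show "integrable lborel (\<lambda>s. indicator {a..b} s * (C * R)^2)"
     by (rule integrable_Icc_const)
   qed (use ab in measurable)
   also have "\<dots> = (C * R * (b - a))^2" using ab by (simp add: power2_eq_square)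
   finally show "(N2 (\<lambda>\<eta>. LB s. indicator {a..b} s * B s (K s) \<eta>))^2 \<le> (C * R * (b - a))^2" .
   show "0 \<le> C * R * (b - a)" using ab C_nonneg R by simp
  qed
  finally show "N2 (\<lambda>\<eta>. K b \<eta> - K a \<eta>) \<le> C * R * (b - a)" .
 qed (use C_nonneg R in simp)
qed

lemma free_evolution_continuous:
 assumes k: "k \<in> L2" and X: "X \<longlonglongrightarrow> t"
 shows "(\<lambda>n. N2 (\<lambda>\<eta>. (cis (- X n * (norm \<eta>)^2) - phase (- t) \<eta>) * k \<eta>)) \<longlonglongrightarrow> 0"
proof (rule L2_dominated)
 note [measurable] = L2_space_measurable[OF k, simplified]
 show g: "(\<lambda>\<eta>. 2 * k \<eta>) \<in> L2" by (rule L2_space_cmult[OF k])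
 show b: "norm ((cis (- X n * (norm \<eta>)^2) - phase (- t) \<eta>) * k \<eta>) \<le> norm (2 * k \<eta>)" for n \<eta>
 proof -
  have "norm (cis (- X n * (norm \<eta>)^2) - phase (- t) \<eta>) \<le> 2"
   by (rule order_trans[OF norm_triangle_ineq4]) simp
  then show ?thesis unfolding norm_mult by (intro mult_right_mono) auto
 qed
 show "(\<lambda>\<eta>. (cis (- X n * (norm \<eta>)^2) - phase (- t) \<eta>) * k \<eta>) \<in> L2" for n
  by (rule L2_space_bound[OF g, where C=1]) (measurable, use b[of n] in auto)
 show "AE \<eta> in lborel. (\<lambda>n. (cis (- X n * (norm \<eta>)^2) - phase (- t) \<eta>) * k \<eta>) \<longlonglongrightarrow> 0"
 proof (rule AE_I2)
  fix \<eta>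
  have "(\<lambda>n. (cis (- X n * (norm \<eta>)^2) - phase (- t) \<eta>) * k \<eta>) \<longlonglongrightarrow> (phase (- t) \<eta> - phase (- t) \<eta>) * k \<eta>"
   unfolding cis_conv_exp by (intro tendsto_intros X)
  then show "(\<lambda>n. (cis (- X n * (norm \<eta>)^2) - phase (- t) \<eta>) * k \<eta>) \<longlonglongrightarrow> 0" by simp
 qed
qed

text \<open>The difference of two slices splits into the phase times an increment of K, which is
  Lipschitz in time, and a difference of phases applied to the fixed K t, where only strong
  continuity of the free evolution is at hand.\<close>

lemma volterra_solution_continuous:
 fixes u :: "real \<Rightarrow> 'a \<Rightarrow> complex"
 assumes v: "volterra k0 K"
  and u: "\<And>t. t \<in> {0..T} \<Longrightarrow> ft_pair (u t) (\<lambda>\<eta>. phase (- t) \<eta> * K t \<eta>)"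
  and t: "t \<in> {0..T}"
 shows "((\<lambda>s. N2 (\<lambda>x. u s x - u t x)) \<longlongrightarrow> 0) (at t within {0..T})"
 unfolding tendsto_at_iff_sequentially comp_def
proof (intro allI impI)
 fix X assume X: "\<forall>i. X i \<in> {0..T} - {t}" "X \<longlonglongrightarrow> t"
 then have XT: "X n \<in> {0..T}" for n by blast
 obtain L where L: "L \<ge> 0" "\<And>a b. 0 \<le> a \<Longrightarrow> a \<le> b \<Longrightarrow> b \<le> T \<Longrightarrow> N2 (\<lambda>\<eta>. K b \<eta> - K a \<eta>) \<le> L * (b - a)"
  by (rule volterra_Lipschitz[OF v]) blast
 note K = volterraD[OF v]
 have Km [measurable]: "K s \<in> borel_measurable borel" for s using measurable_Pair2[OF K(2), of s] by simp
 have Lip: "N2 (\<lambda>\<eta>. K (X n) \<eta> - K t \<eta>) \<le> L * \<bar>X n - t\<bar>" for n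
 proof (cases "X n \<le> t")
  case True
  then show ?thesis using L(2)[of "X n" t] XT[of n] t by (subst L2_norm_minus_commute) auto
 next
  case False
  then show ?thesis using L(2)[of t "X n"] XT[of n] t by auto
 qed
 let ?h = "\<lambda>t \<eta>. phase (- t) \<eta> * K t \<eta>"
 let ?e = "\<lambda>n. N2 (\<lambda>\<eta>. (cis (- X n * (norm \<eta>)^2) - phase (- t) \<eta>) * K t \<eta>)"
 have bound: "N2 (\<lambda>\<eta>. ?h (X n) \<eta> - ?h t \<eta>) \<le> L * \<bar>X n - t\<bar> + ?e n" for n
 proof -
  let ?f = "\<lambda>\<eta>. cis (- X n * (norm \<eta>)^2) * (K (X n) \<eta> - K t \<eta>)"
  let ?g = "\<lambda>\<eta>. (cis (- X n * (norm \<eta>)^2) - phase (- t) \<eta>) * K t \<eta>"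
  have d: "(\<lambda>\<eta>. K (X n) \<eta> - K t \<eta>) \<in> L2" by (rule L2_space_diff[OF K(3)[OF XT] K(3)[OF t]])
  have f: "?f \<in> L2" by (rule L2_space_norm_eq[OF d]) (auto simp: norm_mult)
  have g: "?g \<in> L2"
  proof (rule L2_space_bound[OF K(3)[OF t], where C=2])
   have "norm (cis (- X n * (norm \<eta>)^2) - phase (- t) \<eta>) \<le> 2" for \<eta> :: 'a
    by (rule order_trans[OF norm_triangle_ineq4]) simp
   then show "AE \<eta> in lborel. norm (?g \<eta>) \<le> 2 * norm (K t \<eta>)"
    unfolding norm_mult by (intro AE_I2 mult_right_mono) auto
  qed measurable
  have "(\<lambda>\<eta>. ?h (X n) \<eta> - ?h t \<eta>) = (\<lambda>\<eta>. ?f \<eta> + ?g \<eta>)" by (simp add: fun_eq_iff algebra_simps)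
  then have "N2 (\<lambda>\<eta>. ?h (X n) \<eta> - ?h t \<eta>) \<le> N2 ?f + ?e n"
   using L2_norm_triangle[OF f g] by simp
  moreover have "N2 ?f = N2 (\<lambda>\<eta>. K (X n) \<eta> - K t \<eta>)"
   by (rule L2_norm_cong) (simp add: norm_mult)
  ultimately show ?thesis using Lip[of n] by simp
 qed
 have "(\<lambda>n. L * \<bar>X n - t\<bar> + ?e n) \<longlonglongrightarrow> L * \<bar>t - t\<bar> + 0"
  by (intro tendsto_intros X(2) free_evolution_continuous K(3)[OF t])
 then have "(\<lambda>n. L * \<bar>X n - t\<bar> + ?e n) \<longlonglongrightarrow> 0" by simp
 then have h: "(\<lambda>n. N2 (\<lambda>\<eta>. ?h (X n) \<eta> - ?h t \<eta>)) \<longlonglongrightarrow> 0"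
  by (rule Lim_null_comparison[rotated]) (use bound in \<open>auto intro!: always_eventually\<close>)
 have "N2 (\<lambda>x. u (X n) x - u t x) = inverse (sqrt (fourier_const DIM('a))) * N2 (\<lambda>\<eta>. ?h (X n) \<eta> - ?h t \<eta>)" for n
 proof -
  have c: "0 < sqrt (fourier_const DIM('a))" by simp
  have "N2 (\<lambda>\<eta>. ?h (X n) \<eta> - ?h t \<eta>) = sqrt (fourier_const DIM('a)) * N2 (\<lambda>x. u (X n) x - u t x)"
   by (rule power2_eq_imp_eq)
    (use ft_pair_norm[OF ft_pair_diff[OF u[OF XT[of n]] u[OF t]]] less_imp_le[OF fourier_const_pos[of "DIM('a)"]] in \<open>simp_all add: power_mult_distrib\<close>)
  then show ?thesis using c by simp
 qed
 then show "(\<lambda>n. N2 (\<lambda>x. u (X n) x - u t x)) \<longlonglongrightarrow> 0"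
  using tendsto_mult_right_zero[OF h] by simp
qed

end

section \<open>Solutions of the Volterra equation as distributional solutions\<close>

context schroedinger
begin

text \<open>On the Fourier side the Laplacian contributes the same term H to both sides. What
  remains, -\<i> times the integral of J equals the integral of N, is integration by parts in time
  at each frequency: dQ is the derivative of Q, which vanishes at both ends, and -\<i> B(s)K(s) is
  that of K.\<close>

lemma volterra_weak_solution:
 assumes v: "volterra k0 K"
  and u: "\<And>t. t \<in> {0..T} \<Longrightarrow> ft_pair (u t) (\<lambda>\<eta>. phase (- t) \<eta> * K t \<eta>)"
 shows "weak_solution u"
 unfolding weak_solution_def
proof (intro allI impI)
 fix \<phi> :: "real \<times> (real ^ 'n) \<Rightarrow> complex" assume \<phi>: "test_function T \<phi>"
 interpret slab_test T \<phi> "closure {z. \<phi> z \<noteq> 0}" by (rule test_function_slab[OF T_pos \<phi>])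
 let ?c = "complex_of_real (fourier_const CARD('n))"
 have c0: "?c \<noteq> 0" by simp
 note K = volterraD[OF v]
 note [measurable] = K(2)
 obtain R where R: "R \<ge> 0" "\<And>t. t \<in> {0..T} \<Longrightarrow> N2 (K t) \<le> R" by (rule volterra_bound[OF v]) blast
 obtain D where D: "\<And>t. Q t \<in> L2" "\<And>t. N2 (Q t) \<le> D" by (rule Q_L2) blast
 obtain D' where D': "\<And>t. dQ t \<in> L2" "\<And>t. N2 (dQ t) \<le> D'" by (rule dQ_L2) blast
 obtain E where E: "E \<ge> 0" "\<And>t. N2 (\<lambda>x. laplace_x \<phi> (t, x)) \<le> E" by (rule laplace_norm) blast
 define Z where "Z t \<eta> = inverse ?c * (phase (- t) \<eta> * fourier 1 (\<lambda>x. laplace_x \<phi> (t, x)) \<eta>)" for t \<eta>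
 note [measurable] = laplace_joint
 have Zm [measurable]: "joint Z" unfolding Z_def fourier_def by measurable
 have ZL: "Z t \<in> L2" "N2 (Z t) \<le> inverse (fourier_const CARD('n)) * (sqrt (fourier_const CARD('n)) * E)" for t
  unfolding Z_def[abs_def] by (rule chirped_fourier_L2[OF laplace_slice E(2)])+
 have L12: "(\<lambda>x. \<phi> (t, x)) \<in> L12" "(\<lambda>x. dt \<phi> (t, x)) \<in> L12" for t
  using slice[OF smooth] slice[OF dt_smooth] by blast+
 \<comment> \<open>Pairings of K with the transforms of (dt + \<i> laplace_x) \<phi>, of laplace_x
   \<phi>, and, for N, of the potential term with \<phi>.\<close>
 define J where "J t = (LB \<eta>. K t \<eta> * dQ t \<eta>)" for t
 define H where "H t = (LB \<eta>. K t \<eta> * Z t \<eta>)" for t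
 define N where "N t = (LB \<eta>. B t (K t) \<eta> * Q t \<eta>)" for t
 have pairing: "(LB x. u t x * g x) = (LB \<eta>. K t \<eta> * (inverse ?c * (phase (- t) \<eta> * fourier 1 g \<eta>)))"
  if t: "t \<in> {0..T}" and g: "g \<in> L12" for t g
 proof -
  have "?c * (LB x. u t x * g x) = (LB \<eta>. phase (- t) \<eta> * K t \<eta> * fourier 1 g \<eta>)"
   using ft_pairD(4)[OF u[OF t] g] by simp
  then have "(LB x. u t x * g x) = inverse ?c * (LB \<eta>. phase (- t) \<eta> * K t \<eta> * fourier 1 g \<eta>)"
   using c0 by (simp add: field_simps)
  then show ?thesis unfolding integral_mult_right_zero[symmetric] by (simp only: ac_simps)
 qed
 have I: "(LB x. - \<i> * u t x * dt \<phi> (t, x)) = - \<i> * J t - H t"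
  "(LB x. - u t x * laplace_x \<phi> (t, x) + W t x * u t x * \<phi> (t, x)) = N t - H t" if t: "t \<in> {0..T}" for t
 proof -
  have uL: "u t \<in> L2" by (rule ft_pairD(1)[OF u[OF t]])
  note i1 = L2_mult_integrable[OF uL L12D(1)[OF L12(2)], of t]
   and i2 = L2_mult_integrable[OF uL L12D(1)[OF laplace_slice], of t]
   and i3 = L2_mult_integrable[OF L12D(1)[OF W_mult_L12(1)[OF uL, of t]] L12D(1)[OF L12(1)], of t]
  have h: "(LB x. u t x * laplace_x \<phi> (t, x)) = H t"
   unfolding H_def Z_def by (rule pairing[OF t laplace_slice])
  have "J t = (LB x. u t x * (dt \<phi> (t, x) + \<i> * laplace_x \<phi> (t, x)))"
   unfolding J_def dQ_def by (rule pairing[OF t, symmetric]) (intro L12_add L12_cmult L12 laplace_slice)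
  also have "\<dots> = (LB x. u t x * dt \<phi> (t, x) + \<i> * (u t x * laplace_x \<phi> (t, x)))"
   by (simp only: distrib_left mult.left_commute)
  also have "\<dots> = (LB x. u t x * dt \<phi> (t, x)) + \<i> * H t"
   by (simp only: lint_add[OF i1 integrable_mult_right[OF i2]] integral_mult_right_zero h)
  finally have j: "(LB x. u t x * dt \<phi> (t, x)) = J t - \<i> * H t" by simp
  show "(LB x. - \<i> * u t x * dt \<phi> (t, x)) = - \<i> * J t - H t"
   unfolding mult.assoc integral_mult_right_zero j by (simp add: algebra_simps)
  have n: "(LB x. W t x * u t x * \<phi> (t, x)) = N t"
  proof -
   have "?c * (LB x. W t x * u t x * \<phi> (t, x)) = (LB \<eta>. fourier (-1) (\<lambda>x. W t x * u t x) \<eta> * fourier 1 (\<lambda>x. \<phi> (t, x)) \<eta>)"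
    using ft_pairD(4)[OF ft_pair_fourier[OF W_mult_L12(1)[OF uL, of t]] L12(1), of t] by simp
   then have "(LB x. W t x * u t x * \<phi> (t, x)) = inverse ?c * (LB \<eta>. fourier (-1) (\<lambda>x. W t x * u t x) \<eta> * fourier 1 (\<lambda>x. \<phi> (t, x)) \<eta>)"
    using c0 by (simp add: field_simps)
   also have "\<dots> = (LB \<eta>. inverse ?c * (fourier (-1) (\<lambda>x. W t x * u t x) \<eta> * fourier 1 (\<lambda>x. \<phi> (t, x)) \<eta>))"
    by (rule integral_mult_right_zero[symmetric])
   also have "\<dots> = N t"
    unfolding N_def B_fourier[OF u[OF t]] Q_def
   proof (intro lint_cong refl)
    fix \<eta> :: "real ^ 'n"
    have one: "phase t \<eta> * phase (- t) \<eta> = 1" by (simp add: cis_mult)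
    have "a * F * (c * (b * G)) = (a * b) * (c * (F * G))" for a b c F G :: complex by (simp only: ac_simps)
    then show "inverse ?c * (fourier (-1) (\<lambda>x. W t x * u t x) \<eta> * fourier 1 (\<lambda>x. \<phi> (t, x)) \<eta>) =
     phase t \<eta> * fourier (-1) (\<lambda>x. W t x * u t x) \<eta> * (inverse ?c * (phase (- t) \<eta> * fourier 1 (\<lambda>x. \<phi> (t, x)) \<eta>))"
     by (simp only: one mult_1_left)
   qed
   finally show ?thesis .
  qed
  have "(LB x. - u t x * laplace_x \<phi> (t, x) + W t x * u t x * \<phi> (t, x)) =
   (LB x. (W t x * u t x) * \<phi> (t, x) - u t x * laplace_x \<phi> (t, x))"
   by (intro lint_cong refl) simp
  also have "\<dots> = N t - H t" by (simp only: lint_diff[OF i3 i2] n h)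
  finally show "(LB x. - u t x * laplace_x \<phi> (t, x) + W t x * u t x * \<phi> (t, x)) = N t - H t" .
 qed
 have BL: "B t (K t) \<in> L2" "N2 (B t (K t)) \<le> C * R" if t: "t \<in> {0..T}" for t
  using B_L2[OF K(3)[OF t], of t] mult_left_mono[OF R(2)[OF t] C_nonneg] by auto
 have intJ: "integrable (lborel \<Otimes>\<^sub>M lborel) (\<lambda>(t, \<eta>). indicator {0..T} t * (K t \<eta> * dQ t \<eta>))"
  by (rule pair_L2_integrable[OF K(2) dQ_joint K(3) R(2) D'(1) D'(2)])
 have intH: "integrable (lborel \<Otimes>\<^sub>M lborel) (\<lambda>(t, \<eta>). indicator {0..T} t * (K t \<eta> * Z t \<eta>))"
  by (rule pair_L2_integrable[OF K(2) Zm K(3) R(2) ZL])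
 have intN: "integrable (lborel \<Otimes>\<^sub>M lborel) (\<lambda>(t, \<eta>). indicator {0..T} t * (B t (K t) \<eta> * Q t \<eta>))"
  by (rule pair_L2_integrable[OF _ Q_joint BL D(1) D(2)]) measurable
 have J: "integrable lborel (\<lambda>t. indicator {0..T} t * J t)"
  using lborel_pair.integrable_fst[OF intJ] unfolding integral_mult_right_zero J_def .
 have H: "integrable lborel (\<lambda>t. indicator {0..T} t * H t)"
  using lborel_pair.integrable_fst[OF intH] unfolding integral_mult_right_zero H_def .
 have N: "integrable lborel (\<lambda>t. indicator {0..T} t * N t)"
  using lborel_pair.integrable_fst[OF intN] unfolding integral_mult_right_zero N_def .
 have "(LB t. indicator {0..T} t * J t) = (LB t. LB \<eta>. indicator {0..T} t * (K t \<eta> * dQ t \<eta>))"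
  unfolding integral_mult_right_zero J_def ..
 also have "\<dots> = (LB \<eta>. LB t. indicator {0..T} t * (K t \<eta> * dQ t \<eta>))"
  by (rule lborel_pair.Fubini_integral[OF intJ, symmetric])
 also have "\<dots> = (LB \<eta>. \<i> * (LB s. indicator {0..T} s * (B s (K s) \<eta> * Q s \<eta>)))"
 proof (intro lint_cong refl)
  fix \<eta> :: "real ^ 'n"
  have bm: "(\<lambda>s. B s (K s) \<eta>) \<in> borel_measurable borel" by measurable
  have pm: "(\<lambda>s. dQ s \<eta>) \<in> borel_measurable borel" by measurable
  have bb: "norm (B s (K s) \<eta>) \<le> Wnorm / fourier_const DIM(real ^ 'n) * R" for s
  proof (cases "s \<in> {0..T}")
   case True
   have "0 \<le> Wnorm / fourier_const DIM(real ^ 'n)" by (intro divide_nonneg_pos Wnorm_nonneg fourier_const_pos)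
   then show ?thesis by (rule order_trans[OF B_pointwise[OF K(3)[OF True]] mult_left_mono[OF R(2)[OF True]]])
  next
   case False
   then have "B s (K s) \<eta> = 0" by (intro B_outside) auto
   then show ?thesis
    using mult_nonneg_nonneg[OF divide_nonneg_pos[OF Wnorm_nonneg fourier_const_pos[of "DIM(real ^ 'n)"]] R(1)] by (simp only: norm_zero)
  qed
  have T0: "0 \<le> T" using T_pos by simp
  have Q0: "(LB t. indicator {0..T} t * dQ t \<eta>) = 0" unfolding Q_integral[OF T0] by (rule Q_outside) simp
  have "(LB t. indicator {0..T} t * (K t \<eta> * dQ t \<eta>)) =
   (LB t. indicator {0..T} t * ((k0 \<eta> - \<i> * (LB s. indicator {0..t} s * B s (K s) \<eta>)) * dQ t \<eta>))"
   by (intro lint_cong refl) (auto simp: indicator_def K(4))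
  also have "\<dots> = \<i> * (LB s. indicator {0..T} s * (B s (K s) \<eta> * (LB t. indicator {0..s} t * dQ t \<eta>)))"
   by (rule volterra_by_parts[OF bm pm bb dQ_integrable[OF T0] Q0])
  also have "(LB s. indicator {0..T} s * (B s (K s) \<eta> * (LB t. indicator {0..s} t * dQ t \<eta>))) =
   (LB s. indicator {0..T} s * (B s (K s) \<eta> * Q s \<eta>))"
   by (intro lint_cong refl) (auto simp: indicator_def[of "{0..T}"] Q_integral)
  finally show "(LB t. indicator {0..T} t * (K t \<eta> * dQ t \<eta>)) = \<i> * (LB s. indicator {0..T} s * (B s (K s) \<eta> * Q s \<eta>))" .
 qed
 also have "\<dots> = \<i> * (LB \<eta>. LB s. indicator {0..T} s * (B s (K s) \<eta> * Q s \<eta>))"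
  by (rule integral_mult_right_zero)
 also have "(LB \<eta>. LB s. indicator {0..T} s * (B s (K s) \<eta> * Q s \<eta>)) = (LB s. LB \<eta>. indicator {0..T} s * (B s (K s) \<eta> * Q s \<eta>))"
  by (rule lborel_pair.Fubini_integral[OF intN])
 also have "\<dots> = (LB s. indicator {0..T} s * N s)" unfolding integral_mult_right_zero N_def ..
 finally have JN: "- \<i> * (LB t. indicator {0..T} t * J t) = (LB s. indicator {0..T} s * N s)"
  by simp
 have [measurable]: "J \<in> borel_measurable borel" "H \<in> borel_measurable borel" "N \<in> borel_measurable borel"
  unfolding J_def[abs_def] H_def[abs_def] N_def[abs_def] by measurable
 have closed_interval: "(LB t. indicator {0<..<T} t * X t) = (LB t. indicator {0..T} t * X t)"
  if [measurable]: "X \<in> borel_measurable borel" for X :: "real \<Rightarrow> complex"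
 proof (rule integral_cong_AE)
  have "AE t in lborel. t \<noteq> 0" "AE t in lborel. t \<noteq> T" by (rule AE_lborel_singleton)+
  then show "AE t in lborel. indicator {0<..<T} t * X t = indicator {0..T} t * X t"
   by eventually_elim (auto simp: indicator_def)
 qed measurable
 have "(LB t. indicator {0<..<T} t * (LB x. - \<i> * u t x * dt \<phi> (t, x))) =
  (LB t. indicator {0<..<T} t * (- \<i> * J t - H t))"
 proof (intro lint_cong refl)
  fix t
  show "indicator {0<..<T} t * (LB x. - \<i> * u t x * dt \<phi> (t, x)) = indicator {0<..<T} t * (- \<i> * J t - H t)"
  proof (cases "t \<in> {0<..<T}")
   case True
   then have t: "t \<in> {0..T}" by auto
   show ?thesis unfolding I(1)[OF t] ..
  qed simp
 qed
 also have "\<dots> = (LB t. indicator {0..T} t * (- \<i> * J t - H t))" by (rule closed_interval) measurable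
 also have "\<dots> = (LB t. - \<i> * (indicator {0..T} t * J t) - indicator {0..T} t * H t)"
  by (simp only: right_diff_distrib mult.left_commute)
 also have "\<dots> = - \<i> * (LB t. indicator {0..T} t * J t) - (LB t. indicator {0..T} t * H t)"
  by (simp only: lint_diff[OF integrable_mult_right[OF J] H] integral_mult_right_zero)
 also have "\<dots> = (LB t. indicator {0..T} t * N t - indicator {0..T} t * H t)"
  unfolding JN by (rule lint_diff[OF N H, symmetric])
 also have "\<dots> = (LB t. indicator {0..T} t * (N t - H t))" by (simp only: right_diff_distrib)
 also have "\<dots> = (LB t. indicator {0<..<T} t * (N t - H t))" by (rule closed_interval[symmetric]) measurable
 also have "\<dots> = (LB t. indicator {0<..<T} t *
   (LB x. - u t x * laplace_x \<phi> (t, x) + W t x * u t x * \<phi> (t, x)))"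
 proof (intro lint_cong refl)
  fix t
  show "indicator {0<..<T} t * (N t - H t) = indicator {0<..<T} t * (LB x. - u t x * laplace_x \<phi> (t, x) + W t x * u t x * \<phi> (t, x))"
  proof (cases "t \<in> {0<..<T}")
   case True
   then have t: "t \<in> {0..T}" by auto
   show ?thesis unfolding I(2)[OF t] ..
  qed simp
 qed
 finally show "(LB t. indicator {0<..<T} t * (LB x. - \<i> * u t x * dt \<phi> (t, x))) =
  (LB t. indicator {0<..<T} t *
   (LB x. - u t x * laplace_x \<phi> (t, x) + W t x * u t x * \<phi> (t, x)))" .
qed

text \<open>Inverse transforms chosen separately for each t need not be jointly measurable; since
  the path is continuous in L^2, \<open>L2_path_joint_version\<close> replaces them by a version
  that is.\<close>

theorem weak_solution_exists:
 assumes f: "f \<in> L2"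
 obtains U where "weak_solution U" "joint U" "\<And>t. U t \<in> L2"
  "AE x in lborel. U 0 x = f x"
  "\<And>t. t \<in> {0..T} \<Longrightarrow> ((\<lambda>s. N2 (\<lambda>x. U s x - U t x)) \<longlongrightarrow> 0) (at t within {0..T})"
proof -
 obtain k0 where k0: "ft_pair f k0" using ft_pair_exists[OF f] by blast
 obtain K where K: "volterra k0 K" using volterra_exists[OF ft_pairD(2)[OF k0]] by blast
 let ?h = "\<lambda>t \<eta>. phase (- t) \<eta> * K t \<eta>"
 have hm: "?h t \<in> borel_measurable borel" for t
  using measurable_Pair2[OF volterraD(2)[OF K], of t] by simp
 have "\<exists>v. t \<in> {0..T} \<longrightarrow> ft_pair v (?h t)" for t
 proof (cases "t \<in> {0..T}")
  case True
  have "?h t \<in> L2" by (rule L2_space_norm_eq[OF volterraD(3)[OF K True]]) (use hm in \<open>auto simp: norm_mult\<close>)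
  then show ?thesis using ft_pair_inverse_exists by metis
 qed blast
 then obtain u where u: "\<And>t. t \<in> {0..T} \<Longrightarrow> ft_pair (u t) (?h t)" by metis
 obtain U M where U: "joint U" "\<And>t. U t \<in> L2"
  "\<And>t. N2 (U t) \<le> M" "\<And>t x. t \<notin> {0..T} \<Longrightarrow> U t x = 0" "\<And>t. t \<in> {0..T} \<Longrightarrow> AE x in lborel. U t x = u t x"
  by (rule L2_path_joint_version[OF T_pos ft_pairD(1)[OF u] volterra_solution_continuous[OF K u]]) blast+
 have Uh: "ft_pair (U t) (?h t)" if t: "t \<in> {0..T}" for t
 proof (rule ft_pair_AE_cong[OF u[OF t]])
  show "AE x in lborel. u t x = U t x" using U(5)[OF t] by eventually_elim simp
 qed (use hm L2_space_measurable[OF U(2)] in simp_all)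
 show ?thesis
 proof (rule that[OF volterra_weak_solution[OF K Uh] U(1,2) _ volterra_solution_continuous[OF K Uh]])
  have "ft_pair (U 0) (?h 0)" by (rule Uh) (use T_pos in simp)
  then have "ft_pair (U 0) k0" using volterra_initial[OF K] by simp
  from ft_pair_AE_iff[OF this k0] show "AE x in lborel. U 0 x = f x" by simp
 qed
qed

end

section \<open>Lebesgue measurable potentials and solutions\<close>

lemma completion_borel_version:
 fixes f :: "'a \<Rightarrow> complex"
 assumes f: "f \<in> borel_measurable (completion M)"
 obtains g where "g \<in> borel_measurable M" "AE x in M. f x = g x"
proof -
 have "(\<lambda>x. Re (f x)) \<in> borel_measurable (completion M)" "(\<lambda>x. Im (f x)) \<in> borel_measurable (completion M)"
  using f by measurable
 from this[THEN completion_ex_borel_measurable_real] obtain a b where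
  [measurable]: "a \<in> borel_measurable M" "b \<in> borel_measurable M" and ab: "AE x in M. Re (f x) = a x" "AE x in M. Im (f x) = b x" by blast
 show ?thesis
 proof
  show "(\<lambda>x. of_real (a x) + \<i> * of_real (b x)) \<in> borel_measurable M" by measurable
  show "AE x in M. f x = of_real (a x) + \<i> * of_real (b x)"
   using ab by eventually_elim (simp add: complex_eq_iff)
 qed
qed

lemma completion_measurable_AE:
 fixes f g :: "'a \<Rightarrow> 'b::topological_space"
 assumes g: "g \<in> borel_measurable M" and ae: "AE x in M. f x = g x"
 shows "f \<in> borel_measurable (completion M)"
proof (rule measurableI)
 fix A :: "'b set" assume A: "A \<in> sets borel"
 show "f -` A \<inter> space (completion M) \<in> sets (completion M)"
 proof (rule completion.in_sets_AE)
  show "AE x in completion M. x \<in> g -` A \<inter> space M \<longleftrightarrow> x \<in> f -` A \<inter> space (completion M)"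
   using AE_completion[OF ae] by eventually_elim auto
  show "g -` A \<inter> space M \<in> sets (completion M)" using measurable_sets[OF g A] by (rule sets_completionI_sets)
 qed auto
qed simp

lemma integral_completion_AE:
 fixes f g :: "'a \<Rightarrow> 'b::{banach, second_countable_topology}"
 assumes g: "g \<in> borel_measurable M" and ae: "AE x in M. f x = g x"
 shows "(LINT x|completion M. f x) = (LINT x|M. g x)"
proof -
 have "(LINT x|completion M. f x) = (LINT x|completion M. g x)"
  by (rule integral_cong_AE[OF completion_measurable_AE[OF g ae] measurable_completion[OF g] AE_completion[OF ae]])
 then show ?thesis by (simp add: integral_completion[OF g])
qed

lemma L2_norm_completion:
 assumes g: "g \<in> borel_measurable M" and ae: "AE x in M. f x = g x"
 shows "L2_norm (completion M) f = L2_norm M g"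
proof -
 have "AE x in M. (norm (f x))^2 = (norm (g x))^2" using ae by eventually_elim simp
 then show ?thesis unfolding L2_norm_def using g by (subst integral_completion_AE) auto
qed

lemma L2_space_completionI:
 assumes g: "g \<in> L2_space M" and ae: "AE x in M. f x = g x"
 shows "f \<in> L2_space (completion M)"
proof (rule L2_spaceI)
 note gm = L2_space_measurable[OF g]
 show fm: "f \<in> borel_measurable (completion M)" by (rule completion_measurable_AE[OF gm ae])
 have gm2: "(\<lambda>x. (norm (g x))^2) \<in> borel_measurable M" using gm by measurable
 have "integrable (completion M) (\<lambda>x. (norm (g x))^2)"
  using L2_space_integrable[OF g] by (simp add: integrable_completion[OF gm2])
 moreover have "AE x in completion M. (norm (f x))^2 = (norm (g x))^2" using AE_completion[OF ae] by eventually_elim simp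
 ultimately show "integrable (completion M) (\<lambda>x. (norm (f x))^2)"
  using fm measurable_completion[OF gm2] by (subst integrable_cong_AE) auto
qed

lemma L2_space_borel_version:
 assumes f: "f \<in> L2_space (completion M)"
 obtains g where "g \<in> L2_space M" "AE x in M. f x = g x"
proof -
 note fm = L2_space_measurable[OF f]
 obtain g where g: "g \<in> borel_measurable M" "AE x in M. f x = g x" by (rule completion_borel_version[OF fm])
 have gm2: "(\<lambda>x. (norm (g x))^2) \<in> borel_measurable M" using g(1) by measurable
 have "AE x in completion M. (norm (f x))^2 = (norm (g x))^2" using AE_completion[OF g(2)] by eventually_elim simp
 then have "integrable (completion M) (\<lambda>x. (norm (g x))^2)"
  using L2_space_integrable[OF f] fm measurable_completion[OF gm2] by (subst (asm) integrable_cong_AE) auto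
 then have "g \<in> L2_space M" by (intro L2_spaceI g(1)) (simp add: integrable_completion[OF gm2])
 then show ?thesis using g(2) by (rule that)
qed

text \<open>C is the essential supremum of e^{|x|} |V| over the slab. The bound and a Borel version
  of V hold almost everywhere, and W is obtained by discarding the points where the bound
  fails.\<close>

lemma super_exp_decay_potential:
 fixes V :: "real \<times> (real ^ 'n) \<Rightarrow> complex"
 assumes T: "T > 0" and V: "super_exp_decay T V"
 obtains C W where "potential T C W" "AE z in lborel. z \<in> slab T \<longrightarrow> V z = W (fst z) (snd z)"
proof -
 have "open (slab T :: (real \<times> (real ^ 'n)) set)" unfolding slab_def by (intro open_Times) auto
 then have sl: "(slab T :: (real \<times> (real ^ 'n)) set) \<in> sets lebesgue" by auto
 let ?M = "lebesgue_on (slab T) :: (real \<times> (real ^ 'n)) measure"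
 let ?f = "\<lambda>(t, x). of_real (exp (1 * norm x)) * V (t, x)"
 have Vm: "V \<in> borel_measurable ?M" using V unfolding super_exp_decay_def L1_Linf_def by blast
 have "\<forall>\<rho>>0. (\<lambda>(t, x). of_real (exp (\<rho> * norm x)) * V (t, x)) \<in> L2_space ?M \<inter> Linf_space ?M"
  using V unfolding super_exp_decay_def by (rule conjunct2)
 from this[rule_format, OF zero_less_one] have fL: "?f \<in> Linf_space ?M" by (rule IntD2)
 define C where "C = enn2real (esssup ?M (\<lambda>z. ennreal (norm (?f z))))"
 have C: "0 \<le> C" "esssup ?M (\<lambda>z. ennreal (norm (?f z))) = ennreal C"
  using fL by (auto simp: C_def Linf_space_def)
 have "AE z in ?M. ennreal (norm (?f z)) \<le> ennreal C" unfolding C(2)[symmetric] by (rule esssup_AE)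
 then have "AE z in lebesgue. z \<in> slab T \<longrightarrow> ennreal (norm (?f z)) \<le> ennreal C"
  using sl by (subst (asm) AE_restrict_space_iff) auto
 then have bound: "AE z in lborel. z \<in> slab T \<longrightarrow> norm (V z) \<le> C * exp (- norm (snd z))"
  unfolding AE_completion_iff
 proof eventually_elim
  case (elim z)
  show ?case
  proof
   assume "z \<in> slab T"
   then have "ennreal (norm (?f z)) \<le> ennreal C" using elim by blast
   then have "norm (?f z) \<le> C" using C(1) by (simp add: ennreal_le_iff)
   then have "exp (norm (snd z)) * norm (V z) \<le> C" by (simp add: split_beta' norm_mult)
   then have "exp (- norm (snd z)) * (exp (norm (snd z)) * norm (V z)) \<le> exp (- norm (snd z)) * C" by (rule mult_left_mono) simp
   moreover have "exp (- norm (snd z)) * exp (norm (snd z)) = 1" by (simp add: exp_minus)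
   ultimately show "norm (V z) \<le> C * exp (- norm (snd z))" by (simp only: mult.assoc[symmetric] mult_1_left mult.commute[of C])
  qed
 qed
 have "(\<lambda>z. if z \<in> slab T then V z else 0) \<in> borel_measurable lebesgue"
  using Vm borel_measurable_if[OF sl, of V] by simp
 then obtain G where G [measurable]: "G \<in> borel_measurable lborel" and VG: "AE z in lborel. (if z \<in> slab T then V z else 0) = G z"
  by (rule completion_borel_version)
 \<comment> \<open>The cut-off changes \<open>G\<close> only on a null set within the slab and makes
   the bound hold at every point.\<close>
 define W where "W t x = (if 0 < t \<and> t < T \<and> norm (G (t, x)) \<le> C * exp (- norm x) then G (t, x) else 0)" for t x
 show ?thesis
 proof
  show "potential T C W"
  proof
   have [measurable]: "joint (\<lambda>t x. G (t, x))" using G by (simp add: borel_prod)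
   show "joint W" unfolding W_def by measurable
   show "norm (W s x) \<le> C * exp (- norm x)" for s x using C(1) by (simp add: W_def)
  qed (use T C(1) in \<open>auto simp: W_def\<close>)
  show "AE z in lborel. z \<in> slab T \<longrightarrow> V z = W (fst z) (snd z)"
   using VG bound
  proof eventually_elim
   case (elim z)
   then show ?case by (cases z) (auto simp: W_def slab_def)
  qed
 qed
qed

text \<open>The inner integral as a function of t need not be Borel; it agrees almost everywhere
  with a Borel function, which determines its integral over the completion.\<close>

lemma iterated_lebesgue_integral:
 fixes g G :: "real \<Rightarrow> 'a::euclidean_space \<Rightarrow> complex"
 assumes [measurable]: "joint G"
  and ae: "AE t in lborel. t \<in> {0<..<T} \<longrightarrow> (AE x in lborel. g t x = G t x)"
 shows "(LINT t|lebesgue_on {0<..<T}. LINT x|lebesgue. g t x) = (LB t. indicator {0<..<T} t * (LB x. G t x))"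
proof -
 have Gs: "G t \<in> borel_measurable lborel" for t by measurable
 have "(LINT t|lebesgue_on {0<..<T}. LINT x|lebesgue. g t x) = (LINT t|lebesgue. indicator {0<..<T} t *\<^sub>R (LINT x|lebesgue. g t x))"
  by (rule integral_restrict_space) simp
 also have "\<dots> = (LB t. indicator {0<..<T} t * (LB x. G t x))"
 proof (rule integral_completion_AE)
  show "AE t in lborel. indicator {0<..<T} t *\<^sub>R (LINT x|lebesgue. g t x) = indicator {0<..<T} t * (LB x. G t x)"
   using ae
  proof eventually_elim
   case (elim t)
   show ?case
   proof (cases "t \<in> {0<..<T}")
    case True
    then have "(LINT x|lebesgue. g t x) = (LB x. G t x)" using elim by (intro integral_completion_AE Gs) blast
    then show ?thesis using True by simp
   qed simp
  qed
 qed measurable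
 finally show ?thesis .
qed

lemma test_function_measurable:
 assumes T: "0 < T" and \<phi>: "test_function T (\<phi> :: real \<times> (real ^ 'n) \<Rightarrow> complex)"
 shows "joint (\<lambda>t x. \<phi> (t, x))"
  "joint (\<lambda>t x. dt \<phi> (t, x))"
  "joint (\<lambda>t x. laplace_x \<phi> (t, x))"
proof -
 interpret slab_test T \<phi> "closure {z. \<phi> z \<noteq> 0}" by (rule test_function_slab[OF T \<phi>])
 show "joint (\<lambda>t x. \<phi> (t, x))" by (rule measurable_pair[OF smooth])
 show "joint (\<lambda>t x. dt \<phi> (t, x))" by (rule measurable_pair[OF dt_smooth])
 show "joint (\<lambda>t x. laplace_x \<phi> (t, x))" by (rule laplace_joint)
qed

section \<open>Solutions in the Lebesgue sense\<close>

context schroedinger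
begin

text \<open>Equality of V and W almost everywhere in space-time gives equality almost everywhere in
  x for almost every t, which is what the iterated integrals see.\<close>

lemma weak_solution_lebesgue_iff:
 assumes V: "AE z in lborel. z \<in> slab T \<longrightarrow> V z = W (fst z) (snd z)"
  and [measurable]: "joint U"
  and u: "\<And>t. t \<in> {0..T} \<Longrightarrow> AE x in lborel. u t x = U t x"
 shows "weak_solution U \<longleftrightarrow> (\<forall>\<phi>. test_function T \<phi> \<longrightarrow>
    (LINT t|lebesgue_on {0<..<T}. LINT x|lebesgue. - \<i> * u t x * dt \<phi> (t, x)) =
    (LINT t|lebesgue_on {0<..<T}. LINT x|lebesgue.
      - u t x * laplace_x \<phi> (t, x) + V (t, x) * u t x * \<phi> (t, x)))"
proof -
 have "AE z in lborel \<Otimes>\<^sub>M lborel. z \<in> slab T \<longrightarrow> V z = W (fst z) (snd z)" by (subst lborel_prod) (rule V)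
 from lborel_pair.AE_pair[OF this] have VW: "AE t in lborel. AE x in lborel. (t, x) \<in> slab T \<longrightarrow> V (t, x) = W t x" by simp
 have "(LINT t|lebesgue_on {0<..<T}. LINT x|lebesgue. - \<i> * u t x * dt \<phi> (t, x)) =
   (LB t. indicator {0<..<T} t * (LB x. - \<i> * U t x * dt \<phi> (t, x)))"
  "(LINT t|lebesgue_on {0<..<T}. LINT x|lebesgue. - u t x * laplace_x \<phi> (t, x) + V (t, x) * u t x * \<phi> (t, x)) =
   (LB t. indicator {0<..<T} t * (LB x. - U t x * laplace_x \<phi> (t, x) + W t x * U t x * \<phi> (t, x)))"
  if \<phi>: "test_function T \<phi>" for \<phi>
 proof -
  note [measurable] = test_function_measurable[OF T_pos \<phi>]
  show "(LINT t|lebesgue_on {0<..<T}. LINT x|lebesgue. - \<i> * u t x * dt \<phi> (t, x)) =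
   (LB t. indicator {0<..<T} t * (LB x. - \<i> * U t x * dt \<phi> (t, x)))"
  proof (rule iterated_lebesgue_integral)
   show "AE t in lborel. t \<in> {0<..<T} \<longrightarrow> (AE x in lborel. - \<i> * u t x * dt \<phi> (t, x) = - \<i> * U t x * dt \<phi> (t, x))"
   proof (rule AE_I2, rule impI)
    fix t assume "t \<in> {0<..<T}"
    then have "AE x in lborel. u t x = U t x" by (intro u) auto
    then show "AE x in lborel. - \<i> * u t x * dt \<phi> (t, x) = - \<i> * U t x * dt \<phi> (t, x)" by eventually_elim simp
   qed
  qed measurable
  show "(LINT t|lebesgue_on {0<..<T}. LINT x|lebesgue. - u t x * laplace_x \<phi> (t, x) + V (t, x) * u t x * \<phi> (t, x)) =
   (LB t. indicator {0<..<T} t * (LB x. - U t x * laplace_x \<phi> (t, x) + W t x * U t x * \<phi> (t, x)))"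
  proof (rule iterated_lebesgue_integral)
   show "AE t in lborel. t \<in> {0<..<T} \<longrightarrow> (AE x in lborel. - u t x * laplace_x \<phi> (t, x) + V (t, x) * u t x * \<phi> (t, x) =
     - U t x * laplace_x \<phi> (t, x) + W t x * U t x * \<phi> (t, x))"
    using VW
   proof (eventually_elim, intro impI)
    fix t assume VWt: "AE x in lborel. (t, x) \<in> slab T \<longrightarrow> V (t, x) = W t x" and t: "t \<in> {0<..<T}"
    have "AE x in lborel. u t x = U t x" using t by (intro u) auto
    with VWt show "AE x in lborel. - u t x * laplace_x \<phi> (t, x) + V (t, x) * u t x * \<phi> (t, x) =
     - U t x * laplace_x \<phi> (t, x) + W t x * U t x * \<phi> (t, x)"
     by eventually_elim (use t in \<open>simp add: slab_def\<close>)
   qed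
  qed measurable
 qed
 then show ?thesis unfolding weak_solution_def by (simp cong: imp_cong)
qed

lemma schroedinger_solution_exists:
 assumes V: "AE z in lborel. z \<in> slab T \<longrightarrow> V z = W (fst z) (snd z)" and f: "f \<in> L2"
 shows "\<exists>u. schroedinger_solution T V f u"
proof -
 obtain U where U: "weak_solution U" "joint U" "\<And>t. U t \<in> L2"
  "AE x in lborel. U 0 x = f x"
  "\<And>t. t \<in> {0..T} \<Longrightarrow> ((\<lambda>s. N2 (\<lambda>x. U s x - U t x)) \<longlongrightarrow> 0) (at t within {0..T})"
  by (rule weak_solution_exists[OF f]) blast
 have Um: "U t \<in> borel_measurable borel" for t using L2_space_measurable[OF U(3)] by simp
 have "L2_norm lebesgue (\<lambda>x. U s x - U t x) = N2 (\<lambda>x. U s x - U t x)" for s t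
  by (rule L2_norm_completion) (use Um in simp_all)
 moreover have "U t \<in> L2_space lebesgue" for t by (rule L2_space_completionI[OF U(3)[of t]]) simp
 ultimately have "U \<in> C_L2 T" unfolding C_L2_def using U(5) by simp
 then have "schroedinger_solution T V f U"
  unfolding schroedinger_solution_def using weak_solution_lebesgue_iff[OF V U(2), of U] U(1) AE_completion[OF U(4)] by simp
 then show ?thesis by blast
qed

text \<open>A solution is given slice by slice and its joint measurability is not part of the
  definition. Each slice is replaced by a Borel version, and continuity in time then yields a
  jointly measurable version \<open>U\<close> to which \<open>schroedinger_flow\<close>
  applies.\<close>

lemma schroedinger_solution_volterra:
 assumes V: "AE z in lborel. z \<in> slab T \<longrightarrow> V z = W (fst z) (snd z)" and u: "schroedinger_solution T V f u" and f: "ft_pair f k0"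
 obtains K g where "volterra k0 K" "ft_pair g (\<lambda>\<eta>. phase (- T) \<eta> * K T \<eta>)" "AE x in lborel. u T x = g x"
proof -
 have uC: "\<And>t. t \<in> {0..T} \<Longrightarrow> u t \<in> L2_space lebesgue"
  "\<And>t. t \<in> {0..T} \<Longrightarrow> ((\<lambda>s. L2_norm lebesgue (\<lambda>x. u s x - u t x)) \<longlongrightarrow> 0) (at t within {0..T})"
  and u0: "AE x in lborel. u 0 x = f x"
  using u unfolding schroedinger_solution_def C_L2_def AE_completion_iff by blast+
 have "\<exists>v. v \<in> L2 \<and> (AE x in lborel. u t x = v x)" if "t \<in> {0..T}" for t
  by (rule L2_space_borel_version[OF uC(1)[OF that]]) blast
 then obtain v where v: "\<And>t. t \<in> {0..T} \<Longrightarrow> v t \<in> L2" "\<And>t. t \<in> {0..T} \<Longrightarrow> AE x in lborel. u t x = v t x"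
  by metis
 have vm: "v t \<in> borel_measurable borel" if "t \<in> {0..T}" for t using L2_space_measurable[OF v(1)[OF that]] by simp
 have eq: "L2_norm lebesgue (\<lambda>x. u s x - u t x) = N2 (\<lambda>x. v s x - v t x)" if s: "s \<in> {0..T}" and t: "t \<in> {0..T}" for s t
 proof (rule L2_norm_completion)
  show "AE x in lborel. u s x - u t x = v s x - v t x" using v(2)[OF s] v(2)[OF t] by eventually_elim simp
 qed (use vm[OF s] vm[OF t] in simp)
 have vc: "((\<lambda>s. N2 (\<lambda>x. v s x - v t x)) \<longlongrightarrow> 0) (at t within {0..T})" if t: "t \<in> {0..T}" for t
  using uC(2)[OF t] by (subst (asm) Lim_cong_within[OF refl refl refl]) (auto simp: eq[OF _ t])
 obtain U M where U: "joint U" "\<And>t. U t \<in> L2"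
  "\<And>t. N2 (U t) \<le> M" "\<And>t x. t \<notin> {0..T} \<Longrightarrow> U t x = 0" "\<And>t. t \<in> {0..T} \<Longrightarrow> AE x in lborel. U t x = v t x"
  by (rule L2_path_joint_version[OF T_pos v(1) vc]) blast+
 have uU: "AE x in lborel. u t x = U t x" if t: "t \<in> {0..T}" for t
  using v(2)[OF t] U(5)[OF t] by eventually_elim simp
 have weak: "weak_solution U"
  by (rule weak_solution_lebesgue_iff[OF V U(1) uU, THEN iffD2]) (use u in \<open>simp_all add: schroedinger_solution_def\<close>)
 have Um: "U t \<in> borel_measurable borel" for t using L2_space_measurable[OF U(2)] by simp
 interpret F: schroedinger_flow T C W U M
 proof unfold_locales
  fix t assume t: "t \<in> {0..T}"
  have "N2 (\<lambda>x. U s x - U t x) = N2 (\<lambda>x. v s x - v t x)" if s: "s \<in> {0..T}" for s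
  proof (rule L2_norm_AE_cong)
   show "AE x in lborel. U s x - U t x = v s x - v t x" using U(5)[OF s] U(5)[OF t] by eventually_elim simp
  qed (use Um vm[OF s] vm[OF t] in simp_all)
  then show "((\<lambda>s. N2 (\<lambda>x. U s x - U t x)) \<longlongrightarrow> 0) (at t within {0..T})"
   using vc[OF t] by (subst Lim_cong_within[OF refl refl refl]) auto
 qed (use U weak in auto)
 have "ft_pair (U 0) k0"
 proof (rule ft_pair_AE_cong[OF f])
  have "AE x in lborel. u 0 x = U 0 x" using T_pos by (intro uU) simp
  then show "AE x in lborel. f x = U 0 x" using u0 by eventually_elim simp
 qed (use Um L2_space_measurable[OF ft_pairD(2)[OF f]] in simp_all)
 then obtain K where K: "volterra k0 K" "\<And>t. t \<in> {0..T} \<Longrightarrow> ft_pair (U t) (\<lambda>\<eta>. phase (- t) \<eta> * K t \<eta>)"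
  by (rule F.weak_solution_volterra) blast
 have TT: "T \<in> {0..T}" using T_pos by simp
 show ?thesis by (rule that[OF K(1) K(2)[OF TT] uU[OF TT]])
qed

end

theorem theorem2:
 fixes T :: real and V1 V2 :: "real \<times> (real ^ 'n) \<Rightarrow> complex"
 assumes "CARD('n) \<ge> 2" and "T > 0"
  and "V1 \<in> L1_Linf T" and "V2 \<in> L1_Linf T"
  and "super_exp_decay T V1" and "super_exp_decay T V2"
  and "L2_map_eq (initial_to_final T V1) (initial_to_final T V2)"
 shows "AE z in lebesgue_on (slab T). V1 z = V2 z"
proof -
 obtain C1 W1 where p1: "potential T C1 W1" and V1: "AE z in lborel. z \<in> slab T \<longrightarrow> V1 z = W1 (fst z) (snd z)"
  by (rule super_exp_decay_potential[OF assms(2,5)])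
 obtain C2 W2 where p2: "potential T C2 W2" and V2: "AE z in lborel. z \<in> slab T \<longrightarrow> V2 z = W2 (fst z) (snd z)"
  by (rule super_exp_decay_potential[OF assms(2,6)])
 interpret A: schroedinger T C1 W1 by (rule schroedinger.intro[OF p1])
 interpret B: schroedinger T C2 W2 by (rule schroedinger.intro[OF p2])
 have "AE z in lborel. W1 (fst z) (snd z) = W2 (fst z) (snd z)"
 proof (rule volterra_determines_potential[OF p1 p2])
  show "2 \<le> DIM(real ^ 'n)" using assms(1) by simp
  fix k0 :: "real ^ 'n \<Rightarrow> complex" assume "k0 \<in> L12"
  \<comment> \<open>The initial value is prescribed on the Fourier side; \<open>f\<close> is the
    corresponding function of x.\<close>
  then obtain f where f: "ft_pair f k0" using ft_pair_inverse_exists[OF L12D(1)] by blast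
  note fL = ft_pairD(1)[OF f]
  define u1 where "u1 = (SOME u. schroedinger_solution T V1 f u)"
  define u2 where "u2 = (SOME u. schroedinger_solution T V2 f u)"
  have u1: "schroedinger_solution T V1 f u1" unfolding u1_def by (rule someI_ex[OF A.schroedinger_solution_exists[OF V1 fL]])
  have u2: "schroedinger_solution T V2 f u2" unfolding u2_def by (rule someI_ex[OF B.schroedinger_solution_exists[OF V2 fL]])
  obtain K1 g1 where K1: "A.volterra k0 K1" "ft_pair g1 (\<lambda>\<eta>. phase (- T) \<eta> * K1 T \<eta>)" "AE x in lborel. u1 T x = g1 x"
   by (rule A.schroedinger_solution_volterra[OF V1 u1 f])
  obtain K2 g2 where K2: "B.volterra k0 K2" "ft_pair g2 (\<lambda>\<eta>. phase (- T) \<eta> * K2 T \<eta>)" "AE x in lborel. u2 T x = g2 x"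
   by (rule B.schroedinger_solution_volterra[OF V2 u2 f])
  have "f \<in> L2_space lebesgue" by (rule L2_space_completionI[OF fL]) simp
  with assms(7) have "AE x in lebesgue. initial_to_final T V1 f x = initial_to_final T V2 f x"
   unfolding L2_map_eq_def by (rule bspec)
  then have "AE x in lborel. u1 T x = u2 T x"
   unfolding initial_to_final_def u1_def[symmetric] u2_def[symmetric] AE_completion_iff .
  then have "AE x in lborel. g1 x = g2 x" using K1(3) K2(3) by eventually_elim simp
  then have "AE \<eta> in lborel. phase (- T) \<eta> * K1 T \<eta> = phase (- T) \<eta> * K2 T \<eta>"
   using ft_pair_AE_iff[OF K1(2) K2(2)] by simp
  then have "AE \<eta> in lborel. K1 T \<eta> = K2 T \<eta>" by eventually_elim (simp add: cis_neq_zero)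
  with K1(1) K2(1) show "\<exists>K1 K2. A.volterra k0 K1 \<and> B.volterra k0 K2 \<and> (AE \<eta> in lborel. K1 T \<eta> = K2 T \<eta>)" by blast
 qed
 with V1 V2 have "AE z in lborel. z \<in> slab T \<longrightarrow> V1 z = V2 z" by eventually_elim simp
 then have "AE z in lebesgue. z \<in> slab T \<longrightarrow> V1 z = V2 z" by (rule AE_completion)
 moreover have "slab T \<in> sets (lebesgue :: (real \<times> (real ^ 'n)) measure)"
 proof -
  have "open (slab T :: (real \<times> (real ^ 'n)) set)" unfolding slab_def by (intro open_Times) auto
  then show ?thesis by auto
 qed
 ultimately show ?thesis by (subst AE_restrict_space_iff) auto
qed

end
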